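(* Let $\Omega=[0,1]^2$ and $K_3=\{A_1,A_2,A_3\}$ with $$A_1=\begin{pmatrix}1&0\\0&0\end{pmatrix},\quad A_2=\begin{pmatrix}-1&0\\0&-1\end{pmatrix},\quad A_3=\begin{pmatrix}-1&0\\0&1\end{pmatrix}.$$ For $\epsilon>0$, $u\in W^{1,2}_{loc}(\mathbb R^2;\mathbb R^2)$ and $\chi=\sum_{j=1}^3\chi_jA_j$ with $\chi_j\in BV((0,1)^2;\{0,1\})$, $\chi_1+\chi_2+\chi_3=1$, let $$E_{\epsilon,3}(u,\chi):=\int_\Omega|\nabla u-\chi|^2dx+\epsilon\sum_{j=1}^3\|D\chi_j\|_{TV}.$$ For $F\in K_3^{(lc)}\setminus K_3$ let $$\mathcal A_F:=\{u\in W^{1,2}_{loc}(\mathbb R^2;\mathbb R^2):\ u(x)=Fx+b\text{ in }\mathbb R^2\setminus\Omega\text{ for some }b\in\mathbb R^2\},\qquad E_{\epsilon,3}(F):=\inf_\chi\inf_{u\in\mathcal A_F}E_{\epsilon,3}(u,\chi),$$ where the infimum in $\chi$ is over all $\chi=\sum_{j=1}^3\chi_jA_j$ with $\chi_j\in BV((0,1)^2;\{0,1\})$ for $j=1,2,3$ and $\chi_1+\chi_2+\chi_3=1$. (i) If $F\in K_3^{(1)}\setminus K_3$, then there exist constants $0<c\le C$ such that for every $\epsilon\in(0,1)$ $$c\,\epsilon^{\frac23}\le E_{\epsilon,3}(F)\le C\,\epsilon^{\frac23}.$$ (ii) If $F\in K_3^{(2)}\setminus K_3^{(1)}$, then there exist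 constants $C\ge c>0$ and $\epsilon_0>0$ (depending on $F$ and on the dimension $n=2$) such that for every $\epsilon\in(0,\epsilon_0)$ $$c\,\epsilon^{\frac12}\le E_{\epsilon,3}(F)\le C\,\epsilon^{\frac12}.$$ All constants $c,C$ depend on $F$ and $K_3$.
   Context: For $K\subset\mathbb R^{n\times m}$ the lamination convex hull is $K^{(lc)}=\bigcup_{j\ge0}K^{(j)}$, with $K^{(0)}=K$ and $K^{(j+1)}=K^{(j)}\cup\{\lambda A+(1-\lambda)B:\ A,B\in K^{(j)},\ \operatorname{rank}(A-B)=1,\ \lambda\in[0,1]\}$; elements of $K^{(j+1)}\setminus K^{(j)}$ are laminates of order $j+1$. For $K_3$ one has $K_3^{(1)}\setminus K_3=\{\operatorname{diag}(-1,\mu):|\mu|<1\}$, $K_3^{(2)}\setminus K_3^{(1)}=\{\operatorname{diag}(\nu,0):|\nu|<1\}$, and $K_3^{(lc)}=K_3^{(2)}$. $\|D\chi_j\|_{TV}$ is the total variation of the measure $D\chi_j$ on $(0,1)^2$; $|\cdot|$ is the Frobenius norm. *)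

theory Defs
  imports "HOL-Analysis.Analysis"
begin

section \<open>Lamination convex hull\<close>

primrec laminates :: "nat \<Rightarrow> (real^'n^'m) set \<Rightarrow> (real^'n^'m) set" where
  "laminates 0 K = K"
| "laminates (Suc j) K = laminates j K \<union>
     {l *\<^sub>R A + (1 - l) *\<^sub>R B | l A B.
        A \<in> laminates j K \<and> B \<in> laminates j K \<and> rank (A - B) = 1 \<and> l \<in> {0..1}}"

definition lc_hull :: "(real^'n^'m) set \<Rightarrow> (real^'n^'m) set" where
  "lc_hull K = (\<Union>j. laminates j K)"


section \<open>Sobolev and BV functions\<close>

text \<open>Elements of Lebesgue, Sobolev and BV spaces are represented by Borel measurable functions,
  and pointwise conditions on them are imposed almost everywhere. Weak derivatives and the total
  variation are defined by testing with compactly supported \<open>C\<^sup>1\<close> functions, as in Evans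
  and Gariepy, \<^emph>\<open>Measure Theory and Fine Properties of Functions\<close>.\<close>

definition C1_compact :: "'a::euclidean_space set \<Rightarrow> ('a \<Rightarrow> 'b::real_normed_vector) set" where
  "C1_compact U = {\<phi>.
     (\<exists>\<phi>'. (\<forall>x. (\<phi> has_derivative blinfun_apply (\<phi>' x)) (at x)) \<and> continuous_on UNIV \<phi>') \<and>
     compact (closure {x. \<phi> x \<noteq> 0}) \<and> closure {x. \<phi> x \<noteq> 0} \<subseteq> U}"

definition L_loc :: "nat \<Rightarrow> ('a::euclidean_space \<Rightarrow> 'b::euclidean_space) set" where
  "L_loc p = {f \<in> borel_measurable lborel.
     \<forall>K. compact K \<longrightarrow> set_integrable lborel K (\<lambda>x. norm (f x) ^ p)}"

definition partial_deriv :: "'n \<Rightarrow> (real^'n \<Rightarrow> real) \<Rightarrow> real^'n \<Rightarrow> real" where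
  "partial_deriv j \<phi> x = frechet_derivative \<phi> (at x) (axis j 1)"

text \<open>The entry \<open>G x $ i $ j\<close> is the weak derivative of the \<open>i\<close>-th component of \<open>u\<close> in
  direction \<open>j\<close>, on the whole space.\<close>

definition has_weak_gradient :: "(real^'n \<Rightarrow> real^'m) \<Rightarrow> (real^'n \<Rightarrow> real^'n^'m) \<Rightarrow> bool" where
  "has_weak_gradient u G \<longleftrightarrow> u \<in> L_loc 1 \<and> G \<in> L_loc 1 \<and>
     (\<forall>\<phi> \<in> C1_compact UNIV. \<forall>i j.
        (LINT x|lborel. u x $ i * partial_deriv j \<phi> x) = - (LINT x|lborel. G x $ i $ j * \<phi> x))"

text \<open>The weak gradient is unique up to null sets; an arbitrary representative is chosen.\<close>

definition weak_gradient :: "(real^'n \<Rightarrow> real^'m) \<Rightarrow> real^'n \<Rightarrow> real^'n^'m" where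
  "weak_gradient u = (SOME G. has_weak_gradient u G)"

definition W12_loc :: "(real^'n \<Rightarrow> real^'m) set" where
  "W12_loc = {u \<in> L_loc 2. \<exists>G \<in> L_loc 2. has_weak_gradient u G}"

definition divergence :: "(real^'n \<Rightarrow> real^'n) \<Rightarrow> real^'n \<Rightarrow> real" where
  "divergence \<phi> x = trace (jacobian \<phi> (at x))"

text \<open>The total variation of the distributional derivative of \<open>f\<close> on the open set \<open>U\<close>.
  Since \<open>\<phi> = 0\<close> is admissible, truncating negative values to \<open>0\<close> does not change the supremum.\<close>

definition total_variation :: "(real^'n) set \<Rightarrow> (real^'n \<Rightarrow> real) \<Rightarrow> ennreal" where
  "total_variation U f =
     (SUP \<phi> \<in> {\<phi> \<in> C1_compact U. \<forall>x. norm (\<phi> x) \<le> 1}.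
        ennreal (LINT x:U|lborel. f x * divergence \<phi> x))"

definition BV :: "(real^'n) set \<Rightarrow> (real^'n \<Rightarrow> real) set" where
  "BV U = {f. set_integrable lborel U f \<and> total_variation U f < \<infinity>}"


section \<open>The three-well problem on the unit square\<close>

definition well :: "nat \<Rightarrow> real^2^2" where
  "well j =
    (if j = 1 then vector [vector [1, 0], vector [0, 0]]
     else if j = 2 then vector [vector [-1, 0], vector [0, -1]]
     else vector [vector [-1, 0], vector [0, 1]])"

definition K3 :: "(real^2^2) set" where
  "K3 = {well 1, well 2, well 3}"

definition Omega :: "(real^2) set" where
  "Omega = cbox 0 1"

text \<open>\<open>X j\<close> is the indicator of the \<open>j\<close>-th phase, relevant for \<open>j = 1, 2, 3\<close>.
  The set \<open>box 0 1\<close> is the open unit square.\<close>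

definition phases :: "(nat \<Rightarrow> real^2 \<Rightarrow> real) set" where
  "phases = {X.
     (\<forall>j \<in> {1..3}. X j \<in> BV (box 0 1) \<and> (AE x in lborel. x \<in> box 0 1 \<longrightarrow> X j x \<in> {0, 1})) \<and>
     (AE x in lborel. x \<in> box 0 1 \<longrightarrow> X 1 x + X 2 x + X 3 x = 1)}"

definition energy :: "real \<Rightarrow> (real^2 \<Rightarrow> real^2) \<Rightarrow> (nat \<Rightarrow> real^2 \<Rightarrow> real) \<Rightarrow> ennreal" where
  "energy \<epsilon> u X =
     (\<integral>\<^sup>+x\<in>Omega. ennreal ((norm (weak_gradient u x - (\<Sum>j=1..3. X j x *\<^sub>R well j)))\<^sup>2) \<partial>lborel)
     + ennreal \<epsilon> * (\<Sum>j=1..3. total_variation (box 0 1) (X j))"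

definition admissible :: "real^2^2 \<Rightarrow> (real^2 \<Rightarrow> real^2) set" where
  "admissible F = {u \<in> W12_loc. \<exists>b. AE x in lborel. x \<notin> Omega \<longrightarrow> u x = F *v x + b}"

definition min_energy :: "real \<Rightarrow> real^2^2 \<Rightarrow> ennreal" where
  "min_energy \<epsilon> F = (INF X \<in> phases. INF u \<in> admissible F. energy \<epsilon> u X)"

end

theory Submission
  imports Defs
begin

text \<open>Upper bounds: for \<open>F = diag(-1, \<mu>)\<close> the second component is a sawtooth in \<open>x\<^sub>2\<close> that branches towards
  the sides \<open>x\<^sub>1 = 0, 1\<close>; in each generation the cells become half as high and a third as long, so that both the
  elastic and the surface energy form convergent geometric series. For \<open>F = diag(\<nu>, 0)\<close> the first component is a sawtooth
  in \<open>x\<^sub>1\<close> with strips of width \<open>\<epsilon>\<^bsup>1/4\<^esup>\<close> that branches towards \<open>x\<^sub>2 = 0, 1\<close>, and the strips of slope \<open>-1\<close>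
  are filled with the first construction.

  Lower bounds: mollifying \<open>u - F x - b\<close> gives a compactly supported \<open>C\<^sup>1\<close> field \<open>v\<close> with
  \<open>\<parallel>\<nabla>v - (\<chi> - F)\<parallel>\<^sup>2 \<le> 4 E\<close> in \<open>L\<^sup>2\<close> of the square, where \<open>E\<close> is the energy. As \<open>\<partial>\<^sub>1 v\<^sub>2\<close> and \<open>\<partial>\<^sub>2 v\<^sub>1\<close> are small, so is \<open>v\<close> by Poincare's inequality.
  The total variation is tested with \<open>\<zeta> M sin (v\<^sub>2 / M)\<close> for a cutoff \<open>\<zeta>\<close>, which yields
  \<open>\<integral>\<zeta> (\<chi>\<^sub>2\<^sub>2 - F\<^sub>2\<^sub>2)\<^sup>2 \<lesssim> E / M\<^sup>2 + M (E / \<epsilon> + 1) + \<surd>E\<close>. If \<open>F\<^sub>1\<^sub>1 = -1\<close>, the first phase is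
  rare, so the left side is bounded below, and \<open>M \<sim> \<epsilon>\<^bsup>1/3\<^esup>\<close> gives \<open>E \<gtrsim> \<epsilon>\<^bsup>2/3\<^esup>\<close>. If \<open>F = diag(\<nu>, 0)\<close>, the same
  argument is applied to the increments of \<open>v\<^sub>2\<close> by \<open>s e\<^sub>1\<close>, whose norm is at most \<open>2 s \<surd>E\<close>: hence \<open>\<chi>\<^sub>1\<^sub>1 = 1 - 2 \<chi>\<^sub>2\<^sub>2\<^sup>2\<close> hardly
  changes over distances \<open>s \<sim> \<epsilon>\<^bsup>1/4\<^esup>\<close> in direction \<open>e\<^sub>1\<close>, whereas \<open>\<bar>\<chi>\<^sub>1\<^sub>1 - \<nu>\<bar> \<ge> 1 - \<bar>\<nu>\<bar>\<close> and \<open>v\<^sub>1\<close> is small.\<close>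

section \<open>Test functions and weak derivatives\<close>

text \<open>The length ratio 1/3 of the branching lies strictly between 1/4 and 1/2: a generation
  doubles the number of cells and halves their height r, so with length ratio t the elastic energy,
  of order r^3 / l per cell, changes by the factor 1 / (4 t) and the interface length by 2 t, and
  both factors must be below 1. N rows of cells then cost N^(-2) + \<epsilon> N, whence
  \<epsilon>^(2/3). In the second construction strips of width r contain cells of height r^2, hence
  interfaces of length r^(-2), and r^2 + \<epsilon> r^(-2) gives \<epsilon>^(1/2). The obstacle
  there is that the strips to be filled are slanted: they are cut into short pieces, each containing
  an axis-parallel rectangle, and the leftover corners go to the first phase, an error of order r^2.
  In the lower bound, a variation bound only sees bounded test functions, so v_2 is replaced by M
  sin (v_2 / M). This has size M, and its derivative differs from that of v_2 by the factor cos (v_2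
  / M), which is 1 up to (v_2 / M)^2 / 2; the loss is thus controlled by the L^2 norm of
  v_2.\<close>

lemma norm_axis_real: "norm (axis j (r::real) :: real^'n) = \<bar>r\<bar>"
proof -
  have "axis j r = r *\<^sub>R (axis j 1 :: real^'n)" by (simp add: axis_def vec_eq_iff)
  then show ?thesis by (simp add: norm_axis_1)
qed

text \<open>The derivative in \<open>C1_compact\<close> is an operator; here it becomes the Riesz
  vector field \<open>g\<close>, on which components, products and compositions are computed. Off
  the closed support, \<open>\<phi>\<close> vanishes on a neighbourhood, so \<open>g\<close> is 0 by
  uniqueness of derivatives.\<close>

lemma C1_compact_gradE:
  fixes \<phi> :: "real^'n \<Rightarrow> real"
  assumes "\<phi> \<in> C1_compact U"
  obtains g where "\<And>x. (\<phi> has_derivative (\<lambda>h. g x \<bullet> h)) (at x)" "continuous_on UNIV g"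
    "\<And>x j. partial_deriv j \<phi> x = g x $ j"
    "compact (closure {x. \<phi> x \<noteq> 0})" "closure {x. \<phi> x \<noteq> 0} \<subseteq> U"
    "\<And>x. x \<notin> closure {x. \<phi> x \<noteq> 0} \<Longrightarrow> g x = 0"
proof -
  from assms obtain \<phi>' where d: "\<And>x. (\<phi> has_derivative blinfun_apply (\<phi>' x)) (at x)"
    and c: "continuous_on UNIV \<phi>'" and K: "compact (closure {x. \<phi> x \<noteq> 0})" "closure {x. \<phi> x \<noteq> 0} \<subseteq> U"
    unfolding C1_compact_def by auto
  define g where "g x = (\<chi> i. blinfun_apply (\<phi>' x) (axis i 1))" for x
  have ga: "g x \<bullet> h = blinfun_apply (\<phi>' x) h" for x h
  proof -
    have "blinfun_apply (\<phi>' x) h = blinfun_apply (\<phi>' x) (\<Sum>i\<in>UNIV. h $ i *s axis i 1)"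
      by (simp add: basis_expansion)
    also have "\<dots> = (\<Sum>i\<in>UNIV. h $ i * blinfun_apply (\<phi>' x) (axis i 1))"
      by (simp add: blinfun.sum_right scalar_mult_eq_scaleR blinfun.scaleR_right)
    finally show ?thesis by (simp add: g_def inner_vec_def mult.commute)
  qed
  have pd: "partial_deriv j \<phi> x = g x $ j" for x j
    unfolding partial_deriv_def using frechet_derivative_at[OF d[of x]] by (simp add: g_def)
  show ?thesis
  proof (rule that[of g])
    show "(\<phi> has_derivative (\<lambda>h. g x \<bullet> h)) (at x)" for x using d[of x] by (simp add: ga)
    show "continuous_on UNIV g" unfolding g_def
      by (intro continuous_intros continuous_on_vec_lambda c)
    show "g x = 0" if "x \<notin> closure {x. \<phi> x \<noteq> 0}" for x
    proof -
      have "(\<phi> has_derivative (\<lambda>h. 0)) (at x)"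
      proof (rule has_derivative_transform_within_open)
        show "((\<lambda>x. 0::real) has_derivative (\<lambda>h. 0)) (at x)" by simp
        show "open (- closure {x. \<phi> x \<noteq> 0})" by auto
        show "x \<in> - closure {x. \<phi> x \<noteq> 0}" using that by auto
        show "0 = \<phi> y" if "y \<in> - closure {x. \<phi> x \<noteq> 0}" for y
          using that closure_subset[of "{x. \<phi> x \<noteq> 0}"] by auto
      qed
      then have "blinfun_apply (\<phi>' x) = (\<lambda>h. 0)" using d[of x] has_derivative_unique by blast
      then show ?thesis by (simp add: g_def vec_eq_iff)
    qed
  qed (use K pd in auto)
qed

lemma C1_compact_gradI:
  fixes \<phi> :: "real^'n \<Rightarrow> real"
  assumes "\<And>x. (\<phi> has_derivative (\<lambda>h. g x \<bullet> h)) (at x)" "continuous_on UNIV g"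
    "compact K" "K \<subseteq> U" "\<And>x. \<phi> x \<noteq> 0 \<Longrightarrow> x \<in> K"
  shows "\<phi> \<in> C1_compact U" "partial_deriv j \<phi> x = g x $ j"
proof -
  have d: "(\<phi> has_derivative blinfun_apply (blinfun_inner_right (g x))) (at x)" for x
    using assms(1)[of x] by (simp add: blinfun_inner_right.rep_eq)
  have c: "continuous_on UNIV (\<lambda>x. blinfun_inner_right (g x))"
    by (intro bounded_linear.continuous_on[OF bounded_linear_blinfun_inner_right] assms(2))
  have cl: "closure {x. \<phi> x \<noteq> 0} \<subseteq> K" using assms(3,5) by (intro closure_minimal) (auto dest: compact_imp_closed)
  then have "compact (closure {x. \<phi> x \<noteq> 0})" using assms(3) by (metis closed_closure compact_Int_closed inf.absorb_iff2)
  with cl show "\<phi> \<in> C1_compact U" unfolding C1_compact_def mem_Collect_eq using d c assms(4)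
    by (intro conjI exI[of _ "\<lambda>x. blinfun_inner_right (g x)"] allI) auto
  show "partial_deriv j \<phi> x = g x $ j" unfolding partial_deriv_def
    using frechet_derivative_at[OF assms(1)[of x], symmetric] by (simp add: inner_axis)
qed

lemma C1_compact_mono: "U \<subseteq> V \<Longrightarrow> \<phi> \<in> C1_compact U \<Longrightarrow> \<phi> \<in> C1_compact V"
  unfolding C1_compact_def by auto

lemma C1_compact_continuous: "\<phi> \<in> C1_compact U \<Longrightarrow> continuous_on UNIV \<phi>"
  unfolding C1_compact_def mem_Collect_eq
  by (elim conjE exE) (rule continuous_at_imp_continuous_on, metis has_derivative_continuous)

lemma L_loc_integrable_mult:
  fixes f :: "'a::euclidean_space \<Rightarrow> real"
  assumes "f \<in> L_loc 1" "\<psi> \<in> borel_measurable borel" "\<And>x. \<bar>\<psi> x\<bar> \<le> B" "compact K" "\<And>x. x \<notin> K \<Longrightarrow> \<psi> x = 0"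
  shows "integrable lborel (\<lambda>x. f x * \<psi> x)"
proof (rule Bochner_Integration.integrable_bound)
  show "integrable lborel (\<lambda>x. B * (indicator K x * \<bar>f x\<bar>))"
    using assms(1,4) unfolding L_loc_def set_integrable_def by (auto intro!: integrable_mult_right)
  show "(\<lambda>x. f x * \<psi> x) \<in> borel_measurable lborel" using assms(1,2) unfolding L_loc_def by auto
  show "AE x in lborel. norm (f x * \<psi> x) \<le> norm (B * (indicator K x * \<bar>f x\<bar>))"
  proof (rule AE_I2)
    fix x
    show "norm (f x * \<psi> x) \<le> norm (B * (indicator K x * \<bar>f x\<bar>))"
    proof (cases "x \<in> K")
      case True
      have "\<bar>f x\<bar> * \<bar>\<psi> x\<bar> \<le> \<bar>f x\<bar> * \<bar>B\<bar>" using assms(3)[of x] by (intro mult_left_mono) auto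
      then show ?thesis using True by (simp add: abs_mult mult.commute)
    qed (simp add: assms(5))
  qed
qed

lemma integral_translation:
  fixes f :: "'a::euclidean_space \<Rightarrow> real"
  shows "(LINT x|lborel. f (x + c)) = (LINT x|lborel. f x)"
proof (cases "f \<in> borel_measurable borel")
  case True
  have "(LINT x|lborel. f x) = (LINT x|distr lborel borel ((+) c). f x)" by (simp add: lborel_distr_plus)
  also have "\<dots> = (LINT x|lborel. f (c + x))" using True by (subst integral_distr) auto
  finally show ?thesis by (simp add: add.commute)
next
  case False
  \<comment> \<open>A non-measurable integrand has a non-measurable translate, so both integrals
    take the default value 0.\<close>
  have "(\<lambda>x. f (x + c)) \<notin> borel_measurable borel"
  proof
    assume "(\<lambda>x. f (x + c)) \<in> borel_measurable borel"
    then have "(\<lambda>x. f ((x + (- c)) + c)) \<in> borel_measurable borel" by (rule measurable_compose[rotated]) auto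
    with False show False by simp
  qed
  then have "\<not> integrable lborel (\<lambda>x. f (x + c))" "\<not> integrable lborel f" using False by auto
  then show ?thesis by (simp add: not_integrable_integral_eq)
qed

lemma nn_integral_translation:
  fixes f :: "'a::euclidean_space \<Rightarrow> ennreal"
  assumes "f \<in> borel_measurable borel"
  shows "(\<integral>\<^sup>+x. f (x + c) \<partial>lborel) = (\<integral>\<^sup>+x. f x \<partial>lborel)"
proof -
  have "(\<integral>\<^sup>+x. f x \<partial>lborel) = (\<integral>\<^sup>+x. f x \<partial>distr lborel borel ((+) c))" by (simp add: lborel_distr_plus)
  also have "\<dots> = (\<integral>\<^sup>+x. f (c + x) \<partial>lborel)" using assms by (subst nn_integral_distr) auto
  finally show ?thesis by (simp add: add.commute)
qed

lemma integrable_translation: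
  fixes f :: "'a::euclidean_space \<Rightarrow> real"
  assumes "integrable lborel f" shows "integrable lborel (\<lambda>x. f (x + c))"
proof -
  have "integrable (distr lborel borel ((+) c)) f" using assms by (simp add: lborel_distr_plus)
  then have "integrable lborel (\<lambda>x. f (c + x))" by (subst (asm) integrable_distr_eq) (use assms in auto)
  then show ?thesis by (simp add: add.commute)
qed

lemma C1_compact_bounded:
  fixes \<phi> :: "real^'n \<Rightarrow> real"
  assumes "\<phi> \<in> C1_compact U"
  obtains K B where "compact K" "B \<ge> 0" "\<And>x. x \<notin> K \<Longrightarrow> \<phi> x = 0" "\<And>x. \<bar>\<phi> x\<bar> \<le> B"
    "\<And>x j. x \<notin> K \<Longrightarrow> partial_deriv j \<phi> x = 0" "\<And>x j. \<bar>partial_deriv j \<phi> x\<bar> \<le> B"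
    "\<And>x y. \<bar>\<phi> x - \<phi> y\<bar> \<le> B * norm (x - y)"
    "\<And>j. continuous_on UNIV (partial_deriv j \<phi>)" "\<And>x j c. ((\<lambda>t. \<phi> (x + t *\<^sub>R axis j c)) has_real_derivative c * partial_deriv j \<phi> x) (at 0)"
proof -
  from C1_compact_gradE[OF assms] obtain g where g: "\<And>x. (\<phi> has_derivative (\<lambda>h. g x \<bullet> h)) (at x)" "continuous_on UNIV g"
    "\<And>x j. partial_deriv j \<phi> x = g x $ j" and c: "compact (closure {x. \<phi> x \<noteq> 0})"
    "\<And>x. x \<notin> closure {x. \<phi> x \<noteq> 0} \<Longrightarrow> g x = 0" by metis
  define K where "K = closure {x. \<phi> x \<noteq> 0}"
  have K: "compact K" "\<And>x. x \<notin> K \<Longrightarrow> g x = 0" "\<And>x. x \<notin> K \<Longrightarrow> \<phi> x = 0"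
    using c closure_subset[of "{x. \<phi> x \<noteq> 0}"] by (auto simp: K_def)
  have "bounded (g ` K)" using g(2) K(1) by (intro compact_imp_bounded compact_continuous_image) (auto intro: continuous_on_subset)
  then obtain B1 where B1: "\<And>x. x \<in> K \<Longrightarrow> norm (g x) \<le> B1" unfolding bounded_iff by auto
  have "continuous_on UNIV \<phi>" using assms by (rule C1_compact_continuous)
  then have "bounded (\<phi> ` K)" using K(1) by (intro compact_imp_bounded compact_continuous_image) (auto intro: continuous_on_subset)
  then obtain B2 where B2: "\<And>x. x \<in> K \<Longrightarrow> \<bar>\<phi> x\<bar> \<le> B2" unfolding bounded_iff by auto
  define B where "B = max 0 (max B1 B2)"
  have gB: "norm (g x) \<le> B" for x using B1[of x] K(2)[of x] by (cases "x \<in> K") (auto simp: B_def)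
  have Lip: "\<bar>\<phi> x - \<phi> y\<bar> \<le> B * norm (x - y)" for x y
  proof -
    have "norm (\<phi> x - \<phi> y) \<le> B * norm (x - y)"
    proof (rule differentiable_bound[of UNIV \<phi> "\<lambda>x h. g x \<bullet> h"])
      show "onorm (\<lambda>h. g x \<bullet> h) \<le> B" for x

        by (intro onorm_le) (use order_trans[OF Cauchy_Schwarz_ineq2 mult_right_mono[OF gB[of x]]] in auto)
    qed (use g in \<open>auto intro: has_derivative_at_withinI\<close>)
    then show ?thesis by simp
  qed
  have der: "((\<lambda>t. \<phi> (x + t *\<^sub>R axis j c)) has_real_derivative c * partial_deriv j \<phi> x) (at 0)" for x j c
  proof -
    have "((\<lambda>t::real. x + t *\<^sub>R axis j c) has_derivative (\<lambda>t. t *\<^sub>R axis j c)) (at 0)"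
      by (auto intro!: derivative_eq_intros)
    from has_derivative_compose[OF this, of \<phi> "\<lambda>h. g x \<bullet> h"] g(1)[of x]
    have "((\<lambda>t. \<phi> (x + t *\<^sub>R axis j c)) has_derivative (\<lambda>t. g x \<bullet> (t *\<^sub>R axis j c))) (at 0)" by simp
    then show ?thesis unfolding has_field_derivative_def
      by (rule has_derivative_eq_rhs) (auto simp: g(3) inner_axis mult.commute fun_eq_iff)
  qed
  show ?thesis
  proof (rule that[OF K(1) _ K(3), of B])
    show "\<bar>partial_deriv j \<phi> x\<bar> \<le> B" for j x using gB[of x] component_le_norm_cart[of "g x" j] g(3)[of j x] by simp
    show "\<bar>\<phi> x\<bar> \<le> B" for x using B2[of x] K(3)[of x] by (cases "x \<in> K") (auto simp: B_def)
    show "continuous_on UNIV (partial_deriv j \<phi>)" for j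
      using g(2) by (simp add: g(3)[abs_def]) (auto intro: continuous_intros)
  qed (use Lip der in \<open>auto simp: B_def g(3) K(2)\<close>)
qed

text \<open>Only positive steps occur: for a piecewise affine function the limit is then the
  right-hand slope at every point, kinks included. A sequence of steps is what dominated convergence
  works with.\<close>

definition diffq :: "'n \<Rightarrow> nat \<Rightarrow> (real^'n \<Rightarrow> real) \<Rightarrow> real^'n \<Rightarrow> real" where
  "diffq j n f x = (f (x + axis j (1 / Suc n)) - f x) * real (Suc n)"

text \<open>Discrete integration by parts: a translation moves the difference quotient from
  \<open>f\<close> to \<open>\<phi>\<close>, where it becomes a backward quotient that is bounded by
  the Lipschitz constant and converges to the partial derivative.\<close>

lemma diffq_integral_tendsto:
  fixes f :: "real^'n \<Rightarrow> real"
  assumes f: "f \<in> L_loc 1" and phi: "\<phi> \<in> C1_compact UNIV"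
  shows "(\<lambda>n. - (LINT x|lborel. diffq j n f x * \<phi> x)) \<longlonglongrightarrow> (LINT x|lborel. f x * partial_deriv j \<phi> x)"
proof -
  from C1_compact_bounded[OF phi] obtain K B where K: "compact K" and B0: "B \<ge> 0" and phi0: "\<And>x. x \<notin> K \<Longrightarrow> \<phi> x = 0"
    and B1: "\<And>x. \<bar>\<phi> x\<bar> \<le> B"
    and p0: "\<And>x j. x \<notin> K \<Longrightarrow> partial_deriv j \<phi> x = 0" and p1: "\<And>x j. \<bar>partial_deriv j \<phi> x\<bar> \<le> B"
    and L: "\<And>x y. \<bar>\<phi> x - \<phi> y\<bar> \<le> B * norm (x - y)" and pc: "\<And>j. continuous_on UNIV (partial_deriv j \<phi>)"
    and der: "\<And>x j c. ((\<lambda>t. \<phi> (x + t *\<^sub>R axis j c)) has_real_derivative c * partial_deriv j \<phi> x) (at 0)" by metis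
  \<comment> \<open>All steps have length at most 1, so \<open>K'\<close> contains the support of
    every quotient \<open>q n\<close> and carries a common majorant.\<close>
  define K' where "K' = {x + y |x y. x \<in> K \<and> y \<in> cball (0::real^'n) 1}"
  have K': "compact K'" unfolding K'_def using K by (intro compact_sums) auto
  have phim: "\<phi> \<in> borel_measurable borel" using C1_compact_continuous[OF phi] by (rule borel_measurable_continuous_onI)
  have fm: "f \<in> borel_measurable borel" using f by (simp add: L_loc_def)
  define q where "q n x = (\<phi> x - \<phi> (x - axis j (1 / Suc n))) * real (Suc n)" for n x
  have qB: "\<bar>q n x\<bar> \<le> B" for n x
  proof -
    have "\<bar>q n x\<bar> = \<bar>\<phi> x - \<phi> (x - axis j (1 / Suc n))\<bar> * Suc n" unfolding q_def by (simp add: abs_mult)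
    also have "\<dots> \<le> B * norm (axis j (1 / Suc n) :: real^'n) * Suc n" using L[of x "x - axis j (1 / Suc n)"] by (intro mult_right_mono) auto
    also have "\<dots> = B" by (simp add: norm_axis_real)
    finally show ?thesis .
  qed
  have q0: "q n x = 0" if "x \<notin> K'" for n x
  proof -
    have "x \<notin> K" using that unfolding K'_def by force
    moreover have "x - axis j (1 / Suc n) \<notin> K"
    proof
      assume "x - axis j (1 / Suc n) \<in> K"
      moreover have "axis j (1 / Suc n) \<in> cball (0::real^'n) 1" by (simp add: norm_axis_real)
      ultimately have "x - axis j (1 / Suc n) + axis j (1 / Suc n) \<in> K'" unfolding K'_def by blast
      then show False using that by simp
    qed
    ultimately show ?thesis using phi0 by (simp add: q_def)
  qed
  have qm: "q n \<in> borel_measurable borel" for n unfolding q_def using phim by measurable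
  have lim: "(\<lambda>n. LINT x|lborel. f x * q n x) \<longlonglongrightarrow> (LINT x|lborel. f x * partial_deriv j \<phi> x)"
  proof (rule integral_dominated_convergence)
    have m: "(\<lambda>x. B * indicator K' x :: real) \<in> borel_measurable borel"
      using borel_compact[OF K'] by (intro borel_measurable_times borel_measurable_indicator) auto
    have "integrable lborel (\<lambda>x. f x * (B * indicator K' x))"
      by (rule L_loc_integrable_mult[OF f m _ K', of B]) (use B0 in \<open>auto simp: indicator_def\<close>)
    then have "integrable lborel (\<lambda>x. \<bar>f x * (B * indicator K' x)\<bar>)" by (rule integrable_abs)
    then show "integrable lborel (\<lambda>x. \<bar>f x\<bar> * (B * indicator K' x))" by (rule Bochner_Integration.integrable_cong[THEN iffD1, rotated -1]) (use B0 in \<open>auto simp: abs_mult\<close>)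
    show "AE x in lborel. norm (f x * q n x) \<le> \<bar>f x\<bar> * (B * indicator K' x)" for n
    proof (rule AE_I2)
      fix x show "norm (f x * q n x) \<le> \<bar>f x\<bar> * (B * indicator K' x)"
        using qB[of n x] q0[of x n] by (cases "x \<in> K'") (auto simp: abs_mult intro!: mult_left_mono)
    qed
    show "(\<lambda>x. f x * partial_deriv j \<phi> x) \<in> borel_measurable lborel" using fm borel_measurable_continuous_onI[OF pc[of j]] by auto
    show "(\<lambda>x. f x * q n x) \<in> borel_measurable lborel" for n using fm qm by auto
    show "AE x in lborel. (\<lambda>n. f x * q n x) \<longlonglongrightarrow> f x * partial_deriv j \<phi> x"
    proof (rule AE_I2, rule tendsto_mult[OF tendsto_const])
      fix x
      have "((\<lambda>t. (\<phi> (x + t *\<^sub>R axis j (-1)) - \<phi> x) / t) \<longlongrightarrow> - partial_deriv j \<phi> x) (at 0)"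
        using der[of x j "-1"] by (simp add: has_field_derivative_iff)
      moreover have "filterlim (\<lambda>n. 1 / real (Suc n)) (at 0) sequentially"
        by (intro filterlim_atI LIMSEQ_Suc[OF lim_1_over_n]) auto
      ultimately have "(\<lambda>n. (\<phi> (x + (1 / real (Suc n)) *\<^sub>R axis j (-1)) - \<phi> x) / (1 / real (Suc n))) \<longlonglongrightarrow> - partial_deriv j \<phi> x"
        by (rule filterlim_compose)
      then have "(\<lambda>n. - ((\<phi> (x + (1 / real (Suc n)) *\<^sub>R axis j (-1)) - \<phi> x) / (1 / real (Suc n)))) \<longlonglongrightarrow> - (- partial_deriv j \<phi> x)" by (rule tendsto_minus)
      moreover have "- ((\<phi> (x + (1 / real (Suc n)) *\<^sub>R axis j (-1)) - \<phi> x) / (1 / real (Suc n))) = q n x" for n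
      proof -
        have "(1 / real (Suc n)) *\<^sub>R axis j (-1) = - (axis j (1 / Suc n)::real^'n)" by (simp add: axis_def vec_eq_iff)
        then show ?thesis by (simp add: q_def algebra_simps)
      qed
      ultimately show "(\<lambda>n. q n x) \<longlonglongrightarrow> partial_deriv j \<phi> x" by simp
    qed
  qed
  have "- (LINT x|lborel. diffq j n f x * \<phi> x) = (LINT x|lborel. f x * q n x)" for n
  proof -
    have i1: "integrable lborel (\<lambda>x. f x * \<phi> x)" by (rule L_loc_integrable_mult[OF f phim B1 K phi0])
    have i2: "integrable lborel (\<lambda>x. f x * \<phi> (x - axis j (1 / Suc n)))"
    proof (rule L_loc_integrable_mult[OF f _ B1])
      show "compact ((\<lambda>x. x + axis j (1 / Suc n)) ` K)" using K by (intro compact_continuous_image continuous_intros)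
      show "\<phi> (x - axis j (1 / Suc n)) = 0" if "x \<notin> (\<lambda>x. x + axis j (1 / Suc n)) ` K" for x
      proof (rule phi0, rule notI)
        assume "x - axis j (1 / Suc n) \<in> K"
        from imageI[OF this, of "\<lambda>x. x + axis j (1 / Suc n)"] that show False by simp
      qed
    qed (use phim in measurable)
    have i3: "integrable lborel (\<lambda>x. f (x + axis j (1 / Suc n)) * \<phi> x)"
      using integrable_translation[OF i2, of "axis j (1 / Suc n)"] by simp
    have "(LINT x|lborel. f (x + axis j (1 / Suc n)) * \<phi> x) = (LINT x|lborel. f x * \<phi> (x - axis j (1 / Suc n)))"
      using integral_translation[of "\<lambda>x. f x * \<phi> (x - axis j (1 / Suc n))" "axis j (1 / Suc n)"] by simp
    moreover have "(LINT x|lborel. diffq j n f x * \<phi> x) = ((LINT x|lborel. f (x + axis j (1 / Suc n)) * \<phi> x) - (LINT x|lborel. f x * \<phi> x)) * Suc n"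
      unfolding diffq_def by (subst Bochner_Integration.integral_diff[OF i3 i1, symmetric], subst integral_mult_left_zero[symmetric]) (simp add: algebra_simps)
    moreover have "(LINT x|lborel. f x * q n x) = ((LINT x|lborel. f x * \<phi> x) - (LINT x|lborel. f x * \<phi> (x - axis j (1 / Suc n)))) * Suc n"
      unfolding q_def by (subst Bochner_Integration.integral_diff[OF i1 i2, symmetric], subst integral_mult_left_zero[symmetric]) (simp add: algebra_simps)
    ultimately show ?thesis by (simp add: algebra_simps)
  qed
  with lim show ?thesis by simp
qed

text \<open>A global C^1 function with its gradient field as explicit data. The closure rules below
  compute gradients; compact support is imposed only at the end, by
  \<open>C1_grad_C1_compact\<close>.\<close>

definition C1_grad :: "(real^'n \<Rightarrow> real) \<Rightarrow> (real^'n \<Rightarrow> real^'n) \<Rightarrow> bool" where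
  "C1_grad \<phi> g \<longleftrightarrow> (\<forall>x. (\<phi> has_derivative (\<lambda>h. g x \<bullet> h)) (at x)) \<and> continuous_on UNIV g"

lemma C1_grad_continuous: "C1_grad \<phi> g \<Longrightarrow> continuous_on UNIV \<phi>"
  unfolding C1_grad_def by (metis continuous_at_imp_continuous_on has_derivative_continuous)

lemma C1_gradD: "C1_grad \<phi> g \<Longrightarrow> (\<phi> has_derivative (\<lambda>h. g x \<bullet> h)) (at x)"
  unfolding C1_grad_def by blast

lemma C1_grad_continuous_grad: "C1_grad \<phi> g \<Longrightarrow> continuous_on UNIV g"
  unfolding C1_grad_def by blast

lemma C1_grad_const: "C1_grad (\<lambda>x. c) (\<lambda>x. 0)"
  unfolding C1_grad_def inner_zero_left by simp

lemma C1_grad_component: "C1_grad (\<lambda>x. x $ i) (\<lambda>x. axis i 1)"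
  unfolding C1_grad_def
proof (intro conjI allI)
  fix x :: "real^'a"
  have "((\<lambda>x. x $ i) has_derivative (\<lambda>h. h $ i)) (at x)"
    by (intro bounded_linear_imp_has_derivative bounded_linear_vec_nth)
  then show "((\<lambda>x. x $ i) has_derivative (\<lambda>h. axis i 1 \<bullet> h)) (at x)" by (simp add: inner_axis')
qed simp

lemma C1_grad_add: "C1_grad \<phi> g \<Longrightarrow> C1_grad \<psi> k \<Longrightarrow> C1_grad (\<lambda>x. \<phi> x + \<psi> x) (\<lambda>x. g x + k x)"
  unfolding C1_grad_def by (auto intro!: derivative_eq_intros continuous_intros simp: inner_add_left)

lemma C1_grad_diff: "C1_grad \<phi> g \<Longrightarrow> C1_grad \<psi> k \<Longrightarrow> C1_grad (\<lambda>x. \<phi> x - \<psi> x) (\<lambda>x. g x - k x)"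
  unfolding C1_grad_def by (auto intro!: derivative_eq_intros continuous_intros simp: inner_diff_left)

lemma C1_grad_mult: "C1_grad \<phi> g \<Longrightarrow> C1_grad \<psi> k \<Longrightarrow> C1_grad (\<lambda>x. \<phi> x * \<psi> x) (\<lambda>x. \<psi> x *\<^sub>R g x + \<phi> x *\<^sub>R k x)"
  using C1_grad_continuous[of \<phi> g] C1_grad_continuous[of \<psi> k]
  unfolding C1_grad_def by (auto intro!: derivative_eq_intros continuous_intros simp: inner_add_left)

lemma C1_grad_compose:
  assumes "C1_grad \<phi> g" "\<And>s. (f has_real_derivative f' s) (at s)" "continuous_on UNIV f'"
  shows "C1_grad (\<lambda>x. f (\<phi> x)) (\<lambda>x. f' (\<phi> x) *\<^sub>R g x)"
  unfolding C1_grad_def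
proof (intro conjI allI)
  fix x
  have "(f has_derivative (\<lambda>h. f' (\<phi> x) * h)) (at (\<phi> x))" using assms(2) by (simp add: has_field_derivative_def)
  from has_derivative_compose[OF C1_gradD[OF assms(1)] this]
  show "((\<lambda>x. f (\<phi> x)) has_derivative (\<lambda>h. (f' (\<phi> x) *\<^sub>R g x) \<bullet> h)) (at x)" by simp
  show "continuous_on UNIV (\<lambda>x. f' (\<phi> x) *\<^sub>R g x)"
    by (intro continuous_intros continuous_on_compose2[OF assms(3)] C1_grad_continuous[OF assms(1)] C1_grad_continuous_grad[OF assms(1)]) auto
qed

lemma C1_grad_shift:
  assumes "C1_grad \<phi> g" shows "C1_grad (\<lambda>x. \<phi> (x + c)) (\<lambda>x. g (x + c))"
  unfolding C1_grad_def
proof (intro conjI allI)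
  fix x
  have "((\<lambda>x. x + c) has_derivative (\<lambda>h. h)) (at x)" by (auto intro!: derivative_eq_intros)
  from has_derivative_compose[OF this C1_gradD[OF assms]]
  show "((\<lambda>x. \<phi> (x + c)) has_derivative (\<lambda>h. g (x + c) \<bullet> h)) (at x)" .
  show "continuous_on UNIV (\<lambda>x. g (x + c))"
    by (intro continuous_on_compose2[OF C1_grad_continuous_grad[OF assms]] continuous_intros) auto
qed

lemma C1_grad_C1_compact:
  assumes "C1_grad \<phi> g" "compact K" "K \<subseteq> U" "\<And>x. \<phi> x \<noteq> 0 \<Longrightarrow> x \<in> K"
  shows "\<phi> \<in> C1_compact U" "partial_deriv j \<phi> x = g x $ j"
  using C1_compact_gradI[of \<phi> g K U] assms unfolding C1_grad_def by auto

lemma C1_compact_C1_grad: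
  fixes \<phi> :: "real^'n \<Rightarrow> real"
  assumes "\<phi> \<in> C1_compact U"
  obtains g K where "C1_grad \<phi> g" "compact K" "K \<subseteq> U" "\<And>x. \<phi> x \<noteq> 0 \<Longrightarrow> x \<in> K" "\<And>x j. partial_deriv j \<phi> x = g x $ j"
    "\<And>x. x \<notin> K \<Longrightarrow> g x = 0"
proof -
  from C1_compact_gradE[OF assms] obtain g where g: "\<And>x. (\<phi> has_derivative (\<lambda>h. g x \<bullet> h)) (at x)" "continuous_on UNIV g"
    "\<And>x j. partial_deriv j \<phi> x = g x $ j"
    "compact (closure {x. \<phi> x \<noteq> 0})" "closure {x. \<phi> x \<noteq> 0} \<subseteq> U" "\<And>x. x \<notin> closure {x. \<phi> x \<noteq> 0} \<Longrightarrow> g x = 0" by metis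
  show ?thesis
    by (rule that[of g "closure {x. \<phi> x \<noteq> 0}"]) (use g closure_subset[of "{x. \<phi> x \<noteq> 0}"] in \<open>auto simp: C1_grad_def\<close>)
qed

text \<open>The squared positive part is a simple C^1 function that vanishes exactly on a half-line;
  cutoffs, bumps and the function that detects the complement of the square are built from
  it.\<close>

lemma has_real_derivative_max0_square: "((\<lambda>s::real. (max 0 s)\<^sup>2) has_real_derivative 2 * max 0 s) (at s)"
proof -
  consider "s > 0" | "s < 0" | "s = 0" by linarith
  then show ?thesis
  proof cases
    case 1
    have "((\<lambda>s::real. s\<^sup>2) has_real_derivative 2 * max 0 s) (at s)" using 1 by (auto intro!: derivative_eq_intros)
    then show ?thesis
      by (rule has_field_derivative_transform_within_open[of _ _ _ "{0<..}"]) (use 1 in auto)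
  next
    case 2
    have "((\<lambda>s::real. 0) has_real_derivative 2 * max 0 s) (at s)" using 2 by (auto intro!: derivative_eq_intros)
    then show ?thesis
      by (rule has_field_derivative_transform_within_open[of _ _ _ "{..<0}"]) (use 2 in auto)
  next
    case 3
    have "((\<lambda>y. ((max 0 y)\<^sup>2 - (max 0 0)\<^sup>2) / (y - 0)) \<longlongrightarrow> (0::real)) (at 0)"
    proof (rule tendsto_rabs_zero_cancel, rule tendsto_sandwich[OF _ _ tendsto_const])
      show "((\<lambda>y::real. \<bar>y\<bar>) \<longlongrightarrow> 0) (at 0)" by (intro tendsto_rabs_zero tendsto_ident_at)
      show "\<forall>\<^sub>F y in at (0::real). \<bar>((max 0 y)\<^sup>2 - (max 0 0)\<^sup>2) / (y - 0)\<bar> \<le> \<bar>y\<bar>"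
        by (intro always_eventually allI) (auto simp: max_def power2_eq_square)
    qed auto
    then show ?thesis using 3 by (simp add: has_field_derivative_iff)
  qed
qed

lemma C1_grad_max0_square:
  "C1_grad \<phi> g \<Longrightarrow> C1_grad (\<lambda>x. (max 0 (\<phi> x))\<^sup>2) (\<lambda>x. (2 * max 0 (\<phi> x)) *\<^sub>R g x)"
  by (rule C1_grad_compose[OF _ has_real_derivative_max0_square]) (auto intro!: continuous_intros)

lemma L_loc_1_bounded:
  fixes f :: "real^'n \<Rightarrow> real"
  assumes "f \<in> borel_measurable borel" "\<And>x. \<bar>f x\<bar> \<le> B"
  shows "f \<in> L_loc 1"
proof -
  have "set_integrable lborel K (\<lambda>x. norm (f x) ^ 1)" if "compact K" for K
    unfolding set_integrable_def
  proof (rule Bochner_Integration.integrable_bound)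
    show "integrable lborel (\<lambda>x. B * indicator K x :: real)"
      using emeasure_compact_finite[OF that] borel_compact[OF that] by (intro integrable_mult_right integrable_real_indicator) auto
    have "B \<ge> 0" using assms(2)[of 0] by linarith
    then show "AE x in lborel. norm (indicat_real K x *\<^sub>R norm (f x) ^ 1) \<le> norm (B * indicat_real K x)"
      by (intro AE_I2) (use assms(2) in \<open>auto simp: indicator_def\<close>)
    show "(\<lambda>x. indicat_real K x *\<^sub>R norm (f x) ^ 1) \<in> borel_measurable lborel"
      using assms(1) borel_compact[OF that] by auto
  qed
  then show ?thesis using assms(1) by (simp add: L_loc_def)
qed

text \<open>One direction of one scalar function. Integrability is kept apart from the identity and
  is supplied where integrals are split, as in \<open>weak_deriv_add\<close>.\<close>

definition weak_deriv :: "'n \<Rightarrow> (real^'n \<Rightarrow> real) \<Rightarrow> (real^'n \<Rightarrow> real) \<Rightarrow> bool" where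
  "weak_deriv j w G \<longleftrightarrow> (\<forall>\<phi> \<in> C1_compact UNIV. (LINT x|lborel. w x * partial_deriv j \<phi> x) = - (LINT x|lborel. G x * \<phi> x))"

lemma C1_compact_integrable_mult:
  fixes f :: "real^'n \<Rightarrow> real"
  assumes "f \<in> L_loc 1" "\<phi> \<in> C1_compact U"
  shows "integrable lborel (\<lambda>x. f x * \<phi> x)" "integrable lborel (\<lambda>x. f x * partial_deriv j \<phi> x)"
proof -
  obtain K B where K: "compact K" "\<And>x. x \<notin> K \<Longrightarrow> \<phi> x = 0" "\<And>x. \<bar>\<phi> x\<bar> \<le> B" "\<And>x j. x \<notin> K \<Longrightarrow> partial_deriv j \<phi> x = 0" "\<And>x j. \<bar>partial_deriv j \<phi> x\<bar> \<le> B"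
    "\<And>j. continuous_on UNIV (partial_deriv j \<phi>)"
    using C1_compact_bounded[OF assms(2)] by metis
  show "integrable lborel (\<lambda>x. f x * \<phi> x)"
    by (rule L_loc_integrable_mult[OF assms(1) _ K(3,1,2)]) (use C1_compact_continuous[OF assms(2)] in \<open>auto intro: borel_measurable_continuous_onI\<close>)
  show "integrable lborel (\<lambda>x. f x * partial_deriv j \<phi> x)"
    by (rule L_loc_integrable_mult[OF assms(1) _ K(5,1,4)]) (use K(6) in \<open>auto intro: borel_measurable_continuous_onI\<close>)
qed

text \<open>If bounded difference quotients converge everywhere, discrete integration by parts
  identifies the limit as the weak derivative. Thus the explicit one-sided slopes of a construction
  are its weak derivatives.\<close>

lemma weak_deriv_diffq:
  fixes w :: "real^'n \<Rightarrow> real"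
  assumes "w \<in> L_loc 1" "\<And>x. (\<lambda>n. diffq j n w x) \<longlonglongrightarrow> G x" "\<And>n x. \<bar>diffq j n w x\<bar> \<le> B"
  shows "weak_deriv j w G" "G \<in> borel_measurable borel" "\<bar>G x\<bar> \<le> B"
proof -
  have wm: "w \<in> borel_measurable borel" using assms(1) by (simp add: L_loc_def)
  have dm: "diffq j n w \<in> borel_measurable borel" for n unfolding diffq_def using wm by measurable
  show Gm: "G \<in> borel_measurable borel" by (rule borel_measurable_LIMSEQ_real[OF assms(2) dm])
  show GB: "\<bar>G x\<bar> \<le> B" for x
    using LIMSEQ_le_const2[OF tendsto_rabs[OF assms(2)[of x]]] assms(3) by blast
  show "weak_deriv j w G" unfolding weak_deriv_def
  proof
    fix \<phi> :: "real^'n \<Rightarrow> real" assume phi: "\<phi> \<in> C1_compact UNIV"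
    have phim: "\<phi> \<in> borel_measurable borel" using C1_compact_continuous[OF phi] by (rule borel_measurable_continuous_onI)
    have B0: "(\<lambda>x::real^'n. B) \<in> L_loc 1" by (rule L_loc_1_bounded[of _ "\<bar>B\<bar>"]) auto
    have "(\<lambda>n. LINT x|lborel. diffq j n w x * \<phi> x) \<longlonglongrightarrow> (LINT x|lborel. G x * \<phi> x)"
    proof (rule integral_dominated_convergence)
      show "integrable lborel (\<lambda>x. \<bar>B * \<phi> x\<bar>)" using C1_compact_integrable_mult(1)[OF B0 phi] by (rule integrable_abs)
      show "AE x in lborel. (\<lambda>n. diffq j n w x * \<phi> x) \<longlonglongrightarrow> G x * \<phi> x" by (intro AE_I2 tendsto_mult assms tendsto_const)
      show "AE x in lborel. norm (diffq j n w x * \<phi> x) \<le> \<bar>B * \<phi> x\<bar>" for n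
        using order_trans[OF assms(3) abs_ge_self] by (intro AE_I2) (auto simp: abs_mult intro!: mult_right_mono)
    qed (use Gm dm phim in auto)
    from LIMSEQ_unique[OF diffq_integral_tendsto[OF assms(1) phi] tendsto_minus[OF this]]
    show "(LINT x|lborel. w x * partial_deriv j \<phi> x) = - (LINT x|lborel. G x * \<phi> x)" .
  qed
qed

lemma weak_deriv_add:
  fixes w :: "real^'n \<Rightarrow> real"
  assumes "weak_deriv j w G" "weak_deriv j w' G'" "w \<in> L_loc 1" "w' \<in> L_loc 1" "G \<in> L_loc 1" "G' \<in> L_loc 1"
  shows "weak_deriv j (\<lambda>x. w x + w' x) (\<lambda>x. G x + G' x)"
  unfolding weak_deriv_def
proof
  fix \<phi> :: "real^'n \<Rightarrow> real" assume phi: "\<phi> \<in> C1_compact UNIV"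
  show "(LINT x|lborel. (w x + w' x) * partial_deriv j \<phi> x) = - (LINT x|lborel. (G x + G' x) * \<phi> x)"
    using assms(1,2)[unfolded weak_deriv_def, rule_format, OF phi]
    using C1_compact_integrable_mult[OF assms(3) phi] C1_compact_integrable_mult[OF assms(4) phi]
      C1_compact_integrable_mult[OF assms(5) phi] C1_compact_integrable_mult[OF assms(6) phi]
    by (simp add: distrib_right)
qed

lemma integral_partial_deriv_zero:
  fixes \<phi> :: "real^'n \<Rightarrow> real"
  assumes "\<phi> \<in> C1_compact U"
  shows "(LINT x|lborel. partial_deriv j \<phi> x) = 0"
proof -
  have phi: "\<phi> \<in> C1_compact UNIV" using C1_compact_mono[OF _ assms] by simp
  have 1: "(\<lambda>x::real^'n. 1::real) \<in> L_loc 1" by (rule L_loc_1_bounded[of _ 1]) auto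
  \<comment> \<open>The constant 1 has difference quotients 0, hence weak derivative 0; testing it
    with \<open>\<phi>\<close> is the claim.\<close>
  have "weak_deriv j (\<lambda>x::real^'n. 1) (\<lambda>x. 0)"
    by (rule weak_deriv_diffq[OF 1, of j _ 0]) (auto simp: diffq_def)
  from this[unfolded weak_deriv_def, rule_format, OF phi] show ?thesis by simp
qed

section \<open>Variation bounds from L^1 norms of increments\<close>

definition per_le :: "(real^'n \<Rightarrow> real) \<Rightarrow> real \<Rightarrow> bool" where
  "per_le f A \<longleftrightarrow> f \<in> borel_measurable borel \<and> A \<ge> 0 \<and>
     (\<forall>i. \<forall>h>0. (\<integral>\<^sup>+x. ennreal \<bar>f (x + axis i h) - f x\<bar> \<partial>lborel) \<le> ennreal (A * h))"

lemma per_le_add: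
  assumes "per_le f A" "per_le g B" shows "per_le (\<lambda>x. f x + g x) (A + B)"
  unfolding per_le_def
proof (intro conjI allI impI)
  have fm[measurable]: "f \<in> borel_measurable borel" "g \<in> borel_measurable borel" using assms by (auto simp: per_le_def)
  show "(\<lambda>x. f x + g x) \<in> borel_measurable borel" by measurable
  show "A + B \<ge> 0" using assms by (auto simp: per_le_def)
  fix i :: 'a and h :: real assume h: "h > 0"
  have "(\<integral>\<^sup>+x. ennreal \<bar>f (x + axis i h) + g (x + axis i h) - (f x + g x)\<bar> \<partial>lborel)
     \<le> (\<integral>\<^sup>+x. ennreal \<bar>f (x + axis i h) - f x\<bar> + ennreal \<bar>g (x + axis i h) - g x\<bar> \<partial>lborel)"
    by (intro nn_integral_mono) (auto simp flip: ennreal_plus intro!: ennreal_leI)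
  also have "\<dots> = (\<integral>\<^sup>+x. ennreal \<bar>f (x + axis i h) - f x\<bar> \<partial>lborel) + (\<integral>\<^sup>+x. ennreal \<bar>g (x + axis i h) - g x\<bar> \<partial>lborel)"
    by (intro nn_integral_add) auto
  also have "\<dots> \<le> ennreal (A * h) + ennreal (B * h)" using assms h by (intro add_mono) (auto simp: per_le_def)
  also have "\<dots> = ennreal ((A + B) * h)" using assms h by (simp add: per_le_def distrib_right flip: ennreal_plus)
  finally show "(\<integral>\<^sup>+x. ennreal \<bar>f (x + axis i h) + g (x + axis i h) - (f x + g x)\<bar> \<partial>lborel) \<le> ennreal ((A + B) * h)" .
qed

lemma per_le_minus: "per_le f A \<Longrightarrow> per_le (\<lambda>x. - f x) A"
  unfolding per_le_def by (auto simp: abs_minus_commute)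

lemma per_le_mono: "per_le f A \<Longrightarrow> A \<le> B \<Longrightarrow> per_le f B"
  unfolding per_le_def
proof (elim conjE, intro conjI allI impI)
  fix i and h :: real
  assume *: "A \<le> B" "\<forall>i h. 0 < h \<longrightarrow> (\<integral>\<^sup>+ x. ennreal \<bar>f (x + axis i h) - f x\<bar> \<partial>lborel) \<le> ennreal (A * h)" "0 < h"
  have "ennreal (A * h) \<le> ennreal (B * h)" using * by (intro ennreal_leI mult_right_mono) auto
  from order_trans[OF *(2)[rule_format, OF *(3)] this]
  show "(\<integral>\<^sup>+ x. ennreal \<bar>f (x + axis i h) - f x\<bar> \<partial>lborel) \<le> ennreal (B * h)" .
qed auto

lemma per_le_0: "per_le (\<lambda>x. 0) 0" unfolding per_le_def by auto

lemma C1_compact_component: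
  fixes \<phi> :: "real^'n \<Rightarrow> real^'n"
  assumes "\<phi> \<in> C1_compact U"
  shows "(\<lambda>x. \<phi> x $ j) \<in> C1_compact U" and "divergence \<phi> x = (\<Sum>j\<in>UNIV. partial_deriv j (\<lambda>x. \<phi> x $ j) x)"
proof -
  from assms obtain \<phi>' where d: "\<And>x. (\<phi> has_derivative blinfun_apply (\<phi>' x)) (at x)"
    and c: "continuous_on UNIV \<phi>'" and K: "compact (closure {x. \<phi> x \<noteq> 0})" "closure {x. \<phi> x \<noteq> 0} \<subseteq> U"
    unfolding C1_compact_def by auto
  have d': "((\<lambda>x. \<phi> x $ j) has_derivative (\<lambda>h. blinfun_apply (\<phi>' x) h $ j)) (at x)" for x j
    using bounded_linear.has_derivative[OF bounded_linear_vec_nth d[of x]] by simp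
  define g where "g j x = (\<chi> i. blinfun_apply (\<phi>' x) (axis i 1) $ j)" for x j
  have ga: "g j x \<bullet> h = blinfun_apply (\<phi>' x) h $ j" for x h j
  proof -
    have "blinfun_apply (\<phi>' x) h = blinfun_apply (\<phi>' x) (\<Sum>i\<in>UNIV. h $ i *s axis i 1)"
      by (simp add: basis_expansion)
    also have "\<dots> = (\<Sum>i\<in>UNIV. h $ i *\<^sub>R blinfun_apply (\<phi>' x) (axis i 1))"
      by (simp add: blinfun.sum_right scalar_mult_eq_scaleR blinfun.scaleR_right)
    finally show ?thesis by (simp add: g_def inner_vec_def mult.commute)
  qed
  have gc: "continuous_on UNIV (g j)" for j unfolding g_def
    by (intro continuous_intros continuous_on_vec_lambda c)
  have *: "(\<lambda>x. \<phi> x $ j) \<in> C1_compact U" "partial_deriv j (\<lambda>x. \<phi> x $ j) x = g j x $ j" for j x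
    by (rule C1_compact_gradI[of "\<lambda>x. \<phi> x $ j" "g j" "closure {x. \<phi> x \<noteq> 0}"];
      use d' gc K closure_subset[of "{x. \<phi> x \<noteq> 0}"] in \<open>fastforce simp: ga\<close>)+
  show "(\<lambda>x. \<phi> x $ j) \<in> C1_compact U" by (rule *)
  show "divergence \<phi> x = (\<Sum>j\<in>UNIV. partial_deriv j (\<lambda>x. \<phi> x $ j) x)"
    unfolding divergence_def trace_def jacobian_def matrix_def *(2) frechet_derivative_at[OF d, symmetric]
    by (simp add: g_def)
qed

text \<open>For a field of norm at most 1, each component integrated against the difference
  quotients of \<open>f\<close> gives at most \<open>A\<close>, and in the limit the quotients
  become partial derivatives of the component. The coordinates are treated separately, which costs
  the factor \<open>CARD('n)\<close>.\<close>

lemma total_variation_le: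
  fixes f :: "real^'n \<Rightarrow> real"
  assumes per: "per_le f A" and B: "\<And>x. \<bar>f x\<bar> \<le> B"
  shows "total_variation U f \<le> ennreal (real CARD('n) * A)"
  unfolding total_variation_def
proof (rule SUP_least, clarify)
  fix \<phi> :: "real^'n \<Rightarrow> real^'n" assume phi: "\<phi> \<in> C1_compact U" and le: "\<forall>x. norm (\<phi> x) \<le> 1"
  have A0: "A \<ge> 0" using per by (simp add: per_le_def)
  have fm[measurable]: "f \<in> borel_measurable borel" using per by (auto simp: per_le_def)
  have fL: "f \<in> L_loc 1" by (rule L_loc_1_bounded[OF fm B])
  have phij: "(\<lambda>x. \<phi> x $ j) \<in> C1_compact UNIV" "(\<lambda>x. \<phi> x $ j) \<in> C1_compact U" for j
    using C1_compact_component(1)[OF phi] C1_compact_mono by blast+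
  have le1: "\<bar>\<phi> x $ j\<bar> \<le> 1" for x j using component_le_norm_cart[of "\<phi> x" j] le by (meson order_trans)
  have *: "(LINT x|lborel. f x * partial_deriv j (\<lambda>x. \<phi> x $ j) x) \<le> A" for j
  proof -
  have perj: "(\<integral>\<^sup>+x. ennreal \<bar>f (x + axis j h) - f x\<bar> \<partial>lborel) \<le> ennreal (A * h)" if "h > 0" for h
    using per that by (simp add: per_le_def)
  show ?thesis
  proof (rule LIMSEQ_le_const2[OF diffq_integral_tendsto[OF fL phij(1)]], intro exI allI impI)
    fix n
    have [measurable]: "(\<lambda>x. \<phi> x $ j) \<in> borel_measurable borel" using C1_compact_continuous[OF phij(1)] by (rule borel_measurable_continuous_onI)
    have "diffq j n f \<in> L_loc 1"
    proof (rule L_loc_1_bounded)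
      show "diffq j n f \<in> borel_measurable borel" unfolding diffq_def by measurable
      show "\<bar>diffq j n f x\<bar> \<le> (B + B) * Suc n" for x
        unfolding diffq_def abs_mult using B[of x] B[of "x + axis j (1 / Suc n)"] by (intro mult_mono) auto
    qed
    then have int: "integrable lborel (\<lambda>x. diffq j n f x * \<phi> x $ j)" using C1_compact_integrable_mult(1) phij(1) by blast
    have "ennreal \<bar>LINT x|lborel. diffq j n f x * \<phi> x $ j\<bar> \<le> (\<integral>\<^sup>+x. ennreal (norm (diffq j n f x * \<phi> x $ j)) \<partial>lborel)"
      using integral_norm_bound_ennreal[OF int] by simp
    also have "\<dots> \<le> (\<integral>\<^sup>+x. ennreal (Suc n) * ennreal \<bar>f (x + axis j (1 / Suc n)) - f x\<bar> \<partial>lborel)"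
    proof (rule nn_integral_mono)
      fix x
      have "norm (diffq j n f x * \<phi> x $ j) \<le> \<bar>diffq j n f x\<bar>"
        using mult_left_mono[OF le1[of x j], of "\<bar>diffq j n f x\<bar>"] by (simp add: abs_mult)
      also have "\<dots> = Suc n * \<bar>f (x + axis j (1 / Suc n)) - f x\<bar>" by (simp add: diffq_def abs_mult mult.commute)
      finally show "ennreal (norm (diffq j n f x * \<phi> x $ j)) \<le> ennreal (Suc n) * ennreal \<bar>f (x + axis j (1 / Suc n)) - f x\<bar>"
        by (subst ennreal_mult[symmetric]) (auto intro: ennreal_leI)
    qed
    also have "\<dots> = ennreal (Suc n) * (\<integral>\<^sup>+x. ennreal \<bar>f (x + axis j (1 / Suc n)) - f x\<bar> \<partial>lborel)"
      by (rule nn_integral_cmult) measurable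
    also have "\<dots> \<le> ennreal (Suc n) * ennreal (A * (1 / Suc n))"
    proof (rule mult_left_mono)
      have "0 < 1 / real (Suc n)" by simp
      then show "(\<integral>\<^sup>+x. ennreal \<bar>f (x + axis j (1 / Suc n)) - f x\<bar> \<partial>lborel) \<le> ennreal (A * (1 / Suc n))" by (rule perj)
      show "(0::ennreal) \<le> ennreal (Suc n)" by (rule zero_le)
    qed
    also have "\<dots> = ennreal A" using A0 by (subst ennreal_mult[symmetric]) (auto simp del: of_nat_Suc)
    finally show "- (LINT x|lborel. diffq j n f x * \<phi> x $ j) \<le> A" using A0 by (simp add: ennreal_le_iff)
  qed
  qed
  have "(LINT x:U|lborel. f x * divergence \<phi> x) = (LINT x|lborel. (\<Sum>j\<in>UNIV. f x * partial_deriv j (\<lambda>x. \<phi> x $ j) x))"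
    unfolding set_lebesgue_integral_def
  proof (rule Bochner_Integration.integral_cong[OF refl])
    fix x
    show "indicat_real U x *\<^sub>R (f x * divergence \<phi> x) = (\<Sum>j\<in>UNIV. f x * partial_deriv j (\<lambda>x. \<phi> x $ j) x)"
    proof (cases "x \<in> U")
      case True then show ?thesis by (simp add: C1_compact_component(2)[OF phi] sum_distrib_left)
    next
      case False
      have "partial_deriv j (\<lambda>x. \<phi> x $ j) x = 0" for j
      proof -
        obtain g K where *: "K \<subseteq> U" "\<And>y i. partial_deriv i (\<lambda>x. \<phi> x $ j) y = g y $ i" "\<And>y. y \<notin> K \<Longrightarrow> g y = 0"
          by (rule C1_compact_C1_grad[OF phij(2)[of j]]) blast
        have "x \<notin> K" using *(1) False by blast
        then show ?thesis using *(2)[of j x] *(3)[of x] by simp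
      qed
      then show ?thesis using False by simp
    qed
  qed
  also have "\<dots> = (\<Sum>j\<in>UNIV. LINT x|lborel. f x * partial_deriv j (\<lambda>x. \<phi> x $ j) x)"
    by (intro Bochner_Integration.integral_sum C1_compact_integrable_mult[OF fL phij(1)])
  also have "\<dots> \<le> (\<Sum>j\<in>(UNIV::'n set). A)" by (intro sum_mono *)
  finally show "ennreal (LINT x:U|lborel. f x * divergence \<phi> x) \<le> ennreal (real CARD('n) * A)" by (intro ennreal_leI) simp
qed

section \<open>Slicing the plane along either coordinate\<close>

definition comb :: "2 \<Rightarrow> real \<Rightarrow> real \<Rightarrow> real^2" where
  "comb i s t = (\<chi> k. if k = i then s else t)"

lemma comb_nth: "comb i s t $ i = s" "k \<noteq> i \<Longrightarrow> comb i s t $ k = t"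
  by (auto simp: comb_def)

lemma comb_add_axis: "i \<noteq> j \<Longrightarrow> comb j s t + axis i h = comb j s (t + h)" for i j :: 2
  using exhaust_2[of i] exhaust_2[of j] by (auto simp: comb_def vec_eq_iff axis_def forall_2)

lemma borel_measurable_comb[measurable]: "(\<lambda>(s, t). comb i s t) \<in> borel_measurable (borel \<Otimes>\<^sub>M borel)"
proof -
  have *: "comb i s t = axis i s + (\<Sum>k\<in>UNIV - {i}. axis k t)" for s t
  proof -
    have "(\<Sum>k\<in>UNIV - {i}. axis k t) $ j = (if j = i then 0 else t)" for j
    proof -
      have "(\<Sum>k\<in>UNIV - {i}. axis k t) $ j = (\<Sum>k\<in>UNIV - {i}. if j = k then t else 0)" by (simp add: axis_def eq_commute)
      also have "\<dots> = (if j = i then 0 else t)" by (subst sum.delta') auto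
      finally show ?thesis .
    qed
    then show ?thesis by (auto simp: comb_def vec_eq_iff axis_def)
  qed
  have ax: "axis k = (\<lambda>r::real. r *\<^sub>R (axis k 1 :: real^2))" for k by (auto simp: axis_def vec_eq_iff)
  have "continuous_on UNIV (\<lambda>(s, t). comb i s t)"
    unfolding * by (subst (1 2) ax) (auto intro!: continuous_intros simp: split_beta)
  then show ?thesis by (simp add: borel_prod borel_measurable_continuous_onI)
qed

text \<open>Both measures give a box the product of its side lengths. The distinguished direction is
  a parameter because the two components of the deformation use the same sawtooth with the axes
  exchanged.\<close>

lemma lborel_comb: "distr (lborel \<Otimes>\<^sub>M lborel) borel (\<lambda>(s, t). comb i s t) = (lborel :: (real^2) measure)"
proof (rule lborel_eqI[symmetric])
  fix l u :: "real^2" assume le: "\<And>b. b \<in> Basis \<Longrightarrow> l \<bullet> b \<le> u \<bullet> b"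
  obtain j where j: "j \<noteq> i" by (metis exhaust_2 zero_neq_one)
  have U: "UNIV = {i, j}" using j exhaust_2[of i] exhaust_2[of j] by (auto simp: UNIV_2)
  have le': "l $ k \<le> u $ k" for k using le[of "axis k 1"] by (simp add: inner_axis)
  have "(\<lambda>(s, t). comb i s t) -` box l u \<inter> space (lborel \<Otimes>\<^sub>M lborel) = box (l $ i) (u $ i) \<times> box (l $ j) (u $ j)"
  proof -
    have "(\<forall>k. l $ k < comb i s t $ k \<and> comb i s t $ k < u $ k) \<longleftrightarrow> l $ i < s \<and> s < u $ i \<and> l $ j < t \<and> t < u $ j" for s t
    proof -
      have "(\<forall>k. P k) \<longleftrightarrow> P i \<and> P j" for P using U by (metis UNIV_I empty_iff insert_iff)
      then show ?thesis using j by (simp add: comb_def)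
    qed
    then show ?thesis by (auto simp: space_pair_measure mem_box_cart)
  qed
  then have "emeasure (distr (lborel \<Otimes>\<^sub>M lborel) borel (\<lambda>(s, t). comb i s t)) (box l u)
    = emeasure (lborel \<Otimes>\<^sub>M lborel) (box (l $ i) (u $ i) \<times> box (l $ j) (u $ j))"
    by (subst emeasure_distr) auto
  also have "\<dots> = ennreal ((u $ i - l $ i) * (u $ j - l $ j))"
    using le'[of i] le'[of j] by (subst lborel.emeasure_pair_measure_Times) (auto simp: ennreal_mult)
  also have "(u $ i - l $ i) * (u $ j - l $ j) = (\<Prod>k\<in>UNIV. (u - l) $ k)" unfolding U using j by simp
  also have "\<dots> = (\<Prod>b\<in>Basis. (u - l) \<bullet> b)"
  proof -
    have B: "(Basis :: (real^2) set) = (\<lambda>k. axis k 1) ` UNIV" by (auto simp: Basis_vec_def)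
    have inj: "inj (\<lambda>k. axis k (1::real) :: real^2)" by (auto simp: inj_def axis_eq_axis)
    have "(\<Prod>b\<in>Basis. (u - l) \<bullet> b) = (\<Prod>k\<in>UNIV. (u - l) \<bullet> axis k 1)"
      unfolding B prod.reindex[OF inj] by (simp add: o_def)
    then show ?thesis by (simp add: inner_axis)
  qed
  finally show "emeasure (distr (lborel \<Otimes>\<^sub>M lborel) borel (\<lambda>(s, t). comb i s t)) (box l u) = ennreal (\<Prod>b\<in>Basis. (u - l) \<bullet> b)" .
qed simp

lemma nn_integral_real2:
  fixes f :: "real^2 \<Rightarrow> ennreal"
  assumes [measurable]: "f \<in> borel_measurable borel"
  shows "(\<integral>\<^sup>+x. f x \<partial>lborel) = (\<integral>\<^sup>+s. \<integral>\<^sup>+t. f (comb i s t) \<partial>lborel \<partial>lborel)"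
proof -
  have "(\<integral>\<^sup>+x. f x \<partial>lborel) = (\<integral>\<^sup>+p. f (case p of (s, t) \<Rightarrow> comb i s t) \<partial>(lborel \<Otimes>\<^sub>M lborel))"
    by (subst lborel_comb[of i, symmetric], subst nn_integral_distr) auto
  also have "\<dots> = (\<integral>\<^sup>+s. \<integral>\<^sup>+t. f (comb i s t) \<partial>lborel \<partial>lborel)"
    by (subst lborel.nn_integral_fst[symmetric]) auto
  finally show ?thesis .
qed

lemma emeasure_lborel_le_diameter:
  fixes D :: "real set"
  assumes "\<And>s t. s \<in> D \<Longrightarrow> t \<in> D \<Longrightarrow> t - s \<le> h" "h \<ge> 0"
  shows "emeasure lborel D \<le> ennreal h"
proof (cases "D = {}")
  case False
  then obtain d where d: "d \<in> D" by auto
  have bdd: "bdd_below D" using assms(1)[OF _ d] by (intro bdd_belowI[of _ "d - h"]) (simp add: algebra_simps)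
  have "D \<subseteq> {Inf D .. Inf D + h}"
  proof
    fix t assume t: "t \<in> D"
    have "t - h \<le> Inf D" using False assms(1)[OF _ t] by (intro cInf_greatest) (auto simp: algebra_simps)
    then show "t \<in> {Inf D .. Inf D + h}" using cInf_lower[OF t bdd] by auto
  qed
  then have "emeasure lborel D \<le> emeasure lborel {Inf D .. Inf D + h}" by (intro emeasure_mono) auto
  then show ?thesis using assms(2) by simp
qed simp

text \<open>The indicator changes only where a step of length \<open>h\<close> leaves
  \<open>J\<close> (\<open>D1\<close>) or enters it (\<open>D2\<close>); for an interval each of
  these sets has diameter at most \<open>h\<close>.\<close>

lemma nn_integral_interval_shift:
  fixes J :: "real set"
  assumes J: "convex J" and [measurable]: "J \<in> sets borel" and h: "h > 0"
  shows "(\<integral>\<^sup>+t. ennreal \<bar>indicator J (t + h) - indicator J t\<bar> \<partial>lborel) \<le> ennreal (2 * h)"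
proof -
  have mem: "b \<in> J" if "a \<in> J" "c \<in> J" "a \<le> b" "b \<le> c" for a c b
    using mem_is_interval_1_I[OF J[folded is_interval_convex_1] that] .
  define D1 where "D1 = {t. t \<in> J \<and> t + h \<notin> J}"
  define D2 where "D2 = {t. t \<notin> J \<and> t + h \<in> J}"
  have m[measurable]: "D1 \<in> sets borel" "D2 \<in> sets borel" unfolding D1_def D2_def by measurable
  have "emeasure lborel D1 \<le> ennreal h"
  proof (rule emeasure_lborel_le_diameter)
    fix s t assume "s \<in> D1" "t \<in> D1"
    then have "s \<in> J" "s + h \<notin> J" "t \<in> J" by (auto simp: D1_def)
    then show "t - s \<le> h" using mem[of s t "s + h"] h by (cases "s + h \<le> t") auto
  qed (use h in auto)
  moreover have "emeasure lborel D2 \<le> ennreal h"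
  proof (rule emeasure_lborel_le_diameter)
    fix s t assume "s \<in> D2" "t \<in> D2"
    then have "s + h \<in> J" "t + h \<in> J" "t \<notin> J" by (auto simp: D2_def)
    then show "t - s \<le> h" using mem[of "s + h" "t + h" t] h by (cases "s + h \<le> t") auto
  qed (use h in auto)
  moreover have "(\<integral>\<^sup>+t. ennreal \<bar>indicator J (t + h) - indicator J t\<bar> \<partial>lborel) \<le> (\<integral>\<^sup>+t. indicator D1 t + indicator D2 t \<partial>lborel)"
    by (intro nn_integral_mono) (auto simp: D1_def D2_def indicator_def)
  moreover have "(\<integral>\<^sup>+t. indicator D1 t + indicator D2 t \<partial>lborel) = emeasure lborel D1 + emeasure lborel D2"
    by (subst nn_integral_add) auto
  ultimately have "(\<integral>\<^sup>+t. ennreal \<bar>indicator J (t + h) - indicator J t\<bar> \<partial>lborel) \<le> ennreal h + ennreal h"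
    by (auto intro: order_trans add_mono)
  then show ?thesis using h by (simp flip: ennreal_plus)
qed

text \<open>Every line parallel to an axis meets a convex set in an interval and contributes at most
  \<open>2 * h\<close>; the lines that meet it range over the extent of the bounding box in the
  other coordinate.\<close>

lemma per_le_convex:
  fixes P :: "(real^2) set"
  assumes P: "convex P" and [measurable]: "P \<in> sets borel"
    and sub: "\<And>x k. x \<in> P \<Longrightarrow> a k \<le> x $ k \<and> x $ k \<le> b k" and ab: "\<And>k. a k \<le> b k"
  shows "per_le (indicator P) (2 * ((b 1 - a 1) + (b 2 - a 2)))"
  unfolding per_le_def
proof (intro conjI allI impI)
  show "2 * ((b 1 - a 1) + (b 2 - a 2)) \<ge> 0" using ab[of 1] ab[of 2] by simp
  fix i :: 2 and h :: real assume h: "h > 0"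
  obtain j where j: "i \<noteq> j" by (metis exhaust_2 zero_neq_one)
  have "(\<integral>\<^sup>+x. ennreal \<bar>indicator P (x + axis i h) - indicator P x\<bar> \<partial>lborel)
     = (\<integral>\<^sup>+s. \<integral>\<^sup>+t. ennreal \<bar>indicator P (comb j s (t + h)) - indicator P (comb j s t)\<bar> \<partial>lborel \<partial>lborel)"
    by (subst nn_integral_real2[of _ j]) (auto simp: comb_add_axis[OF j])
  also have "\<dots> \<le> (\<integral>\<^sup>+s. ennreal (2 * h) * indicator {a j .. b j} s \<partial>lborel)"
  proof (rule nn_integral_mono)
    fix s
    define J where "J = {t. comb j s t \<in> P}"
    have [measurable]: "(\<lambda>t. comb j s t) \<in> borel_measurable borel"
      using measurable_Pair2[OF borel_measurable_comb[of j], of s] by simp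
    have Jm: "J \<in> sets borel" unfolding J_def by measurable
    have "convex J"
    proof (rule convexI)
      fix x y u v :: real assume *: "x \<in> J" "y \<in> J" "0 \<le> u" "0 \<le> v" "u + v = 1"
      have "u *\<^sub>R comb j s x + v *\<^sub>R comb j s y = comb j s (u *\<^sub>R x + v *\<^sub>R y)"
        using *(5) by (auto simp: comb_def vec_eq_iff distrib_right[symmetric])
      then show "u *\<^sub>R x + v *\<^sub>R y \<in> J" using * convexD[OF P, of "comb j s x" "comb j s y" u v] by (simp add: J_def)
    qed
    then have *: "(\<integral>\<^sup>+t. ennreal \<bar>indicator J (t + h) - indicator J t\<bar> \<partial>lborel) \<le> ennreal (2 * h)"
      using Jm h by (rule nn_integral_interval_shift)
    have **: "indicator P (comb j s t) = (indicator J t :: real)" for t by (simp add: J_def indicator_def)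
    show "(\<integral>\<^sup>+t. ennreal \<bar>indicator P (comb j s (t + h)) - indicator P (comb j s t)\<bar> \<partial>lborel) \<le> ennreal (2 * h) * indicator {a j .. b j} s"
    proof (cases "s \<in> {a j .. b j}")
      case True then show ?thesis using * by (simp add: **)
    next
      case False
      then have "comb j s t \<notin> P" for t using sub[of "comb j s t" j] by (auto simp: comb_nth)
      then show ?thesis by simp
    qed
  qed
  also have "\<dots> = ennreal (2 * h) * ennreal (b j - a j)" using ab[of j] by (subst nn_integral_cmult_indicator) auto
  also have "\<dots> = ennreal (2 * (b j - a j) * h)" using ab[of j] h by (subst ennreal_mult[symmetric]) (auto simp: algebra_simps)
  also have "\<dots> \<le> ennreal (2 * ((b 1 - a 1) + (b 2 - a 2)) * h)"
    using ab[of 1] ab[of 2] h exhaust_2[of j] by (intro ennreal_leI mult_right_mono) auto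
  finally show "(\<integral>\<^sup>+x. ennreal \<bar>indicator P (x + axis i h) - indicator P x\<bar> \<partial>lborel) \<le> ennreal (2 * ((b 1 - a 1) + (b 2 - a 2)) * h)" .
qed simp

section \<open>The fundamental lemma of the calculus of variations\<close>

lemma integral_box_zero_if_test_zero:
  fixes f :: "real^2 \<Rightarrow> real"
  assumes f: "f \<in> L_loc 1" and z: "\<And>\<phi>. \<phi> \<in> C1_compact UNIV \<Longrightarrow> (LINT x|lborel. f x * \<phi> x) = 0"
  shows "(LINT x|lborel. f x * indicator (box a b) x) = 0"
proof (cases "box a b = {}")
  case False
  then have ab: "a $ i < b $ i" for i by (simp add: interval_ne_empty_cart)
  define k where "k i x = (max 0 ((x $ i - a $ i) * (b $ i - x $ i)))\<^sup>2" for i and x :: "real^2"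
  define \<beta> where "\<beta> x = k 1 x * k 2 x" for x
  have k0: "k i x \<ge> 0" for i x by (simp add: k_def)
  have kpos: "k i x > 0 \<longleftrightarrow> a $ i < x $ i \<and> x $ i < b $ i" for i x
  proof -
    have "k i x > 0 \<longleftrightarrow> (x $ i - a $ i) * (b $ i - x $ i) > 0" by (auto simp: k_def max_def less_le)
    also have "\<dots> \<longleftrightarrow> a $ i < x $ i \<and> x $ i < b $ i" using ab[of i] by (auto simp: zero_less_mult_iff)
    finally show ?thesis .
  qed
  have b0: "\<beta> x \<ge> 0" for x using k0 by (simp add: \<beta>_def)
  have bpos: "\<beta> x > 0 \<longleftrightarrow> x \<in> box a b" for x
    using kpos k0[of 1 x] k0[of 2 x] by (auto simp: \<beta>_def mem_box_cart forall_2 zero_less_mult_iff)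
  have "\<exists>g. C1_grad (k i) g" for i unfolding k_def[abs_def]
    by (rule exI, rule C1_grad_max0_square[OF C1_grad_mult[OF C1_grad_diff[OF C1_grad_component C1_grad_const]
      C1_grad_diff[OF C1_grad_const C1_grad_component]]])
  then obtain kg where "C1_grad (k i) (kg i)" for i by metis
  from C1_grad_mult[OF this this] obtain g where g: "C1_grad \<beta> g" unfolding \<beta>_def[abs_def] by blast
  \<comment> \<open>\<open>\<beta>\<close> is positive exactly on the open box, so these C^1
    functions with values in [0, 1] converge pointwise to its indicator.\<close>
  define \<phi> where "\<phi> n x = (real n * \<beta> x) / (1 + real n * \<beta> x)" for n x
  define p where "p s = s / (1 + s)" for s :: real
  have "\<exists>g. C1_grad (\<phi> n) g" for n
  proof -
    have "\<exists>g. C1_grad (\<lambda>x. \<phi> n x) g"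
    proof -
      have "C1_grad (\<lambda>x. real n * \<beta> x) (\<lambda>x. \<beta> x *\<^sub>R 0 + real n *\<^sub>R g x)"
        using C1_grad_mult[OF C1_grad_const g] .
      then have A: "C1_grad (\<lambda>x. real n * \<beta> x) (\<lambda>x. real n *\<^sub>R g x)" by simp
      have pos: "1 + real n * \<beta> x > 0" for x using b0[of x] by (intro add_pos_nonneg) auto
      have "C1_grad (\<phi> n) (\<lambda>x. (1 / (1 + real n * \<beta> x)\<^sup>2) *\<^sub>R (real n *\<^sub>R g x))"
        unfolding C1_grad_def
      proof (intro conjI allI)
        fix x
        have "(p has_real_derivative 1 / (1 + real n * \<beta> x)\<^sup>2) (at (real n * \<beta> x))"
          unfolding p_def using pos[of x] by (auto intro!: derivative_eq_intros simp: power2_eq_square field_simps)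
        then have "(p has_derivative (*) (1 / (1 + real n * \<beta> x)\<^sup>2)) (at (real n * \<beta> x))" by (simp add: has_field_derivative_def)
        from has_derivative_compose[OF C1_gradD[OF A] this]
        have "((\<lambda>x. p (real n * \<beta> x)) has_derivative (\<lambda>h. ((1 / (1 + real n * \<beta> x)\<^sup>2) *\<^sub>R (real n *\<^sub>R g x)) \<bullet> h)) (at x)" by simp
        then show "(\<phi> n has_derivative (\<lambda>h. ((1 / (1 + real n * \<beta> x)\<^sup>2) *\<^sub>R (real n *\<^sub>R g x)) \<bullet> h)) (at x)"
          by (simp add: p_def \<phi>_def[abs_def])
        show "continuous_on UNIV (\<lambda>x. (1 / (1 + real n * \<beta> x)\<^sup>2) *\<^sub>R (real n *\<^sub>R g x))"
          using pos by (intro continuous_intros C1_grad_continuous[OF g] C1_grad_continuous_grad[OF g]) (auto simp: less_imp_neq[symmetric])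
      qed
      then show ?thesis by blast
    qed
    then show ?thesis by simp
  qed
  then obtain gg where gg: "C1_grad (\<phi> n) (gg n)" for n by metis
  have phi_out: "\<phi> n x = 0" if "x \<notin> box a b" for n x using bpos[of x] b0[of x] that by (simp add: \<phi>_def)
  have phiC: "\<phi> n \<in> C1_compact UNIV" for n
  proof (rule C1_grad_C1_compact(1)[OF gg compact_cbox])
    show "x \<in> cbox a b" if "\<phi> n x \<noteq> 0" for x using phi_out[of x n] that box_subset_cbox[of a b] by blast
  qed auto
  have "(\<lambda>n. LINT x|lborel. f x * \<phi> n x) \<longlonglongrightarrow> (LINT x|lborel. f x * indicator (box a b) x)"
  proof (rule integral_dominated_convergence)
    have fm: "f \<in> borel_measurable borel" using f by (simp add: L_loc_def)
    have "integrable lborel (\<lambda>x. f x * indicator (cbox a b) x)"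
      by (rule L_loc_integrable_mult[OF f _ _ compact_cbox, of _ 1]) (auto simp: indicator_def)
    then show "integrable lborel (\<lambda>x. \<bar>f x * indicator (cbox a b) x\<bar>)" by (rule integrable_abs)
    show "(\<lambda>x. f x * indicator (box a b) x) \<in> borel_measurable lborel" using fm by auto
    show "(\<lambda>x. f x * \<phi> n x) \<in> borel_measurable lborel" for n
      using fm borel_measurable_continuous_onI[OF C1_compact_continuous[OF phiC[of n]]] by auto
    show "AE x in lborel. norm (f x * \<phi> n x) \<le> \<bar>f x * indicator (cbox a b) x\<bar>" for n
    proof (rule AE_I2)
      fix x
      have "real n * \<beta> x \<ge> 0" using b0[of x] by simp
      then have "\<bar>\<phi> n x\<bar> \<le> 1" unfolding \<phi>_def by (simp add: divide_le_eq)
      then show "norm (f x * \<phi> n x) \<le> \<bar>f x * indicator (cbox a b) x\<bar>"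
        using phi_out[of x n] box_subset_cbox[of a b] by (cases "x \<in> box a b") (auto simp: abs_mult mult_left_le)
    qed
    show "AE x in lborel. (\<lambda>n. f x * \<phi> n x) \<longlonglongrightarrow> f x * indicator (box a b) x"
    proof (intro AE_I2 tendsto_mult tendsto_const)
      fix x
      show "(\<lambda>n. \<phi> n x) \<longlonglongrightarrow> indicator (box a b) x"
      proof (cases "x \<in> box a b")
        case True
        then have pos: "\<beta> x > 0" using bpos by simp
        have "(\<lambda>n. 1 - 1 / (1 + real n * \<beta> x)) \<longlonglongrightarrow> 1 - 0"
        proof (intro tendsto_diff tendsto_const tendsto_divide_0[OF tendsto_const])
          have "filterlim (\<lambda>n. real n * \<beta> x) at_top sequentially"
            by (rule filterlim_at_top_mult_tendsto_pos[OF tendsto_const pos filterlim_real_sequentially])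
          then have "filterlim (\<lambda>n. 1 + real n * \<beta> x) at_top sequentially"
            by (intro filterlim_tendsto_add_at_top[OF tendsto_const])
          then show "filterlim (\<lambda>n. 1 + real n * \<beta> x) at_infinity sequentially" by (rule filterlim_at_top_imp_at_infinity)
        qed
        moreover have "1 - 1 / (1 + real n * \<beta> x) = \<phi> n x" for n
        proof -
          have "1 + real n * \<beta> x > 0" using pos by (intro add_pos_nonneg) auto
          then show ?thesis by (simp add: \<phi>_def field_simps)
        qed
        ultimately show ?thesis using True by simp
      qed (use phi_out in auto)
    qed
  qed
  moreover have "(LINT x|lborel. f x * \<phi> n x) = 0" for n using z[OF phiC] .
  ultimately show ?thesis using LIMSEQ_unique[OF _ tendsto_const] by fastforce
qed simp

text \<open>The densities \<open>ennreal (f x)\<close> and \<open>ennreal (- f x)\<close> are the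
  positive and the negative part. They give equal finite mass to every box, and boxes are stable
  under intersection and generate the Borel sets, so the two measures and hence the two parts
  agree.\<close>

lemma AE_zero_if_test_zero:
  fixes f :: "real^2 \<Rightarrow> real"
  assumes f: "f \<in> L_loc 1" and z: "\<And>\<phi>. \<phi> \<in> C1_compact UNIV \<Longrightarrow> (LINT x|lborel. f x * \<phi> x) = 0"
  shows "AE x in lborel. f x = 0"
proof -
  have fm[measurable]: "f \<in> borel_measurable borel" using f by (simp add: L_loc_def)
  have int: "integrable lborel (\<lambda>x. f x * indicator (box a b) x)" for a b
  proof -
    have "integrable lborel (\<lambda>x. f x * indicator (cbox a b) x)"
      by (rule L_loc_integrable_mult[OF f _ _ compact_cbox, of _ 1]) (auto simp: indicator_def)
    then show ?thesis
      by (rule Bochner_Integration.integrable_bound) (use box_subset_cbox[of a b] in \<open>auto simp: indicator_def\<close>)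
  qed
  have fin: "(\<integral>\<^sup>+x. ennreal (f x) * indicator (box a b) x \<partial>lborel) \<noteq> \<infinity>"
    "(\<integral>\<^sup>+x. ennreal (f x) * indicator (box a b) x \<partial>lborel) = (\<integral>\<^sup>+x. ennreal (- f x) * indicator (box a b) x \<partial>lborel)" for a b
  proof -
    have e: "ennreal (f x) * indicator (box a b) x = ennreal (f x * indicator (box a b) x)"
       "ennreal (- f x) * indicator (box a b) x = ennreal (- (f x * indicator (box a b) x))" for x
      by (auto simp: indicator_def)
    have f1: "(\<integral>\<^sup>+x. ennreal (f x * indicator (box a b) x) \<partial>lborel) \<noteq> \<infinity>" "(\<integral>\<^sup>+x. ennreal (- (f x * indicator (box a b) x)) \<partial>lborel) \<noteq> \<infinity>"
      using int[of a b] unfolding real_integrable_def by auto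
    have "enn2real (\<integral>\<^sup>+x. ennreal (f x * indicator (box a b) x) \<partial>lborel) = enn2real (\<integral>\<^sup>+x. ennreal (- (f x * indicator (box a b) x)) \<partial>lborel)"
      using real_lebesgue_integral_def[OF int[of a b]] integral_box_zero_if_test_zero[OF f z, of a b] by simp
    then have "(\<integral>\<^sup>+x. ennreal (f x * indicator (box a b) x) \<partial>lborel) = (\<integral>\<^sup>+x. ennreal (- (f x * indicator (box a b) x)) \<partial>lborel)"
      using f1 by (cases "\<integral>\<^sup>+x. ennreal (f x * indicator (box a b) x) \<partial>lborel"; cases "\<integral>\<^sup>+x. ennreal (- (f x * indicator (box a b) x)) \<partial>lborel") simp_all
    then show "(\<integral>\<^sup>+x. ennreal (f x) * indicator (box a b) x \<partial>lborel) \<noteq> \<infinity>"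
       "(\<integral>\<^sup>+x. ennreal (f x) * indicator (box a b) x \<partial>lborel) = (\<integral>\<^sup>+x. ennreal (- f x) * indicator (box a b) x \<partial>lborel)"
      using f1(1) unfolding e by auto
  qed
  have "density lborel (\<lambda>x. ennreal (f x)) = density lborel (\<lambda>x. ennreal (- f x))"
  proof (rule measure_eqI_generator_eq[where E = "range (\<lambda>(a, b). box a b)" and \<Omega> = UNIV and A = "\<lambda>n. box (- (real n *\<^sub>R One)) (real n *\<^sub>R One)"])
    show "Int_stable (range (\<lambda>(a, b). box a b :: (real^2) set))" by (auto simp: Int_stable_def box_Int_box)
    show "emeasure (density lborel (\<lambda>x. ennreal (f x))) X = emeasure (density lborel (\<lambda>x. ennreal (- f x))) X"
      if "X \<in> range (\<lambda>(a, b). box a b)" for X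
      using that fin(2) by (auto simp: emeasure_density)
    show "emeasure (density lborel (\<lambda>x. ennreal (f x))) (box (- (real n *\<^sub>R One)) (real n *\<^sub>R One)) \<noteq> \<infinity>" for n
      using fin(1) by (auto simp: emeasure_density)
  qed (auto simp: borel_eq_box UN_box_eq_UNIV)
  then have "AE x in lborel. ennreal (f x) = ennreal (- f x)" by (subst (asm) sigma_finite_measure.density_unique_iff[OF sigma_finite_lborel]) auto
  then show ?thesis
  proof eventually_elim
    case (elim x)
    show ?case using elim by (cases "f x \<ge> 0") (auto simp: ennreal_neg)
  qed
qed

section \<open>Branching functions of one sawtooth\<close>

text \<open>Piecewise affine in the sense of germs: no list of breakpoints has to be carried along,
  and maxima and gluings are treated point by point. The slope \<open>r\<close> refers to the
  distance \<open>t\<close>, so for \<open>\<sigma> = -1\<close> it is the negative of the left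
  derivative.\<close>

definition pwa :: "(real \<Rightarrow> real) \<Rightarrow> bool" where
  "pwa f \<longleftrightarrow> (\<forall>x. \<forall>\<sigma>\<in>{1,-1}. \<exists>r. \<exists>\<delta>>0. \<forall>t. 0 \<le> t \<and> t \<le> \<delta> \<longrightarrow> f (x + \<sigma> * t) = f x + r * t)"

lemma pwaI:
  assumes "\<And>x \<sigma>. \<sigma> = 1 \<or> \<sigma> = -1 \<Longrightarrow> \<exists>r. \<exists>\<delta>>0. \<forall>t. 0 \<le> t \<and> t \<le> \<delta> \<longrightarrow> f (x + \<sigma> * t) = f x + r * t"
  shows "pwa f"
  using assms unfolding pwa_def by blast

lemma affine_germI:
  fixes F :: "real \<Rightarrow> real"
  assumes "\<delta> > 0" "\<And>t. 0 \<le> t \<Longrightarrow> t \<le> \<delta> \<Longrightarrow> F t = a + r * t"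
  shows "\<exists>r. \<exists>\<delta>>0. \<forall>t. 0 \<le> t \<and> t \<le> \<delta> \<longrightarrow> F t = a + r * t"
  using assms by blast

lemma pwaE:
  assumes "pwa f" "\<sigma> = 1 \<or> \<sigma> = -1"
  obtains r \<delta> where "\<delta> > 0" "\<And>t. 0 \<le> t \<Longrightarrow> t \<le> \<delta> \<Longrightarrow> f (x + \<sigma> * t) = f x + r * t"
  using assms unfolding pwa_def by (metis insertCI)

lemma pwa_affine: "pwa (\<lambda>x. c * x + d)"
proof (rule pwaI, intro exI conjI allI impI)
  show "c * (x + \<sigma> * t) + d = c * x + d + (c * \<sigma>) * t" for x \<sigma> t :: real by (simp add: algebra_simps)
  show "(0::real) < 1" by simp
qed

lemma pwa_cmult: assumes "pwa f" shows "pwa (\<lambda>x. c * f x)"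
proof (rule pwaI)
  fix x \<sigma> :: real assume s: "\<sigma> = 1 \<or> \<sigma> = -1"
  from pwaE[OF assms s, of x] obtain r \<delta> where r: "\<delta> > 0" "\<And>t. 0 \<le> t \<Longrightarrow> t \<le> \<delta> \<Longrightarrow> f (x + \<sigma> * t) = f x + r * t" by metis
  show "\<exists>r. \<exists>\<delta>>0. \<forall>t. 0 \<le> t \<and> t \<le> \<delta> \<longrightarrow> c * f (x + \<sigma> * t) = c * f x + r * t"
    by (rule affine_germI[where r="c * r" and \<delta>=\<delta>]) (auto simp: r distrib_left mult.assoc)
qed

text \<open>Where the values differ, the larger function stays larger for a short time; where they
  agree, the larger slope wins on that side.\<close>

lemma pwa_max: assumes "pwa f" "pwa g" shows "pwa (\<lambda>x. max (f x) (g x))"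
proof (rule pwaI)
  fix x \<sigma> :: real assume s: "\<sigma> = 1 \<or> \<sigma> = -1"
  from pwaE[OF assms(1) s, of x] obtain r \<delta> where r: "\<delta> > 0" "\<And>t. 0 \<le> t \<Longrightarrow> t \<le> \<delta> \<Longrightarrow> f (x + \<sigma> * t) = f x + r * t" by metis
  from pwaE[OF assms(2) s, of x] obtain r' \<delta>' where r': "\<delta>' > 0" "\<And>t. 0 \<le> t \<Longrightarrow> t \<le> \<delta>' \<Longrightarrow> g (x + \<sigma> * t) = g x + r' * t" by metis
  have *: "\<exists>\<delta>''>0. \<forall>t. 0 \<le> t \<and> t \<le> \<delta>'' \<longrightarrow> a + r * t \<ge> b + r' * t" if "a > b" for a b r' r :: real
  proof (intro exI conjI allI impI)
    \<comment> \<open>A gap a - b closes at a speed of at most |r - r'|; the summand 1 keeps the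
      denominator positive.\<close>
    show "(a - b) / (1 + \<bar>r - r'\<bar>) > 0" using that by (intro divide_pos_pos) auto
    fix t assume t: "0 \<le> t \<and> t \<le> (a - b) / (1 + \<bar>r - r'\<bar>)"
    moreover have D: "1 + \<bar>r - r'\<bar> > 0" by simp
    ultimately have "t * (1 + \<bar>r - r'\<bar>) \<le> a - b" by (simp only: pos_le_divide_eq[OF D])
    moreover have "t * (r' - r) \<le> t * (1 + \<bar>r - r'\<bar>)"
      by (rule mult_left_mono[OF _ conjunct1[OF t]]) linarith
    ultimately show "a + r * t \<ge> b + r' * t" unfolding right_diff_distrib by (simp only: mult.commute[of _ t])
  qed
  consider "f x > g x" | "f x < g x" | "f x = g x" by linarith
  then show "\<exists>r. \<exists>\<delta>>0. \<forall>t. 0 \<le> t \<and> t \<le> \<delta> \<longrightarrow> max (f (x + \<sigma> * t)) (g (x + \<sigma> * t)) = max (f x) (g x) + r * t"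
  proof cases
    case 1
    obtain d where "0 < d \<and> (\<forall>t. 0 \<le> t \<and> t \<le> d \<longrightarrow> g x + r' * t \<le> f x + r * t)"
      using *[OF 1, of r' r] by (rule exE)
    then have d: "d > 0" "\<And>t. 0 \<le> t \<and> t \<le> d \<longrightarrow> g x + r' * t \<le> f x + r * t" by simp_all
    have "max (f (x + \<sigma> * t)) (g (x + \<sigma> * t)) = max (f x) (g x) + r * t" if "0 \<le> t" "t \<le> min d (min \<delta> \<delta>')" for t
      using that r(2)[of t] r'(2)[of t] d(2)[of t] 1 by simp
    moreover have "0 < min d (min \<delta> \<delta>')" using d r r' by simp
    ultimately show ?thesis by blast
  next
    case 2
    obtain d where "0 < d \<and> (\<forall>t. 0 \<le> t \<and> t \<le> d \<longrightarrow> f x + r * t \<le> g x + r' * t)"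
      using *[OF 2, of r r'] by (rule exE)
    then have d: "d > 0" "\<And>t. 0 \<le> t \<and> t \<le> d \<longrightarrow> f x + r * t \<le> g x + r' * t" by simp_all
    have "max (f (x + \<sigma> * t)) (g (x + \<sigma> * t)) = max (f x) (g x) + r' * t" if "0 \<le> t" "t \<le> min d (min \<delta> \<delta>')" for t
      using that r(2)[of t] r'(2)[of t] d(2)[of t] 2 by simp
    moreover have "0 < min d (min \<delta> \<delta>')" using d r r' by simp
    ultimately show ?thesis by blast
  next
    case 3
    have "max (f (x + \<sigma> * t)) (g (x + \<sigma> * t)) = max (f x) (g x) + max r r' * t" if "0 \<le> t" "t \<le> min \<delta> \<delta>'" for t
      using that r(2)[of t] r'(2)[of t] 3 mult_right_mono[of r r' t] mult_right_mono[of r' r t] by (auto simp: max_def)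
    with r(1) r'(1) show ?thesis by (intro affine_germI[where r="max r r'" and \<delta>="min \<delta> \<delta>'"]) auto
  qed
qed

lemma pwa_min: assumes "pwa f" "pwa g" shows "pwa (\<lambda>x. min (f x) (g x))"
proof -
  have "pwa (\<lambda>x. - 1 * max (-1 * f x) (-1 * g x))" by (intro pwa_cmult pwa_max assms)
  moreover have "- 1 * max (-1 * f x) (-1 * g x) = min (f x) (g x)" for x by (simp add: max_def min_def)
  ultimately show ?thesis by simp
qed

lemma pwa_glue:
  assumes "pwa f" "pwa g" "f c = g c" shows "pwa (\<lambda>x. if x < c then f x else g x)"
proof (rule pwaI)
  fix x \<sigma> :: real assume s: "\<sigma> = 1 \<or> \<sigma> = -1"
  from pwaE[OF assms(1) s, of x] obtain r \<delta> where r: "\<delta> > 0" "\<And>t. 0 \<le> t \<Longrightarrow> t \<le> \<delta> \<Longrightarrow> f (x + \<sigma> * t) = f x + r * t" by metis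
  from pwaE[OF assms(2) s, of x] obtain r' \<delta>' where r': "\<delta>' > 0" "\<And>t. 0 \<le> t \<Longrightarrow> t \<le> \<delta>' \<Longrightarrow> g (x + \<sigma> * t) = g x + r' * t" by metis
  consider "x < c" | "x > c" | "x = c" "\<sigma> = 1" | "x = c" "\<sigma> = -1" using s by linarith
  then show "\<exists>r. \<exists>\<delta>>0. \<forall>t. 0 \<le> t \<and> t \<le> \<delta> \<longrightarrow> (if x + \<sigma> * t < c then f (x + \<sigma> * t) else g (x + \<sigma> * t)) = (if x < c then f x else g x) + r * t"
  proof cases
    case 1 show ?thesis by (rule affine_germI[where r=r and \<delta>="min \<delta> ((c - x)/2)"]) (use 1 r s in auto)
  next
    case 2 show ?thesis by (rule affine_germI[where r=r' and \<delta>="min \<delta>' ((x - c)/2)"]) (use 2 r' s in auto)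
  next
    case 3 show ?thesis by (rule affine_germI[where r=r' and \<delta>=\<delta>']) (use 3 r' in auto)
  next
    case 4 show ?thesis by (rule affine_germI[where r=r and \<delta>=\<delta>]) (use 4 r assms(3) in auto)
  qed
qed

lemma pwa_translate: assumes "pwa f" shows "pwa (\<lambda>x. f (x + c))"
proof (rule pwaI)
  fix x \<sigma> :: real assume s: "\<sigma> = 1 \<or> \<sigma> = -1"
  from pwaE[OF assms(1) s, of "x + c"] obtain r \<delta> where r: "\<delta> > 0" "\<And>t. 0 \<le> t \<Longrightarrow> t \<le> \<delta> \<Longrightarrow> f (x + c + \<sigma> * t) = f (x + c) + r * t" by metis
  show "\<exists>r. \<exists>\<delta>>0. \<forall>t. 0 \<le> t \<and> t \<le> \<delta> \<longrightarrow> f (x + \<sigma> * t + c) = f (x + c) + r * t"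
    by (rule affine_germI[where r=r and \<delta>=\<delta>]) (use r in \<open>auto simp: add_ac\<close>)
qed

lemma pwa_reflect: assumes "pwa f" shows "pwa (\<lambda>x. f (c - x))"
proof (rule pwaI)
  fix x \<sigma> :: real assume s: "\<sigma> = 1 \<or> \<sigma> = -1"
  then have s': "- \<sigma> = 1 \<or> - \<sigma> = -1" by auto
  from pwaE[OF assms(1) s', of "c - x"] obtain r \<delta> where r: "\<delta> > 0" "\<And>t. 0 \<le> t \<Longrightarrow> t \<le> \<delta> \<Longrightarrow> f (c - x + - \<sigma> * t) = f (c - x) + r * t" by metis
  show "\<exists>r. \<exists>\<delta>>0. \<forall>t. 0 \<le> t \<and> t \<le> \<delta> \<longrightarrow> f (c - (x + \<sigma> * t)) = f (c - x) + r * t"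
    by (rule affine_germI[where r=r and \<delta>=\<delta>]) (use r in \<open>auto simp: algebra_simps\<close>)
qed

lemma abs_max_diff_le:
  fixes a :: real
  assumes "\<bar>a - a'\<bar> \<le> C" "\<bar>b - b'\<bar> \<le> C" shows "\<bar>max a b - max a' b'\<bar> \<le> C"
  using assms by (auto simp: max_def)

lemma abs_min_diff_le:
  fixes a :: real
  assumes "\<bar>a - a'\<bar> \<le> C" "\<bar>b - b'\<bar> \<le> C" shows "\<bar>min a b - min a' b'\<bar> \<le> C"
  using assms by (auto simp: min_def)

text \<open>A sawtooth rises with slope \<open>p\<close> and falls with slope \<open>- q\<close>.
  The wells that are mixed differ by 2 in the relevant diagonal entry, hence
  \<open>p + q = 2\<close>, and a cell of height r with equal end values descends on a length
  \<open>p * r / 2\<close>.\<close>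

locale teeth =
  fixes p q :: real
  assumes p_pos: "0 < p" and q_pos: "0 < q" and pq: "p + q = 2"
begin

text \<open>For 0 \<le> m \<le> q r / 2 this is a zigzag on [0, r] with zero end values: it rises up
  to \<open>m\<close>, falls on an interval of length \<open>p * r / 2\<close>, and rises again up
  to \<open>r\<close>; the breakpoints follow from \<open>p + q = 2\<close>. Changing
  \<open>m\<close> slides the descending interval through the cell.\<close>

definition tooth :: "real \<Rightarrow> real \<Rightarrow> real \<Rightarrow> real" where
  "tooth m r y = max (p * (y - r)) (min (p * y) (2 * m - q * y))"

text \<open>One half of a branching construction: it is 0 at \<open>x = 0\<close> and a single tooth
  of height \<open>r\<close> at \<open>x = l\<close>. For \<open>x\<close> from \<open>l / 3\<close>
  to \<open>l\<close>, two cells of height \<open>r / 2\<close> slide their descending intervals. At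
  \<open>x = l\<close> these are adjacent (\<open>m = q * r / 4\<close> below, \<open>m = 0\<close>
  above) and form one tooth; at \<open>x = l / 3\<close> both cells have
  \<open>m = q * (r / 2) / 4\<close>, which is the trace of two copies of half the height. After
  \<open>K\<close> generations the rest is interpolated linearly in \<open>x\<close> to 0.\<close>

fun hh :: "nat \<Rightarrow> real \<Rightarrow> real \<Rightarrow> real \<Rightarrow> real \<Rightarrow> real" where
  "hh 0 l r x y = tooth (q * r / 4) r y / l * x"
| "hh (Suc K) l r x y =
    (if x < l / 3 then (if y < r / 2 then hh K (l / 3) (r / 2) x y else hh K (l / 3) (r / 2) x (y - r / 2))
     else if y < r / 2 then tooth (q * r / 8 * (1 + (x - l / 3) / (2 * l / 3))) (r / 2) y
     else tooth (q * r / 8 * (1 - (x - l / 3) / (2 * l / 3))) (r / 2) (y - r / 2))"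

text \<open>The half-open strips where \<open>hh\<close> descends with slope \<open>- q\<close>; the layer \<open>x < l / 3 ^ K\<close> contains none.\<close>

fun down :: "nat \<Rightarrow> real \<Rightarrow> real \<Rightarrow> real \<Rightarrow> real \<Rightarrow> bool" where
  "down 0 l r x y = False"
| "down (Suc K) l r x y =
    (if x < l / 3 then (if y < r / 2 then down K (l / 3) (r / 2) x y else down K (l / 3) (r / 2) x (y - r / 2))
     else let m = q * r / 8 * (1 + (x - l / 3) / (2 * l / 3)); m' = q * r / 8 * (1 - (x - l / 3) / (2 * l / 3)) in
       if y < r / 2 then m \<le> y \<and> y < m + p * r / 4
       else m' \<le> y - r / 2 \<and> y - r / 2 < m' + p * r / 4)"

text \<open>Bound for the derivative of \<open>hh\<close> in \<open>x\<close>: \<open>r / l\<close>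
  in the current generation, \<open>2 * r / l\<close> in the interpolation layer. The interface
  \<open>x = l / 3\<close> is assigned to the inner generation, whose bound is the larger one, so
  that both one-sided slopes are covered.\<close>

fun slope :: "nat \<Rightarrow> real \<Rightarrow> real \<Rightarrow> real \<Rightarrow> real" where
  "slope 0 l r x = 2 * r / l"
| "slope (Suc K) l r x = (if x \<le> l / 3 then slope K (l / 3) (r / 2) x else r / l)"

lemma pq_less: "p < 2" "q < 2" using p_pos q_pos pq by auto

lemma p_eq: "p = 2 - q" using pq by simp

lemma tooth_0: "0 \<le> m \<Longrightarrow> 0 \<le> r \<Longrightarrow> tooth m r 0 = 0"
  using p_pos by (simp add: tooth_def)

lemma tooth_r: "m \<le> q * r / 2 \<Longrightarrow> 0 \<le> r \<Longrightarrow> tooth m r r = 0"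
proof -
  assume "m \<le> q * r / 2" "0 \<le> r"
  then have "2 * m - q * r \<le> 0" "0 \<le> p * r" using p_pos by auto
  then show ?thesis by (auto simp: tooth_def)
qed

lemma tooth_lipschitz_y: "\<bar>tooth m r y - tooth m r y'\<bar> \<le> 2 * \<bar>y - y'\<bar>"
proof -
  have P: "\<bar>p * z\<bar> \<le> 2 * \<bar>z\<bar>" "\<bar>q * z\<bar> \<le> 2 * \<bar>z\<bar>" for z
    using p_pos q_pos pq_less by (auto simp: abs_mult intro!: mult_right_mono)
  show ?thesis unfolding tooth_def
    by (intro abs_max_diff_le abs_min_diff_le) (use P(1)[of "y - y'"] P(2)[of "y' - y"] in \<open>simp_all add: algebra_simps abs_minus_commute\<close>)
qed

lemma tooth_lipschitz_m: "\<bar>tooth m r y - tooth m' r y\<bar> \<le> 2 * \<bar>m - m'\<bar>"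
proof -
  have "\<bar>2 * m - q * y - (2 * m' - q * y)\<bar> = 2 * \<bar>m - m'\<bar>" by (simp add: abs_if)
  then show ?thesis unfolding tooth_def by (intro abs_max_diff_le abs_min_diff_le) simp_all
qed

lemma tooth_bound:
  assumes "0 \<le> m" "0 \<le> r" "0 \<le> y" "y \<le> r" shows "\<bar>tooth m r y\<bar> \<le> 2 * r"
proof -
  have "\<bar>tooth m r y - tooth m r 0\<bar> \<le> 2 * \<bar>y - 0\<bar>" by (rule tooth_lipschitz_y)
  then show ?thesis using tooth_0[of m r] assms by simp
qed

text \<open>These are right-hand slopes; with a half-open interval for the descent they are correct
  at the kinks as well.\<close>

lemma tooth_germ:
  assumes "0 \<le> m" "m \<le> q * r / 2" "0 \<le> y" "y < r"
  shows "\<exists>\<delta>>0. \<forall>t. 0 \<le> t \<and> t \<le> \<delta> \<longrightarrow> tooth m r (y + t) = tooth m r y + (if m \<le> y \<and> y < m + p * r / 2 then - q else p) * t"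
proof -
  have Q: "q = 2 - p" using pq by simp
  consider "y < m" | "m \<le> y" "y < m + p * r / 2" | "m + p * r / 2 \<le> y" by linarith
  then show ?thesis
  proof cases
    case 1
    have "tooth m r (y + t) = p * (y + t)" if "0 \<le> t" "t \<le> m - y" for t
    proof -
      have "p * (y + t) \<le> 2 * m - q * (y + t)" using that by (simp add: Q algebra_simps)
      moreover have "p * (y + t - r) \<le> p * (y + t)" using assms p_pos by (intro mult_left_mono) auto
      ultimately show ?thesis by (simp add: tooth_def)
    qed
    note * = this
    show ?thesis using *[of 0] 1 by (intro exI[of _ "m - y"]) (auto simp: * ring_distribs)
  next
    case 2
    have "tooth m r (y + t) = 2 * m - q * (y + t)" if "0 \<le> t" "t \<le> m + p * r / 2 - y" for t
    proof -
      have "p * (y + t) \<ge> 2 * m - q * (y + t)" using that 2 by (simp add: Q algebra_simps)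
      moreover have "p * (y + t - r) \<le> 2 * m - q * (y + t)" using that 2 by (simp add: Q algebra_simps)
      ultimately show ?thesis by (simp add: tooth_def)
    qed
    note * = this
    show ?thesis using *[of 0] 2 by (intro exI[of _ "m + p * r / 2 - y"]) (auto simp: * ring_distribs)
  next
    case 3
    have "tooth m r (y + t) = p * (y + t - r)" if "0 \<le> t" for t
    proof -
      have "p * (y + t - r) \<ge> 2 * m - q * (y + t)" using that 3 by (simp add: Q algebra_simps)
      then show ?thesis by (simp add: tooth_def)
    qed
    note * = this
    show ?thesis using *[of 0] 3 by (intro exI[of _ 1]) (auto simp: * ring_distribs)
  qed
qed

text \<open>In this position the lower cell descends up to \<open>r / 2\<close> and the upper one
  from there on, so the two descents merge into the single descent of a tooth of full height. This
  is why consecutive generations fit together.\<close>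

lemma tooth_split:
  assumes "0 \<le> r" "0 \<le> y"
  shows "y \<le> r / 2 \<Longrightarrow> tooth (q * r / 4) (r / 2) y = tooth (q * r / 4) r y"
    "r / 2 \<le> y \<Longrightarrow> tooth 0 (r / 2) (y - r / 2) = tooth (q * r / 4) r y"
proof -
  assume y: "y \<le> r / 2"
  have "p * (y - r / 2) \<le> 0" "p * (y - r) \<le> 0" using y assms p_pos by (auto intro!: mult_nonneg_nonpos)
  moreover have "0 \<le> p * y" "0 \<le> 2 * (q * r / 4) - q * y"
    using y assms p_pos q_pos mult_left_mono[OF y, of q] by auto
  ultimately show "tooth (q * r / 4) (r / 2) y = tooth (q * r / 4) r y" by (auto simp: tooth_def)
next
  assume y: "r / 2 \<le> y"
  have "2 * (q * r / 4) - q * y \<le> 0" using q_pos mult_left_mono[OF y, of q] by auto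
  moreover have "- (q * (y - r / 2)) \<le> p * (y - r / 2)" using y p_pos q_pos mult_nonneg_nonneg[of "p + q" "y - r / 2"] by (auto simp: algebra_simps)
  moreover have "0 \<le> p * y" using assms p_pos by auto
  ultimately have "min (p * (y - r / 2)) (2 * 0 - q * (y - r / 2)) = - (q * (y - r / 2))"
    "min (p * y) (2 * (q * r / 4) - q * y) = - (q * (y - r / 2))"
    by (simp_all add: min_def algebra_simps)
  moreover have "p * (y - r / 2 - r / 2) = p * (y - r)" by simp
  ultimately show "tooth 0 (r / 2) (y - r / 2) = tooth (q * r / 4) r y" by (simp only: tooth_def)
qed

lemma m_bounds:
  assumes "0 < l" "0 < r" "l / 3 \<le> x" "x \<le> l"
  shows "0 \<le> q * r / 8 * (1 + (x - l / 3) / (2 * l / 3))" "q * r / 8 * (1 + (x - l / 3) / (2 * l / 3)) \<le> q * (r / 2) / 2"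
    "0 \<le> q * r / 8 * (1 - (x - l / 3) / (2 * l / 3))" "q * r / 8 * (1 - (x - l / 3) / (2 * l / 3)) \<le> q * (r / 2) / 2"
proof -
  define t where "t = (x - l / 3) / (2 * l / 3)"
  have t: "0 \<le> t" "t \<le> 1" using assms by (auto simp: t_def)
  have qr: "q * r / 8 \<ge> 0" using q_pos assms by simp
  show "0 \<le> q * r / 8 * (1 + (x - l / 3) / (2 * l / 3))" "0 \<le> q * r / 8 * (1 - (x - l / 3) / (2 * l / 3))"
    unfolding t_def[symmetric] using t qr by (auto intro!: mult_nonneg_nonneg simp del: times_divide_eq_left)
  have "q * r / 8 * (1 + t) \<le> q * r / 8 * 2" "q * r / 8 * (1 - t) \<le> q * r / 8 * 2" using t by (intro mult_left_mono qr; simp)+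
  then show "q * r / 8 * (1 + (x - l / 3) / (2 * l / 3)) \<le> q * (r / 2) / 2" "q * r / 8 * (1 - (x - l / 3) / (2 * l / 3)) \<le> q * (r / 2) / 2"
    unfolding t_def[symmetric] by auto
qed

lemma hh_left: "0 < l \<Longrightarrow> hh K l r 0 y = 0"
  by (induction K arbitrary: l r y) auto

text \<open>The trace at \<open>x = l\<close> does not depend on \<open>K\<close>, which makes the
  recursion continuous across the interface \<open>x = l / 3\<close>.\<close>

lemma hh_right:
  assumes "0 < l" "0 < r" "0 \<le> y" "y \<le> r" shows "hh K l r l y = tooth (q * r / 4) r y"
proof (cases K)
  case 0 then show ?thesis using assms by simp
next
  case (Suc K')
  have e: "(l - l / 3) / (2 * l / 3) = 1" using assms by (simp add: field_simps)
  show ?thesis unfolding Suc hh.simps e using assms tooth_split[of r y] by (auto simp: mult.commute)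
qed

lemma hh_zero_y:
  assumes "0 < l" "0 < r" "0 \<le> x" "x \<le> l" shows "hh K l r x 0 = 0 \<and> hh K l r x r = 0"
  using assms
proof (induction K arbitrary: l r)
  case 0
  have "q * r / 4 \<le> q * r / 2" using q_pos 0 by simp
  then show ?case using tooth_0[of "q * r / 4" r] tooth_r[of "q * r / 4" r] 0 q_pos by simp
next
  case (Suc K)
  show ?case
  proof (cases "x < l / 3")
    case True
    then show ?thesis using Suc.IH[of "l / 3" "r / 2"] Suc.prems by auto
  next
    case False
    with m_bounds[of l r x] Suc.prems show ?thesis by (auto intro!: tooth_0 tooth_r)
  qed
qed

text \<open>The slopes in \<open>y\<close> never exceed those of a tooth, so the constant does not
  deteriorate with \<open>K\<close>; the two half cells are joined at \<open>r / 2\<close>, where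
  both functions vanish.\<close>

lemma hh_lipschitz_y:
  assumes "0 < l" "0 < r" "0 \<le> x" "x \<le> l" "0 \<le> y" "y \<le> r" "0 \<le> y'" "y' \<le> r"
  shows "\<bar>hh K l r x y - hh K l r x y'\<bar> \<le> 2 * \<bar>y - y'\<bar>"
proof -
  have glue: "\<bar>f y - f y'\<bar> \<le> 2 * \<bar>y - y'\<bar>"
    if f: "\<And>y. f y = (if y < r / 2 then g y else g' y)" "g (r / 2) = g' (r / 2)"
      and L: "\<And>y y'. 0 \<le> y \<Longrightarrow> y \<le> r / 2 \<Longrightarrow> 0 \<le> y' \<Longrightarrow> y' \<le> r / 2 \<Longrightarrow> \<bar>g y - g y'\<bar> \<le> 2 * \<bar>y - y'\<bar>"
        "\<And>y y'. r / 2 \<le> y \<Longrightarrow> y \<le> r \<Longrightarrow> r / 2 \<le> y' \<Longrightarrow> y' \<le> r \<Longrightarrow> \<bar>g' y - g' y'\<bar> \<le> 2 * \<bar>y - y'\<bar>"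
      and y: "0 \<le> y" "y \<le> r" "0 \<le> y'" "y' \<le> r" and r: "0 < r"
    for f g g' :: "real \<Rightarrow> real" and y y' r
  proof -
    consider "y < r / 2" "y' < r / 2" | "y < r / 2" "r / 2 \<le> y'" | "r / 2 \<le> y" "y' < r / 2" | "r / 2 \<le> y" "r / 2 \<le> y'" by linarith
    then show ?thesis
    proof cases
      case 1 then show ?thesis using L(1)[of y y'] y f by auto
    next
      case 2
      have "\<bar>g y - g (r / 2)\<bar> \<le> 2 * \<bar>y - r / 2\<bar>" "\<bar>g' (r / 2) - g' y'\<bar> \<le> 2 * \<bar>r / 2 - y'\<bar>" using L(1)[of y "r / 2"] L(2)[of "r / 2" y'] y r 2 by simp_all
      then show ?thesis using f 2 by (auto simp: abs_if split: if_splits)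
    next
      case 3
      have "\<bar>g' y - g' (r / 2)\<bar> \<le> 2 * \<bar>y - r / 2\<bar>" "\<bar>g (r / 2) - g y'\<bar> \<le> 2 * \<bar>r / 2 - y'\<bar>" using L(2)[of y "r / 2"] L(1)[of "r / 2" y'] y r 3 by simp_all
      then show ?thesis using f 3 by (auto simp: abs_if split: if_splits)
    next
      case 4 then show ?thesis using L(2)[of y y'] y f by auto
    qed
  qed
  show ?thesis using assms
  proof (induction K arbitrary: l r y y')
    case 0
    have "\<bar>tooth (q * r / 4) r y - tooth (q * r / 4) r y'\<bar> * (x / l) \<le> 2 * \<bar>y - y'\<bar> * 1"
      using 0 by (intro mult_mono tooth_lipschitz_y) auto
    moreover have "hh 0 l r x y - hh 0 l r x y' = (tooth (q * r / 4) r y - tooth (q * r / 4) r y') * (x / l)"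
      by (simp add: field_simps diff_divide_distrib)
    ultimately show ?case using 0 by (simp add: abs_mult del: hh.simps)
  next
    case (Suc K)
    show ?case
    proof (cases "x < l / 3")
      case True
      have z: "hh K (l / 3) (r / 2) x (r / 2) = 0" "hh K (l / 3) (r / 2) x 0 = 0"
        using hh_zero_y[of "l / 3" "r / 2" x K] Suc.prems True by auto
      show ?thesis
        by (rule glue[of "\<lambda>y. hh (Suc K) l r x y" r "\<lambda>y. hh K (l / 3) (r / 2) x y" "\<lambda>y. hh K (l / 3) (r / 2) x (y - r / 2)"];
          (use Suc.prems True z in simp)?; (rule order_trans[OF Suc.IH]; use Suc.prems True in auto)?)
    next
      case False
      note m = m_bounds[of l r x]
      show ?thesis
        by (rule glue[of "\<lambda>y. hh (Suc K) l r x y" r "\<lambda>y. tooth (q * r / 8 * (1 + (x - l / 3) / (2 * l / 3))) (r / 2) y"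
            "\<lambda>y. tooth (q * r / 8 * (1 - (x - l / 3) / (2 * l / 3))) (r / 2) (y - r / 2)"];
          (use Suc.prems False m in \<open>simp add: tooth_0 tooth_r del: times_divide_eq_left times_divide_eq_right\<close>)?; (rule order_trans[OF tooth_lipschitz_y]; simp)?)
    qed
  qed
qed

end

text \<open>Affine to the right of a point, with the slope as data; this determines the limit of
  \<open>diffq\<close>, whose steps are positive.\<close>

definition rgerm :: "(real \<Rightarrow> real) \<Rightarrow> real \<Rightarrow> real \<Rightarrow> bool" where
  "rgerm f y s \<longleftrightarrow> (\<exists>\<delta>>0. \<forall>t. 0 \<le> t \<and> t \<le> \<delta> \<longrightarrow> f (y + t) = f y + s * t)"

lemma rgerm_cong:
  assumes "rgerm f y s" "\<epsilon> > 0" "\<And>t. 0 \<le> t \<Longrightarrow> t < \<epsilon> \<Longrightarrow> g (y + t) = f (y + t)"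
  shows "rgerm g y s"
proof -
  from assms(1) obtain \<delta> where d: "\<delta> > 0" "\<forall>t. 0 \<le> t \<and> t \<le> \<delta> \<longrightarrow> f (y + t) = f y + s * t"
    unfolding rgerm_def by (elim exE conjE) (rule that)
  have "g (y + t) = g y + s * t" if "0 \<le> t" "t \<le> min \<delta> (\<epsilon> / 2)" for t
    using d(2)[rule_format, of t] assms(3)[of t] assms(3)[of 0] assms(2) that by simp
  moreover have "min \<delta> (\<epsilon> / 2) > 0" using d assms(2) by simp
  ultimately show ?thesis unfolding rgerm_def by blast
qed

lemma rgerm_shift: "rgerm f (y - c) s \<Longrightarrow> rgerm (\<lambda>y. f (y - c)) y s"
  unfolding rgerm_def by (simp add: diff_add_eq[symmetric])

lemma rgerm_cmult: "rgerm f y s \<Longrightarrow> rgerm (\<lambda>y. f y * c) y (s * c)"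
  unfolding rgerm_def by (elim exE conjE, rule exI) (auto simp: distrib_right mult.assoc mult.left_commute[of c])

lemma pwa_rgerm: assumes "pwa f" obtains s where "rgerm f y s"
proof -
  obtain s \<delta> where "\<delta> > 0" "\<And>t. 0 \<le> t \<Longrightarrow> t \<le> \<delta> \<Longrightarrow> f (y + 1 * t) = f y + s * t"
    by (rule pwaE[OF assms, of 1 y]) auto
  then show ?thesis using that[of s] unfolding rgerm_def by auto
qed

lemma pwa_const: "pwa (\<lambda>x. c)" using pwa_affine[of 0 c] by simp

context teeth
begin

lemma slope_nonneg: "0 < l \<Longrightarrow> 0 < r \<Longrightarrow> 0 \<le> slope K l r x"
  by (induction K arbitrary: l r) auto

text \<open>The breakpoint \<open>m\<close> moves at speed 3 q r / (16 l) and a tooth is 2-Lipschitz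
  in \<open>m\<close>; since \<open>q < 2\<close>, the product 3 q r / (8 l) is below
  \<open>r / l\<close>.\<close>

lemma cell_slope:
  assumes "0 < l" "0 < r"
  shows "\<bar>tooth (q * r / 8 * (1 + (x - l / 3) / (2 * l / 3))) (r / 2) y - tooth (q * r / 8 * (1 + (x' - l / 3) / (2 * l / 3))) (r / 2) y\<bar> \<le> r / l * \<bar>x - x'\<bar>"
    "\<bar>tooth (q * r / 8 * (1 - (x - l / 3) / (2 * l / 3))) (r / 2) y - tooth (q * r / 8 * (1 - (x' - l / 3) / (2 * l / 3))) (r / 2) y\<bar> \<le> r / l * \<bar>x - x'\<bar>"
proof -
  have e: "q * r / 8 * (1 + (x - l / 3) / (2 * l / 3)) - q * r / 8 * (1 + (x' - l / 3) / (2 * l / 3)) = (3 * q / 16) * (r / l * (x - x'))"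
    "q * r / 8 * (1 - (x - l / 3) / (2 * l / 3)) - q * r / 8 * (1 - (x' - l / 3) / (2 * l / 3)) = - ((3 * q / 16) * (r / l * (x - x')))"
    using assms by (simp_all add: field_simps)
  have "2 * \<bar>(3 * q / 16) * (r / l * (x - x'))\<bar> = (3 * q / 8) * (r / l * \<bar>x - x'\<bar>)"
    using assms q_pos by (simp add: abs_mult)
  also have "\<dots> \<le> 1 * (r / l * \<bar>x - x'\<bar>)" using assms q_pos pq_less by (intro mult_right_mono) auto
  finally have le: "2 * \<bar>(3 * q / 16) * (r / l * (x - x'))\<bar> \<le> r / l * \<bar>x - x'\<bar>" by simp
  show "\<bar>tooth (q * r / 8 * (1 + (x - l / 3) / (2 * l / 3))) (r / 2) y - tooth (q * r / 8 * (1 + (x' - l / 3) / (2 * l / 3))) (r / 2) y\<bar> \<le> r / l * \<bar>x - x'\<bar>"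
    by (rule order_trans[OF tooth_lipschitz_m]) (use le in \<open>simp only: e\<close>)
  show "\<bar>tooth (q * r / 8 * (1 - (x - l / 3) / (2 * l / 3))) (r / 2) y - tooth (q * r / 8 * (1 - (x' - l / 3) / (2 * l / 3))) (r / 2) y\<bar> \<le> r / l * \<bar>x - x'\<bar>"
    by (rule order_trans[OF tooth_lipschitz_m]) (use le in \<open>simp only: e abs_minus_cancel\<close>)
qed

lemma hh_glue_x:
  assumes "0 < l" "0 < r" "0 \<le> y" "y \<le> r"
  shows "(if y < r / 2 then hh K (l / 3) (r / 2) (l / 3) y else hh K (l / 3) (r / 2) (l / 3) (y - r / 2))
    = (if y < r / 2 then tooth (q * r / 8 * (1 + (l / 3 - l / 3) / (2 * l / 3))) (r / 2) y
       else tooth (q * r / 8 * (1 - (l / 3 - l / 3) / (2 * l / 3))) (r / 2) (y - r / 2))"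
  using hh_right[of "l / 3" "r / 2" y K] hh_right[of "l / 3" "r / 2" "y - r / 2" K] assms by simp

text \<open>A crude bound: slopes grow by the factor 3/2 per generation and are estimated by powers
  of 2. It serves to keep the difference quotients bounded for fixed \<open>K\<close>; the energy is
  computed from \<open>slope\<close>.\<close>

lemma hh_lipschitz_x:
  assumes "0 < l" "0 < r" "0 \<le> x" "x \<le> l" "0 \<le> x'" "x' \<le> l" "0 \<le> y" "y \<le> r"
  shows "\<bar>hh K l r x y - hh K l r x' y\<bar> \<le> 2 * r / l * 2 ^ K * \<bar>x - x'\<bar>"
  using assms
proof (induction K arbitrary: l r x x' y)
  case 0
  have "\<bar>tooth (q * r / 4) r y\<bar> * \<bar>(x - x') / l\<bar> \<le> 2 * r * \<bar>(x - x') / l\<bar>"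
    using 0 q_pos by (intro mult_right_mono tooth_bound) auto
  moreover have "hh 0 l r x y - hh 0 l r x' y = tooth (q * r / 4) r y * ((x - x') / l)" by (simp add: diff_divide_distrib algebra_simps)
  ultimately show ?case using 0 by (simp add: abs_mult del: hh.simps)
next
  case (Suc K)
  define f where "f x = (if y < r / 2 then hh K (l / 3) (r / 2) x y else hh K (l / 3) (r / 2) x (y - r / 2))" for x
  define g where "g x = (if y < r / 2 then tooth (q * r / 8 * (1 + (x - l / 3) / (2 * l / 3))) (r / 2) y
       else tooth (q * r / 8 * (1 - (x - l / 3) / (2 * l / 3))) (r / 2) (y - r / 2))" for x
  have h: "hh (Suc K) l r x y = (if x < l / 3 then f x else g x)" for x by (simp add: f_def g_def)
  have fg: "f (l / 3) = g (l / 3)" unfolding f_def g_def using Suc.prems by (intro hh_glue_x) auto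
  define L where "L = 2 * r / l * 2 ^ Suc K"
  have fL: "\<bar>f x - f x'\<bar> \<le> L * \<bar>x - x'\<bar>" if "0 \<le> x" "x \<le> l / 3" "0 \<le> x'" "x' \<le> l / 3" for x x'
  proof -
    have "\<bar>f x - f x'\<bar> \<le> 2 * (r / 2) / (l / 3) * 2 ^ K * \<bar>x - x'\<bar>"
    proof (cases "y < r / 2")
      case True then show ?thesis using Suc.IH[of "l / 3" "r / 2" x x' y] Suc.prems that by (simp only: f_def if_True)
    next
      case False then show ?thesis using Suc.IH[of "l / 3" "r / 2" x x' "y - r / 2"] Suc.prems that by (simp only: f_def if_False)
    qed
    also have "\<dots> \<le> L * \<bar>x - x'\<bar>" unfolding L_def using Suc.prems by (intro mult_right_mono) (auto simp: divide_simps)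
    finally show ?thesis .
  qed
  have gL: "\<bar>g x - g x'\<bar> \<le> L * \<bar>x - x'\<bar>" for x x'
  proof -
    have "\<bar>g x - g x'\<bar> \<le> r / l * \<bar>x - x'\<bar>" using cell_slope[of l r x _ x'] Suc.prems by (simp only: g_def split: if_split) simp
    also have "r / l * \<bar>x - x'\<bar> \<le> L * \<bar>x - x'\<bar>"
    proof (intro mult_right_mono)
      have "(1::real) \<le> 2 * 2 ^ Suc K" using one_le_power[of "2::real" "Suc K"] by linarith
      then have "r / l * 1 \<le> (r / l) * (2 * 2 ^ Suc K)" using Suc.prems by (intro mult_left_mono) auto
      then show "r / l \<le> L" by (simp add: L_def mult_ac)
    qed auto
    finally show ?thesis .
  qed
  have mixed: "\<bar>f x - g x'\<bar> \<le> L * \<bar>x - x'\<bar>" if "0 \<le> x" "x \<le> l / 3" "l / 3 \<le> x'" for x x'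
  proof -
    have "\<bar>f x - g x'\<bar> \<le> \<bar>f x - f (l / 3)\<bar> + \<bar>g (l / 3) - g x'\<bar>" using fg by simp
    also have "\<dots> \<le> L * \<bar>x - l / 3\<bar> + L * \<bar>l / 3 - x'\<bar>" using that Suc.prems by (intro add_mono fL gL) auto
    also have "\<dots> = L * \<bar>x - x'\<bar>" using that by (simp add: algebra_simps)
    finally show ?thesis .
  qed
  have "\<bar>(if x < l / 3 then f x else g x) - (if x' < l / 3 then f x' else g x')\<bar> \<le> L * \<bar>x - x'\<bar>"
  proof -
    consider "x < l / 3" "x' < l / 3" | "x < l / 3" "l / 3 \<le> x'" | "l / 3 \<le> x" "x' < l / 3" | "l / 3 \<le> x" "l / 3 \<le> x'" by linarith
    then show ?thesis
    proof cases
      case 1 then show ?thesis using fL[of x x'] Suc.prems by simp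
    next
      case 2 then show ?thesis using mixed[of x x'] Suc.prems by simp
    next
      case 3 then show ?thesis using mixed[of x' x] Suc.prems by (simp add: abs_minus_commute)
    next
      case 4 then show ?thesis using gL[of x x'] by simp
    qed
  qed
  then show ?case unfolding h L_def .
qed

text \<open>The quantitative bound, at each point and in both directions;
  \<open>\<sigma> = -1\<close> is used on the reflected half of a block.\<close>

lemma hh_local_slope:
  assumes "0 < l" "0 < r" "0 \<le> x" "x \<le> l" "0 \<le> y" "y \<le> r" "\<sigma> = 1 \<or> \<sigma> = -1"
  shows "\<exists>\<delta>>0. \<forall>t. 0 \<le> t \<and> t \<le> \<delta> \<and> 0 \<le> x + \<sigma> * t \<and> x + \<sigma> * t \<le> l \<longrightarrow> \<bar>hh K l r (x + \<sigma> * t) y - hh K l r x y\<bar> \<le> slope K l r x * t"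
  using assms
proof (induction K arbitrary: l r y)
  case 0
  have "\<bar>hh 0 l r (x + \<sigma> * t) y - hh 0 l r x y\<bar> \<le> slope 0 l r x * t" if "0 \<le> t" for t
  proof -
    have "hh 0 l r (x + \<sigma> * t) y - hh 0 l r x y = tooth (q * r / 4) r y * (\<sigma> * t / l)" by (simp add: distrib_left)
    then have "\<bar>hh 0 l r (x + \<sigma> * t) y - hh 0 l r x y\<bar> = \<bar>tooth (q * r / 4) r y\<bar> * \<bar>\<sigma> * t / l\<bar>" by (simp only: abs_mult)
    also have "\<dots> \<le> 2 * r * \<bar>\<sigma> * t / l\<bar>" using 0 q_pos by (intro mult_right_mono tooth_bound) auto
    also have "\<bar>\<sigma> * t / l\<bar> = t / l" using 0 that by (auto simp: abs_mult)
    finally show ?thesis by simp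
  qed
  then show ?case by (intro exI[of _ 1]) simp
next
  case (Suc K)
  define g where "g x = (if y < r / 2 then tooth (q * r / 8 * (1 + (x - l / 3) / (2 * l / 3))) (r / 2) y
       else tooth (q * r / 8 * (1 - (x - l / 3) / (2 * l / 3))) (r / 2) (y - r / 2))" for x
  have gL: "\<bar>g (x + \<sigma> * t) - g x\<bar> \<le> r / l * t" if "0 \<le> t" for t
  proof -
    have "\<bar>g (x + \<sigma> * t) - g x\<bar> \<le> r / l * \<bar>x + \<sigma> * t - x\<bar>" using cell_slope[of l r "x + \<sigma> * t" _ x] Suc.prems by (simp only: g_def split: if_split) simp
    also have "\<bar>x + \<sigma> * t - x\<bar> = t" using Suc.prems(7) that by auto
    finally show ?thesis .
  qed
  define f where "f z = (if y < r / 2 then hh K (l / 3) (r / 2) z y else hh K (l / 3) (r / 2) z (y - r / 2))" for z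
  have h: "hh (Suc K) l r z y = (if z < l / 3 then f z else g z)" for z
    by (simp add: g_def f_def)
  have fg: "f (l / 3) = g (l / 3)" unfolding f_def g_def using Suc.prems by (intro hh_glue_x) auto
  have sK: "r / l \<le> slope K (l / 3) (r / 2) (l / 3)"
  proof (cases K)
    case (Suc K')
    have "slope K (l / 3) (r / 2) (l / 3) = (r / 2) / (l / 3)" using Suc Suc.prems by simp
    then show ?thesis using Suc.prems by (simp add: divide_simps)
  qed (use Suc.prems in \<open>simp add: divide_simps\<close>)
  show ?case
  proof (cases "x \<le> l / 3")
    case True
    have "\<exists>\<delta>>0. \<forall>t. 0 \<le> t \<and> t \<le> \<delta> \<and> 0 \<le> x + \<sigma> * t \<and> x + \<sigma> * t \<le> l / 3 \<longrightarrow> \<bar>f (x + \<sigma> * t) - f x\<bar> \<le> slope K (l / 3) (r / 2) x * t"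
    proof (cases "y < r / 2")
      case y: True then show ?thesis using Suc.IH[of "l / 3" "r / 2" y] Suc.prems True by (simp only: f_def if_True)
    next
      case y: False then show ?thesis using Suc.IH[of "l / 3" "r / 2" "y - r / 2"] Suc.prems True by (simp only: f_def if_False)
    qed
    then obtain \<delta> where d: "\<delta> > 0" "\<forall>t. 0 \<le> t \<and> t \<le> \<delta> \<and> 0 \<le> x + \<sigma> * t \<and> x + \<sigma> * t \<le> l / 3 \<longrightarrow> \<bar>f (x + \<sigma> * t) - f x\<bar> \<le> slope K (l / 3) (r / 2) x * t"
      by (elim exE conjE) (rule that)
    have hf: "hh (Suc K) l r z y = f z" if "z \<le> l / 3" for z using that fg unfolding h by (cases "z < l / 3") auto
    show ?thesis
    \<comment> \<open>The one case in which an arbitrarily short step from the inner range enters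
      the outer generation.\<close>
    proof (cases "x = l / 3 \<and> \<sigma> = 1")
      case True
      have "\<bar>hh (Suc K) l r (x + \<sigma> * t) y - hh (Suc K) l r x y\<bar> \<le> slope (Suc K) l r x * t" if "0 \<le> t" for t
      proof -
        have "\<bar>hh (Suc K) l r (x + \<sigma> * t) y - hh (Suc K) l r x y\<bar> \<le> r / l * t" using gL[OF that] that by (simp only: h conjunct1[OF True] conjunct2[OF True]) simp
        also have "\<dots> \<le> slope (Suc K) l r x * t" using sK True that by (intro mult_right_mono) auto
        finally show ?thesis .
      qed
      then show ?thesis by (intro exI[of _ 1]) auto
    next
      case False
      define \<delta>' where "\<delta>' = (if \<sigma> = 1 then min \<delta> (l / 3 - x) else \<delta>)"
      have d': "\<delta>' > 0" using d(1) True False Suc.prems(7) by (auto simp: \<delta>'_def)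
      have *: "x + \<sigma> * t \<le> l / 3" "t \<le> \<delta>" if "0 \<le> t" "t \<le> \<delta>'" for t using that True False Suc.prems(7) by (auto simp: \<delta>'_def split: if_splits)
      have "\<bar>hh (Suc K) l r (x + \<sigma> * t) y - hh (Suc K) l r x y\<bar> \<le> slope (Suc K) l r x * t" if "0 \<le> t" "t \<le> \<delta>'" "0 \<le> x + \<sigma> * t" for t
        using d(2)[rule_format, of t] *[OF that(1,2)] that True by (simp only: hf slope.simps if_True)
      then show ?thesis using d' by blast
    qed
  next
    case False
    have "\<bar>hh (Suc K) l r (x + \<sigma> * t) y - hh (Suc K) l r x y\<bar> \<le> slope (Suc K) l r x * t" if "0 \<le> t" "t \<le> (x - l / 3) / 2" for t
    proof -
      have "x + \<sigma> * t \<ge> l / 3" using that False Suc.prems(7) by auto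
      then show ?thesis using gL[OF that(1)] False unfolding h by simp
    qed
    then show ?thesis using False by (intro exI[of _ "(x - l / 3) / 2"]) auto
  qed
qed

lemma pwa_tooth: assumes "pwa m" shows "pwa (\<lambda>x. tooth (m x) r y)"
proof -
  have "pwa (\<lambda>x. 2 * m x - q * y)"
  proof (rule pwaI)
    fix x \<sigma> :: real assume s: "\<sigma> = 1 \<or> \<sigma> = -1"
    from pwaE[OF assms s, of x] obtain k \<delta> where r: "\<delta> > 0" "\<And>t. 0 \<le> t \<Longrightarrow> t \<le> \<delta> \<Longrightarrow> m (x + \<sigma> * t) = m x + k * t" by metis
    show "\<exists>r. \<exists>\<delta>>0. \<forall>t. 0 \<le> t \<and> t \<le> \<delta> \<longrightarrow> 2 * m (x + \<sigma> * t) - q * y = 2 * m x - q * y + r * t"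
      by (rule affine_germI[where r="2 * k" and \<delta>=\<delta>]) (auto simp: r distrib_left)
  qed
  then show ?thesis unfolding tooth_def by (intro pwa_max pwa_min pwa_const)
qed

lemma pwa_hh:
  assumes "0 < l" "0 < r" "0 \<le> y" "y \<le> r" shows "pwa (\<lambda>x. hh K l r x y)"
  using assms
proof (induction K arbitrary: l r y)
  case 0
  show ?case using pwa_affine[of "tooth (q * r / 4) r y / l" 0] by simp
next
  case (Suc K)
  have m: "pwa (\<lambda>x. q * r / 8 * (1 + (x - l / 3) / (2 * l / 3)))" "pwa (\<lambda>x. q * r / 8 * (1 - (x - l / 3) / (2 * l / 3)))"
  proof -
    have e: "q * r / 8 * (1 + (x - l / 3) / (2 * l / 3)) = (q * r / 8 * (3 / (2 * l))) * x + (q * r / 8 * (1 - 1 / 2))"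
      "q * r / 8 * (1 - (x - l / 3) / (2 * l / 3)) = (- (q * r / 8 * (3 / (2 * l)))) * x + (q * r / 8 * (1 + 1 / 2))" for x
      using Suc.prems by (simp_all add: field_simps)
    show "pwa (\<lambda>x. q * r / 8 * (1 + (x - l / 3) / (2 * l / 3)))" "pwa (\<lambda>x. q * r / 8 * (1 - (x - l / 3) / (2 * l / 3)))"
      unfolding e by (rule pwa_affine)+
  qed
  have "pwa (\<lambda>x. if x < l / 3 then (if y < r / 2 then hh K (l / 3) (r / 2) x y else hh K (l / 3) (r / 2) x (y - r / 2))
    else (if y < r / 2 then tooth (q * r / 8 * (1 + (x - l / 3) / (2 * l / 3))) (r / 2) y
       else tooth (q * r / 8 * (1 - (x - l / 3) / (2 * l / 3))) (r / 2) (y - r / 2)))"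
  proof (rule pwa_glue)
    show "pwa (\<lambda>x. if y < r / 2 then hh K (l / 3) (r / 2) x y else hh K (l / 3) (r / 2) x (y - r / 2))"
      using Suc.IH[of "l / 3" "r / 2" y] Suc.IH[of "l / 3" "r / 2" "y - r / 2"] Suc.prems by (cases "y < r / 2") simp_all
    show "pwa (\<lambda>x. if y < r / 2 then tooth (q * r / 8 * (1 + (x - l / 3) / (2 * l / 3))) (r / 2) y
       else tooth (q * r / 8 * (1 - (x - l / 3) / (2 * l / 3))) (r / 2) (y - r / 2))"
      by (cases "y < r / 2") (simp_all only: if_True if_False pwa_tooth[OF m(1)] pwa_tooth[OF m(2)])
  qed (use Suc.prems in \<open>intro hh_glue_x, auto\<close>)
  then show ?case by simp
qed

text \<open>A right-hand slope exists everywhere, but its value is claimed only outside the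
  interpolation layer \<open>x < l / 3 ^ K\<close>. For \<open>K = 0\<close> the range of that claim
  is empty, so the induction starts without information on the slope.\<close>

lemma hh_germ_y:
  assumes "0 < l" "0 < r" "0 \<le> x" "x \<le> l" "0 \<le> y" "y < r"
  shows "\<exists>s. rgerm (\<lambda>y. hh K l r x y) y s \<and> (l / 3 ^ K \<le> x \<and> x < l \<longrightarrow> s = (if down K l r x y then - q else p))"
  using assms
proof (induction K arbitrary: l r y)
  case 0
  have "0 \<le> q * r / 4" "q * r / 4 \<le> q * r / 2" using 0 q_pos by auto
  from tooth_germ[OF this 0(5,6)] have "\<exists>s. rgerm (tooth (q * r / 4) r) y s" unfolding rgerm_def by blast
  then obtain s where "rgerm (tooth (q * r / 4) r) y s" by blast
  from rgerm_cmult[OF this, of "1 / l * x"] show ?case using 0 by (auto intro!: exI[of _ "s * (1 / l * x)"])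
next
  case (Suc K)
  show ?case
  proof (cases "x < l / 3")
    case True
    show ?thesis
    proof (cases "y < r / 2")
      case y: True
      obtain s where s: "rgerm (\<lambda>y. hh K (l / 3) (r / 2) x y) y s" "l / 3 / 3 ^ K \<le> x \<and> x < l / 3 \<longrightarrow> s = (if down K (l / 3) (r / 2) x y then - q else p)"
        using Suc.IH[of "l / 3" "r / 2" y] Suc.prems True y by auto
      have "rgerm (\<lambda>y. hh (Suc K) l r x y) y s"
        by (rule rgerm_cong[OF s(1), of "r / 2 - y"]) (use True y in auto)
      then show ?thesis using s(2) True y by (intro exI[of _ s]) simp
    next
      case y: False
      obtain s where s: "rgerm (\<lambda>y. hh K (l / 3) (r / 2) x y) (y - r / 2) s" "l / 3 / 3 ^ K \<le> x \<and> x < l / 3 \<longrightarrow> s = (if down K (l / 3) (r / 2) x (y - r / 2) then - q else p)"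
        using Suc.IH[of "l / 3" "r / 2" "y - r / 2"] Suc.prems True y by auto
      have "rgerm (\<lambda>y. hh (Suc K) l r x y) y s"
        by (rule rgerm_cong[OF rgerm_shift[OF s(1)], of 1]) (use True y in auto)
      then show ?thesis using s(2) True y by (intro exI[of _ s]) simp
    qed
  next
    case False
    define m m' where "m = q * r / 8 * (1 + (x - l / 3) / (2 * l / 3))" and "m' = q * r / 8 * (1 - (x - l / 3) / (2 * l / 3))"
    have m: "0 \<le> m" "m \<le> q * (r / 2) / 2" "0 \<le> m'" "m' \<le> q * (r / 2) / 2"
      unfolding m_def m'_def using m_bounds[of l r x] Suc.prems False by auto
    have h: "hh (Suc K) l r x y = (if y < r / 2 then tooth m (r / 2) y else tooth m' (r / 2) (y - r / 2))" for y
      using False by (simp add: m_def m'_def)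
    have d: "down (Suc K) l r x y = (if y < r / 2 then m \<le> y \<and> y < m + p * (r / 2) / 2 else m' \<le> y - r / 2 \<and> y - r / 2 < m' + p * (r / 2) / 2)"
      using False by (simp add: m_def m'_def Let_def)
    show ?thesis
    proof (cases "y < r / 2")
      case y: True
      have "rgerm (tooth m (r / 2)) y (if m \<le> y \<and> y < m + p * (r / 2) / 2 then - q else p)"
        unfolding rgerm_def by (rule tooth_germ) (use m y Suc.prems in auto)
      then have "rgerm (\<lambda>y. hh (Suc K) l r x y) y (if m \<le> y \<and> y < m + p * (r / 2) / 2 then - q else p)"
        by (rule rgerm_cong[of _ _ _ "r / 2 - y"]) (use y in \<open>auto simp only: h split: if_splits\<close>)
      then show ?thesis unfolding d using y by (intro exI conjI) auto
    next
      case y: False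
      have "rgerm (tooth m' (r / 2)) (y - r / 2) (if m' \<le> y - r / 2 \<and> y - r / 2 < m' + p * (r / 2) / 2 then - q else p)"
        unfolding rgerm_def by (rule tooth_germ) (use m y Suc.prems in auto)
      from rgerm_shift[OF this] have "rgerm (\<lambda>y. hh (Suc K) l r x y) y (if m' \<le> y - r / 2 \<and> y - r / 2 < m' + p * (r / 2) / 2 then - q else p)"
        by (rule rgerm_cong[of _ _ _ 1]) (use y in \<open>auto simp only: h split: if_splits\<close>)
      then show ?thesis unfolding d using y by (intro exI conjI) auto
    qed
  qed
qed

lemma borel_measurable_slope[measurable]: "slope K l r \<in> borel_measurable borel"
proof (induction K arbitrary: l r)
  case (Suc K)
  have [measurable]: "slope K (l / 3) (r / 2) \<in> borel_measurable borel" by (rule Suc)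
  show ?case unfolding slope.simps[abs_def] by measurable
qed (simp add: slope.simps[abs_def])

text \<open>The geometric series of the elastic energy: the inner generations contribute 4 (r/2)^2 /
  (l/3) = 3 r^2 / l and the outer layer 2/3 r^2 / l, and 3 + 2/3 \<le> 4. The interpolation layer
  alone gives exactly 4 r^2 / l.\<close>

lemma nn_integral_slope:
  assumes "0 < l" "0 < r"
  shows "(\<integral>\<^sup>+x. ennreal ((slope K l r x)\<^sup>2) * indicator {0..l} x \<partial>lborel) \<le> ennreal (4 * r\<^sup>2 / l)"
  using assms
proof (induction K arbitrary: l r)
  case 0
  have "(\<integral>\<^sup>+x. ennreal ((slope 0 l r x)\<^sup>2) * indicator {0..l} x \<partial>lborel) = ennreal ((2 * r / l)\<^sup>2) * ennreal l"
    using 0 by (simp add: nn_integral_cmult)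
  also have "\<dots> = ennreal (4 * r\<^sup>2 / l)" using 0 by (simp add: ennreal_mult[symmetric] power2_eq_square)
  finally show ?case by simp
next
  case (Suc K)
  have "(\<integral>\<^sup>+x. ennreal ((slope (Suc K) l r x)\<^sup>2) * indicator {0..l} x \<partial>lborel)
    = (\<integral>\<^sup>+x. (ennreal ((slope K (l / 3) (r / 2) x)\<^sup>2) * indicator {0..l / 3} x + ennreal ((r / l)\<^sup>2) * indicator {l / 3<..l} x) \<partial>lborel)"
    using Suc.prems by (intro nn_integral_cong) (auto simp: indicator_def)
  also have "\<dots> = (\<integral>\<^sup>+x. ennreal ((slope K (l / 3) (r / 2) x)\<^sup>2) * indicator {0..l / 3} x \<partial>lborel) + (\<integral>\<^sup>+x. ennreal ((r / l)\<^sup>2) * indicator {l / 3<..l} x \<partial>lborel)"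
    by (rule nn_integral_add) measurable
  also have "(\<integral>\<^sup>+x. ennreal ((r / l)\<^sup>2) * indicator {l / 3<..l} x \<partial>lborel) = ennreal ((r / l)\<^sup>2 * (2 * l / 3))"
    using Suc.prems by (subst nn_integral_cmult_indicator) (auto simp: ennreal_mult[symmetric])
  also have "(\<integral>\<^sup>+x. ennreal ((slope K (l / 3) (r / 2) x)\<^sup>2) * indicator {0..l / 3} x \<partial>lborel) \<le> ennreal (4 * (r / 2)\<^sup>2 / (l / 3))"
    using Suc.prems by (intro Suc.IH) auto
  also have "ennreal (4 * (r / 2)\<^sup>2 / (l / 3)) + ennreal ((r / l)\<^sup>2 * (2 * l / 3)) = ennreal (4 * (r / 2)\<^sup>2 / (l / 3) + (r / l)\<^sup>2 * (2 * l / 3))"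
    using Suc.prems by (subst ennreal_plus) auto
  also have "\<dots> \<le> ennreal (4 * r\<^sup>2 / l)" using Suc.prems by (intro ennreal_leI) (simp add: power2_eq_square divide_simps)
  finally show ?case by (simp add: add_right_mono)
qed

end

section \<open>Blocks: zero boundary values, weak derivatives, elastic energy\<close>

lemma lipschitz_zero_extension:
  fixes f :: "real \<Rightarrow> real"
  assumes "\<And>s. s < a \<or> b < s \<Longrightarrow> f s = 0" "f a = 0" "f b = 0" "0 \<le> L" "a \<le> b"
    "\<And>s t. a \<le> s \<Longrightarrow> s \<le> b \<Longrightarrow> a \<le> t \<Longrightarrow> t \<le> b \<Longrightarrow> \<bar>f s - f t\<bar> \<le> L * \<bar>s - t\<bar>"
  shows "\<bar>f s - f t\<bar> \<le> L * \<bar>s - t\<bar>"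
proof -
  \<comment> \<open>The projection to [a, b] is 1-Lipschitz and does not change the values of
    \<open>f\<close>.\<close>
  define c where "c s = max a (min b s)" for s
  have "f s = f (c s)" for s
  proof -
    consider "s < a" | "b < s" | "a \<le> s" "s \<le> b" by linarith
    then show ?thesis using assms(1)[of s] assms(2,3,5) by cases (auto simp: c_def)
  qed
  moreover have "\<bar>f (c s) - f (c t)\<bar> \<le> L * \<bar>c s - c t\<bar>" using assms(5) by (intro assms(6)) (auto simp: c_def)
  moreover have "L * \<bar>c s - c t\<bar> \<le> L * \<bar>s - t\<bar>" using assms(4) by (intro mult_left_mono) (auto simp: c_def max_def min_def)
  ultimately show ?thesis by (metis order_trans)
qed

text \<open>Along positive steps an affine right germ makes the difference quotients eventually
  constant.\<close>

lemma diffq_tendsto_germ: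
  assumes "rgerm (\<lambda>t. w (z + axis k (t - z $ k))) (z $ k) s"
  shows "(\<lambda>n. diffq k n w z) \<longlonglongrightarrow> s"
proof -
  from assms obtain \<delta> where d: "\<delta> > 0" "\<forall>t. 0 \<le> t \<and> t \<le> \<delta> \<longrightarrow> w (z + axis k (z $ k + t - z $ k)) = w (z + axis k (z $ k - z $ k)) + s * t"
    unfolding rgerm_def by (elim exE conjE) (rule that)
  have a0: "axis k 0 = 0" by (simp add: axis_def vec_eq_iff)
  have "eventually (\<lambda>n. 1 / real (Suc n) < \<delta>) sequentially"
    using d(1) LIMSEQ_Suc[OF lim_1_over_n[where 'a=real]] by (rule order_tendstoD(2)[rotated])
  then have "eventually (\<lambda>n. s = diffq k n w z) sequentially"
  proof eventually_elim
    case (elim n)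
    then have "w (z + axis k (1 / real (Suc n))) = w z + s * (1 / real (Suc n))"
      using d(2)[rule_format, of "1 / real (Suc n)"] by (simp add: a0 del: of_nat_Suc)
    then show ?case by (simp add: diffq_def del: of_nat_Suc)
  qed
  then show ?thesis by (rule Lim_transform_eventually[OF tendsto_const])
qed

lemma comb_line: "i \<noteq> j \<Longrightarrow> z + axis i (t - z $ i) = comb j (z $ j) t" for i j :: 2
  using exhaust_2[of i] exhaust_2[of j] by (auto simp: comb_def vec_eq_iff axis_def forall_2)

lemma axis_zero: "axis k 0 = 0" by (simp add: axis_def vec_eq_iff)

lemma rgerm_const: "rgerm (\<lambda>t. c) y 0" unfolding rgerm_def by (intro exI[of _ 1]) auto

context teeth
begin

text \<open>Two copies of \<open>hh\<close>, mirrored at the line z_i = a + l, so that the function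
  vanishes on all sides of the rectangle. The direction of branching is \<open>i\<close>, that of
  the oscillation is \<open>j\<close>, and the minimum is the distance to the nearer branching side.
  The rectangle is half-open in \<open>j\<close>, so that stacked blocks are disjoint.\<close>

definition block :: "2 \<Rightarrow> 2 \<Rightarrow> real \<Rightarrow> real \<Rightarrow> nat \<Rightarrow> real \<Rightarrow> real \<Rightarrow> real^2 \<Rightarrow> real" where
  "block i j a c K l r z = (if a \<le> z $ i \<and> z $ i \<le> a + 2 * l \<and> c \<le> z $ j \<and> z $ j < c + r
     then hh K l r (min (z $ i - a) (a + 2 * l - z $ i)) (z $ j - c) else 0)"

text \<open>The descending set of one half of a block, seen from the branching side \<open>a\<close>
  in direction \<open>\<sigma>\<close>. A block uses \<open>\<sigma> = 1\<close> at \<open>a\<close>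
  and \<open>\<sigma> = -1\<close> at \<open>a + 2 * l\<close>.\<close>

definition downset :: "2 \<Rightarrow> 2 \<Rightarrow> real \<Rightarrow> real \<Rightarrow> real \<Rightarrow> nat \<Rightarrow> real \<Rightarrow> real \<Rightarrow> (real^2) set" where
  "downset i j \<sigma> a c K l r = {z. 0 \<le> \<sigma> * (z $ i - a) \<and> \<sigma> * (z $ i - a) < l \<and> c \<le> z $ j \<and> z $ j < c + r
     \<and> down K l r (\<sigma> * (z $ i - a)) (z $ j - c)}"

lemma measurable_hh[measurable (raw)]:
  assumes [measurable]: "f \<in> borel_measurable M" "g \<in> borel_measurable M"
  shows "(\<lambda>z. hh K l r (f z) (g z)) \<in> borel_measurable M"
  using assms(2)
proof (induction K arbitrary: l r g)
  case 0
  then show ?case unfolding hh.simps tooth_def by measurable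
next
  case (Suc K)
  have [measurable]: "g \<in> borel_measurable M" by fact
  have [measurable]: "(\<lambda>z. hh K (l / 3) (r / 2) (f z) (g z)) \<in> borel_measurable M"
    "(\<lambda>z. hh K (l / 3) (r / 2) (f z) (g z - r / 2)) \<in> borel_measurable M"
    by (rule Suc.IH; measurable)+
  show ?case unfolding hh.simps tooth_def by measurable
qed

lemma measurable_down[measurable (raw)]:
  assumes [measurable]: "f \<in> borel_measurable M" "g \<in> borel_measurable M"
  shows "Measurable.pred M (\<lambda>z. down K l r (f z) (g z))"
  using assms(2)
proof (induction K arbitrary: l r g)
  case 0
  then show ?case by simp
next
  case (Suc K)
  have [measurable]: "g \<in> borel_measurable M" by fact
  have [measurable]: "Measurable.pred M (\<lambda>z. down K (l / 3) (r / 2) (f z) (g z))"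
    "Measurable.pred M (\<lambda>z. down K (l / 3) (r / 2) (f z) (g z - r / 2))"
    by (rule Suc.IH; measurable)+
  show ?case unfolding down.simps Let_def by measurable
qed

lemma borel_measurable_nth[measurable]: "(\<lambda>z::real^2. z $ k) \<in> borel_measurable borel"
  by (intro borel_measurable_continuous_onI continuous_intros)

lemma block_measurable[measurable]: "block i j a c K l r \<in> borel_measurable borel"
  unfolding block_def by measurable

lemma downset_measurable[measurable]: "downset i j \<sigma> a c K l r \<in> sets borel"
  unfolding downset_def by measurable

lemma hh_bound:
  assumes "0 < l" "0 < r" "0 \<le> x" "x \<le> l" "0 \<le> y" "y \<le> r" shows "\<bar>hh K l r x y\<bar> \<le> 2 * r"
  using hh_lipschitz_y[OF assms(1-4), of y 0 K] hh_zero_y[OF assms(1-4), of K] assms by simp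

context
  fixes i j :: 2 and a c l r :: real and K :: nat
  assumes ij: "i \<noteq> j" and l: "0 < l" and r: "0 < r"
begin

lemma block_bound: "\<bar>block i j a c K l r z\<bar> \<le> 2 * r"
  using hh_bound[OF l r, of "min (z $ i - a) (a + 2 * l - z $ i)" "z $ j - c" K] r by (auto simp: block_def)

lemma block_section_j:
  "block i j a c K l r (comb i s t) = (if a \<le> s \<and> s \<le> a + 2 * l \<and> c \<le> t \<and> t < c + r
    then hh K l r (min (s - a) (a + 2 * l - s)) (t - c) else 0)"
  using ij by (simp add: block_def comb_def)

lemma block_section_i:
  "block i j a c K l r (comb j t s) = (if a \<le> s \<and> s \<le> a + 2 * l \<and> c \<le> t \<and> t < c + r
    then hh K l r (min (s - a) (a + 2 * l - s)) (t - c) else 0)"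
  using ij by (simp add: block_def comb_def)

lemma block_lipschitz_j: "\<bar>block i j a c K l r (comb i s t) - block i j a c K l r (comb i s t')\<bar> \<le> 2 * \<bar>t - t'\<bar>"
proof (cases "a \<le> s \<and> s \<le> a + 2 * l")
  case True
  then have d: "0 \<le> min (s - a) (a + 2 * l - s)" "min (s - a) (a + 2 * l - s) \<le> l" by auto
  note z = hh_zero_y[OF l r d, of K]
  have e: "block i j a c K l r (comb i s t) = hh K l r (min (s - a) (a + 2 * l - s)) (t - c)" if "c \<le> t" "t \<le> c + r" for t
    using that True z by (cases "t = c + r") (simp_all add: block_section_j)
  show ?thesis
  proof (rule lipschitz_zero_extension[of c "c + r"])
    fix s' t' assume "c \<le> s'" "s' \<le> c + r" "c \<le> t'" "t' \<le> c + r"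
    then show "\<bar>block i j a c K l r (comb i s s') - block i j a c K l r (comb i s t')\<bar> \<le> 2 * \<bar>s' - t'\<bar>"
      using hh_lipschitz_y[OF l r d, of "s' - c" "t' - c" K] by (simp add: e)
  qed (use z r in \<open>auto simp: block_section_j\<close>)
next
  case False then show ?thesis by (auto simp: block_section_j)
qed

lemma block_lipschitz_i: "\<bar>block i j a c K l r (comb j t s) - block i j a c K l r (comb j t s')\<bar> \<le> 2 * r / l * 2 ^ K * \<bar>s - s'\<bar>"
proof (cases "c \<le> t \<and> t < c + r")
  case True
  have L0: "0 \<le> 2 * r / l * 2 ^ K" using l r by simp
  show ?thesis
  proof (rule lipschitz_zero_extension[of a "a + 2 * l"])
    fix s s' assume s: "a \<le> s" "s \<le> a + 2 * l" "a \<le> s'" "s' \<le> a + 2 * l"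
    have "\<bar>hh K l r (min (s - a) (a + 2 * l - s)) (t - c) - hh K l r (min (s' - a) (a + 2 * l - s')) (t - c)\<bar>
      \<le> 2 * r / l * 2 ^ K * \<bar>min (s - a) (a + 2 * l - s) - min (s' - a) (a + 2 * l - s')\<bar>"
      using s True by (intro hh_lipschitz_x[OF l r]) auto
    also have "\<dots> \<le> 2 * r / l * 2 ^ K * \<bar>s - s'\<bar>" using L0 by (intro mult_left_mono abs_min_diff_le) auto
    finally show "\<bar>block i j a c K l r (comb j t s) - block i j a c K l r (comb j t s')\<bar> \<le> 2 * r / l * 2 ^ K * \<bar>s - s'\<bar>"
      using s True by (simp add: block_section_i)
  qed (use l L0 hh_left[OF l, of K r] in \<open>auto simp: block_section_i\<close>)
next
  case False then show ?thesis using l r by (auto simp: block_section_i)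
qed

lemma block_diffq_bound: "\<bar>diffq k n (block i j a c K l r) z\<bar> \<le> 2 + 2 * r / l * 2 ^ K"
proof -
  have L0: "0 \<le> 2 * r / l * 2 ^ K" using l r by simp
  have "\<bar>block i j a c K l r (z + axis k (1 / Suc n)) - block i j a c K l r z\<bar> \<le> (2 + 2 * r / l * 2 ^ K) * (1 / Suc n)"
  proof (cases "k = i")
    case True
    have "\<bar>block i j a c K l r (z + axis k (1 / Suc n)) - block i j a c K l r z\<bar> \<le> 2 * r / l * 2 ^ K * (1 / Suc n)"
      using block_lipschitz_i[of "z $ j" "z $ i + 1 / Suc n" "z $ i"] comb_line[OF ij, of z "z $ i + 1 / Suc n"] comb_line[OF ij, of z "z $ i"]
      by (simp add: True axis_zero del: of_nat_Suc)
    also have "\<dots> \<le> (2 + 2 * r / l * 2 ^ K) * (1 / Suc n)" by (rule mult_right_mono) simp_all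
    finally show ?thesis .
  next
    case False
    then have k: "k = j" using ij exhaust_2[of i] exhaust_2[of j] exhaust_2[of k] by auto
    have "\<bar>block i j a c K l r (z + axis k (1 / Suc n)) - block i j a c K l r z\<bar> \<le> 2 * (1 / Suc n)"
      using block_lipschitz_j[of "z $ i" "z $ j + 1 / Suc n" "z $ j"] comb_line[OF ij[symmetric], of z "z $ j + 1 / Suc n"] comb_line[OF ij[symmetric], of z "z $ j"]
      by (simp add: k axis_zero del: of_nat_Suc)
    also have "\<dots> \<le> (2 + 2 * r / l * 2 ^ K) * (1 / Suc n)" using L0 by (intro mult_right_mono) simp_all
    finally show ?thesis .
  qed
  from mult_right_mono[OF this, of "real (Suc n)"] show ?thesis unfolding diffq_def by (simp add: abs_mult del: of_nat_Suc)
qed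

lemma block_germ_i_ex: "\<exists>s. rgerm (\<lambda>s. block i j a c K l r (comb j t s)) x s"
proof (cases "c \<le> t \<and> t < c + r")
  case True
  have h: "pwa (\<lambda>x. hh K l r x (t - c))" by (rule pwa_hh) (use l r True in auto)
  \<comment> \<open>Four pieces: zero, the copy, its mirror image, zero. They agree at the joints
    because \<open>hh\<close> vanishes at distance 0 and the two copies meet at distance
    \<open>l\<close>.\<close>
  have "pwa (\<lambda>s. if s < a then 0 else if s < a + l then hh K l r (s + - a) (t - c)
    else if s < a + 2 * l then hh K l r ((a + 2 * l) - s) (t - c) else 0)"
    by (intro pwa_glue pwa_const pwa_translate[OF h] pwa_reflect[OF h]) (use l hh_left[OF l] in auto)
  moreover have "(\<lambda>s. if s < a then 0 else if s < a + l then hh K l r (s + - a) (t - c)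
    else if s < a + 2 * l then hh K l r ((a + 2 * l) - s) (t - c) else 0) = (\<lambda>s. block i j a c K l r (comb j t s))"
  proof
    fix s
    consider "s < a" | "a \<le> s" "s < a + l" | "a + l \<le> s" "s < a + 2 * l" | "s = a + 2 * l" | "a + 2 * l < s" by linarith
    then show "(if s < a then 0 else if s < a + l then hh K l r (s + - a) (t - c)
      else if s < a + 2 * l then hh K l r ((a + 2 * l) - s) (t - c) else 0) = block i j a c K l r (comb j t s)"
    proof cases
      case 2
      then have "min (s - a) (a + 2 * l - s) = s + - a" by auto
      then show ?thesis using 2 l True by (simp add: block_section_i)
    next
      case 3
      then have "min (s - a) (a + 2 * l - s) = a + 2 * l - s" by auto
      then show ?thesis using 3 l True by (simp add: block_section_i)
    next
      case 4
      then have "min (s - a) (a + 2 * l - s) = 0" using l by auto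
      then show ?thesis using 4 l True hh_left[OF l] by (simp add: block_section_i)
    qed (use l in \<open>auto simp: block_section_i\<close>)
  qed
  ultimately have "pwa (\<lambda>s. block i j a c K l r (comb j t s))" by simp
  from pwa_rgerm[OF this, of x] show ?thesis by blast
next
  case False
  then have "(\<lambda>s. block i j a c K l r (comb j t s)) = (\<lambda>s. 0)" by (auto simp: block_section_i)
  then show ?thesis using rgerm_const by auto
qed

lemma block_germ_i_outside:
  assumes "\<not> (a \<le> x \<and> x \<le> a + 2 * l \<and> c \<le> t \<and> t < c + r)"
  shows "rgerm (\<lambda>s. block i j a c K l r (comb j t s)) x 0"
proof -
  consider "\<not> (c \<le> t \<and> t < c + r)" | "x < a" | "a + 2 * l < x" using assms by linarith
  then show ?thesis
  proof cases
    case 1 then show ?thesis by (intro rgerm_cong[OF rgerm_const[of 0], of 1]) (auto simp: block_section_i)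
  next
    case 2 then show ?thesis by (intro rgerm_cong[OF rgerm_const[of 0], of "a - x"]) (auto simp: block_section_i)
  next
    case 3 then show ?thesis by (intro rgerm_cong[OF rgerm_const[of 0], of 1]) (auto simp: block_section_i)
  qed
qed

lemma block_germ_j:
  assumes "a \<le> x" "x \<le> a + 2 * l" "c \<le> t" "t < c + r"
  shows "\<exists>s. rgerm (\<lambda>t. block i j a c K l r (comb i x t)) t s \<and>
    (l / 3 ^ K \<le> min (x - a) (a + 2 * l - x) \<and> min (x - a) (a + 2 * l - x) < l \<longrightarrow>
      s = (if down K l r (min (x - a) (a + 2 * l - x)) (t - c) then - q else p))"
proof -
  obtain s where s: "rgerm (\<lambda>y. hh K l r (min (x - a) (a + 2 * l - x)) y) (t - c) s"
    "l / 3 ^ K \<le> min (x - a) (a + 2 * l - x) \<and> min (x - a) (a + 2 * l - x) < l \<longrightarrow>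
      s = (if down K l r (min (x - a) (a + 2 * l - x)) (t - c) then - q else p)"
  proof -
    have "0 \<le> min (x - a) (a + 2 * l - x)" "min (x - a) (a + 2 * l - x) \<le> l" "0 \<le> t - c" "t - c < r" using assms by auto
    from hh_germ_y[OF l r this, of K] show ?thesis using that by blast
  qed
  have "rgerm (\<lambda>t. block i j a c K l r (comb i x t)) t s"
    by (rule rgerm_cong[OF rgerm_shift[OF s(1)], of "c + r - t"]) (use assms in \<open>auto simp: block_section_j\<close>)
  then show ?thesis using s(2) by blast
qed

lemma block_germ_j_outside:
  assumes "\<not> (a \<le> x \<and> x \<le> a + 2 * l \<and> c \<le> t \<and> t < c + r)"
  shows "rgerm (\<lambda>t. block i j a c K l r (comb i x t)) t 0"
proof -
  consider "\<not> (a \<le> x \<and> x \<le> a + 2 * l)" | "t < c" | "c + r \<le> t" using assms by linarith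
  then show ?thesis
  proof cases
    case 1 then show ?thesis by (intro rgerm_cong[OF rgerm_const[of 0], of 1]) (auto simp: block_section_j)
  next
    case 2 then show ?thesis by (intro rgerm_cong[OF rgerm_const[of 0], of "c - t"]) (auto simp: block_section_j)
  next
    case 3 then show ?thesis by (intro rgerm_cong[OF rgerm_const[of 0], of 1]) (auto simp: block_section_j)
  qed
qed

lemma block_germ_i_slope:
  assumes "a \<le> x" "x \<le> a + 2 * l" "c \<le> t" "t < c + r" "rgerm (\<lambda>s. block i j a c K l r (comb j t s)) x s"
  shows "\<bar>s\<bar> \<le> slope K l r (min (x - a) (a + 2 * l - x))"
proof -
  \<comment> \<open>From the midline on, a positive step decreases the distance to the branching
    side, so there the slope of \<open>hh\<close> in the backward direction is needed.\<close>
  define \<sigma> :: real where "\<sigma> = (if x < a + l then 1 else -1)"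
  define d where "d = min (x - a) (a + 2 * l - x)"
  have d: "0 \<le> d" "d \<le> l" using assms by (auto simp: d_def)
  have \<sigma>: "\<sigma> = 1 \<or> \<sigma> = -1" by (auto simp: \<sigma>_def)
  from assms(5) obtain \<delta> where \<delta>: "\<delta> > 0" "\<forall>u. 0 \<le> u \<and> u \<le> \<delta> \<longrightarrow> block i j a c K l r (comb j t (x + u)) = block i j a c K l r (comb j t x) + s * u"
    unfolding rgerm_def by (elim exE conjE) (rule that)
  show ?thesis
  proof (cases "x = a + 2 * l")
    case True
    have "block i j a c K l r (comb j t (x + \<delta>)) = 0" "block i j a c K l r (comb j t x) = 0"
      using True \<delta>(1) l hh_left[OF l] by (auto simp: block_section_i)
    then have "s * \<delta> = 0" using \<delta>(2)[rule_format, of \<delta>] \<delta>(1) by simp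
    then show ?thesis using \<delta>(1) slope_nonneg[OF l r] by simp
  next
    case False
    have "0 \<le> t - c" "t - c \<le> r" using assms by auto
    from hh_local_slope[OF l r d this \<sigma>, of K] obtain \<eta> where \<eta>: "\<eta> > 0"
      "\<forall>u. 0 \<le> u \<and> u \<le> \<eta> \<and> 0 \<le> d + \<sigma> * u \<and> d + \<sigma> * u \<le> l \<longrightarrow> \<bar>hh K l r (d + \<sigma> * u) (t - c) - hh K l r d (t - c)\<bar> \<le> slope K l r d * u"
      by (elim exE conjE) (rule that)
    define u where "u = min \<delta> (min \<eta> (if x < a + l then a + l - x else a + 2 * l - x))"
    have u: "u > 0" "u \<le> \<delta>" "u \<le> \<eta>" using \<delta>(1) \<eta>(1) False assms by (auto simp: u_def)
    have u3: "u \<le> (if x < a + l then a + l - x else a + 2 * l - x)" by (simp add: u_def)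
    have e: "min (x + u - a) (a + 2 * l - (x + u)) = d + \<sigma> * u" using u u3 by (auto simp: d_def \<sigma>_def split: if_splits)
    have rng: "0 \<le> d + \<sigma> * u" "d + \<sigma> * u \<le> l" "x + u \<le> a + 2 * l" using u u3 assms unfolding e[symmetric] by (auto split: if_splits)
    have "block i j a c K l r (comb j t (x + u)) = hh K l r (d + \<sigma> * u) (t - c)"
      using assms u rng by (simp add: block_section_i e)
    moreover have "block i j a c K l r (comb j t x) = hh K l r d (t - c)" using assms by (simp add: block_section_i d_def)
    ultimately have "s * u = hh K l r (d + \<sigma> * u) (t - c) - hh K l r d (t - c)" using \<delta>(2)[rule_format, of u] u by simp
    then have "\<bar>s * u\<bar> \<le> slope K l r d * u" using \<eta>(2)[rule_format, of u] u rng by simp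
    then have "\<bar>s\<bar> * u \<le> slope K l r d * u" using u by (simp add: abs_mult)
    then show ?thesis using u(1) by (simp add: d_def)
  qed
qed

end

end

context teeth
begin

context
  fixes i j :: 2 and a c l r :: real and K :: nat
  assumes ij: "i \<noteq> j" and l: "0 < l" and r: "0 < r"
begin

lemma block_L_loc: "block i j a c K l r \<in> L_loc 1"
  by (rule L_loc_1_bounded[OF block_measurable block_bound[OF ij l r]])

text \<open>\<open>g\<close> consists of the right-hand slopes, which exist everywhere. The last
  clause identifies the slope in \<open>j\<close> outside the two interpolation layers and the
  midline; \<open>nn_integral_block\<close> treats those sets separately.\<close>

lemma block_weak_deriv:
  obtains g where "\<And>k. weak_deriv k (block i j a c K l r) (g k)" "\<And>k. g k \<in> borel_measurable borel"
    "\<And>k z. \<bar>g k z\<bar> \<le> 2 + 2 * r / l * 2 ^ K"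
    "\<And>k z. \<not> (a \<le> z $ i \<and> z $ i \<le> a + 2 * l \<and> c \<le> z $ j \<and> z $ j < c + r) \<Longrightarrow> g k z = 0"
    "\<And>z. a \<le> z $ i \<and> z $ i \<le> a + 2 * l \<and> c \<le> z $ j \<and> z $ j < c + r \<Longrightarrow>
      \<bar>g i z\<bar> \<le> slope K l r (min (z $ i - a) (a + 2 * l - z $ i))"
    "\<And>z. \<bar>g j z\<bar> \<le> 2"
    "\<And>z. a \<le> z $ i \<and> z $ i \<le> a + 2 * l \<and> c \<le> z $ j \<and> z $ j < c + r \<Longrightarrow>
      l / 3 ^ K \<le> min (z $ i - a) (a + 2 * l - z $ i) \<and> min (z $ i - a) (a + 2 * l - z $ i) < l \<Longrightarrow>
      g j z = (if z \<in> downset i j 1 a c K l r \<union> downset i j (-1) (a + 2 * l) c K l r then - q else p)"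
proof -
  let ?w = "block i j a c K l r"
  let ?R = "\<lambda>z::real^2. a \<le> z $ i \<and> z $ i \<le> a + 2 * l \<and> c \<le> z $ j \<and> z $ j < c + r"
  let ?d = "\<lambda>z::real^2. min (z $ i - a) (a + 2 * l - z $ i)"
  have li: "z + axis i (t - z $ i) = comb j (z $ j) t" for z t by (rule comb_line[OF ij])
  have lj: "z + axis j (t - z $ j) = comb i (z $ i) t" for z t by (rule comb_line[OF ij[symmetric]])
  have Gi: "\<exists>s. (\<lambda>n. diffq i n ?w z) \<longlonglongrightarrow> s \<and> (?R z \<longrightarrow> \<bar>s\<bar> \<le> slope K l r (?d z)) \<and> (\<not> ?R z \<longrightarrow> s = 0)" for z
  proof (cases "?R z")
    case True
    obtain s where s: "rgerm (\<lambda>s. ?w (comb j (z $ j) s)) (z $ i) s" using block_germ_i_ex[OF ij l r] by blast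
    have "\<bar>s\<bar> \<le> slope K l r (?d z)" using block_germ_i_slope[OF ij l r _ _ _ _ s] True by blast
    then show ?thesis using diffq_tendsto_germ[of ?w z i s] s True unfolding li by blast
  next
    case False
    then show ?thesis using diffq_tendsto_germ[of ?w z i 0] block_germ_i_outside[OF ij l r False] unfolding li by blast
  qed
  have Gj: "\<exists>s. (\<lambda>n. diffq j n ?w z) \<longlonglongrightarrow> s \<and> (\<not> ?R z \<longrightarrow> s = 0) \<and> (?R z \<longrightarrow> l / 3 ^ K \<le> ?d z \<and> ?d z < l \<longrightarrow>
      s = (if down K l r (?d z) (z $ j - c) then - q else p))" for z
  proof (cases "?R z")
    case True
    obtain s where s: "rgerm (\<lambda>t. ?w (comb i (z $ i) t)) (z $ j) s" "l / 3 ^ K \<le> ?d z \<and> ?d z < l \<longrightarrow>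
      s = (if down K l r (?d z) (z $ j - c) then - q else p)"
      using block_germ_j[OF ij l r, of a "z $ i" c "z $ j" K] True by blast
    then show ?thesis using diffq_tendsto_germ[of ?w z j s] True unfolding lj by blast
  next
    case False
    then show ?thesis using diffq_tendsto_germ[of ?w z j 0] block_germ_j_outside[OF ij l r False] unfolding lj by blast
  qed
  obtain gi where gi: "\<And>z. (\<lambda>n. diffq i n ?w z) \<longlonglongrightarrow> gi z" "\<And>z. ?R z \<Longrightarrow> \<bar>gi z\<bar> \<le> slope K l r (?d z)" "\<And>z. \<not> ?R z \<Longrightarrow> gi z = 0"
    using Gi by metis
  obtain gj where gj: "\<And>z. (\<lambda>n. diffq j n ?w z) \<longlonglongrightarrow> gj z" "\<And>z. \<not> ?R z \<Longrightarrow> gj z = 0"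
    "\<And>z. ?R z \<Longrightarrow> l / 3 ^ K \<le> ?d z \<and> ?d z < l \<Longrightarrow> gj z = (if down K l r (?d z) (z $ j - c) then - q else p)"
    using Gj by metis
  define g where "g k = (if k = i then gi else gj)" for k
  have k: "k = i \<or> k = j" for k using ij exhaust_2[of i] exhaust_2[of j] exhaust_2[of k] by auto
  have lim: "(\<lambda>n. diffq k n ?w z) \<longlonglongrightarrow> g k z" for k z using k[of k] gi(1) gj(1) ij by (auto simp: g_def)
  note W = weak_deriv_diffq[OF block_L_loc lim block_diffq_bound[OF ij l r]]
  show ?thesis
  proof (rule that[of g])
    show "\<bar>g j z\<bar> \<le> 2" for z
    proof -
      have "\<bar>diffq j n ?w z\<bar> \<le> 2" for n
      proof -
        have "\<bar>?w (comb i (z $ i) (z $ j + 1 / Suc n)) - ?w (comb i (z $ i) (z $ j))\<bar> \<le> 2 * \<bar>(z $ j + 1 / Suc n) - z $ j\<bar>"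
          by (rule block_lipschitz_j[OF ij l r])
        then have "\<bar>?w (z + axis j (1 / Suc n)) - ?w z\<bar> \<le> 2 * (1 / Suc n)"
          using lj[of z "z $ j + 1 / Suc n"] lj[of z "z $ j"] by (simp add: axis_zero del: of_nat_Suc)
        from mult_right_mono[OF this, of "real (Suc n)"] show ?thesis unfolding diffq_def by (simp add: abs_mult del: of_nat_Suc)
      qed
      then show ?thesis using LIMSEQ_le_const2[OF tendsto_rabs[OF lim[of j z]]] by blast
    qed
    show "g j z = (if z \<in> downset i j 1 a c K l r \<union> downset i j (-1) (a + 2 * l) c K l r then - q else p)"
      if R: "?R z" and d: "l / 3 ^ K \<le> ?d z \<and> ?d z < l" for z
    proof -
      have "z \<in> downset i j 1 a c K l r \<union> downset i j (-1) (a + 2 * l) c K l r \<longleftrightarrow> down K l r (?d z) (z $ j - c)"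
      proof (cases "z $ i < a + l")
        case True
        then have "?d z = z $ i - a" by auto
        then show ?thesis using R d True by (auto simp: downset_def)
      next
        case False
        then have "?d z = a + 2 * l - z $ i" by auto
        then show ?thesis using R d False by (auto simp: downset_def)
      qed
      then show ?thesis using gj(3)[OF R d] ij by (simp add: g_def)
    qed
  qed (use W k gi gj ij in \<open>auto simp: g_def\<close>)
qed

text \<open>On each line in direction \<open>i\<close>, the square of \<open>slope\<close>
  integrates to at most 4 r^2 / l per half. In the layers of width l / 3^K the slope in
  \<open>j\<close> deviates from the prescribed values by at most 4, hence the term with 16 =
  4^2.\<close>

lemma nn_integral_block:
  obtains g where "\<And>k. weak_deriv k (block i j a c K l r) (g k)" "\<And>k. g k \<in> borel_measurable borel"
    "\<And>k z. \<bar>g k z\<bar> \<le> 2 + 2 * r / l * 2 ^ K"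
    "\<And>k z. \<not> (a \<le> z $ i \<and> z $ i \<le> a + 2 * l \<and> c \<le> z $ j \<and> z $ j < c + r) \<Longrightarrow> g k z = 0"
    "(\<integral>\<^sup>+z. ennreal ((g i z)\<^sup>2 + (g j z - (if z \<in> downset i j 1 a c K l r \<union> downset i j (-1) (a + 2 * l) c K l r then - q else p))\<^sup>2)
       * indicator {z. a \<le> z $ i \<and> z $ i \<le> a + 2 * l \<and> c \<le> z $ j \<and> z $ j < c + r} z \<partial>lborel)
      \<le> ennreal (2 * r * (4 * r\<^sup>2 / l + 16 * l / 3 ^ K))"
proof -
  let ?R = "{z::real^2. a \<le> z $ i \<and> z $ i \<le> a + 2 * l \<and> c \<le> z $ j \<and> z $ j < c + r}"
  let ?d = "\<lambda>s::real. min (s - a) (a + 2 * l - s)"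
  let ?D = "downset i j 1 a c K l r \<union> downset i j (-1) (a + 2 * l) c K l r"
  obtain g where g: "\<And>k. weak_deriv k (block i j a c K l r) (g k)" "\<And>k. g k \<in> borel_measurable borel"
    "\<And>k z. \<bar>g k z\<bar> \<le> 2 + 2 * r / l * 2 ^ K"
    "\<And>k z. \<not> (a \<le> z $ i \<and> z $ i \<le> a + 2 * l \<and> c \<le> z $ j \<and> z $ j < c + r) \<Longrightarrow> g k z = 0"
    "\<And>z. a \<le> z $ i \<and> z $ i \<le> a + 2 * l \<and> c \<le> z $ j \<and> z $ j < c + r \<Longrightarrow>
      \<bar>g i z\<bar> \<le> slope K l r (min (z $ i - a) (a + 2 * l - z $ i))"
    "\<And>z. \<bar>g j z\<bar> \<le> 2"
    "\<And>z. a \<le> z $ i \<and> z $ i \<le> a + 2 * l \<and> c \<le> z $ j \<and> z $ j < c + r \<Longrightarrow>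
      l / 3 ^ K \<le> min (z $ i - a) (a + 2 * l - z $ i) \<and> min (z $ i - a) (a + 2 * l - z $ i) < l \<Longrightarrow>
      g j z = (if z \<in> downset i j 1 a c K l r \<union> downset i j (-1) (a + 2 * l) c K l r then - q else p)"
    by (rule block_weak_deriv) blast
  \<comment> \<open>A majorant that depends only on the distance to the branching side. The point
    \<open>l\<close> is the midline, where the slope in \<open>j\<close> is not identified; it has
    measure 0.\<close>
  define F where "F x = ennreal ((slope K l r x)\<^sup>2) * indicator {0..l} x + 16 * indicator ({0..l / 3 ^ K} \<union> {l}) x" for x :: real
  have [measurable]: "F \<in> borel_measurable borel" unfolding F_def[abs_def] by measurable
  have F: "(\<integral>\<^sup>+x. F x \<partial>lborel) \<le> ennreal (4 * r\<^sup>2 / l + 16 * l / 3 ^ K)"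
  proof -
    have "(\<integral>\<^sup>+x. F x \<partial>lborel) = (\<integral>\<^sup>+x. ennreal ((slope K l r x)\<^sup>2) * indicator {0..l} x \<partial>lborel) + (\<integral>\<^sup>+x. 16 * indicator ({0..l / 3 ^ K} \<union> {l}) x \<partial>lborel)"
      unfolding F_def by (rule nn_integral_add) measurable
    also have "(\<integral>\<^sup>+x. 16 * indicator ({0..l / 3 ^ K} \<union> {l}) x \<partial>lborel) = 16 * emeasure lborel ({0..l / 3 ^ K} \<union> {l})"
      by (subst nn_integral_cmult_indicator) auto
    also have "\<dots> \<le> 16 * (emeasure lborel {0..l / 3 ^ K} + emeasure lborel {l})"
      by (intro mult_left_mono emeasure_subadditive) auto
    also have "\<dots> = ennreal (16 * l / 3 ^ K)" using l by (simp add: ennreal_mult[symmetric] flip: ennreal_numeral)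
    also have "(\<integral>\<^sup>+x. ennreal ((slope K l r x)\<^sup>2) * indicator {0..l} x \<partial>lborel) \<le> ennreal (4 * r\<^sup>2 / l)" by (rule nn_integral_slope[OF l r])
    finally have "(\<integral>\<^sup>+x. F x \<partial>lborel) \<le> ennreal (4 * r\<^sup>2 / l) + ennreal (16 * l / 3 ^ K)" by (simp add: add_mono)
    then show ?thesis using l r by (simp add: ennreal_plus)
  qed
  define h where "h z = ennreal ((g i z)\<^sup>2 + (g j z - (if z \<in> ?D then - q else p))\<^sup>2) * indicator ?R z" for z
  have pw: "h z \<le> (F (z $ i - a) + F (a + 2 * l - z $ i)) * indicator {c..c + r} (z $ j)" for z
  proof (cases "z \<in> ?R")
    case True
    then have R: "a \<le> z $ i \<and> z $ i \<le> a + 2 * l \<and> c \<le> z $ j \<and> z $ j < c + r" by simp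
    have 1: "(g i z)\<^sup>2 \<le> (slope K l r (?d (z $ i)))\<^sup>2" using g(5)[OF R] by (intro power2_le_iff_abs_le[THEN iffD2]) auto
    have 2: "(g j z - (if z \<in> ?D then - q else p))\<^sup>2 \<le> 16 * indicator ({0..l / 3 ^ K} \<union> {l}) (?d (z $ i))"
    proof (cases "?d (z $ i) \<in> {0..l / 3 ^ K} \<union> {l}")
      case True
      have "\<bar>g j z - (if z \<in> ?D then - q else p)\<bar> \<le> 4" using g(6)[of z] pq_less p_pos q_pos by auto
      then have "(g j z - (if z \<in> ?D then - q else p))\<^sup>2 \<le> 4\<^sup>2" by (intro power2_le_iff_abs_le[THEN iffD2]) auto
      then show ?thesis using True by simp
    next
      case False
      have "?d (z $ i) \<le> l" "0 \<le> ?d (z $ i)" using R by auto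
      then have "g j z = (if z \<in> ?D then - q else p)" using False by (intro g(7)[OF R]) auto
      then show ?thesis by simp
    qed
    have "h z \<le> ennreal ((slope K l r (?d (z $ i)))\<^sup>2 + 16 * indicator ({0..l / 3 ^ K} \<union> {l}) (?d (z $ i)))"
      unfolding h_def indicator_simps(1)[OF True] mult_1_right by (rule ennreal_leI[OF add_mono[OF 1 2]])
    also have "\<dots> = F (?d (z $ i))"
    proof -
      have "?d (z $ i) \<in> {0..l}" using R by auto
      then show ?thesis unfolding F_def by (auto simp: ennreal_plus indicator_def)
    qed
    also have "\<dots> \<le> F (z $ i - a) + F (a + 2 * l - z $ i)"
      by (cases "z $ i - a \<le> a + 2 * l - z $ i") (simp_all add: min_def)
    finally show ?thesis using R by simp
  qed (simp add: h_def)
  have "(\<integral>\<^sup>+z. h z \<partial>lborel) \<le> (\<integral>\<^sup>+z. (F (z $ i - a) + F (a + 2 * l - z $ i)) * indicator {c..c + r} (z $ j) \<partial>lborel)"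
    by (intro nn_integral_mono pw)
  also have "\<dots> = (\<integral>\<^sup>+s. \<integral>\<^sup>+t. (F (s - a) + F (a + 2 * l - s)) * indicator {c..c + r} t \<partial>lborel \<partial>lborel)"
    by (subst nn_integral_real2[of _ i]) (auto simp: comb_nth ij[symmetric])
  also have "\<dots> = (\<integral>\<^sup>+s. (F (s - a) + F (a + 2 * l - s)) * ennreal r \<partial>lborel)"
    using r by (subst nn_integral_cmult_indicator) auto
  also have "\<dots> = ((\<integral>\<^sup>+s. F (s - a) \<partial>lborel) + (\<integral>\<^sup>+s. F (a + 2 * l - s) \<partial>lborel)) * ennreal r"
    by (simp add: nn_integral_multc nn_integral_add)
  also have "(\<integral>\<^sup>+s. F (s - a) \<partial>lborel) = (\<integral>\<^sup>+s. F s \<partial>lborel)"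
    using nn_integral_real_affine[of F 1 "- a"] by simp
  also have "(\<integral>\<^sup>+s. F (a + 2 * l - s) \<partial>lborel) = (\<integral>\<^sup>+s. F s \<partial>lborel)"
    using nn_integral_real_affine[of F "-1" "a + 2 * l"] by simp
  also have "((\<integral>\<^sup>+s. F s \<partial>lborel) + (\<integral>\<^sup>+s. F s \<partial>lborel)) * ennreal r \<le> (ennreal (4 * r\<^sup>2 / l + 16 * l / 3 ^ K) + ennreal (4 * r\<^sup>2 / l + 16 * l / 3 ^ K)) * ennreal r"
    by (intro mult_right_mono add_mono F) auto
  also have "\<dots> = ennreal (2 * r * (4 * r\<^sup>2 / l + 16 * l / 3 ^ K))"
    using l r by (simp add: ennreal_plus[symmetric] ennreal_mult[symmetric] del: ennreal_plus add: mult_ac)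
  finally have "(\<integral>\<^sup>+z. h z \<partial>lborel) \<le> ennreal (2 * r * (4 * r\<^sup>2 / l + 16 * l / 3 ^ K))" .
  then show ?thesis using that[of g] g(1-4) unfolding h_def by blast
qed

end

text \<open>A parallelogram: while the distance from the side \<open>a\<close> grows from
  \<open>x0\<close> to \<open>x1\<close>, a section of length \<open>w\<close> moves with speed
  \<open>s\<close>.\<close>

definition strip :: "2 \<Rightarrow> 2 \<Rightarrow> real \<Rightarrow> real \<Rightarrow> real \<Rightarrow> real \<Rightarrow> real \<Rightarrow> real \<Rightarrow> real \<Rightarrow> real \<Rightarrow> (real^2) set" where
  "strip i j \<sigma> a c x0 x1 m s w = {z. x0 \<le> \<sigma> * (z $ i - a) \<and> \<sigma> * (z $ i - a) < x1 \<and>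
     m + s * (\<sigma> * (z $ i - a)) \<le> z $ j - c \<and> z $ j - c < m + s * (\<sigma> * (z $ i - a)) + w}"

lemma strip_measurable[measurable]: "strip i j \<sigma> a c x0 x1 m s w \<in> sets borel"
  unfolding strip_def by measurable

text \<open>The outer generation contributes one slanted strip in each of its two cells. The speeds
  are those of the parameter \<open>m\<close> in \<open>hh\<close>, and q r / 16 and 3 q r / 16 are
  its values extrapolated to distance 0.\<close>

lemma downset_Suc:
  assumes "0 < l" "0 < r"
  shows "downset i j \<sigma> a c (Suc K) l r =
    strip i j \<sigma> a c (l / 3) l (q * r / 16) (3 * q * r / (16 * l)) (p * r / 4) \<union>
    strip i j \<sigma> a (c + r / 2) (l / 3) l (3 * q * r / 16) (- (3 * q * r / (16 * l))) (p * r / 4) \<union>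
    (downset i j \<sigma> a c K (l / 3) (r / 2) \<union> downset i j \<sigma> a (c + r / 2) K (l / 3) (r / 2))" (is "?A = ?B")
proof -
  have "z \<in> ?A \<longleftrightarrow> z \<in> ?B" for z :: "real^2"
  proof -
    define x y where "x = \<sigma> * (z $ i - a)" and "y = z $ j - c"
    have zA: "z \<in> ?A \<longleftrightarrow> 0 \<le> x \<and> x < l \<and> 0 \<le> y \<and> y < r \<and> down (Suc K) l r x y"
      unfolding downset_def x_def y_def by auto
    have zB: "z \<in> ?B \<longleftrightarrow>
      (l / 3 \<le> x \<and> x < l \<and> q * r / 16 + 3 * q * r / (16 * l) * x \<le> y \<and> y < q * r / 16 + 3 * q * r / (16 * l) * x + p * r / 4) \<or>
      (l / 3 \<le> x \<and> x < l \<and> 3 * q * r / 16 - 3 * q * r / (16 * l) * x \<le> y - r / 2 \<and> y - r / 2 < 3 * q * r / 16 - 3 * q * r / (16 * l) * x + p * r / 4) \<or>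
      (0 \<le> x \<and> x < l / 3 \<and> 0 \<le> y \<and> y < r / 2 \<and> down K (l / 3) (r / 2) x y) \<or>
      (0 \<le> x \<and> x < l / 3 \<and> r / 2 \<le> y \<and> y < r \<and> down K (l / 3) (r / 2) x (y - r / 2))"
      unfolding downset_def strip_def x_def y_def by (auto simp: algebra_simps)
    have e: "q * r / 8 * (1 + (x - l / 3) / (2 * l / 3)) = q * r / 16 + 3 * q * r / (16 * l) * x"
      "q * r / 8 * (1 - (x - l / 3) / (2 * l / 3)) = 3 * q * r / 16 - 3 * q * r / (16 * l) * x"
      using assms by (simp_all add: field_simps)
    have d: "down (Suc K) l r x y \<longleftrightarrow> (if x < l / 3 then (if y < r / 2 then down K (l / 3) (r / 2) x y else down K (l / 3) (r / 2) x (y - r / 2))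
       else if y < r / 2 then q * r / 16 + 3 * q * r / (16 * l) * x \<le> y \<and> y < q * r / 16 + 3 * q * r / (16 * l) * x + p * r / 4
       else 3 * q * r / 16 - 3 * q * r / (16 * l) * x \<le> y - r / 2 \<and> y - r / 2 < 3 * q * r / 16 - 3 * q * r / (16 * l) * x + p * r / 4)"
      unfolding down.simps Let_def e ..
    show ?thesis
    proof (cases "l / 3 \<le> x \<and> x < l")
      case True
      have pqr: "p * r / 4 = r / 2 - q * r / 4" unfolding p_eq by (simp add: left_diff_distrib diff_divide_distrib)
      have "0 \<le> q * r / 16 + 3 * q * r / (16 * l) * x" "q * r / 16 + 3 * q * r / (16 * l) * x + p * r / 4 \<le> r / 2"
        "0 \<le> 3 * q * r / 16 - 3 * q * r / (16 * l) * x" "3 * q * r / 16 - 3 * q * r / (16 * l) * x + p * r / 4 \<le> r / 2"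
        using m_bounds[of l r x] True assms unfolding e pqr by auto
      then show ?thesis unfolding zA zB d using True by auto
    next
      case False then show ?thesis unfolding zA zB d using assms by auto
    qed
  qed
  then show ?thesis by blast
qed

end

section \<open>Perimeters of rectangles, strips and descending sets\<close>

lemma AE_nth_neq: "AE z in lborel. z $ k \<noteq> (c::real)" for k :: 2
proof -
  have "(\<integral>\<^sup>+z. indicator {z::real^2. z $ k = c} z \<partial>lborel) = (\<integral>\<^sup>+s. \<integral>\<^sup>+(t::real). indicator {c} s \<partial>lborel \<partial>lborel)"
    by (subst nn_integral_real2[of _ k]) (auto simp: comb_nth indicator_def intro!: nn_integral_cong)
  also have "\<dots> = (\<integral>\<^sup>+s. \<infinity> * indicator {c} s \<partial>lborel)" by (intro nn_integral_cong) (auto simp: indicator_def)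
  also have "\<dots> = 0" by (subst nn_integral_cmult_indicator) auto
  finally have "emeasure lborel {z::real^2. z $ k = c} = 0" by simp
  then show ?thesis by (intro AE_I[of _ _ "{z. z $ k = c}"]) auto
qed

lemma per_le_Un:
  assumes "per_le (indicator S) A" "per_le (indicator T) B"
  shows "per_le (indicator (S \<union> T)) (A + B)"
  unfolding per_le_def
proof (intro conjI allI impI)
  have fm[measurable]: "(indicator S :: _ \<Rightarrow> real) \<in> borel_measurable borel" "(indicator T :: _ \<Rightarrow> real) \<in> borel_measurable borel" using assms by (auto simp: per_le_def)
  have "(indicator (S \<union> T) :: _ \<Rightarrow> real) = (\<lambda>x. max (indicator S x) (indicator T x))" by (auto simp: indicator_def)
  then show "(indicator (S \<union> T) :: _ \<Rightarrow> real) \<in> borel_measurable borel" by simp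
  show "A + B \<ge> 0" using assms by (auto simp: per_le_def)
  fix i :: 'a and h :: real assume h: "h > 0"
  have "(\<integral>\<^sup>+x. ennreal \<bar>indicator (S \<union> T) (x + axis i h) - indicator (S \<union> T) x\<bar> \<partial>lborel)
     \<le> (\<integral>\<^sup>+x. ennreal \<bar>indicator S (x + axis i h) - indicator S x\<bar> + ennreal \<bar>indicator T (x + axis i h) - indicator T x\<bar> \<partial>lborel)"
    by (intro nn_integral_mono) (auto simp: indicator_def)
  also have "\<dots> = (\<integral>\<^sup>+x. ennreal \<bar>indicator S (x + axis i h) - indicator S x\<bar> \<partial>lborel) + (\<integral>\<^sup>+x. ennreal \<bar>indicator T (x + axis i h) - indicator T x\<bar> \<partial>lborel)"
    by (intro nn_integral_add) auto
  also have "\<dots> \<le> ennreal (A * h) + ennreal (B * h)" using assms h by (intro add_mono) (auto simp: per_le_def)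
  also have "\<dots> = ennreal ((A + B) * h)" using assms h by (simp add: per_le_def distrib_right flip: ennreal_plus)
  finally show "(\<integral>\<^sup>+x. ennreal \<bar>indicator (S \<union> T) (x + axis i h) - indicator (S \<union> T) x\<bar> \<partial>lborel) \<le> ennreal ((A + B) * h)" .
qed

lemma convex_affine_ge: "convex {z::real^2. k \<le> \<alpha> * z $ i + \<beta> * z $ j}"
proof -
  have "{z::real^2. k \<le> \<alpha> * z $ i + \<beta> * z $ j} = {z. (\<alpha> *\<^sub>R axis i 1 + \<beta> *\<^sub>R axis j 1) \<bullet> z \<ge> k}"
    by (simp add: inner_add_left inner_axis')
  then show ?thesis by (simp add: convex_halfspace_ge)
qed

lemma convex_affine_less: "convex {z::real^2. \<alpha> * z $ i + \<beta> * z $ j < k}"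
proof -
  have "{z::real^2. \<alpha> * z $ i + \<beta> * z $ j < k} = {z. (\<alpha> *\<^sub>R axis i 1 + \<beta> *\<^sub>R axis j 1) \<bullet> z < k}"
    by (simp add: inner_add_left inner_axis')
  then show ?thesis by (simp add: convex_halfspace_lt)
qed

text \<open>Closed in the first and half-open in the second coordinate, as \<open>block\<close> is
  for branching direction 1.\<close>

definition rect :: "real \<Rightarrow> real \<Rightarrow> real \<Rightarrow> real \<Rightarrow> (real^2) set" where
  "rect a w c h = {z. a \<le> z $ 1 \<and> z $ 1 \<le> a + w \<and> c \<le> z $ 2 \<and> z $ 2 < c + h}"

lemma rect_measurable[measurable]: "rect a w c h \<in> sets borel"
  unfolding rect_def by measurable

lemma per_le_rect:
  assumes "0 \<le> w" "0 \<le> h" shows "per_le (indicator (rect a w c h)) (2 * (w + h))"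
proof -
  have e: "rect a w c h = {z. a \<le> 1 * z $ 1 + 0 * z $ 2} \<inter> {z. - a - w \<le> (-1) * z $ 1 + 0 * z $ 2} \<inter> {z. c \<le> 0 * z $ 1 + 1 * z $ 2} \<inter> {z. 0 * z $ 1 + 1 * z $ 2 < c + h}"
    by (auto simp: rect_def)
  have "per_le (indicator (rect a w c h)) (2 * (((if (1::2) = 1 then a + w else c + h) - (if (1::2) = 1 then a else c)) + ((if (2::2) = 1 then a + w else c + h) - (if (2::2) = 1 then a else c))))"
  proof (rule per_le_convex)
    show "convex (rect a w c h)" unfolding e by (intro convex_Int convex_affine_ge convex_affine_less)
    show "(if k = 1 then a else c) \<le> x $ k \<and> x $ k \<le> (if k = 1 then a + w else c + h)" if "x \<in> rect a w c h" for x k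
      using that exhaust_2[of k] by (auto simp: rect_def)
  qed (use assms in auto)
  then show ?thesis by simp
qed

context teeth
begin

lemma strip_convex: "convex (strip i j \<sigma> a c x0 x1 m s w)"
proof -
  have "strip i j \<sigma> a c x0 x1 m s w = {z. x0 + \<sigma> * a \<le> \<sigma> * z $ i + 0 * z $ j} \<inter> {z. \<sigma> * z $ i + 0 * z $ j < x1 + \<sigma> * a} \<inter>
    {z. m - s * \<sigma> * a + c \<le> (- s * \<sigma>) * z $ i + 1 * z $ j} \<inter> {z. (- s * \<sigma>) * z $ i + 1 * z $ j < m - s * \<sigma> * a + c + w}"
    unfolding strip_def by (auto simp: algebra_simps)
  then show ?thesis by (simp only: convex_Int convex_affine_ge convex_affine_less)
qed

lemma per_le_strip:
  assumes ij: "i \<noteq> j" and \<sigma>: "\<sigma> = 1 \<or> \<sigma> = -1" and x: "x0 \<le> x1" and w: "0 \<le> w"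
  shows "per_le (indicator (strip i j \<sigma> a c x0 x1 m s w)) (2 * ((x1 - x0) + (w + \<bar>s\<bar> * (x1 - x0))))"
proof -
  define lo hi where "lo k = (if k = i then min (a + \<sigma> * x0) (a + \<sigma> * x1) else c + m + min (s * x0) (s * x1))"
    and "hi k = (if k = i then max (a + \<sigma> * x0) (a + \<sigma> * x1) else c + m + max (s * x0) (s * x1) + w)" for k
  have "per_le (indicator (strip i j \<sigma> a c x0 x1 m s w)) (2 * ((hi 1 - lo 1) + (hi 2 - lo 2)))"
  proof (rule per_le_convex[OF strip_convex strip_measurable])
    fix z k assume z: "z \<in> strip i j \<sigma> a c x0 x1 m s w"
    define X where "X = \<sigma> * (z $ i - a)"
    have X: "x0 \<le> X" "X < x1" "m + s * X \<le> z $ j - c" "z $ j - c < m + s * X + w" "z $ i = a + \<sigma> * X"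
      using z \<sigma> by (auto simp: strip_def X_def)
    have sX: "min (s * x0) (s * x1) \<le> s * X" "s * X \<le> max (s * x0) (s * x1)"
      using X(1,2) mult_left_mono[of x0 X s] mult_left_mono[of X x1 s] mult_left_mono_neg[of x0 X s] mult_left_mono_neg[of X x1 s]
      by (cases "0 \<le> s"; auto)+
    show "lo k \<le> z $ k \<and> z $ k \<le> hi k"
    proof (cases "k = i")
      case True then show ?thesis using X \<sigma> by (auto simp: lo_def hi_def)
    next
      case False
      then have "k = j" using ij exhaust_2[of i] exhaust_2[of j] exhaust_2[of k] by auto
      then show ?thesis using X sX ij by (auto simp: lo_def hi_def)
    qed
  next
    fix k show "lo k \<le> hi k" using w by (auto simp: lo_def hi_def)
  qed
  also have "(hi 1 - lo 1) + (hi 2 - lo 2) = (hi i - lo i) + (hi j - lo j)" using ij exhaust_2[of i] exhaust_2[of j] by auto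
  also have "hi i - lo i = x1 - x0" using \<sigma> x by (auto simp: hi_def lo_def)
  also have "hi j - lo j = w + \<bar>s\<bar> * (x1 - x0)"
  proof -
    have "max (s * x0) (s * x1) - min (s * x0) (s * x1) = \<bar>s * x1 - s * x0\<bar>" by (auto simp: max_def min_def)
    also have "\<dots> = \<bar>s\<bar> * (x1 - x0)" using x by (simp add: right_diff_distrib[symmetric] abs_mult)
    finally show ?thesis using ij by (simp add: hi_def lo_def)
  qed
  finally show ?thesis .
qed

text \<open>Strip lengths add up like a geometric series of ratio 2/3: 8/3 from the outer strips and
  8 from the inner copies, which is below 12. The heights add at most 4 r per generation, hence the
  term linear in \<open>K\<close>.\<close>

lemma per_le_downset:
  assumes ij: "i \<noteq> j" and \<sigma>: "\<sigma> = 1 \<or> \<sigma> = -1" and "0 < l" "0 < r"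
  shows "per_le (indicator (downset i j \<sigma> a c K l r)) (12 * l + 4 * real K * r)"
  using assms(3-)
proof (induction K arbitrary: l r c)
  case 0
  have "downset i j \<sigma> a c 0 l r = {}" by (auto simp: downset_def)
  then show ?case using per_le_mono[OF per_le_0, of "12 * l"] 0 by simp
next
  case (Suc K)
  have s: "\<bar>3 * q * r / (16 * l)\<bar> * (l - l / 3) = q * r / 8" "\<bar>- (3 * q * r / (16 * l))\<bar> * (l - l / 3) = q * r / 8"
    using Suc.prems q_pos by (simp_all add: field_simps)
  have p4: "p * r / 4 \<ge> 0" using p_pos Suc.prems by simp
  have P: "2 * ((l - l / 3) + (p * r / 4 + q * r / 8)) \<le> 2 * (2 * l / 3 + r / 2)"
    unfolding p_eq using q_pos Suc.prems by (simp add: left_diff_distrib diff_divide_distrib)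
  have S: "per_le (indicator (strip i j \<sigma> a c' (l / 3) l m (3 * q * r / (16 * l)) (p * r / 4))) (2 * (2 * l / 3 + r / 2))"
    "per_le (indicator (strip i j \<sigma> a c' (l / 3) l m (- (3 * q * r / (16 * l))) (p * r / 4))) (2 * (2 * l / 3 + r / 2))" for c' m
    by (rule per_le_mono[OF per_le_strip[OF ij \<sigma>]]; use Suc.prems p4 P s in simp)+
  have D: "per_le (indicator (downset i j \<sigma> a c' K (l / 3) (r / 2))) (12 * (l / 3) + 4 * real K * (r / 2))" for c'
    using Suc.prems by (intro Suc.IH) auto
  show ?case unfolding downset_Suc[OF Suc.prems]
    by (rule per_le_mono[OF per_le_Un[OF per_le_Un[OF S(1) S(2)] per_le_Un[OF D D]]])
      (use Suc.prems in \<open>simp add: algebra_simps\<close>)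
qed

end

text \<open>A filling of \<open>S\<close> by a second component \<open>u\<close> that vanishes
  outside: \<open>X\<close> and \<open>Y\<close> are the indicators of the second and third phase,
  with entries -1 and 1, and \<open>\<mu>\<close> is the prescribed mean slope in the second
  coordinate. The part of \<open>S\<close> that is left over, of area at most \<open>al\<close>, is
  meant for the first phase; \<open>el\<close> bounds the elastic energy and \<open>pl\<close> the
  variation. All bounds are additive over disjoint sets, so that large constructions reduce to
  sums.\<close>

definition fillable :: "real \<Rightarrow> (real^2) set \<Rightarrow> real \<Rightarrow> real \<Rightarrow> real \<Rightarrow> bool" where
  "fillable \<mu> S al el pl \<longleftrightarrow> S \<in> sets borel \<and> 0 \<le> al \<and> 0 \<le> el \<and> (\<exists>u g X Y. u \<in> borel_measurable borel \<and>
     (\<forall>k. g k \<in> borel_measurable borel \<and> weak_deriv k u (g k)) \<and> per_le X pl \<and> per_le Y pl \<and>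
     (\<exists>B. \<forall>z. \<bar>u z\<bar> \<le> B \<and> (\<forall>k. \<bar>g k z\<bar> \<le> B) \<and> \<bar>X z\<bar> \<le> B \<and> \<bar>Y z\<bar> \<le> B) \<and>
     (AE z in lborel. X z \<in> {0,1} \<and> Y z \<in> {0,1} \<and> X z + Y z \<le> 1 \<and>
        (z \<notin> S \<longrightarrow> u z = 0 \<and> g 1 z = 0 \<and> g 2 z = 0 \<and> X z = 0 \<and> Y z = 0)) \<and>
     (\<integral>\<^sup>+z. ennreal (1 - X z - Y z) * indicator S z \<partial>lborel) \<le> ennreal al \<and>
     (\<integral>\<^sup>+z. ennreal ((g 1 z)\<^sup>2 + (\<mu> + g 2 z - (Y z - X z))\<^sup>2) * indicator S z \<partial>lborel) \<le> ennreal el)"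

lemma fillableI:
  assumes "S \<in> sets borel" "0 \<le> al" "0 \<le> el" "u \<in> borel_measurable borel"
     "\<forall>k. g k \<in> borel_measurable borel \<and> weak_deriv k u (g k)" "per_le X pl" "per_le Y pl"
     "\<forall>z. \<bar>u z\<bar> \<le> B \<and> (\<forall>k. \<bar>g k z\<bar> \<le> B) \<and> \<bar>X z\<bar> \<le> B \<and> \<bar>Y z\<bar> \<le> B"
     "AE z in lborel. X z \<in> {0,1} \<and> Y z \<in> {0,1} \<and> X z + Y z \<le> 1 \<and>
        (z \<notin> S \<longrightarrow> u z = 0 \<and> g 1 z = 0 \<and> g 2 z = 0 \<and> X z = 0 \<and> Y z = 0)"
     "(\<integral>\<^sup>+z. ennreal (1 - X z - Y z) * indicator S z \<partial>lborel) \<le> ennreal al"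
     "(\<integral>\<^sup>+z. ennreal ((g 1 z)\<^sup>2 + (\<mu> + g 2 z - (Y z - X z))\<^sup>2) * indicator S z \<partial>lborel) \<le> ennreal el"
  shows "fillable \<mu> S al el pl"
  unfolding fillable_def
  by (intro conjI assms(1-3), rule exI[of _ u], rule exI[of _ g], rule exI[of _ X], rule exI[of _ Y])
    (intro conjI assms(4-7,9-11) exI[of _ B] assms(8))

lemma fillable_empty: "fillable \<mu> {} 0 0 0"
proof -
  have "weak_deriv k (\<lambda>z. 0) (\<lambda>z. 0)" for k :: 2 by (simp add: weak_deriv_def)
  then show ?thesis
    by (intro fillableI[of _ _ _ "\<lambda>z. 0" "\<lambda>k z. 0" "\<lambda>z. 0" _ "\<lambda>z. 0" 0]) (auto intro: per_le_0)
qed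

lemma fillable_mono:
  assumes "fillable \<mu> S al el pl" "al \<le> al'" "el \<le> el'" "pl \<le> pl'" shows "fillable \<mu> S al' el' pl'"
proof -
  from assms(1) obtain u g X Y B where 0: "S \<in> sets borel" "0 \<le> al" "0 \<le> el"
    and *: "u \<in> borel_measurable borel" "\<forall>k. g k \<in> borel_measurable borel \<and> weak_deriv k u (g k)" "per_le X pl" "per_le Y pl"
     "\<forall>z. \<bar>u z\<bar> \<le> B \<and> (\<forall>k. \<bar>g k z\<bar> \<le> B) \<and> \<bar>X z\<bar> \<le> B \<and> \<bar>Y z\<bar> \<le> B"
     "AE z in lborel. X z \<in> {0,1} \<and> Y z \<in> {0,1} \<and> X z + Y z \<le> 1 \<and>
        (z \<notin> S \<longrightarrow> u z = 0 \<and> g 1 z = 0 \<and> g 2 z = 0 \<and> X z = 0 \<and> Y z = 0)"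
     "(\<integral>\<^sup>+z. ennreal (1 - X z - Y z) * indicator S z \<partial>lborel) \<le> ennreal al"
     "(\<integral>\<^sup>+z. ennreal ((g 1 z)\<^sup>2 + (\<mu> + g 2 z - (Y z - X z))\<^sup>2) * indicator S z \<partial>lborel) \<le> ennreal el"
    unfolding fillable_def by (elim conjE exE) (rule that)
  show ?thesis
  proof (rule fillableI[of _ _ _ u g X _ Y B])
    show "per_le X pl'" "per_le Y pl'" using * assms by (auto intro: per_le_mono)
    show "(\<integral>\<^sup>+z. ennreal (1 - X z - Y z) * indicator S z \<partial>lborel) \<le> ennreal al'"
      by (rule order_trans[OF *(7)]) (use assms in \<open>auto intro: ennreal_leI\<close>)
    show "(\<integral>\<^sup>+z. ennreal ((g 1 z)\<^sup>2 + (\<mu> + g 2 z - (Y z - X z))\<^sup>2) * indicator S z \<partial>lborel) \<le> ennreal el'"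
      by (rule order_trans[OF *(8)]) (use assms in \<open>auto intro: ennreal_leI\<close>)
  qed (use 0 * assms in auto)
qed

text \<open>On \<open>T - S\<close> the function \<open>u\<close> and both indicators are 0. Since
  the mean slope is 0, no elastic energy arises there, but the area counts as left over.\<close>

lemma fillable_superset:
  assumes "fillable 0 S al el pl" "AE z in lborel. z \<in> S \<longrightarrow> z \<in> T" "T \<in> sets borel" "0 \<le> b"
    "emeasure lborel (T - S) \<le> ennreal b" shows "fillable 0 T (al + b) el pl"
proof -
  from assms(1) obtain u g X Y B where 0: "S \<in> sets borel" "0 \<le> al" "0 \<le> el"
    and *: "u \<in> borel_measurable borel" "\<forall>k. g k \<in> borel_measurable borel \<and> weak_deriv k u (g k)" "per_le X pl" "per_le Y pl"
     "\<forall>z. \<bar>u z\<bar> \<le> B \<and> (\<forall>k. \<bar>g k z\<bar> \<le> B) \<and> \<bar>X z\<bar> \<le> B \<and> \<bar>Y z\<bar> \<le> B"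
     "AE z in lborel. X z \<in> {0,1} \<and> Y z \<in> {0,1} \<and> X z + Y z \<le> 1 \<and>
        (z \<notin> S \<longrightarrow> u z = 0 \<and> g 1 z = 0 \<and> g 2 z = 0 \<and> X z = 0 \<and> Y z = 0)"
     "(\<integral>\<^sup>+z. ennreal (1 - X z - Y z) * indicator S z \<partial>lborel) \<le> ennreal al"
     "(\<integral>\<^sup>+z. ennreal ((g 1 z)\<^sup>2 + (0 + g 2 z - (Y z - X z))\<^sup>2) * indicator S z \<partial>lborel) \<le> ennreal el"
    unfolding fillable_def by (elim conjE exE) (rule that)
  have m[measurable]: "X \<in> borel_measurable borel" "Y \<in> borel_measurable borel" "S \<in> sets borel" "T \<in> sets borel"
    using *(3,4) 0 assms by (auto simp: per_le_def)
  show ?thesis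
  proof (rule fillableI[of _ _ _ u g X _ Y B])
    show "AE z in lborel. X z \<in> {0,1} \<and> Y z \<in> {0,1} \<and> X z + Y z \<le> 1 \<and>
        (z \<notin> T \<longrightarrow> u z = 0 \<and> g 1 z = 0 \<and> g 2 z = 0 \<and> X z = 0 \<and> Y z = 0)"
      using *(6) assms(2) by eventually_elim blast
    have "(\<integral>\<^sup>+z. ennreal (1 - X z - Y z) * indicator T z \<partial>lborel) \<le> (\<integral>\<^sup>+z. ennreal (1 - X z - Y z) * indicator S z + indicator (T - S) z \<partial>lborel)"
      using *(6) by (intro nn_integral_mono_AE, eventually_elim) (auto simp: indicator_def)
    also have "\<dots> = (\<integral>\<^sup>+z. ennreal (1 - X z - Y z) * indicator S z \<partial>lborel) + emeasure lborel (T - S)"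
      by (subst nn_integral_add) auto
    also have "\<dots> \<le> ennreal al + ennreal b" by (intro add_mono * assms)
    finally show "(\<integral>\<^sup>+z. ennreal (1 - X z - Y z) * indicator T z \<partial>lborel) \<le> ennreal (al + b)"
      using 0 assms by (simp add: ennreal_plus)
    have "(\<integral>\<^sup>+z. ennreal ((g 1 z)\<^sup>2 + (0 + g 2 z - (Y z - X z))\<^sup>2) * indicator T z \<partial>lborel) \<le>
      (\<integral>\<^sup>+z. ennreal ((g 1 z)\<^sup>2 + (0 + g 2 z - (Y z - X z))\<^sup>2) * indicator S z \<partial>lborel)"
      using *(6) by (intro nn_integral_mono_AE, eventually_elim) (auto simp: indicator_def)
    also note *(8)
    finally show "(\<integral>\<^sup>+z. ennreal ((g 1 z)\<^sup>2 + (0 + g 2 z - (Y z - X z))\<^sup>2) * indicator T z \<partial>lborel) \<le> ennreal el" .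
  qed (use 0 * assms in auto)
qed

lemma fillable_Un:
  assumes "fillable \<mu> S al el pl" "fillable \<mu> T al' el' pl'" "S \<inter> T = {}"
  shows "fillable \<mu> (S \<union> T) (al + al') (el + el') (pl + pl')"
proof -
  from assms(1) obtain u g X Y B where 0: "S \<in> sets borel" "0 \<le> al" "0 \<le> el"
    and *: "u \<in> borel_measurable borel" "\<forall>k. g k \<in> borel_measurable borel \<and> weak_deriv k u (g k)" "per_le X pl" "per_le Y pl"
     "\<forall>z. \<bar>u z\<bar> \<le> B \<and> (\<forall>k. \<bar>g k z\<bar> \<le> B) \<and> \<bar>X z\<bar> \<le> B \<and> \<bar>Y z\<bar> \<le> B"
     "AE z in lborel. X z \<in> {0,1} \<and> Y z \<in> {0,1} \<and> X z + Y z \<le> 1 \<and>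
        (z \<notin> S \<longrightarrow> u z = 0 \<and> g 1 z = 0 \<and> g 2 z = 0 \<and> X z = 0 \<and> Y z = 0)"
     "(\<integral>\<^sup>+z. ennreal (1 - X z - Y z) * indicator S z \<partial>lborel) \<le> ennreal al"
     "(\<integral>\<^sup>+z. ennreal ((g 1 z)\<^sup>2 + (\<mu> + g 2 z - (Y z - X z))\<^sup>2) * indicator S z \<partial>lborel) \<le> ennreal el"
    unfolding fillable_def by (elim conjE exE) (rule that)
  from assms(2) obtain u' g' X' Y' B' where zt: "T \<in> sets borel" "0 \<le> al'" "0 \<le> el'"
    and st: "u' \<in> borel_measurable borel" "\<forall>k. g' k \<in> borel_measurable borel \<and> weak_deriv k u' (g' k)" "per_le X' pl'" "per_le Y' pl'"
     "\<forall>z. \<bar>u' z\<bar> \<le> B' \<and> (\<forall>k. \<bar>g' k z\<bar> \<le> B') \<and> \<bar>X' z\<bar> \<le> B' \<and> \<bar>Y' z\<bar> \<le> B'"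
     "AE z in lborel. X' z \<in> {0,1} \<and> Y' z \<in> {0,1} \<and> X' z + Y' z \<le> 1 \<and>
        (z \<notin> T \<longrightarrow> u' z = 0 \<and> g' 1 z = 0 \<and> g' 2 z = 0 \<and> X' z = 0 \<and> Y' z = 0)"
     "(\<integral>\<^sup>+z. ennreal (1 - X' z - Y' z) * indicator T z \<partial>lborel) \<le> ennreal al'"
     "(\<integral>\<^sup>+z. ennreal ((g' 1 z)\<^sup>2 + (\<mu> + g' 2 z - (Y' z - X' z))\<^sup>2) * indicator T z \<partial>lborel) \<le> ennreal el'"
    unfolding fillable_def by (elim conjE exE) (rule that)
  have m[measurable]: "X \<in> borel_measurable borel" "Y \<in> borel_measurable borel" "S \<in> sets borel"
    "X' \<in> borel_measurable borel" "Y' \<in> borel_measurable borel" "T \<in> sets borel"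
    "g k \<in> borel_measurable borel" "g' k \<in> borel_measurable borel" for k
    using * st 0 zt by (auto simp: per_le_def)
  have AE: "AE z in lborel. X z \<in> {0,1} \<and> Y z \<in> {0,1} \<and> X z + Y z \<le> 1 \<and> X' z \<in> {0,1} \<and> Y' z \<in> {0,1} \<and> X' z + Y' z \<le> 1 \<and>
        (z \<notin> S \<longrightarrow> u z = 0 \<and> g 1 z = 0 \<and> g 2 z = 0 \<and> X z = 0 \<and> Y z = 0) \<and>
        (z \<notin> T \<longrightarrow> u' z = 0 \<and> g' 1 z = 0 \<and> g' 2 z = 0 \<and> X' z = 0 \<and> Y' z = 0) \<and> (z \<notin> S \<or> z \<notin> T)"
    using *(6) st(6) by eventually_elim (use assms(3) in blast)
  show ?thesis
  proof (rule fillableI[of _ _ _ "\<lambda>z. u z + u' z" "\<lambda>k z. g k z + g' k z" "\<lambda>z. X z + X' z" _ "\<lambda>z. Y z + Y' z" "B + B'"])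
    show "\<forall>z. \<bar>u z + u' z\<bar> \<le> B + B' \<and> (\<forall>k. \<bar>g k z + g' k z\<bar> \<le> B + B') \<and> \<bar>X z + X' z\<bar> \<le> B + B' \<and> \<bar>Y z + Y' z\<bar> \<le> B + B'"
      using *(5) st(5) by (auto intro!: order_trans[OF abs_triangle_ineq] add_mono)
    show "\<forall>k. (\<lambda>z. g k z + g' k z) \<in> borel_measurable borel \<and> weak_deriv k (\<lambda>z. u z + u' z) (\<lambda>z. g k z + g' k z)"
    proof (intro allI conjI weak_deriv_add)
      fix k
      show "u \<in> L_loc 1" "g k \<in> L_loc 1" using *(1,5) m(7) by (intro L_loc_1_bounded[of _ B]; simp)+
      show "u' \<in> L_loc 1" "g' k \<in> L_loc 1" using st(1,5) m(8) by (intro L_loc_1_bounded[of _ B']; simp)+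
    qed (use * st in auto)
    show "AE z in lborel. X z + X' z \<in> {0,1} \<and> Y z + Y' z \<in> {0,1} \<and> X z + X' z + (Y z + Y' z) \<le> 1 \<and>
        (z \<notin> S \<union> T \<longrightarrow> u z + u' z = 0 \<and> g 1 z + g' 1 z = 0 \<and> g 2 z + g' 2 z = 0 \<and> X z + X' z = 0 \<and> Y z + Y' z = 0)"
      using AE
    proof eventually_elim
      case (elim z) then show ?case by (cases "z \<in> S"; cases "z \<in> T") auto
    qed
    have "(\<integral>\<^sup>+z. ennreal (1 - (X z + X' z) - (Y z + Y' z)) * indicator (S \<union> T) z \<partial>lborel) =
      (\<integral>\<^sup>+z. ennreal (1 - X z - Y z) * indicator S z + ennreal (1 - X' z - Y' z) * indicator T z \<partial>lborel)"
      using AE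
    proof (intro nn_integral_cong_AE, eventually_elim)
      case (elim z) then show ?case by (cases "z \<in> S"; cases "z \<in> T") auto
    qed
    also have "\<dots> = (\<integral>\<^sup>+z. ennreal (1 - X z - Y z) * indicator S z \<partial>lborel) + (\<integral>\<^sup>+z. ennreal (1 - X' z - Y' z) * indicator T z \<partial>lborel)"
      by (rule nn_integral_add) auto
    also have "\<dots> \<le> ennreal al + ennreal al'" by (intro add_mono * st)
    finally show "(\<integral>\<^sup>+z. ennreal (1 - (X z + X' z) - (Y z + Y' z)) * indicator (S \<union> T) z \<partial>lborel) \<le> ennreal (al + al')"
      using 0 zt by (simp add: ennreal_plus)
    have "(\<integral>\<^sup>+z. ennreal ((g 1 z + g' 1 z)\<^sup>2 + (\<mu> + (g 2 z + g' 2 z) - (Y z + Y' z - (X z + X' z)))\<^sup>2) * indicator (S \<union> T) z \<partial>lborel) =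
      (\<integral>\<^sup>+z. ennreal ((g 1 z)\<^sup>2 + (\<mu> + g 2 z - (Y z - X z))\<^sup>2) * indicator S z + ennreal ((g' 1 z)\<^sup>2 + (\<mu> + g' 2 z - (Y' z - X' z))\<^sup>2) * indicator T z \<partial>lborel)"
      using AE
    proof (intro nn_integral_cong_AE, eventually_elim)
      case (elim z) then show ?case by (cases "z \<in> S"; cases "z \<in> T") auto
    qed
    also have "\<dots> = (\<integral>\<^sup>+z. ennreal ((g 1 z)\<^sup>2 + (\<mu> + g 2 z - (Y z - X z))\<^sup>2) * indicator S z \<partial>lborel) + (\<integral>\<^sup>+z. ennreal ((g' 1 z)\<^sup>2 + (\<mu> + g' 2 z - (Y' z - X' z))\<^sup>2) * indicator T z \<partial>lborel)"
      by (rule nn_integral_add) auto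
    also have "\<dots> \<le> ennreal el + ennreal el'" by (intro add_mono * st)
    finally show "(\<integral>\<^sup>+z. ennreal ((g 1 z + g' 1 z)\<^sup>2 + (\<mu> + (g 2 z + g' 2 z) - (Y z + Y' z - (X z + X' z)))\<^sup>2) * indicator (S \<union> T) z \<partial>lborel) \<le> ennreal (el + el')"
      using 0 zt by (simp add: ennreal_plus)
  qed (use 0 zt * st in \<open>auto intro: per_le_add\<close>)
qed

text \<open>For the choice of the number of generations: linearly many make 3^(-K) quadratically
  small.\<close>

lemma square_le_three_power: "real K ^ 2 \<le> 3 ^ K"
proof (induction K)
  case (Suc K)
  consider "K = 0" | "K = 1" | "K \<ge> 2" by linarith
  then show ?case
  proof cases
    case 3
    then have "2 * real K \<le> real K * real K" by (intro mult_right_mono) auto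
    moreover have "2 * 2 \<le> real K * real K" using 3 by (intro mult_mono) auto
    moreover have "real (Suc K) ^ 2 = real K * real K + 2 * real K + 1" by (simp add: power2_eq_square algebra_simps)
    ultimately have "real (Suc K) ^ 2 \<le> 3 * real K ^ 2" unfolding power2_eq_square by linarith
    then show ?thesis using Suc by simp
  qed auto
qed simp

section \<open>Filling rectangles and slanted strips\<close>

context teeth
begin

text \<open>With mean slope \<open>1 - p\<close>, the slope \<open>p\<close> leads to 1, the third
  phase, and \<open>- q\<close> to -1, the second. About \<omega> / \<eta> generations are enough to
  make the unresolved layers, of order \<eta> \<omega> / 3^K, no larger than \<eta>^3 / \<omega>,
  and few enough that the contribution K \<eta> to the perimeter stays of order \<omega>.\<close>

lemma fillable_rect:
  assumes "0 < \<eta>" "\<eta> \<le> \<omega>"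
  shows "fillable (1 - p) (rect a \<omega> c \<eta>) 0 (32 * \<eta> ^ 3 / \<omega>) (32 * \<omega>)"
proof -
  define K where "K = nat \<lceil>\<omega> / \<eta>\<rceil>"
  have K: "\<omega> / \<eta> \<le> K" "K \<le> \<omega> / \<eta> + 1" using assms by (auto simp: K_def of_nat_ceiling)
  have K1: "K * \<eta> \<le> \<omega> + \<eta>"
  proof -
    have "K * \<eta> \<le> (\<omega> / \<eta> + 1) * \<eta>" using K assms by (intro mult_right_mono) auto
    then show ?thesis using assms by (simp add: distrib_right)
  qed
  define D where "D = downset 1 2 1 a c K (\<omega> / 2) \<eta> \<union> downset 1 2 (-1) (a + 2 * (\<omega> / 2)) c K (\<omega> / 2) \<eta>"
  let ?u = "block 1 2 a c K (\<omega> / 2) \<eta>"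
  have pos: "0 < \<omega> / 2" "0 < \<eta>" "(1::2) \<noteq> 2" using assms by auto
  obtain g where g: "\<And>k. weak_deriv k ?u (g k)" "\<And>k. g k \<in> borel_measurable borel"
    "\<And>k z. \<bar>g k z\<bar> \<le> 2 + 2 * \<eta> / (\<omega> / 2) * 2 ^ K"
    "\<And>k z. \<not> (a \<le> z $ 1 \<and> z $ 1 \<le> a + 2 * (\<omega> / 2) \<and> c \<le> z $ 2 \<and> z $ 2 < c + \<eta>) \<Longrightarrow> g k z = 0"
    "(\<integral>\<^sup>+z. ennreal ((g 1 z)\<^sup>2 + (g 2 z - (if z \<in> downset 1 2 1 a c K (\<omega> / 2) \<eta> \<union> downset 1 2 (-1) (a + 2 * (\<omega> / 2)) c K (\<omega> / 2) \<eta> then - q else p))\<^sup>2)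
       * indicator {z. a \<le> z $ 1 \<and> z $ 1 \<le> a + 2 * (\<omega> / 2) \<and> c \<le> z $ 2 \<and> z $ 2 < c + \<eta>} z \<partial>lborel)
      \<le> ennreal (2 * \<eta> * (4 * \<eta>\<^sup>2 / (\<omega> / 2) + 16 * (\<omega> / 2) / 3 ^ K))"
    by (rule nn_integral_block[OF pos(3) pos(1,2)]) blast
  have R: "rect a \<omega> c \<eta> = {z. a \<le> z $ 1 \<and> z $ 1 \<le> a + 2 * (\<omega> / 2) \<and> c \<le> z $ 2 \<and> z $ 2 < c + \<eta>}" by (simp add: rect_def)
  have DR: "D \<subseteq> rect a \<omega> c \<eta>" using assms by (auto simp: D_def downset_def rect_def)
  have [measurable]: "D \<in> sets borel" unfolding D_def by measurable
  define X Y :: "real^2 \<Rightarrow> real" where "X = indicator D" and "Y = indicator (rect a \<omega> c \<eta> - D)"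
  have pX: "per_le X (28 * \<omega>)"
  proof -
    have P: "per_le X ((12 * (\<omega> / 2) + 4 * real K * \<eta>) + (12 * (\<omega> / 2) + 4 * real K * \<eta>))"
      unfolding X_def D_def using pos by (intro per_le_Un per_le_downset) auto
    show ?thesis by (rule per_le_mono[OF P]) (use K1 assms in linarith)
  qed
  have pY: "per_le Y (32 * \<omega>)"
  proof -
    have e: "Y = (\<lambda>z. indicator (rect a \<omega> c \<eta>) z + - X z)" using DR by (intro ext) (auto simp: Y_def X_def indicator_def)
    have P: "per_le Y (2 * (\<omega> + \<eta>) + 28 * \<omega>)" unfolding e using assms by (intro per_le_add per_le_rect per_le_minus pX) auto
    show ?thesis by (rule per_le_mono[OF P]) (use assms in simp)
  qed
  show ?thesis
  proof (rule fillableI[of _ _ _ ?u g X _ Y "2 + 2 * \<eta> / (\<omega> / 2) * 2 ^ K + 2 * \<eta>"])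
    show "per_le X (32 * \<omega>)" by (rule per_le_mono[OF pX]) (use assms in simp)
    show "per_le Y (32 * \<omega>)" by (rule pY)
    have nn: "0 \<le> 2 * \<eta> / (\<omega> / 2) * 2 ^ K" using assms by simp
    show "\<forall>z. \<bar>?u z\<bar> \<le> 2 + 2 * \<eta> / (\<omega> / 2) * 2 ^ K + 2 * \<eta> \<and> (\<forall>k. \<bar>g k z\<bar> \<le> 2 + 2 * \<eta> / (\<omega> / 2) * 2 ^ K + 2 * \<eta>) \<and>
      \<bar>X z\<bar> \<le> 2 + 2 * \<eta> / (\<omega> / 2) * 2 ^ K + 2 * \<eta> \<and> \<bar>Y z\<bar> \<le> 2 + 2 * \<eta> / (\<omega> / 2) * 2 ^ K + 2 * \<eta>"
    proof (intro allI conjI)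
      fix z k
      show "\<bar>?u z\<bar> \<le> 2 + 2 * \<eta> / (\<omega> / 2) * 2 ^ K + 2 * \<eta>" using block_bound[OF pos(3) pos(1,2), of a c K z] nn by linarith
      show "\<bar>g k z\<bar> \<le> 2 + 2 * \<eta> / (\<omega> / 2) * 2 ^ K + 2 * \<eta>" using g(3)[of k z] assms by linarith
      have "\<bar>X z\<bar> \<le> 1" "\<bar>Y z\<bar> \<le> 1" by (auto simp: X_def Y_def indicator_def)
      then show "\<bar>X z\<bar> \<le> 2 + 2 * \<eta> / (\<omega> / 2) * 2 ^ K + 2 * \<eta>" "\<bar>Y z\<bar> \<le> 2 + 2 * \<eta> / (\<omega> / 2) * 2 ^ K + 2 * \<eta>" using nn assms by linarith+
    qed
    show "AE z in lborel. X z \<in> {0, 1} \<and> Y z \<in> {0, 1} \<and> X z + Y z \<le> 1 \<and>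
      (z \<notin> rect a \<omega> c \<eta> \<longrightarrow> ?u z = 0 \<and> g 1 z = 0 \<and> g 2 z = 0 \<and> X z = 0 \<and> Y z = 0)"
    proof (rule AE_I2, intro conjI impI)
      fix z assume z: "z \<notin> rect a \<omega> c \<eta>"
      show "?u z = 0" using z by (auto simp: block_def rect_def)
      show "g 1 z = 0" "g 2 z = 0" using g(4)[of z] z by (auto simp: rect_def)
      show "X z = 0" "Y z = 0" using z DR by (auto simp: X_def Y_def indicator_def)
    qed (auto simp: X_def Y_def indicator_def)
    show "(\<integral>\<^sup>+z. ennreal (1 - X z - Y z) * indicator (rect a \<omega> c \<eta>) z \<partial>lborel) \<le> ennreal 0"
    proof -
      have "(\<integral>\<^sup>+z. ennreal (1 - X z - Y z) * indicator (rect a \<omega> c \<eta>) z \<partial>lborel) = (\<integral>\<^sup>+z. 0 \<partial>(lborel :: (real^2) measure))"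
        by (intro nn_integral_cong) (auto simp: X_def Y_def indicator_def)
      then show ?thesis by simp
    qed
    have "(\<integral>\<^sup>+z. ennreal ((g 1 z)\<^sup>2 + (1 - p + g 2 z - (Y z - X z))\<^sup>2) * indicator (rect a \<omega> c \<eta>) z \<partial>lborel) =
       (\<integral>\<^sup>+z. ennreal ((g 1 z)\<^sup>2 + (g 2 z - (if z \<in> D then - q else p))\<^sup>2) * indicator (rect a \<omega> c \<eta>) z \<partial>lborel)"
    proof (rule nn_integral_cong)
      fix z
      show "ennreal ((g 1 z)\<^sup>2 + (1 - p + g 2 z - (Y z - X z))\<^sup>2) * indicator (rect a \<omega> c \<eta>) z = ennreal ((g 1 z)\<^sup>2 + (g 2 z - (if z \<in> D then - q else p))\<^sup>2) * indicator (rect a \<omega> c \<eta>) z"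
      proof (cases "z \<in> rect a \<omega> c \<eta>")
        case True
        have "1 - p + g 2 z - (Y z - X z) = g 2 z - (if z \<in> D then - q else p)" using True pq by (auto simp: X_def Y_def)
        then show ?thesis by (simp only:)
      qed simp
    qed
    also have "\<dots> \<le> ennreal (2 * \<eta> * (4 * \<eta>\<^sup>2 / (\<omega> / 2) + 16 * (\<omega> / 2) / 3 ^ K))" using g(5) unfolding R D_def .
    also have "\<dots> \<le> ennreal (32 * \<eta> ^ 3 / \<omega>)"
    proof (rule ennreal_leI)
      have "(\<omega> / \<eta>)\<^sup>2 \<le> real K ^ 2" using K assms by (intro power_mono) auto
      also have "\<dots> \<le> 3 ^ K" by (rule square_le_three_power)
      finally have "\<omega>\<^sup>2 \<le> \<eta>\<^sup>2 * 3 ^ K" using assms by (simp add: power_divide divide_le_eq mult.commute)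
      then have "\<omega> / 3 ^ K \<le> \<eta>\<^sup>2 / \<omega>" using assms by (simp add: divide_simps power2_eq_square mult_ac)
      then have "16 * \<eta> * (\<omega> / 3 ^ K) \<le> 16 * \<eta> * (\<eta>\<^sup>2 / \<omega>)" using assms by (intro mult_left_mono) auto
      moreover have "2 * \<eta> * (4 * \<eta>\<^sup>2 / (\<omega> / 2) + 16 * (\<omega> / 2) / 3 ^ K) = 16 * \<eta> * (\<eta>\<^sup>2 / \<omega>) + 16 * \<eta> * (\<omega> / 3 ^ K)"
        by (simp add: algebra_simps)
      moreover have "32 * \<eta> ^ 3 / \<omega> = 2 * (16 * \<eta> * (\<eta>\<^sup>2 / \<omega>))" by (simp add: power2_eq_square power3_eq_cube)
      ultimately show "2 * \<eta> * (4 * \<eta>\<^sup>2 / (\<omega> / 2) + 16 * (\<omega> / 2) / 3 ^ K) \<le> 32 * \<eta> ^ 3 / \<omega>" by linarith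
    qed
    finally show "(\<integral>\<^sup>+z. ennreal ((g 1 z)\<^sup>2 + (1 - p + g 2 z - (Y z - X z))\<^sup>2) * indicator (rect a \<omega> c \<eta>) z \<partial>lborel) \<le> ennreal (32 * \<eta> ^ 3 / \<omega>)" .
    show "\<forall>k. g k \<in> borel_measurable borel \<and> weak_deriv k ?u (g k)" using g by auto
  qed (use assms in auto)
qed

end

context teeth
begin

text \<open>Over a height \<open>h\<close> the section moves by |s| h \<le> w / 2, so an
  axis-parallel rectangle of width w - |s| h fits into the strip and is filled. On each line the
  part of the strip outside the rectangle has length |s| h, which gives the area h^2 |s|.\<close>

lemma fillable_short_strip:
  assumes \<sigma>: "\<sigma> = 1 \<or> \<sigma> = -1" and h: "0 < h" "x1 = x0 + h" "\<bar>s\<bar> * h \<le> w / 2" "h \<le> w / 2"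
  shows "fillable 0 (strip 2 1 \<sigma> a c x0 x1 m s w) (h\<^sup>2 * \<bar>s\<bar>) (64 * h ^ 3 / w) (32 * w)"
proof -
  define \<omega> where "\<omega> = w - \<bar>s\<bar> * h"
  define M where "M = max (s * x0) (s * x1)"
  define M' where "M' = min (s * x0) (s * x1)"
  define c' where "c' = (if \<sigma> = 1 then a + x0 else a - x1)"
  have \<omega>: "w / 2 \<le> \<omega>" "\<omega> \<le> w" "0 < w" "h \<le> \<omega>" using h by (auto simp: \<omega>_def)
  have MM: "M - M' = \<bar>s\<bar> * h"
  proof -
    have "M - M' = \<bar>s * x1 - s * x0\<bar>" by (auto simp: M_def M'_def)
    also have "\<dots> = \<bar>s\<bar> * h" using h by (simp add: right_diff_distrib[symmetric] abs_mult)
    finally show ?thesis .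
  qed
  have sX: "M' \<le> s * X" "s * X \<le> M" if "x0 \<le> X" "X \<le> x1" for X
    using that mult_left_mono[of x0 X s] mult_left_mono[of X x1 s] mult_left_mono_neg[of x0 X s] mult_left_mono_neg[of X x1 s]
    by (cases "0 \<le> s"; auto simp: M_def M'_def)+
  let ?R = "rect (c + m + M) \<omega> c' h" and ?S = "strip 2 1 \<sigma> a c x0 x1 m s w"
  \<comment> \<open>Mean slope 0 between the entries -1 and 1: both slopes have modulus 1.\<close>
  interpret T: teeth 1 1 by unfold_locales auto
  have fR: "fillable 0 ?R 0 (64 * h ^ 3 / w) (32 * w)"
  proof (rule fillable_mono[OF T.fillable_rect, simplified])
    have "1 / \<omega> \<le> 2 / w" using \<omega> by (simp add: divide_simps)
    from mult_left_mono[OF this, of "32 * h ^ 3"] show "32 * h ^ 3 / \<omega> \<le> 64 * h ^ 3 / w" using h by simp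
  qed (use h \<omega> in auto)
  have "fillable 0 ?S (0 + h\<^sup>2 * \<bar>s\<bar>) (64 * h ^ 3 / w) (32 * w)"
  proof (rule fillable_superset[OF fR])
    \<comment> \<open>Two lines are exceptional: the rectangle is closed in the first coordinate,
      and for \<open>\<sigma> = -1\<close> the half-open ends of strip and rectangle in the second
      coordinate are opposite.\<close>
    show "AE z in lborel. z \<in> ?R \<longrightarrow> z \<in> ?S"
      using AE_nth_neq[of 2 c'] AE_nth_neq[of 1 "c + m + M + \<omega>"]
    proof eventually_elim
      case (elim z)
      show ?case
      proof
        assume z: "z \<in> ?R"
        define X where "X = \<sigma> * (z $ 2 - a)"
        have X: "x0 \<le> X" "X < x1" using z elim \<sigma> h by (auto simp: X_def rect_def c'_def split: if_splits)
        have "s * X \<le> M" "M' \<le> s * X" using sX[of X] X by auto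
        then show "z \<in> ?S" using z elim X MM by (auto simp: strip_def rect_def X_def \<omega>_def)
      qed
    qed
    have "emeasure lborel (?S - ?R) = (\<integral>\<^sup>+z. indicator (?S - ?R) z \<partial>lborel)" by simp
    also have "\<dots> = (\<integral>\<^sup>+y. \<integral>\<^sup>+t. indicator (?S - ?R) (comb 2 y t) \<partial>lborel \<partial>lborel)"
      by (rule nn_integral_real2) measurable
    also have "\<dots> \<le> (\<integral>\<^sup>+y. ennreal (h * \<bar>s\<bar>) * indicator {c'..c' + h} y \<partial>lborel)"
    proof (rule nn_integral_mono_AE)
      show "AE y in lborel. (\<integral>\<^sup>+t. indicator (?S - ?R) (comb 2 y t) \<partial>lborel) \<le> ennreal (h * \<bar>s\<bar>) * indicator {c'..c' + h} y"
        using AE_lborel_singleton[of "c' + h"]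
      proof eventually_elim
        case (elim y)
        define X where "X = \<sigma> * (y - a)"
        show ?case
        proof (cases "x0 \<le> X \<and> X < x1")
          case False
          then have "comb 2 y t \<notin> ?S" for t by (auto simp: strip_def comb_def X_def)
          then show ?thesis by simp
        next
          case True
          have y: "c' \<le> y" "y < c' + h" using True \<sigma> h elim by (auto simp: X_def c'_def)
          have b: "M' \<le> s * X" "s * X \<le> M" using sX[of X] True by auto
          have "comb 2 y t \<in> ?S - ?R \<Longrightarrow> t \<in> {c + m + s * X..<c + m + M} \<union> {c + m + M + \<omega><..<c + m + s * X + w}" for t
            using y by (auto simp: strip_def rect_def comb_def X_def)
          then have "(\<integral>\<^sup>+t. indicator (?S - ?R) (comb 2 y t) \<partial>lborel) \<le> (\<integral>\<^sup>+t. indicator {c + m + s * X..<c + m + M} t + indicator {c + m + M + \<omega><..<c + m + s * X + w} t \<partial>lborel)"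
            by (intro nn_integral_mono) (auto simp: indicator_def)
          also have "\<dots> = ennreal (M - s * X) + ennreal (s * X + w - M - \<omega>)"
          proof -
            have "emeasure lborel {c + m + M + \<omega><..<c + m + s * X + w} = ennreal (s * X + w - M - \<omega>)"
              using b MM by (subst emeasure_lborel_Ioo) (auto simp: \<omega>_def algebra_simps)
            then show ?thesis using b by (subst nn_integral_add) auto
          qed
          also have "\<dots> = ennreal (h * \<bar>s\<bar>)" using b MM by (subst ennreal_plus[symmetric]) (auto simp: \<omega>_def mult.commute)
          finally show ?thesis using y by simp
        qed
      qed
    qed
    also have "\<dots> = ennreal (h * \<bar>s\<bar> * h)" using h by (subst nn_integral_cmult_indicator) (auto simp: ennreal_mult)
    finally show "emeasure lborel (?S - ?R) \<le> ennreal (h\<^sup>2 * \<bar>s\<bar>)" by (simp add: power2_eq_square mult_ac)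
  qed (use h in auto)
  then show ?thesis by simp
qed

lemma fillable_strip:
  assumes \<sigma>: "\<sigma> = 1 \<or> \<sigma> = -1" and h: "0 < h" "\<bar>s\<bar> * h \<le> w / 2" "h \<le> w / 2"
  shows "fillable 0 (strip 2 1 \<sigma> a c x0 (x0 + real n * h) m s w) (real n * (h\<^sup>2 * \<bar>s\<bar>)) (real n * (64 * h ^ 3 / w)) (real n * (32 * w))"
proof (induction n)
  case 0
  have "strip 2 1 \<sigma> a c x0 (x0 + real 0 * h) m s w = {}" by (auto simp: strip_def)
  then show ?case using fillable_empty by simp
next
  case (Suc n)
  have h': "x0 + real n * h + h = x0 + real (Suc n) * h" "0 \<le> real n * h" using h by (simp_all add: algebra_simps)
  have e: "strip 2 1 \<sigma> a c x0 (x0 + real (Suc n) * h) m s w =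
    strip 2 1 \<sigma> a c x0 (x0 + real n * h) m s w \<union> strip 2 1 \<sigma> a c (x0 + real n * h) (x0 + real (Suc n) * h) m s w"
    unfolding h'(1)[symmetric] by (auto simp: strip_def; use h'(2) h(1) in linarith)
  have F: "fillable 0 (strip 2 1 \<sigma> a c (x0 + real n * h) (x0 + real (Suc n) * h) m s w) (h\<^sup>2 * \<bar>s\<bar>) (64 * h ^ 3 / w) (32 * w)"
    by (rule fillable_short_strip[OF \<sigma> h(1) h'(1)[symmetric] h(2,3)])
  have "fillable 0 (strip 2 1 \<sigma> a c x0 (x0 + real (Suc n) * h) m s w) (real n * (h\<^sup>2 * \<bar>s\<bar>) + h\<^sup>2 * \<bar>s\<bar>)
      (real n * (64 * h ^ 3 / w) + 64 * h ^ 3 / w) (real n * (32 * w) + 32 * w)"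
    unfolding e by (rule fillable_Un[OF Suc F]) (auto simp: strip_def)
  moreover have "real (Suc n) * A = real n * A + A" for A by (simp add: algebra_simps)
  ultimately show ?case by (metis (no_types, lifting))
qed

lemma downset_pieces_disjoint:
  assumes "0 < l" "0 < r"
  shows "strip i j \<sigma> a c (l / 3) l (q * r / 16) (3 * q * r / (16 * l)) (p * r / 4) \<inter>
    strip i j \<sigma> a (c + r / 2) (l / 3) l (3 * q * r / 16) (- (3 * q * r / (16 * l))) (p * r / 4) = {}" (is ?A)
    "(strip i j \<sigma> a c (l / 3) l (q * r / 16) (3 * q * r / (16 * l)) (p * r / 4) \<union>
    strip i j \<sigma> a (c + r / 2) (l / 3) l (3 * q * r / 16) (- (3 * q * r / (16 * l))) (p * r / 4)) \<inter>
    (downset i j \<sigma> a c K (l / 3) (r / 2) \<union> downset i j \<sigma> a (c + r / 2) K (l / 3) (r / 2)) = {}"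
    "downset i j \<sigma> a c K (l / 3) (r / 2) \<inter> downset i j \<sigma> a (c + r / 2) K (l / 3) (r / 2) = {}"
proof -
  have e: "q * r / 8 * (1 + (x - l / 3) / (2 * l / 3)) = q * r / 16 + 3 * q * r / (16 * l) * x"
      "q * r / 8 * (1 - (x - l / 3) / (2 * l / 3)) = 3 * q * r / 16 - 3 * q * r / (16 * l) * x" for x
    using assms by (simp_all add: field_simps)
  have pqr: "p * r / 4 = r / 2 - q * r / 4" unfolding p_eq by (simp add: left_diff_distrib diff_divide_distrib)
  have b: "q * r / 16 + 3 * q * r / (16 * l) * x + p * r / 4 \<le> r / 2" "0 \<le> 3 * q * r / 16 - 3 * q * r / (16 * l) * x"
    if "l / 3 \<le> x" "x < l" for x
    using m_bounds[of l r x] that assms unfolding e pqr by auto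
  show ?A
  proof (rule equals0I)
    fix z assume z: "z \<in> strip i j \<sigma> a c (l / 3) l (q * r / 16) (3 * q * r / (16 * l)) (p * r / 4) \<inter>
      strip i j \<sigma> a (c + r / 2) (l / 3) l (3 * q * r / 16) (- (3 * q * r / (16 * l))) (p * r / 4)"
    have x: "l / 3 \<le> \<sigma> * (z $ i - a)" "\<sigma> * (z $ i - a) < l" using z by (auto simp: strip_def)
    have "z $ j - c < q * r / 16 + 3 * q * r / (16 * l) * (\<sigma> * (z $ i - a)) + p * r / 4"
      "3 * q * r / 16 + - (3 * q * r / (16 * l)) * (\<sigma> * (z $ i - a)) \<le> z $ j - (c + r / 2)" using z unfolding strip_def by blast+
    then show False using b[OF x] unfolding mult_minus_left by linarith
  qed
qed (auto simp: strip_def downset_def)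

text \<open>\<open>y\<close> bounds the height of the filling rectangles in the outer generation and
  is halved along with \<open>r\<close>. The two outer strips and the two inner copies contribute
  1/2 + 1/2 of the area, 344 + 172 = 516 to the elastic constant and 32 + 64 = 96 to the leading
  perimeter constant, so the three estimates reproduce themselves.\<close>

lemma fillable_downset:
  assumes \<sigma>: "\<sigma> = 1 \<or> \<sigma> = -1" and n0: "q / p \<le> real n0" and "0 < l" "0 < r" "0 < y" "y \<le> p * r / 8"
  shows "fillable 0 (downset 2 1 \<sigma> a c K l r) (r * y) (516 / p * l * y\<^sup>2 / r) (96 * l * r / y + 32 * (1 + real n0) * real K * r)"
  using assms(3-)
proof (induction K arbitrary: l r y c)
  case 0
  have "downset 2 1 \<sigma> a c 0 l r = {}" by (auto simp: downset_def)
  then show ?case using 0 p_pos by (auto intro!: fillable_mono[OF fillable_empty])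
next
  case (Suc K)
  \<comment> \<open>At least 2 l / (3 y) pieces make each of them no higher than \<open>y\<close>;
    having also at least q / p pieces limits the drift of the strip within a piece to half its
    width, as \<open>fillable_short_strip\<close> requires.\<close>
  define n where "n = nat \<lceil>2 * l / 3 / y\<rceil> + n0"
  define h where "h = 2 * l / 3 / n"
  have pos: "0 < 2 * l / 3 / y" using Suc.prems by simp
  have n: "2 * l / 3 / y \<le> n" "n \<le> 2 * l / 3 / y + 1 + n0" "q / p \<le> n"
    using pos n0 by (auto simp: n_def of_nat_ceiling) linarith+
  have n_pos: "0 < real n" using n(1) pos by linarith
  have nh: "real n * h = l - l / 3" using n_pos by (simp add: h_def)
  have hy: "0 < h" "h \<le> y"
  proof -
    show "0 < h" using Suc.prems n_pos by (simp add: h_def)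
    have "2 * l / 3 \<le> n * y" using n(1) Suc.prems by (simp add: pos_divide_le_eq)
    then show "h \<le> y" using n_pos by (simp add: h_def pos_divide_le_eq mult.commute)
  qed
  define s where "s = 3 * q * r / (16 * l)"
  have s0: "s > 0" using q_pos Suc.prems by (simp add: s_def)
  have sl: "s * (l - l / 3) = q * r / 8" using Suc.prems by (simp add: s_def field_simps)
  have sh: "s * h \<le> p * r / 4 / 2"
  proof -
    have "n * (s * h) = q * r / 8" using sl nh by (metis mult.left_commute)
    moreover have "q * r / 8 \<le> n * (p * r / 8)"
    proof -
      have "q \<le> n * p" using n(3) p_pos by (simp add: pos_divide_le_eq)
      from mult_right_mono[OF this, of "r / 8"] show ?thesis using Suc.prems by simp
    qed
    ultimately have "n * (s * h) \<le> n * (p * r / 8)" by simp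
    then show ?thesis using n_pos by simp
  qed
  have S: "fillable 0 (strip 2 1 \<sigma> a c' (l / 3) l m s' (p * r / 4)) (r * y / 4) (172 / p * l * y\<^sup>2 / r) (16 * r * (l / y + 1 + n0))"
    if "\<bar>s'\<bar> = s" for c' m s'
  proof -
    have "fillable 0 (strip 2 1 \<sigma> a c' (l / 3) (l / 3 + real n * h) m s' (p * r / 4)) (real n * (h\<^sup>2 * \<bar>s'\<bar>)) (real n * (64 * h ^ 3 / (p * r / 4))) (real n * (32 * (p * r / 4)))"
      by (rule fillable_strip[OF \<sigma>]) (use hy sh that Suc.prems in auto)
    then have "fillable 0 (strip 2 1 \<sigma> a c' (l / 3) l m s' (p * r / 4)) (real n * (h\<^sup>2 * s)) (real n * (64 * h ^ 3 / (p * r / 4))) (real n * (32 * (p * r / 4)))"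
      unfolding nh that by simp
    then show ?thesis
    proof (rule fillable_mono)
      have "real n * (h\<^sup>2 * s) = (s * (real n * h)) * h" by (simp add: power2_eq_square mult_ac)
      also have "\<dots> = q * r / 8 * h" unfolding nh sl ..
      also have "\<dots> \<le> 2 * r / 8 * y" using hy q_pos pq_less Suc.prems by (intro mult_mono) auto
      finally show "real n * (h\<^sup>2 * s) \<le> r * y / 4" by simp
      have "real n * (64 * h ^ 3 / (p * r / 4)) = 256 / (p * r) * (real n * h) * h\<^sup>2" by (simp add: power2_eq_square power3_eq_cube)
      also have "\<dots> \<le> 256 / (p * r) * (l - l / 3) * y\<^sup>2" unfolding nh using hy p_pos Suc.prems by (intro mult_left_mono power_mono) auto
      also have "\<dots> = (512 / 3) * (l * y\<^sup>2 / (p * r))" by (simp add: field_simps)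
      also have "\<dots> \<le> 172 * (l * y\<^sup>2 / (p * r))" using p_pos Suc.prems by (intro mult_right_mono) auto
      finally show "real n * (64 * h ^ 3 / (p * r / 4)) \<le> 172 / p * l * y\<^sup>2 / r" by simp
      have "real n * (32 * (p * r / 4)) \<le> (2 * l / 3 / y + 1 + n0) * (32 * (2 * r / 4))"
        using n(2) p_pos pq_less Suc.prems pos by (intro mult_mono) auto
      also have "\<dots> \<le> (l / y + 1 + n0) * (32 * (2 * r / 4))" using Suc.prems by (intro mult_right_mono add_mono divide_right_mono) auto
      finally show "real n * (32 * (p * r / 4)) \<le> 16 * r * (l / y + 1 + n0)" by (simp add: mult_ac)
    qed
  qed
  have D: "fillable 0 (downset 2 1 \<sigma> a c' K (l / 3) (r / 2)) (r / 2 * (y / 2)) (516 / p * (l / 3) * (y / 2)\<^sup>2 / (r / 2))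
     (96 * (l / 3) * (r / 2) / (y / 2) + 32 * (1 + real n0) * real K * (r / 2))" for c'
    using Suc.prems by (intro Suc.IH) auto
  have abs: "\<bar>3 * q * r / (16 * l)\<bar> = s" "\<bar>- (3 * q * r / (16 * l))\<bar> = s"
    using s0 unfolding s_def by (simp_all only: abs_minus_cancel abs_of_pos)
  note dis = downset_pieces_disjoint[OF Suc.prems(1,2)]
  have "fillable 0 (downset 2 1 \<sigma> a c (Suc K) l r) ((r * y / 4 + r * y / 4) + (r / 2 * (y / 2) + r / 2 * (y / 2)))
    ((172 / p * l * y\<^sup>2 / r + 172 / p * l * y\<^sup>2 / r) + (516 / p * (l / 3) * (y / 2)\<^sup>2 / (r / 2) + 516 / p * (l / 3) * (y / 2)\<^sup>2 / (r / 2)))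
    ((16 * r * (l / y + 1 + n0) + 16 * r * (l / y + 1 + n0)) + ((96 * (l / 3) * (r / 2) / (y / 2) + 32 * (1 + real n0) * real K * (r / 2)) + (96 * (l / 3) * (r / 2) / (y / 2) + 32 * (1 + real n0) * real K * (r / 2))))"
    unfolding downset_Suc[OF Suc.prems(1,2)]
    by (intro fillable_Un S[OF abs(1)] S[OF abs(2)] D dis)
  then show ?case
  proof (rule fillable_mono)
    show "(172 / p * l * y\<^sup>2 / r + 172 / p * l * y\<^sup>2 / r) + (516 / p * (l / 3) * (y / 2)\<^sup>2 / (r / 2) + 516 / p * (l / 3) * (y / 2)\<^sup>2 / (r / 2)) \<le> 516 / p * l * y\<^sup>2 / r"
      by (simp add: power2_eq_square field_simps)
    show "(16 * r * (l / y + 1 + n0) + 16 * r * (l / y + 1 + n0)) + ((96 * (l / 3) * (r / 2) / (y / 2) + 32 * (1 + real n0) * real K * (r / 2)) + (96 * (l / 3) * (r / 2) / (y / 2) + 32 * (1 + real n0) * real K * (r / 2)))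
      \<le> 96 * l * r / y + 32 * (1 + real n0) * real (Suc K) * r"
      by (simp add: field_simps)
  qed simp
qed

end

section \<open>Second-order laminates: columns with filled strips\<close>

definition vcolumn :: "real \<Rightarrow> real \<Rightarrow> (real^2) set" where
  "vcolumn c r = {z. 0 \<le> z $ 2 \<and> z $ 2 \<le> 1 \<and> c \<le> z $ 1 \<and> z $ 1 < c + r}"

context teeth
begin

text \<open>The second-order construction on \<open>S\<close>: a first component \<open>w\<close>
  whose slope in the first coordinate should be \<open>- q\<close> on \<open>D\<close> and
  \<open>p\<close> elsewhere, and a filling of \<open>D\<close> by the second and third phase.
  \<open>e\<close> bounds the elastic error of \<open>w\<close>; the other bounds belong to the
  filling.\<close>

definition laminate :: "(real^2) set \<Rightarrow> real \<Rightarrow> real \<Rightarrow> real \<Rightarrow> real \<Rightarrow> bool" where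
  "laminate S e al el pl \<longleftrightarrow> S \<in> sets borel \<and> 0 \<le> e \<and> (\<exists>w g D. w \<in> borel_measurable borel \<and>
     (\<forall>k. g k \<in> borel_measurable borel \<and> weak_deriv k w (g k)) \<and> (\<exists>B. \<forall>z. \<bar>w z\<bar> \<le> B \<and> (\<forall>k. \<bar>g k z\<bar> \<le> B)) \<and>
     (\<forall>z. z \<notin> S \<longrightarrow> w z = 0 \<and> (\<forall>k. g k z = 0)) \<and> D \<subseteq> S \<and> fillable 0 D al el pl \<and>
     (\<integral>\<^sup>+z. ennreal ((g 2 z)\<^sup>2 + (g 1 z - (if z \<in> D then - q else p))\<^sup>2) * indicator S z \<partial>lborel) \<le> ennreal e)"

lemma laminateI:
  assumes "S \<in> sets borel" "0 \<le> e" "w \<in> borel_measurable borel"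
     "\<forall>k. g k \<in> borel_measurable borel \<and> weak_deriv k w (g k)" "\<forall>z. \<bar>w z\<bar> \<le> B \<and> (\<forall>k. \<bar>g k z\<bar> \<le> B)"
     "\<forall>z. z \<notin> S \<longrightarrow> w z = 0 \<and> (\<forall>k. g k z = 0)" "D \<subseteq> S" "fillable 0 D al el pl"
     "(\<integral>\<^sup>+z. ennreal ((g 2 z)\<^sup>2 + (g 1 z - (if z \<in> D then - q else p))\<^sup>2) * indicator S z \<partial>lborel) \<le> ennreal e"
  shows "laminate S e al el pl"
  unfolding laminate_def
  by (intro conjI assms(1,2), rule exI[of _ w], rule exI[of _ g], rule exI[of _ D])
    (intro conjI assms(3,4,6-9) exI[of _ B] assms(5))

lemma laminate_empty: "laminate {} 0 0 0 0"
proof -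
  have "weak_deriv k (\<lambda>z. 0) (\<lambda>z. 0)" for k :: 2 by (simp add: weak_deriv_def)
  then show ?thesis
    by (intro laminateI[of _ _ "\<lambda>z. 0" "\<lambda>k z. 0" 0 "{}"]) (auto intro: fillable_empty)
qed

lemma laminate_Un:
  assumes "laminate S e al el pl" "laminate T e' al' el' pl'" "S \<inter> T = {}"
  shows "laminate (S \<union> T) (e + e') (al + al') (el + el') (pl + pl')"
proof -
  from assms(1) obtain w g D B where 0: "S \<in> sets borel" "0 \<le> e"
    and *: "w \<in> borel_measurable borel" "\<forall>k. g k \<in> borel_measurable borel \<and> weak_deriv k w (g k)" "\<forall>z. \<bar>w z\<bar> \<le> B \<and> (\<forall>k. \<bar>g k z\<bar> \<le> B)"
     "\<forall>z. z \<notin> S \<longrightarrow> w z = 0 \<and> (\<forall>k. g k z = 0)" "D \<subseteq> S" "fillable 0 D al el pl"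
     "(\<integral>\<^sup>+z. ennreal ((g 2 z)\<^sup>2 + (g 1 z - (if z \<in> D then - q else p))\<^sup>2) * indicator S z \<partial>lborel) \<le> ennreal e"
    unfolding laminate_def by (elim conjE exE) (rule that)
  from assms(2) obtain w' g' D' B' where zt: "T \<in> sets borel" "0 \<le> e'"
    and st: "w' \<in> borel_measurable borel" "\<forall>k. g' k \<in> borel_measurable borel \<and> weak_deriv k w' (g' k)" "\<forall>z. \<bar>w' z\<bar> \<le> B' \<and> (\<forall>k. \<bar>g' k z\<bar> \<le> B')"
     "\<forall>z. z \<notin> T \<longrightarrow> w' z = 0 \<and> (\<forall>k. g' k z = 0)" "D' \<subseteq> T" "fillable 0 D' al' el' pl'"
     "(\<integral>\<^sup>+z. ennreal ((g' 2 z)\<^sup>2 + (g' 1 z - (if z \<in> D' then - q else p))\<^sup>2) * indicator T z \<partial>lborel) \<le> ennreal e'"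
    unfolding laminate_def by (elim conjE exE) (rule that)
  have m[measurable]: "S \<in> sets borel" "T \<in> sets borel" "D \<in> sets borel" "D' \<in> sets borel"
    "g k \<in> borel_measurable borel" "g' k \<in> borel_measurable borel" for k
    using * st 0 zt by (auto simp: fillable_def)
  show ?thesis
  proof (rule laminateI[of _ _ "\<lambda>z. w z + w' z" "\<lambda>k z. g k z + g' k z" "B + B'" "D \<union> D'"])
    show "\<forall>z. \<bar>w z + w' z\<bar> \<le> B + B' \<and> (\<forall>k. \<bar>g k z + g' k z\<bar> \<le> B + B')"
      using *(3) st(3) by (auto intro!: order_trans[OF abs_triangle_ineq] add_mono)
    show "\<forall>k. (\<lambda>z. g k z + g' k z) \<in> borel_measurable borel \<and> weak_deriv k (\<lambda>z. w z + w' z) (\<lambda>z. g k z + g' k z)"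
    proof (intro allI conjI weak_deriv_add)
      fix k
      show "w \<in> L_loc 1" "g k \<in> L_loc 1" using *(1,3) m(5) by (intro L_loc_1_bounded[of _ B]; simp)+
      show "w' \<in> L_loc 1" "g' k \<in> L_loc 1" using st(1,3) m(6) by (intro L_loc_1_bounded[of _ B']; simp)+
    qed (use * st in auto)
    show "fillable 0 (D \<union> D') (al + al') (el + el') (pl + pl')" using * st assms(3) by (intro fillable_Un) auto
    have "(\<integral>\<^sup>+z. ennreal ((g 2 z + g' 2 z)\<^sup>2 + (g 1 z + g' 1 z - (if z \<in> D \<union> D' then - q else p))\<^sup>2) * indicator (S \<union> T) z \<partial>lborel) =
      (\<integral>\<^sup>+z. ennreal ((g 2 z)\<^sup>2 + (g 1 z - (if z \<in> D then - q else p))\<^sup>2) * indicator S z +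
        ennreal ((g' 2 z)\<^sup>2 + (g' 1 z - (if z \<in> D' then - q else p))\<^sup>2) * indicator T z \<partial>lborel)"
    proof (rule nn_integral_cong)
      fix z
      consider "z \<in> S" "z \<notin> T" | "z \<in> T" "z \<notin> S" | "z \<notin> S" "z \<notin> T" using assms(3) by blast
      then show "ennreal ((g 2 z + g' 2 z)\<^sup>2 + (g 1 z + g' 1 z - (if z \<in> D \<union> D' then - q else p))\<^sup>2) * indicator (S \<union> T) z =
        ennreal ((g 2 z)\<^sup>2 + (g 1 z - (if z \<in> D then - q else p))\<^sup>2) * indicator S z +
        ennreal ((g' 2 z)\<^sup>2 + (g' 1 z - (if z \<in> D' then - q else p))\<^sup>2) * indicator T z"
      proof cases
        case 1
        then have "z \<notin> D'" "g' 1 z = 0" "g' 2 z = 0" using st by auto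
        then show ?thesis using 1 by simp
      next
        case 2
        then have "z \<notin> D" "g 1 z = 0" "g 2 z = 0" using * by auto
        then show ?thesis using 2 by simp
      qed simp
    qed
    also have "\<dots> = (\<integral>\<^sup>+z. ennreal ((g 2 z)\<^sup>2 + (g 1 z - (if z \<in> D then - q else p))\<^sup>2) * indicator S z \<partial>lborel) +
        (\<integral>\<^sup>+z. ennreal ((g' 2 z)\<^sup>2 + (g' 1 z - (if z \<in> D' then - q else p))\<^sup>2) * indicator T z \<partial>lborel)"
      by (rule nn_integral_add) auto
    also have "\<dots> \<le> ennreal e + ennreal e'" by (intro add_mono * st)
    finally show "(\<integral>\<^sup>+z. ennreal ((g 2 z + g' 2 z)\<^sup>2 + (g 1 z + g' 1 z - (if z \<in> D \<union> D' then - q else p))\<^sup>2) * indicator (S \<union> T) z \<partial>lborel) \<le> ennreal (e + e')"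
      using 0 zt by (simp add: ennreal_plus)
  qed (use 0 zt * st in auto)
qed

lemma laminate_mono:
  assumes "laminate S e al el pl" "e \<le> e'" "al \<le> al'" "el \<le> el'" "pl \<le> pl'"
  shows "laminate S e' al' el' pl'"
proof -
  from assms(1) obtain w g D B where 0: "S \<in> sets borel" "0 \<le> e"
    and *: "w \<in> borel_measurable borel" "\<forall>k. g k \<in> borel_measurable borel \<and> weak_deriv k w (g k)" "\<forall>z. \<bar>w z\<bar> \<le> B \<and> (\<forall>k. \<bar>g k z\<bar> \<le> B)"
     "\<forall>z. z \<notin> S \<longrightarrow> w z = 0 \<and> (\<forall>k. g k z = 0)" "D \<subseteq> S" "fillable 0 D al el pl"
     "(\<integral>\<^sup>+z. ennreal ((g 2 z)\<^sup>2 + (g 1 z - (if z \<in> D then - q else p))\<^sup>2) * indicator S z \<partial>lborel) \<le> ennreal e"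
    unfolding laminate_def by (elim conjE exE) (rule that)
  show ?thesis
    by (rule laminateI[OF 0(1) _ *(1-5) fillable_mono[OF *(6) assms(3-5)] order_trans[OF *(7) ennreal_leI[OF assms(2)]]])
      (use 0 assms in auto)
qed

text \<open>The column branches towards the bottom and the top of the square, hence the half length
  1 / 2; compared with \<open>fillable_rect\<close> the axes are exchanged. The two halves double
  the constants of \<open>fillable_downset\<close> for \<open>l = 1 / 2\<close>.\<close>

lemma laminate_column:
  assumes n0: "q / p \<le> real n0" and "0 < r" "0 < y" "y \<le> p * r / 8"
  shows "laminate (vcolumn c r) (2 * r * (8 * r\<^sup>2 + 8 / 3 ^ K)) (2 * r * y) (516 / p * y\<^sup>2 / r) (96 * r / y + 64 * (1 + real n0) * real K * r)"
proof -
  have pos: "(2::2) \<noteq> 1" "(0::real) < 1 / 2" "0 < r" using assms by auto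
  let ?w = "block 2 1 0 c K (1 / 2) r"
  let ?D1 = "downset 2 1 1 0 c K (1 / 2) r" and ?D2 = "downset 2 1 (-1) (0 + 2 * (1 / 2)) c K (1 / 2) r"
  obtain g where g: "\<And>k. weak_deriv k ?w (g k)" "\<And>k. g k \<in> borel_measurable borel"
    "\<And>k z. \<bar>g k z\<bar> \<le> 2 + 2 * r / (1 / 2) * 2 ^ K"
    "\<And>k z. \<not> (0 \<le> z $ 2 \<and> z $ 2 \<le> 0 + 2 * (1 / 2) \<and> c \<le> z $ 1 \<and> z $ 1 < c + r) \<Longrightarrow> g k z = 0"
    "(\<integral>\<^sup>+z. ennreal ((g 2 z)\<^sup>2 + (g 1 z - (if z \<in> ?D1 \<union> ?D2 then - q else p))\<^sup>2)
       * indicator {z. 0 \<le> z $ 2 \<and> z $ 2 \<le> 0 + 2 * (1 / 2) \<and> c \<le> z $ 1 \<and> z $ 1 < c + r} z \<partial>lborel)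
      \<le> ennreal (2 * r * (4 * r\<^sup>2 / (1 / 2) + 16 * (1 / 2) / 3 ^ K))"
    by (rule nn_integral_block[OF pos]) blast
  have F: "fillable 0 (?D1 \<union> ?D2) (r * y + r * y) (516 / p * (1 / 2) * y\<^sup>2 / r + 516 / p * (1 / 2) * y\<^sup>2 / r)
    ((96 * (1 / 2) * r / y + 32 * (1 + real n0) * real K * r) + (96 * (1 / 2) * r / y + 32 * (1 + real n0) * real K * r))"
    by (intro fillable_Un fillable_downset n0) (use assms in \<open>auto simp: downset_def\<close>)
  have col: "vcolumn c r = {z. 0 \<le> z $ 2 \<and> z $ 2 \<le> 0 + 2 * (1 / 2) \<and> c \<le> z $ 1 \<and> z $ 1 < c + r}" by (simp add: vcolumn_def)
  show ?thesis
  proof (rule laminateI[of _ _ ?w g "2 + 2 * r / (1 / 2) * 2 ^ K + 2 * r" "?D1 \<union> ?D2"])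
    show "vcolumn c r \<in> sets borel" unfolding vcolumn_def by measurable
    show "\<forall>z. \<bar>?w z\<bar> \<le> 2 + 2 * r / (1 / 2) * 2 ^ K + 2 * r \<and> (\<forall>k. \<bar>g k z\<bar> \<le> 2 + 2 * r / (1 / 2) * 2 ^ K + 2 * r)"
    proof (intro allI conjI)
      fix z k
      have nn: "0 \<le> 2 * r / (1 / 2) * 2 ^ K" using assms by simp
      show "\<bar>?w z\<bar> \<le> 2 + 2 * r / (1 / 2) * 2 ^ K + 2 * r" using block_bound[OF pos, of 0 c K z] nn by linarith
      show "\<bar>g k z\<bar> \<le> 2 + 2 * r / (1 / 2) * 2 ^ K + 2 * r" using g(3)[of k z] assms by linarith
    qed
    show "\<forall>z. z \<notin> vcolumn c r \<longrightarrow> ?w z = 0 \<and> (\<forall>k. g k z = 0)"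
      using g(4) by (auto simp: block_def vcolumn_def)
    show "?D1 \<union> ?D2 \<subseteq> vcolumn c r" by (auto simp: downset_def vcolumn_def)
    show "fillable 0 (?D1 \<union> ?D2) (2 * r * y) (516 / p * y\<^sup>2 / r) (96 * r / y + 64 * (1 + real n0) * real K * r)"
      by (rule fillable_mono[OF F]) (simp_all add: algebra_simps)
    show "(\<integral>\<^sup>+z. ennreal ((g 2 z)\<^sup>2 + (g 1 z - (if z \<in> ?D1 \<union> ?D2 then - q else p))\<^sup>2) * indicator (vcolumn c r) z \<partial>lborel)
      \<le> ennreal (2 * r * (8 * r\<^sup>2 + 8 / 3 ^ K))" using g(5) unfolding col by simp
  qed (use g assms in auto)
qed

lemma laminate_columns:
  assumes n0: "q / p \<le> real n0" and "0 < r" "0 < y" "y \<le> p * r / 8"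
  shows "laminate (vcolumn 0 (real n * r)) (real n * (2 * r * (8 * r\<^sup>2 + 8 / 3 ^ K))) (real n * (2 * r * y)) (real n * (516 / p * y\<^sup>2 / r))
    (real n * (96 * r / y + 64 * (1 + real n0) * real K * r))"
proof (induction n)
  case 0
  have "vcolumn 0 (real 0 * r) = {}" by (auto simp: vcolumn_def)
  then show ?case using laminate_empty by simp
next
  case (Suc n)
  have nn: "0 \<le> real n * r" using assms by simp
  have e: "vcolumn 0 (real (Suc n) * r) = vcolumn 0 (real n * r) \<union> vcolumn (real n * r) r"
    by (auto simp: vcolumn_def distrib_right; use assms(2) nn in linarith)
  have A: "real (Suc n) * A = real n * A + A" for A by (simp add: algebra_simps)
  have "laminate (vcolumn 0 (real (Suc n) * r)) (real n * (2 * r * (8 * r\<^sup>2 + 8 / 3 ^ K)) + 2 * r * (8 * r\<^sup>2 + 8 / 3 ^ K))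
    (real n * (2 * r * y) + 2 * r * y) (real n * (516 / p * y\<^sup>2 / r) + 516 / p * y\<^sup>2 / r)
    (real n * (96 * r / y + 64 * (1 + real n0) * real K * r) + (96 * r / y + 64 * (1 + real n0) * real K * r))"
    unfolding e by (rule laminate_Un[OF Suc laminate_column[OF assms]]) (auto simp: vcolumn_def)
  then show ?case unfolding A .
qed

lemma fillable_rows:
  assumes "0 < \<eta>" "\<eta> \<le> 1"
  shows "fillable (1 - p) (rect 0 1 0 (real n * \<eta>)) 0 (real n * (32 * \<eta> ^ 3)) (real n * 32)"
proof (induction n)
  case 0
  have "rect 0 1 0 (real 0 * \<eta>) = {}" by (auto simp: rect_def)
  then show ?case using fillable_empty by simp
next
  case (Suc n)
  have nn: "0 \<le> real n * \<eta>" using assms by simp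
  have e: "rect 0 1 0 (real (Suc n) * \<eta>) = rect 0 1 0 (real n * \<eta>) \<union> rect 0 1 (real n * \<eta>) \<eta>"
    by (auto simp: rect_def distrib_right; use assms(1) nn in linarith)
  have A: "real (Suc n) * A = real n * A + A" for A by (simp add: algebra_simps)
  have R: "fillable (1 - p) (rect 0 1 (real n * \<eta>) \<eta>) 0 (32 * \<eta> ^ 3) 32" using fillable_rect[OF assms] by simp
  have "fillable (1 - p) (rect 0 1 0 (real (Suc n) * \<eta>)) (0 + 0) (real n * (32 * \<eta> ^ 3) + 32 * \<eta> ^ 3) (real n * 32 + 32)"
    unfolding e by (rule fillable_Un[OF Suc R]) (auto simp: rect_def)
  then show ?case unfolding A by simp
qed

end

section \<open>Assembling competitors\<close>

lemma L_loc_locally_bounded: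
  fixes f :: "'a::euclidean_space \<Rightarrow> 'b::euclidean_space"
  assumes "f \<in> borel_measurable borel" "\<And>K. compact K \<Longrightarrow> \<exists>B. \<forall>z\<in>K. norm (f z) \<le> B"
  shows "f \<in> L_loc m"
proof -
  have "set_integrable lborel K (\<lambda>x. norm (f x) ^ m)" if K: "compact K" for K
    unfolding set_integrable_def
  proof -
    obtain B where B: "\<And>z. z \<in> K \<Longrightarrow> norm (f z) \<le> B" using assms(2)[OF K] by blast
    show "integrable lborel (\<lambda>x. indicat_real K x *\<^sub>R norm (f x) ^ m)"
    proof (rule Bochner_Integration.integrable_bound)
      show "integrable lborel (\<lambda>x. B ^ m * indicator K x :: real)"
        using emeasure_compact_finite[OF K] borel_compact[OF K] by (intro integrable_mult_right integrable_real_indicator) auto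
      show "AE x in lborel. norm (indicat_real K x *\<^sub>R norm (f x) ^ m) \<le> norm (B ^ m * indicat_real K x)"
      proof (rule AE_I2)
        fix x
        show "norm (indicat_real K x *\<^sub>R norm (f x) ^ m) \<le> norm (B ^ m * indicat_real K x)"
        proof (cases "x \<in> K")
          case True
          have "norm (f x) ^ m \<le> B ^ m" using B[OF True] by (intro power_mono) auto
          moreover have "0 \<le> B ^ m" using B[OF True] norm_ge_zero[of "f x"] by (intro zero_le_power) linarith
          ultimately show ?thesis using True by simp
        qed simp
      qed
      show "(\<lambda>x. indicat_real K x *\<^sub>R norm (f x) ^ m) \<in> borel_measurable lborel"
        using assms(1) borel_compact[OF K] by auto
    qed
  qed
  then show ?thesis using assms(1) by (simp add: L_loc_def)
qed

lemma matrix_expand2: "(\<chi> k j. a k j) = (\<Sum>k\<in>UNIV. \<Sum>j\<in>UNIV. a k j *\<^sub>R (axis k (axis j 1) :: real^2^2))"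
  by (simp add: vec_eq_iff forall_2 sum_2 axis_def)

lemma vector_expand2: "(\<chi> k. a k) = (\<Sum>k\<in>UNIV. a k *\<^sub>R (axis k 1 :: real^2))"
  by (simp add: vec_eq_iff forall_2 sum_2 axis_def)

lemma norm_matrix2_square: "(norm (M :: real^2^2))\<^sup>2 = (M $ 1 $ 1)\<^sup>2 + (M $ 1 $ 2)\<^sup>2 + (M $ 2 $ 1)\<^sup>2 + (M $ 2 $ 2)\<^sup>2"
  by (simp add: power2_norm_eq_inner inner_vec_def sum_2) (simp add: power2_eq_square)

lemma phase_sum_nth:
  "(\<Sum>j=1..3. (X j :: real) *\<^sub>R well j) $ 1 $ 1 = X 1 - X 2 - X 3"
  "(\<Sum>j=1..3. (X j :: real) *\<^sub>R well j) $ 1 $ 2 = 0"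
  "(\<Sum>j=1..3. (X j :: real) *\<^sub>R well j) $ 2 $ 1 = 0"
  "(\<Sum>j=1..3. (X j :: real) *\<^sub>R well j) $ 2 $ 2 = X 3 - X 2"
proof -
  have "{1..3::nat} = {1, 2, 3}" by auto
  then have e: "(\<Sum>j=1..3. X j *\<^sub>R well j) = X 1 *\<^sub>R well 1 + (X 2 *\<^sub>R well 2 + X 3 *\<^sub>R well 3)" by simp
  show "(\<Sum>j=1..3. (X j :: real) *\<^sub>R well j) $ 1 $ 1 = X 1 - X 2 - X 3"
    "(\<Sum>j=1..3. (X j :: real) *\<^sub>R well j) $ 1 $ 2 = 0"
    "(\<Sum>j=1..3. (X j :: real) *\<^sub>R well j) $ 2 $ 1 = 0"
    "(\<Sum>j=1..3. (X j :: real) *\<^sub>R well j) $ 2 $ 2 = X 3 - X 2"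
    unfolding e by (simp_all add: well_def vector_2)
qed

text \<open>The energy refers to an arbitrarily chosen weak gradient. Two weak gradients have the
  same integrals against every test function, so their entries agree almost everywhere and an
  explicit one may be inserted.\<close>

lemma weak_gradient_AE_eq:
  fixes u :: "real^2 \<Rightarrow> real^2"
  assumes "has_weak_gradient u G"
  shows "AE z in lborel. weak_gradient u z = G z"
proof -
  have W: "has_weak_gradient u (weak_gradient u)" unfolding weak_gradient_def by (rule someI[of "has_weak_gradient u", OF assms])
  have comp: "(\<lambda>z. H z $ k $ j) \<in> L_loc 1" if "H \<in> L_loc 1" for H :: "real^2 \<Rightarrow> real^2^2" and k j
  proof -
    have Hm: "H \<in> borel_measurable borel" using that by (simp add: L_loc_def)
    have m: "(\<lambda>z. H z $ k $ j) \<in> borel_measurable borel"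
    proof -
      have "continuous_on UNIV (\<lambda>M::real^2^2. M $ k $ j)" by (intro continuous_intros)
      then show ?thesis using Hm by (intro measurable_compose[OF Hm borel_measurable_continuous_onI])
    qed
    have "set_integrable lborel K (\<lambda>x. norm (H x $ k $ j) ^ 1)" if K: "compact K" for K
    proof -
      have i: "set_integrable lborel K (\<lambda>x. norm (H x) ^ 1)" using \<open>H \<in> L_loc 1\<close> K by (simp add: L_loc_def)
      show ?thesis
        using i unfolding set_integrable_def
      proof (rule Bochner_Integration.integrable_bound)
        show "(\<lambda>x. indicat_real K x *\<^sub>R norm (H x $ k $ j) ^ 1) \<in> borel_measurable lborel"
          using m borel_compact[OF K] by auto
        show "AE x in lborel. norm (indicat_real K x *\<^sub>R norm (H x $ k $ j) ^ 1) \<le> norm (indicat_real K x *\<^sub>R norm (H x) ^ 1)"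
        proof (rule AE_I2)
          fix x
          have "\<bar>H x $ k $ j\<bar> \<le> norm (H x $ k)" using component_le_norm_cart[of "H x $ k" j] by simp
          also have "\<dots> \<le> norm (H x)" by (rule Finite_Cartesian_Product.norm_nth_le)
          finally show "norm (indicat_real K x *\<^sub>R norm (H x $ k $ j) ^ 1) \<le> norm (indicat_real K x *\<^sub>R norm (H x) ^ 1)"
            by (auto simp: indicator_def)
        qed
      qed
    qed
    then show ?thesis using m by (simp add: L_loc_def)
  qed
  have L: "weak_gradient u \<in> L_loc 1" "G \<in> L_loc 1" using W assms by (auto simp: has_weak_gradient_def)
  have "AE z in lborel. weak_gradient u z $ k $ j - G z $ k $ j = 0" for k j
  proof (rule AE_zero_if_test_zero)
    have "(\<lambda>z. weak_gradient u z $ k $ j) \<in> L_loc 1" "(\<lambda>z. G z $ k $ j) \<in> L_loc 1" using L comp by blast+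
    note C = this
    have m: "(\<lambda>z. weak_gradient u z $ k $ j) \<in> borel_measurable borel" "(\<lambda>z. G z $ k $ j) \<in> borel_measurable borel" using C by (auto simp: L_loc_def)
    show "(\<lambda>z. weak_gradient u z $ k $ j - G z $ k $ j) \<in> L_loc 1"
    proof -
      have "set_integrable lborel K (\<lambda>x. norm (weak_gradient u x $ k $ j - G x $ k $ j) ^ 1)" if K: "compact K" for K
      proof -
        have "set_integrable lborel K (\<lambda>x. norm (weak_gradient u x $ k $ j) ^ 1)" "set_integrable lborel K (\<lambda>x. norm (G x $ k $ j) ^ 1)"
          using C K by (auto simp: L_loc_def)
        then have i: "integrable lborel (\<lambda>x. indicat_real K x *\<^sub>R norm (weak_gradient u x $ k $ j) ^ 1 + indicat_real K x *\<^sub>R norm (G x $ k $ j) ^ 1)"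
          unfolding set_integrable_def by (rule Bochner_Integration.integrable_add)
        show ?thesis unfolding set_integrable_def
        proof (rule Bochner_Integration.integrable_bound[OF i])
          show "(\<lambda>x. indicat_real K x *\<^sub>R norm (weak_gradient u x $ k $ j - G x $ k $ j) ^ 1) \<in> borel_measurable lborel"
            using m borel_compact[OF K] by auto
          show "AE x in lborel. norm (indicat_real K x *\<^sub>R norm (weak_gradient u x $ k $ j - G x $ k $ j) ^ 1)
            \<le> norm (indicat_real K x *\<^sub>R norm (weak_gradient u x $ k $ j) ^ 1 + indicat_real K x *\<^sub>R norm (G x $ k $ j) ^ 1)"
            by (intro AE_I2) (auto simp: indicator_def)
        qed
      qed
      then show ?thesis using m by (simp add: L_loc_def)
    qed
    fix \<phi> :: "real^2 \<Rightarrow> real" assume phi: "\<phi> \<in> C1_compact UNIV"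
    have "- (LINT x|lborel. weak_gradient u x $ k $ j * \<phi> x) = - (LINT x|lborel. G x $ k $ j * \<phi> x)"
      using W[unfolded has_weak_gradient_def, THEN conjunct2, THEN conjunct2, rule_format, OF phi, of k j]
        assms[unfolded has_weak_gradient_def, THEN conjunct2, THEN conjunct2, rule_format, OF phi, of k j] by simp
    then show "(LINT x|lborel. (weak_gradient u x $ k $ j - G x $ k $ j) * \<phi> x) = 0"
      using C1_compact_integrable_mult(1)[OF C(1) phi] C1_compact_integrable_mult(1)[OF C(2) phi]
      by (simp add: left_diff_distrib)
  qed
  then have "AE z in lborel. \<forall>k j. weak_gradient u z $ k $ j - G z $ k $ j = 0" by (simp add: AE_all_countable)
  then show ?thesis by eventually_elim (simp add: vec_eq_iff)
qed

lemma weak_deriv_linear: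
  fixes F :: "real^2^2"
  shows "weak_deriv j (\<lambda>z. (F *v z) $ k) (\<lambda>z. F $ k $ j)" "(\<lambda>z. (F *v z) $ k) \<in> L_loc 1"
proof -
  have c: "continuous_on UNIV (\<lambda>z::real^2. (F *v z) $ k)" by (intro continuous_intros linear_continuous_on matrix_vector_mul_bounded_linear)
  show L: "(\<lambda>z. (F *v z) $ k) \<in> L_loc 1"
  proof (rule L_loc_locally_bounded)
    show "(\<lambda>z. (F *v z) $ k) \<in> borel_measurable borel" using c by (rule borel_measurable_continuous_onI)
    fix K :: "(real^2) set" assume "compact K"
    then have "bounded ((\<lambda>z. (F *v z) $ k) ` K)" using c by (intro compact_imp_bounded compact_continuous_image) (auto intro: continuous_on_subset)
    then show "\<exists>B. \<forall>z\<in>K. norm ((F *v z) $ k) \<le> B" by (auto simp: bounded_iff)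
  qed
  have d: "diffq j n (\<lambda>z. (F *v z) $ k) z = F $ k $ j" for n z
  proof -
    have "axis j (1 / real (Suc n)) = (1 / real (Suc n)) *\<^sub>R (axis j 1 :: real^2)" by (simp add: axis_def vec_eq_iff)
    then have "(F *v (z + axis j (1 / real (Suc n)))) $ k = (F *v z) $ k + (1 / real (Suc n)) * (F *v axis j 1) $ k"
      by (simp only: matrix_vector_right_distrib vector_add_component matrix_vector_mult_scaleR vector_scaleR_component real_scaleR_def)
    moreover have "(F *v axis j 1) $ k = F $ k $ j" by (simp add: matrix_vector_mul_component inner_axis)
    ultimately show ?thesis unfolding diffq_def by (simp del: of_nat_Suc)
  qed
  show "weak_deriv j (\<lambda>z. (F *v z) $ k) (\<lambda>z. F $ k $ j)"
    by (rule weak_deriv_diffq[OF L, of _ _ "\<bar>F $ k $ j\<bar>"]) (simp_all add: d)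
qed

text \<open>The interface for both upper bounds: \<open>w\<close> is the deviation from the affine
  map, \<open>g\<close> its gradient, and \<open>X1\<close>, \<open>X2\<close>, \<open>X3\<close>
  are the phases. The factor 2 in front of the perimeters is the dimension in
  \<open>total_variation_le\<close>.\<close>

lemma min_energy_le:
  fixes F :: "real^2^2" and w :: "2 \<Rightarrow> real^2 \<Rightarrow> real" and g :: "2 \<Rightarrow> 2 \<Rightarrow> real^2 \<Rightarrow> real"
  assumes w: "\<And>k. w k \<in> borel_measurable borel" "\<And>k z. \<bar>w k z\<bar> \<le> B"
    and g: "\<And>k j. g k j \<in> borel_measurable borel" "\<And>k j z. \<bar>g k j z\<bar> \<le> B" "\<And>k j. weak_deriv j (w k) (g k j)"
    and w0: "AE z in lborel. z \<notin> Omega \<longrightarrow> (\<forall>k. w k z = 0)"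
    and per: "per_le X1 P1" "per_le X2 P2" "per_le X3 P3" and XB: "\<And>z. \<bar>X1 z\<bar> \<le> B \<and> \<bar>X2 z\<bar> \<le> B \<and> \<bar>X3 z\<bar> \<le> B"
    and X: "AE z in lborel. z \<in> box 0 1 \<longrightarrow> X1 z \<in> {0,1} \<and> X2 z \<in> {0,1} \<and> X3 z \<in> {0,1} \<and> X1 z + X2 z + X3 z = 1"
    and E: "(\<integral>\<^sup>+z. ennreal ((F $ 1 $ 1 + g 1 1 z - (X1 z - X2 z - X3 z))\<^sup>2 + (F $ 1 $ 2 + g 1 2 z)\<^sup>2 +
       (F $ 2 $ 1 + g 2 1 z)\<^sup>2 + (F $ 2 $ 2 + g 2 2 z - (X3 z - X2 z))\<^sup>2) * indicator Omega z \<partial>lborel) \<le> ennreal e"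
    and eps: "0 \<le> \<epsilon>" and e0: "0 \<le> e"
  shows "min_energy \<epsilon> F \<le> ennreal (e + \<epsilon> * (2 * (P1 + P2 + P3)))"
proof -
  define u where "u z = F *v z + (\<chi> k. w k z)" for z
  define G where "G z = F + (\<chi> k j. g k j z)" for z
  define X where "X n = (if n = 1 then X1 else if n = 2 then X2 else X3)" for n :: nat
  have um: "u \<in> borel_measurable borel"
  proof -
    have "(\<lambda>z. F *v z) \<in> borel_measurable borel" by (intro borel_measurable_continuous_onI linear_continuous_on matrix_vector_mul_bounded_linear)
    then show ?thesis unfolding u_def vector_expand2 using w(1) by measurable
  qed
  have Gm: "G \<in> borel_measurable borel" unfolding G_def matrix_expand2 using g(1) by measurable
  have vB: "norm (\<chi> k. w k z) \<le> B + B" for z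
  proof -
    have "norm (\<chi> k. w k z) \<le> (\<Sum>k\<in>UNIV. \<bar>(\<chi> k. w k z) $ k\<bar>)" by (rule norm_le_l1_cart)
    also have "\<dots> \<le> B + B" using w(2)[of 1 z] w(2)[of 2 z] by (simp add: sum_2)
    finally show ?thesis .
  qed
  have GB: "norm (G z) \<le> norm F + 4 * B" for z
  proof -
    have "norm (\<chi> k j. g k j z) \<le> (\<Sum>k\<in>UNIV. \<Sum>j\<in>UNIV. norm (g k j z *\<^sub>R (axis k (axis j 1) :: real^2^2)))"
      unfolding matrix_expand2 by (intro order_trans[OF norm_sum] sum_mono order_refl)
    also have "\<dots> = (\<Sum>k\<in>UNIV. \<Sum>j\<in>UNIV. \<bar>g k j z\<bar>)" by (simp add: norm_eq_sqrt_inner inner_axis)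
    also have "\<dots> \<le> 4 * B" using g(2)[of 1 1 z] g(2)[of 1 2 z] g(2)[of 2 1 z] g(2)[of 2 2 z] by (simp add: sum_2)
    finally show ?thesis unfolding G_def by (intro order_trans[OF norm_triangle_ineq]) simp
  qed
  have uL: "u \<in> L_loc m" for m
  proof (rule L_loc_locally_bounded[OF um])
    fix K :: "(real^2) set" assume K: "compact K"
    have "continuous_on K (\<lambda>z. F *v z)" by (intro linear_continuous_on matrix_vector_mul_bounded_linear)
    then have "bounded ((\<lambda>z. F *v z) ` K)" using K by (intro compact_imp_bounded compact_continuous_image)
    then obtain C where C: "\<And>z. z \<in> K \<Longrightarrow> norm (F *v z) \<le> C" by (auto simp: bounded_iff)
    have "norm (u z) \<le> C + (B + B)" if "z \<in> K" for z
      unfolding u_def by (rule order_trans[OF norm_triangle_ineq add_mono[OF C[OF that] vB]])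
    then show "\<exists>B. \<forall>z\<in>K. norm (u z) \<le> B" by blast
  qed
  have GL: "G \<in> L_loc m" for m using GB by (intro L_loc_locally_bounded[OF Gm]) blast
  have wL: "w k \<in> L_loc 1" "g k j \<in> L_loc 1" for k j using w g by (intro L_loc_1_bounded[of _ B]; blast)+
  have cL: "(\<lambda>z::real^2. F $ k $ j) \<in> L_loc 1" for k j by (rule L_loc_1_bounded[of _ "\<bar>F $ k $ j\<bar>"]) auto
  have W: "has_weak_gradient u G" unfolding has_weak_gradient_def
  proof (intro conjI uL GL ballI allI)
    fix \<phi> :: "real^2 \<Rightarrow> real" and k j assume phi: "\<phi> \<in> C1_compact UNIV"
    have "weak_deriv j (\<lambda>z. (F *v z) $ k + w k z) (\<lambda>z. F $ k $ j + g k j z)"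
      by (intro weak_deriv_add weak_deriv_linear g wL cL)
    then show "(LINT x|lborel. u x $ k * partial_deriv j \<phi> x) = - (LINT x|lborel. G x $ k $ j * \<phi> x)"
      using phi by (simp add: weak_deriv_def u_def G_def)
  qed
  have uA: "u \<in> admissible F" unfolding admissible_def W12_loc_def
  proof (intro CollectI conjI exI[of _ 0])
    show "AE x in lborel. x \<notin> Omega \<longrightarrow> u x = F *v x + 0"
      using w0 by eventually_elim (auto simp: u_def vec_eq_iff)
  qed (use uL GL W in auto)
  have TV: "total_variation (box 0 1) X1 \<le> ennreal (2 * P1)" "total_variation (box 0 1) X2 \<le> ennreal (2 * P2)" "total_variation (box 0 1) X3 \<le> ennreal (2 * P3)"
    using total_variation_le[OF per(1), of B] total_variation_le[OF per(2), of B] total_variation_le[OF per(3), of B] XB by auto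
  have P0: "0 \<le> P1" "0 \<le> P2" "0 \<le> P3" using per by (auto simp: per_le_def)
  have int: "set_integrable lborel (box 0 1) f" if f: "f \<in> borel_measurable borel" "\<And>z. \<bar>f z\<bar> \<le> B" for f :: "real^2 \<Rightarrow> real"
    unfolding set_integrable_def
  proof (rule Bochner_Integration.integrable_bound)
    show "integrable lborel (\<lambda>x. B * indicator (box 0 1 :: (real^2) set) x :: real)"
      using emeasure_lborel_box_finite by (intro integrable_mult_right integrable_real_indicator) auto
    show "AE x in lborel. norm (indicat_real (box 0 1) x *\<^sub>R f x) \<le> norm (B * indicat_real (box 0 1) x)"
      using order_trans[OF f(2) abs_ge_self] by (intro AE_I2) (auto simp: indicator_def)
  qed (use f in auto)
  have BV: "X1 \<in> BV (box 0 1)" "X2 \<in> BV (box 0 1)" "X3 \<in> BV (box 0 1)"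
    unfolding BV_def using TV per XB by (auto simp: per_le_def intro!: int intro: le_less_trans)
  have XP: "X \<in> phases" unfolding phases_def
  proof (intro CollectI conjI ballI)
    fix j :: nat assume "j \<in> {1..3}"
    show "X j \<in> BV (box 0 1)" using BV by (auto simp: X_def)
    show "AE x in lborel. x \<in> box 0 1 \<longrightarrow> X j x \<in> {0, 1}" using X by eventually_elim (auto simp: X_def)
  next
    show "AE x in lborel. x \<in> box 0 1 \<longrightarrow> X 1 x + X 2 x + X 3 x = 1" using X by eventually_elim (simp add: X_def)
  qed
  have X123: "X 1 = X1" "X 2 = X2" "X 3 = X3" by (simp_all add: X_def)
  have "(\<integral>\<^sup>+x\<in>Omega. ennreal ((norm (weak_gradient u x - (\<Sum>j=1..3. X j x *\<^sub>R well j)))\<^sup>2) \<partial>lborel) =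
    (\<integral>\<^sup>+z. ennreal ((F $ 1 $ 1 + g 1 1 z - (X1 z - X2 z - X3 z))\<^sup>2 + (F $ 1 $ 2 + g 1 2 z)\<^sup>2 +
       (F $ 2 $ 1 + g 2 1 z)\<^sup>2 + (F $ 2 $ 2 + g 2 2 z - (X3 z - X2 z))\<^sup>2) * indicator Omega z \<partial>lborel)"
    using weak_gradient_AE_eq[OF W]
    by (intro nn_integral_cong_AE, eventually_elim)
      (simp only: norm_matrix2_square vector_minus_component phase_sum_nth X123 G_def vector_add_component vec_lambda_beta diff_0_right)
  also note E
  finally have E': "(\<integral>\<^sup>+x\<in>Omega. ennreal ((norm (weak_gradient u x - (\<Sum>j=1..3. X j x *\<^sub>R well j)))\<^sup>2) \<partial>lborel) \<le> ennreal e" .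
  have "{1..3::nat} = {1, 2, 3}" by auto
  then have "(\<Sum>j=1..3. total_variation (box 0 1) (X j)) = total_variation (box 0 1) X1 + (total_variation (box 0 1) X2 + total_variation (box 0 1) X3)"
    by (simp add: X_def)
  also have "\<dots> \<le> ennreal (2 * P1) + (ennreal (2 * P2) + ennreal (2 * P3))" by (intro add_mono TV)
  also have "\<dots> = ennreal (2 * (P1 + P2 + P3))" using P0 by (simp flip: ennreal_plus)
  finally have T: "ennreal \<epsilon> * (\<Sum>j=1..3. total_variation (box 0 1) (X j)) \<le> ennreal \<epsilon> * ennreal (2 * (P1 + P2 + P3))" by (intro mult_left_mono) auto
  have "min_energy \<epsilon> F \<le> energy \<epsilon> u X" unfolding min_energy_def
    by (rule order_trans[OF INF_lower[OF XP] INF_lower[OF uA]])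
  also have "\<dots> \<le> ennreal e + ennreal \<epsilon> * ennreal (2 * (P1 + P2 + P3))" unfolding energy_def by (rule add_mono[OF E' T])
  also have "\<dots> = ennreal (e + \<epsilon> * (2 * (P1 + P2 + P3)))" using eps e0 P0 by (simp add: ennreal_mult ennreal_plus)
  finally show ?thesis .
qed

lemma AE_Omega_rect: "AE z in lborel. z \<in> Omega \<longleftrightarrow> z \<in> rect 0 1 0 1"
  using AE_nth_neq[of 2 1] by eventually_elim (auto simp: Omega_def rect_def mem_box_cart forall_2 less_le)

lemma box_subset_rect: "box 0 1 \<subseteq> rect 0 1 0 1"
  by (auto simp: rect_def mem_box_cart forall_2 less_imp_le)

lemma nat_ceiling_powr:
  fixes \<epsilon> a :: real
  assumes "0 < \<epsilon>" "\<epsilon> < 1" "0 < a"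
  shows "1 \<le> real (nat \<lceil>\<epsilon> powr (- a)\<rceil>)" "\<epsilon> powr (- a) \<le> real (nat \<lceil>\<epsilon> powr (- a)\<rceil>)" "real (nat \<lceil>\<epsilon> powr (- a)\<rceil>) \<le> 2 * \<epsilon> powr (- a)"
proof -
  have 1: "1 \<le> \<epsilon> powr (- a)" using powr_mono_both'[of "-a" 0 \<epsilon> \<epsilon>] assms powr_le1[of a \<epsilon>] by (simp add: powr_minus one_le_inverse_iff)
  have e: "real (nat \<lceil>\<epsilon> powr (- a)\<rceil>) = of_int \<lceil>\<epsilon> powr (- a)\<rceil>" using 1 by simp
  show "1 \<le> real (nat \<lceil>\<epsilon> powr (- a)\<rceil>)" "\<epsilon> powr (- a) \<le> real (nat \<lceil>\<epsilon> powr (- a)\<rceil>)" "real (nat \<lceil>\<epsilon> powr (- a)\<rceil>) \<le> 2 * \<epsilon> powr (- a)"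
    unfolding e using 1 by linarith+
qed

text \<open>\<open>N\<close> rows of height 1 / N have elastic energy at most 32 / N^2 and surface
  energy of order \<epsilon> N, which are balanced for N of order \<epsilon>^(-1/3). The first
  component stays affine, since F_11 = -1 is already the entry of the second and third well.\<close>

lemma upper_bound_first_order:
  fixes F :: "real^2^2"
  assumes F: "F $ 1 $ 1 = -1" "F $ 1 $ 2 = 0" "F $ 2 $ 1 = 0" "F $ 2 $ 2 = \<mu>" and \<mu>: "\<bar>\<mu>\<bar> < 1" and \<epsilon>: "0 < \<epsilon>" "\<epsilon> < 1"
  shows "min_energy \<epsilon> F \<le> ennreal (560 * \<epsilon> powr (2/3))"
proof -
  interpret T: teeth "1 - \<mu>" "1 + \<mu>" using \<mu> by unfold_locales auto
  define N where "N = nat \<lceil>\<epsilon> powr (- (1/3))\<rceil>"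
  have N: "1 \<le> real N" "\<epsilon> powr (- (1/3)) \<le> real N" "real N \<le> 2 * \<epsilon> powr (- (1/3))"
    unfolding N_def using nat_ceiling_powr[OF \<epsilon>, of "1/3"] by auto
  have N0: "0 < 1 / real N" "1 / real N \<le> 1" using N(1) by auto
  have "fillable \<mu> (rect 0 1 0 1) 0 (real N * (32 * (1 / real N) ^ 3)) (real N * 32)"
    using T.fillable_rows[OF N0, of N] N(1) by simp
  then obtain u g X Y B where *: "u \<in> borel_measurable borel" "\<forall>k. g k \<in> borel_measurable borel \<and> weak_deriv k u (g k)" "per_le X (real N * 32)" "per_le Y (real N * 32)"
     "\<forall>z. \<bar>u z\<bar> \<le> B \<and> (\<forall>k. \<bar>g k z\<bar> \<le> B) \<and> \<bar>X z\<bar> \<le> B \<and> \<bar>Y z\<bar> \<le> B"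
     "AE z in lborel. X z \<in> {0,1} \<and> Y z \<in> {0,1} \<and> X z + Y z \<le> 1 \<and>
        (z \<notin> rect 0 1 0 1 \<longrightarrow> u z = 0 \<and> g 1 z = 0 \<and> g 2 z = 0 \<and> X z = 0 \<and> Y z = 0)"
     "(\<integral>\<^sup>+z. ennreal (1 - X z - Y z) * indicator (rect 0 1 0 1) z \<partial>lborel) \<le> ennreal 0"
     "(\<integral>\<^sup>+z. ennreal ((g 1 z)\<^sup>2 + (\<mu> + g 2 z - (Y z - X z))\<^sup>2) * indicator (rect 0 1 0 1) z \<partial>lborel) \<le> ennreal (real N * (32 * (1 / real N) ^ 3))"
    unfolding fillable_def by (elim conjE exE) (rule that)
  have m[measurable]: "X \<in> borel_measurable borel" "Y \<in> borel_measurable borel" using *(3,4) by (auto simp: per_le_def)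
  define X1 where "X1 z = indicator (rect 0 1 0 1) z + (- X z + - Y z)" for z
  \<comment> \<open>The leftover area is 0, so the first phase is absent up to a null set.\<close>
  have full: "AE z in lborel. z \<in> rect 0 1 0 1 \<longrightarrow> X z + Y z = 1"
  proof -
    have "(\<integral>\<^sup>+z. ennreal (1 - X z - Y z) * indicator (rect 0 1 0 1) z \<partial>lborel) = 0" using *(7) by simp
    then have "AE z in lborel. ennreal (1 - X z - Y z) * indicator (rect 0 1 0 1) z = 0" by (subst (asm) nn_integral_0_iff_AE) auto
    then show ?thesis using *(6) by eventually_elim (auto simp: indicator_def ennreal_eq_0_iff)
  qed
  have N3: "real N * (32 * (1 / real N) ^ 3) = 32 * (1 / real N)\<^sup>2" using N(1) by (simp add: power2_eq_square power3_eq_cube)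
  have B0: "0 \<le> B" using *(5) by (meson abs_ge_zero order_trans)
  have "min_energy \<epsilon> F \<le> ennreal (real N * (32 * (1 / real N) ^ 3) + \<epsilon> * (2 * ((2 * (1 + 1) + (real N * 32 + real N * 32)) + real N * 32 + real N * 32)))"
  proof (rule min_energy_le[of "\<lambda>k. if k = 1 then (\<lambda>z. 0) else u" "1 + B + B" "\<lambda>k j. if k = 1 then (\<lambda>z. 0) else g j"])
    show "per_le X1 (2 * (1 + 1) + (real N * 32 + real N * 32))" unfolding X1_def[abs_def]
      using * by (intro per_le_add per_le_rect per_le_minus) auto
    show "AE z in lborel. z \<notin> Omega \<longrightarrow> (\<forall>k. (if k = 1 then (\<lambda>z. 0) else u) z = 0)"
      using AE_Omega_rect *(6) by eventually_elim auto
    show "AE z in lborel. z \<in> box 0 1 \<longrightarrow> X1 z \<in> {0,1} \<and> X z \<in> {0,1} \<and> Y z \<in> {0,1} \<and> X1 z + X z + Y z = 1"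
      using *(6) full by eventually_elim (use box_subset_rect in \<open>auto simp: X1_def\<close>)
    show "\<bar>X1 z\<bar> \<le> 1 + B + B \<and> \<bar>X z\<bar> \<le> 1 + B + B \<and> \<bar>Y z\<bar> \<le> 1 + B + B" for z
    proof -
      have "\<bar>X z\<bar> \<le> B" "\<bar>Y z\<bar> \<le> B" using *(5) by auto
      moreover have "\<bar>indicator (rect 0 1 0 1) z :: real\<bar> \<le> 1" by (auto simp: indicator_def)
      ultimately show ?thesis unfolding X1_def by linarith
    qed
    show "\<bar>(if k = 1 then (\<lambda>z. 0) else u) z\<bar> \<le> 1 + B + B" for k :: 2 and z using *(5)[rule_format, of z] B0 by auto
    show "\<bar>(if k = 1 then (\<lambda>z. 0) else g j) z\<bar> \<le> 1 + B + B" for k j :: 2 and z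
    proof -
      have "\<bar>g j z\<bar> \<le> B" using *(5) by blast
      then show ?thesis using B0 by auto
    qed
    have "(\<integral>\<^sup>+z. ennreal ((F $ 1 $ 1 + (if (1::2) = 1 then (\<lambda>z. 0) else g 1) z - (X1 z - X z - Y z))\<^sup>2 + (F $ 1 $ 2 + (if (1::2) = 1 then (\<lambda>z. 0) else g 2) z)\<^sup>2 +
       (F $ 2 $ 1 + (if (2::2) = 1 then (\<lambda>z. 0) else g 1) z)\<^sup>2 + (F $ 2 $ 2 + (if (2::2) = 1 then (\<lambda>z. 0) else g 2) z - (Y z - X z))\<^sup>2) * indicator Omega z \<partial>lborel)
      = (\<integral>\<^sup>+z. ennreal ((g 1 z)\<^sup>2 + (\<mu> + g 2 z - (Y z - X z))\<^sup>2) * indicator (rect 0 1 0 1) z \<partial>lborel)"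
      using AE_Omega_rect full
    proof (intro nn_integral_cong_AE, eventually_elim)
      case (elim z)
      show ?case
      proof (cases "z \<in> rect 0 1 0 1")
        case True
        then have "X1 z - X z - Y z = -1" using elim by (simp add: X1_def)
        then show ?thesis using True elim by (simp add: F)
      next
        case False
        then show ?thesis using elim by simp
      qed
    qed
    also note *(8)
    finally show "(\<integral>\<^sup>+z. ennreal ((F $ 1 $ 1 + (if (1::2) = 1 then (\<lambda>z. 0) else g 1) z - (X1 z - X z - Y z))\<^sup>2 + (F $ 1 $ 2 + (if (1::2) = 1 then (\<lambda>z. 0) else g 2) z)\<^sup>2 +
       (F $ 2 $ 1 + (if (2::2) = 1 then (\<lambda>z. 0) else g 1) z)\<^sup>2 + (F $ 2 $ 2 + (if (2::2) = 1 then (\<lambda>z. 0) else g 2) z - (Y z - X z))\<^sup>2) * indicator Omega z \<partial>lborel) \<le> ennreal (real N * (32 * (1 / real N) ^ 3))" .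
    show "weak_deriv j (if k = 1 then (\<lambda>z. 0) else u) (if k = 1 then (\<lambda>z. 0) else g j)" for k j :: 2
      using *(2) by (simp add: weak_deriv_def)
  qed (use * \<epsilon> in auto)
  also have "\<dots> \<le> ennreal (560 * \<epsilon> powr (2/3))"
  proof (rule ennreal_leI)
    have e13: "0 < \<epsilon> powr (1/3)" using \<epsilon> by simp
    have inv: "1 / real N \<le> \<epsilon> powr (1/3)"
    proof -
      have "1 \<le> \<epsilon> powr (1/3) * real N" using mult_left_mono[OF N(2), of "\<epsilon> powr (1/3)"] \<epsilon> by (simp add: powr_add[symmetric])
      then show ?thesis using N(1) by (simp add: divide_le_eq)
    qed
    have "(1 / real N)\<^sup>2 \<le> (\<epsilon> powr (1/3))\<^sup>2" using inv by (intro power_mono) auto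
    also have "\<dots> = \<epsilon> powr (2/3)" by (simp add: power2_eq_square powr_add[symmetric])
    finally have 1: "(1 / real N)\<^sup>2 \<le> \<epsilon> powr (2/3)" .
    have "\<epsilon> * real N \<le> \<epsilon> powr 1 * (2 * \<epsilon> powr (- (1/3)))" using N(3) \<epsilon> by (simp add: mult_left_mono)
    also have "\<dots> = 2 * \<epsilon> powr (2/3)" by (simp only: powr_add[symmetric] mult.left_commute) simp
    finally have 2: "\<epsilon> * real N \<le> 2 * \<epsilon> powr (2/3)" .
    have "\<epsilon> * 1 \<le> \<epsilon> * real N" using N(1) \<epsilon> by (intro mult_left_mono) auto
    \<comment> \<open>The surface term is (8 + 256 N) \<epsilon> \<le> 264 \<epsilon> N \<le> 528
      \<epsilon>^(2/3), and 32 + 528 = 560.\<close>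
    then show "real N * (32 * (1 / real N) ^ 3) + \<epsilon> * (2 * ((2 * (1 + 1) + (real N * 32 + real N * 32)) + real N * 32 + real N * 32)) \<le> 560 * \<epsilon> powr (2/3)"
      unfolding N3 using 1 2 by (simp add: algebra_simps)
  qed
  finally show ?thesis .
qed

lemma ennreal_weighted_sum:
  "0 \<le> u \<Longrightarrow> 0 \<le> s \<Longrightarrow> 0 \<le> v \<Longrightarrow> ennreal (2 * u + (8 * s + v)) = 2 * ennreal u + (8 * ennreal s + ennreal v)"
  by (simp add: ennreal_plus ennreal_mult)

text \<open>Strips of width r = 1 / N with r of order \<epsilon>^(1/4). Filling rectangles of height
  y of order r^2 leave over an area of order y and have elastic energy of order y^2 / r^2, both of
  order r^2, while their interfaces have length of order 1 / y, that is r^(-2).\<close>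

lemma upper_bound_second_order:
  fixes F :: "real^2^2"
  assumes F: "F $ 1 $ 1 = \<nu>" "F $ 1 $ 2 = 0" "F $ 2 $ 1 = 0" "F $ 2 $ 2 = 0" and \<nu>: "\<bar>\<nu>\<bar> < 1"
  shows "\<exists>C>0. \<forall>\<epsilon>. 0 < \<epsilon> \<and> \<epsilon> < 1 \<longrightarrow> min_energy \<epsilon> F \<le> ennreal (C * \<epsilon> powr (1/2))"
proof -
  define p q where "p = 1 - \<nu>" and "q = 1 + \<nu>"
  interpret T: teeth p q using \<nu> by unfold_locales (auto simp: p_def q_def)
  have pp: "0 < p" "p < 2" using \<nu> by (auto simp: p_def)
  define n0 where "n0 = nat \<lceil>q / p\<rceil>"
  have n0: "q / p \<le> real n0" unfolding n0_def by linarith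
  define c where "c = 768 / p + 64 * (1 + real n0)"
  have c0: "0 < c" using pp by (simp add: c_def add_pos_pos)
  have main: "min_energy \<epsilon> F \<le> ennreal ((93 + 32 * c) * \<epsilon> powr (1/2))" if \<epsilon>: "0 < \<epsilon>" "\<epsilon> < 1" for \<epsilon>
  proof -
    define N where "N = nat \<lceil>\<epsilon> powr (- (1/4))\<rceil>"
    have N: "1 \<le> real N" "\<epsilon> powr (- (1/4)) \<le> real N" "real N \<le> 2 * \<epsilon> powr (- (1/4))"
      unfolding N_def using nat_ceiling_powr[OF \<epsilon>, of "1/4"] by auto
    define r where "r = 1 / real N"
    define y where "y = p * r\<^sup>2 / 8"
    have r: "0 < r" "r \<le> 1" "real N * r = 1" using N(1) by (auto simp: r_def)
    have rN: "real N = 1 / r" by (simp add: r_def)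
    have y: "0 < y" "y \<le> p * r / 8"
    proof -
      show "0 < y" using r pp by (simp add: y_def)
      have "r * r \<le> r * 1" using r by (intro mult_left_mono) auto
      then show "y \<le> p * r / 8" using pp by (simp add: y_def power2_eq_square)
    qed
    have "T.laminate (vcolumn 0 1) (32 * r\<^sup>2) (p * r\<^sup>2 / 4) (17 * r\<^sup>2) (c * (real N)\<^sup>2)"
    proof -
      \<comment> \<open>\<open>N\<close> generations as well: 3^N \<ge> N^2 = r^(-2) makes the
        unresolved layers as small as the other errors.\<close>
      have L: "T.laminate (vcolumn 0 1) (real N * (2 * r * (8 * r\<^sup>2 + 8 / 3 ^ N))) (real N * (2 * r * y)) (real N * (516 / p * y\<^sup>2 / r))
        (real N * (96 * r / y + 64 * (1 + real n0) * real N * r))"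
        using T.laminate_columns[OF n0 r(1) y, of N N] r(3) by simp
      have 1: "real N * (2 * r * (8 * r\<^sup>2 + 8 / 3 ^ N)) \<le> 32 * r\<^sup>2"
      proof -
        have "1 / 3 ^ N \<le> r\<^sup>2" using square_le_three_power[of N] N(1) by (simp add: r_def power_divide frac_le)
        moreover have "real N * (2 * r * (8 * r\<^sup>2 + 8 / 3 ^ N)) = 16 * r\<^sup>2 + 16 * (1 / 3 ^ N)" using r by (simp add: rN distrib_left)
        ultimately show ?thesis by linarith
      qed
      have 2: "real N * (2 * r * y) = p * r\<^sup>2 / 4" using r by (simp add: rN y_def)
      have 3: "real N * (516 / p * y\<^sup>2 / r) \<le> 17 * r\<^sup>2"
      proof -
        have "real N * (516 / p * y\<^sup>2 / r) = (516 / 64) * p * r\<^sup>2" using r pp by (simp add: rN y_def power2_eq_square)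
        also have "\<dots> \<le> (516 / 64) * 2 * r\<^sup>2" using pp by (intro mult_right_mono mult_left_mono) auto
        also have "\<dots> \<le> 17 * r\<^sup>2" by simp
        finally show ?thesis .
      qed
      have 4: "real N * (96 * r / y + 64 * (1 + real n0) * real N * r) \<le> c * (real N)\<^sup>2"
      proof -
        have "real N * (96 * r / y) = 768 / p * (real N)\<^sup>2" using r pp by (simp add: rN y_def power2_eq_square)
        moreover have "real N * (64 * (1 + real n0) * real N * r) = 64 * (1 + real n0) * real N" using r by (simp add: rN)
        moreover have "64 * (1 + real n0) * real N \<le> 64 * (1 + real n0) * (real N)\<^sup>2" using N(1) by (intro mult_left_mono) (auto simp: power2_eq_square)
        ultimately show ?thesis by (simp add: c_def distrib_left distrib_right)
      qed
      show ?thesis by (rule T.laminate_mono[OF L 1 _ 3 4]) (use 2 in simp)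
    qed
    then obtain w g D B where W: "w \<in> borel_measurable borel" "\<forall>k. g k \<in> borel_measurable borel \<and> weak_deriv k w (g k)" "\<forall>z. \<bar>w z\<bar> \<le> B \<and> (\<forall>k. \<bar>g k z\<bar> \<le> B)"
     "\<forall>z. z \<notin> vcolumn 0 1 \<longrightarrow> w z = 0 \<and> (\<forall>k. g k z = 0)" "D \<subseteq> vcolumn 0 1" "fillable 0 D (p * r\<^sup>2 / 4) (17 * r\<^sup>2) (c * (real N)\<^sup>2)"
     "(\<integral>\<^sup>+z. ennreal ((g 2 z)\<^sup>2 + (g 1 z - (if z \<in> D then - q else p))\<^sup>2) * indicator (vcolumn 0 1) z \<partial>lborel) \<le> ennreal (32 * r\<^sup>2)"
      unfolding T.laminate_def by (elim conjE exE) (rule that)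
    from W(6) obtain u h X Y B' where Dm: "D \<in> sets borel" and *: "u \<in> borel_measurable borel" "\<forall>k. h k \<in> borel_measurable borel \<and> weak_deriv k u (h k)" "per_le X (c * (real N)\<^sup>2)" "per_le Y (c * (real N)\<^sup>2)"
     "\<forall>z. \<bar>u z\<bar> \<le> B' \<and> (\<forall>k. \<bar>h k z\<bar> \<le> B') \<and> \<bar>X z\<bar> \<le> B' \<and> \<bar>Y z\<bar> \<le> B'"
     "AE z in lborel. X z \<in> {0,1} \<and> Y z \<in> {0,1} \<and> X z + Y z \<le> 1 \<and>
        (z \<notin> D \<longrightarrow> u z = 0 \<and> h 1 z = 0 \<and> h 2 z = 0 \<and> X z = 0 \<and> Y z = 0)"
     "(\<integral>\<^sup>+z. ennreal (1 - X z - Y z) * indicator D z \<partial>lborel) \<le> ennreal (p * r\<^sup>2 / 4)"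
     "(\<integral>\<^sup>+z. ennreal ((h 1 z)\<^sup>2 + (0 + h 2 z - (Y z - X z))\<^sup>2) * indicator D z \<partial>lborel) \<le> ennreal (17 * r\<^sup>2)"
      unfolding fillable_def by (elim conjE exE) (rule that)
    have m[measurable]: "X \<in> borel_measurable borel" "Y \<in> borel_measurable borel" "D \<in> sets borel" "g k \<in> borel_measurable borel" "h k \<in> borel_measurable borel" for k
      using *(2,3,4) W(2) Dm by (auto simp: per_le_def)
    have [measurable]: "vcolumn 0 1 \<in> sets borel" unfolding vcolumn_def by measurable
    define X1 where "X1 z = indicator (rect 0 1 0 1) z + (- X z + - Y z)" for z
    have AEc: "AE z in lborel. (z \<in> Omega \<longleftrightarrow> z \<in> vcolumn 0 1) \<and> (z \<in> Omega \<longleftrightarrow> z \<in> rect 0 1 0 1)"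
      using AE_nth_neq[of 1 1] AE_nth_neq[of 2 1]
      by eventually_elim (auto simp: Omega_def rect_def vcolumn_def mem_box_cart forall_2 less_le)
    have B0: "0 \<le> B" "0 \<le> B'" using W(3) *(5) by (meson abs_ge_zero order_trans)+
    have "min_energy \<epsilon> F \<le> ennreal (85 * r\<^sup>2 + \<epsilon> * (2 * ((2 * (1 + 1) + (c * (real N)\<^sup>2 + c * (real N)\<^sup>2)) + c * (real N)\<^sup>2 + c * (real N)\<^sup>2)))"
    proof (rule min_energy_le[of "\<lambda>k. if k = 1 then w else u" "1 + B + B' + B'" "\<lambda>k j. if k = 1 then g j else h j"])
      show "per_le X1 (2 * (1 + 1) + (c * (real N)\<^sup>2 + c * (real N)\<^sup>2))" unfolding X1_def[abs_def]
        using * by (intro per_le_add per_le_rect per_le_minus) auto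
      show "AE z in lborel. z \<notin> Omega \<longrightarrow> (\<forall>k. (if k = 1 then w else u) z = 0)"
        using AEc *(6) by eventually_elim (use W in auto)
      show "AE z in lborel. z \<in> box 0 1 \<longrightarrow> X1 z \<in> {0,1} \<and> X z \<in> {0,1} \<and> Y z \<in> {0,1} \<and> X1 z + X z + Y z = 1"
        using *(6) by eventually_elim (use box_subset_rect in \<open>auto simp: X1_def\<close>)
      show "\<bar>X1 z\<bar> \<le> 1 + B + B' + B' \<and> \<bar>X z\<bar> \<le> 1 + B + B' + B' \<and> \<bar>Y z\<bar> \<le> 1 + B + B' + B'" for z
      proof -
        have "\<bar>X z\<bar> \<le> B'" "\<bar>Y z\<bar> \<le> B'" using *(5) by auto
        moreover have "\<bar>indicator (rect 0 1 0 1) z :: real\<bar> \<le> 1" by (auto simp: indicator_def)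
        ultimately show ?thesis unfolding X1_def using B0 by linarith
      qed
      show "\<bar>(if k = 1 then w else u) z\<bar> \<le> 1 + B + B' + B'" for k :: 2 and z using W(3)[rule_format, of z] *(5)[rule_format, of z] B0 by auto
      show "\<bar>(if k = 1 then g j else h j) z\<bar> \<le> 1 + B + B' + B'" for k j :: 2 and z
      proof -
        have "\<bar>g j z\<bar> \<le> B" "\<bar>h j z\<bar> \<le> B'" using W(3) *(5) by blast+
        then show ?thesis using B0 by auto
      qed
      have "(\<integral>\<^sup>+z. ennreal ((F $ 1 $ 1 + (if (1::2) = 1 then g 1 else h 1) z - (X1 z - X z - Y z))\<^sup>2 + (F $ 1 $ 2 + (if (1::2) = 1 then g 2 else h 2) z)\<^sup>2 +
         (F $ 2 $ 1 + (if (2::2) = 1 then g 1 else h 1) z)\<^sup>2 + (F $ 2 $ 2 + (if (2::2) = 1 then g 2 else h 2) z - (Y z - X z))\<^sup>2) * indicator Omega z \<partial>lborel)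
        \<le> (\<integral>\<^sup>+z. 2 * (ennreal ((g 2 z)\<^sup>2 + (g 1 z - (if z \<in> D then - q else p))\<^sup>2) * indicator (vcolumn 0 1) z) +
           (8 * (ennreal (1 - X z - Y z) * indicator D z) + ennreal ((h 1 z)\<^sup>2 + (0 + h 2 z - (Y z - X z))\<^sup>2) * indicator D z) \<partial>lborel)"
        using AEc *(6)
      proof (intro nn_integral_mono_AE, eventually_elim)
        case (elim z)
        show ?case
        proof (cases "z \<in> Omega")
          case False then show ?thesis by simp
        next
          case True
          then have z: "z \<in> vcolumn 0 1" "z \<in> rect 0 1 0 1" using elim by auto
          then have X1: "X1 z = 1 - X z - Y z" by (simp add: X1_def)
          have qq: "q = 1 + \<nu>" "p = 1 - \<nu>" by (auto simp: p_def q_def)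
          show ?thesis
          proof (cases "z \<in> D")
            case zD: True
            \<comment> \<open>\<open>s\<close> is the indicator of the first phase inside
              \<open>D\<close>. The construction aims at the entry -1 there, whereas the first well
              has entry 1; this difference of 2 produces the summand 8 s.\<close>
            define s where "s = 1 - X z - Y z"
            have s: "s = 0 \<or> s = 1" using elim by (auto simp: s_def)
            define a where "a = g 1 z + q"
            have "(\<nu> + g 1 z - (X1 z - X z - Y z))\<^sup>2 = (a - 2 * s)\<^sup>2" unfolding X1 s_def a_def qq by (simp add: algebra_simps)
            also have "\<dots> \<le> 2 * a\<^sup>2 + 8 * s"
            proof -
              have "2 * a\<^sup>2 + 8 * s\<^sup>2 - (a - 2 * s)\<^sup>2 = (a + 2 * s)\<^sup>2" by (simp add: power2_eq_square algebra_simps)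
              then have "(a - 2 * s)\<^sup>2 \<le> 2 * a\<^sup>2 + 8 * s\<^sup>2" using zero_le_power2[of "a + 2 * s"] by linarith
              then show ?thesis using s by auto
            qed
            finally have le: "(\<nu> + g 1 z - (X1 z - X z - Y z))\<^sup>2 \<le> 2 * a\<^sup>2 + 8 * s" .
            have "ennreal ((\<nu> + g 1 z - (X1 z - X z - Y z))\<^sup>2 + (g 2 z)\<^sup>2 + (h 1 z)\<^sup>2 + (0 + h 2 z - (Y z - X z))\<^sup>2)
              \<le> ennreal (2 * ((g 2 z)\<^sup>2 + a\<^sup>2) + (8 * s + ((h 1 z)\<^sup>2 + (0 + h 2 z - (Y z - X z))\<^sup>2)))"
            proof -
              have "A + G + H + I \<le> 2 * (G + b) + (d + (H + I))" if "A \<le> 2 * b + d" "0 \<le> G" for A G H I b d :: real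
                unfolding distrib_left using that by linarith
              from this[OF le zero_le_power2] show ?thesis by (intro ennreal_leI)
            qed
            also have "\<dots> = 2 * ennreal ((g 2 z)\<^sup>2 + a\<^sup>2) + (8 * ennreal s + ennreal ((h 1 z)\<^sup>2 + (0 + h 2 z - (Y z - X z))\<^sup>2))"
              using s by (intro ennreal_weighted_sum) auto
            finally show ?thesis using True z zD by (simp add: F a_def s_def del: ennreal_plus)
          next
            case zD: False
            have "X z = 0" "Y z = 0" "h 1 z = 0" "h 2 z = 0" using elim zD by auto
            moreover have "(\<nu> + g 1 z - 1)\<^sup>2 + (g 2 z)\<^sup>2 \<le> 2 * ((g 2 z)\<^sup>2 + (g 1 z - p)\<^sup>2)"
            proof -
              have e: "\<nu> + g 1 z - 1 = g 1 z - p" unfolding qq by simp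
              show ?thesis unfolding e distrib_left using zero_le_power2[of "g 2 z"] zero_le_power2[of "g 1 z - p"] by linarith
            qed
            then have "ennreal ((\<nu> + g 1 z - 1)\<^sup>2 + (g 2 z)\<^sup>2) \<le> 2 * ennreal ((g 2 z)\<^sup>2 + (g 1 z - p)\<^sup>2)"
              using ennreal_leI[of "(\<nu> + g 1 z - 1)\<^sup>2 + (g 2 z)\<^sup>2" "2 * ((g 2 z)\<^sup>2 + (g 1 z - p)\<^sup>2)"] by (simp only: ennreal_mult''[of _ 2] ennreal_numeral) (simp add: ennreal_mult)
            ultimately show ?thesis using True z zD by (simp add: F X1 del: ennreal_plus)
          qed
        qed
      qed
      also have "\<dots> = 2 * (\<integral>\<^sup>+z. ennreal ((g 2 z)\<^sup>2 + (g 1 z - (if z \<in> D then - q else p))\<^sup>2) * indicator (vcolumn 0 1) z \<partial>lborel) +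
         (8 * (\<integral>\<^sup>+z. ennreal (1 - X z - Y z) * indicator D z \<partial>lborel) + (\<integral>\<^sup>+z. ennreal ((h 1 z)\<^sup>2 + (0 + h 2 z - (Y z - X z))\<^sup>2) * indicator D z \<partial>lborel))"
        by (subst nn_integral_add, simp, simp, subst nn_integral_add, simp, simp, subst nn_integral_cmult, simp, subst nn_integral_cmult, simp) simp
      also have "\<dots> \<le> 2 * ennreal (32 * r\<^sup>2) + (8 * ennreal (p * r\<^sup>2 / 4) + ennreal (17 * r\<^sup>2))"
        by (intro add_mono mult_left_mono W(7) *(7,8)) auto
      also have "\<dots> = ennreal (2 * (32 * r\<^sup>2) + (8 * (p * r\<^sup>2 / 4) + 17 * r\<^sup>2))"
        using pp by (intro ennreal_weighted_sum[symmetric]) auto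
      also have "\<dots> \<le> ennreal (85 * r\<^sup>2)" using pp mult_right_mono[of p 2 "r\<^sup>2"] by (intro ennreal_leI) (simp add: mult.assoc)
      finally show "(\<integral>\<^sup>+z. ennreal ((F $ 1 $ 1 + (if (1::2) = 1 then g 1 else h 1) z - (X1 z - X z - Y z))\<^sup>2 + (F $ 1 $ 2 + (if (1::2) = 1 then g 2 else h 2) z)\<^sup>2 +
         (F $ 2 $ 1 + (if (2::2) = 1 then g 1 else h 1) z)\<^sup>2 + (F $ 2 $ 2 + (if (2::2) = 1 then g 2 else h 2) z - (Y z - X z))\<^sup>2) * indicator Omega z \<partial>lborel) \<le> ennreal (85 * r\<^sup>2)" .
      show "weak_deriv j (if k = 1 then w else u) (if k = 1 then g j else h j)" for k j :: 2
        using *(2) W(2) by simp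
    qed (use * W \<epsilon> in auto)
    also have "\<dots> \<le> ennreal ((93 + 32 * c) * \<epsilon> powr (1/2))"
    proof (rule ennreal_leI)
      have inv: "r \<le> \<epsilon> powr (1/4)"
      proof -
        have "1 \<le> \<epsilon> powr (1/4) * real N" using mult_left_mono[OF N(2), of "\<epsilon> powr (1/4)"] \<epsilon> by (simp add: powr_add[symmetric])
        then show ?thesis using N(1) by (simp add: r_def divide_le_eq)
      qed
      have "r\<^sup>2 \<le> (\<epsilon> powr (1/4))\<^sup>2" using inv r by (intro power_mono) auto
      also have "\<dots> = \<epsilon> powr (1/2)" by (simp add: power2_eq_square powr_add[symmetric])
      finally have 1: "r\<^sup>2 \<le> \<epsilon> powr (1/2)" .
      have "(real N)\<^sup>2 \<le> (2 * \<epsilon> powr (- (1/4)))\<^sup>2" using N by (intro power_mono) auto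
      also have "\<dots> = 4 * \<epsilon> powr (- (1/2))" by (simp add: power2_eq_square powr_add[symmetric])
      finally have "\<epsilon> * (real N)\<^sup>2 \<le> \<epsilon> powr 1 * (4 * \<epsilon> powr (- (1/2)))" using \<epsilon> by (simp add: mult_left_mono)
      also have "\<dots> = 4 * (\<epsilon> powr 1 * \<epsilon> powr (- (1/2)))" by (simp only: mult.left_commute)
      also have "\<dots> = 4 * \<epsilon> powr (1/2)" unfolding powr_add[symmetric] by simp
      finally have 2: "\<epsilon> * (real N)\<^sup>2 \<le> 4 * \<epsilon> powr (1/2)" .
      have 3: "\<epsilon> \<le> \<epsilon> powr (1/2)" using powr_mono'[of "1/2" 1 \<epsilon>] \<epsilon> by simp
      have "8 * c * (\<epsilon> * (real N)\<^sup>2) \<le> 8 * c * (4 * \<epsilon> powr (1/2))" using 2 c0 by (intro mult_left_mono) auto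
      then show "85 * r\<^sup>2 + \<epsilon> * (2 * ((2 * (1 + 1) + (c * (real N)\<^sup>2 + c * (real N)\<^sup>2)) + c * (real N)\<^sup>2 + c * (real N)\<^sup>2)) \<le> (93 + 32 * c) * \<epsilon> powr (1/2)"
        using 1 3 by (simp add: algebra_simps)
    qed
    finally show ?thesis .
  qed
  show ?thesis using main c0 by (intro exI[of _ "93 + 32 * c"]) auto
qed

section \<open>Mollification\<close>

lemma square_diff_le: "(a - c :: real)\<^sup>2 \<le> 2 * (a - b)\<^sup>2 + 2 * (b - c)\<^sup>2"
proof -
  have "2 * (a - b)\<^sup>2 + 2 * (b - c)\<^sup>2 - (a - c)\<^sup>2 = ((a - b) - (b - c))\<^sup>2" by (simp add: power2_eq_square algebra_simps)
  then show ?thesis using zero_le_power2[of "(a - b) - (b - c)"] by linarith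
qed

lemma nn_integral_square_diff_le:
  fixes f g h :: "'a::euclidean_space \<Rightarrow> real"
  assumes [measurable]: "f \<in> borel_measurable borel" "g \<in> borel_measurable borel" "h \<in> borel_measurable borel"
  shows "(\<integral>\<^sup>+x. ennreal ((f x - h x)\<^sup>2) \<partial>lborel) \<le> 2 * (\<integral>\<^sup>+x. ennreal ((f x - g x)\<^sup>2) \<partial>lborel) + 2 * (\<integral>\<^sup>+x. ennreal ((g x - h x)\<^sup>2) \<partial>lborel)"
proof -
  have "(\<integral>\<^sup>+x. ennreal ((f x - h x)\<^sup>2) \<partial>lborel) \<le> (\<integral>\<^sup>+x. 2 * ennreal ((f x - g x)\<^sup>2) + 2 * ennreal ((g x - h x)\<^sup>2) \<partial>lborel)"
  proof (rule nn_integral_mono)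
    fix x
    have "ennreal ((f x - h x)\<^sup>2) \<le> ennreal (2 * (f x - g x)\<^sup>2 + 2 * (g x - h x)\<^sup>2)" by (rule ennreal_leI[OF square_diff_le])
    also have "\<dots> = 2 * ennreal ((f x - g x)\<^sup>2) + 2 * ennreal ((g x - h x)\<^sup>2)" by (simp add: ennreal_plus ennreal_mult)
    finally show "ennreal ((f x - h x)\<^sup>2) \<le> 2 * ennreal ((f x - g x)\<^sup>2) + 2 * ennreal ((g x - h x)\<^sup>2)" .
  qed
  also have "\<dots> = 2 * (\<integral>\<^sup>+x. ennreal ((f x - g x)\<^sup>2) \<partial>lborel) + 2 * (\<integral>\<^sup>+x. ennreal ((g x - h x)\<^sup>2) \<partial>lborel)"
    by (subst nn_integral_add) (simp_all add: nn_integral_cmult)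
  finally show ?thesis .
qed

lemma L2_truncation:
  fixes H :: "'a::euclidean_space \<Rightarrow> real"
  assumes [measurable]: "H \<in> borel_measurable borel" and fin: "(\<integral>\<^sup>+x. ennreal ((H x)\<^sup>2) \<partial>lborel) < \<infinity>" and \<kappa>: "\<kappa> > 0"
  shows "\<exists>n. (\<integral>\<^sup>+x. ennreal ((H x - (if norm x \<le> real n then max (- real n) (min (real n) (H x)) else 0))\<^sup>2) \<partial>lborel) \<le> ennreal \<kappa>"
proof -
  define T where "T n x = (if norm x \<le> real n then max (- real n) (min (real n) (H x)) else 0)" for n x
  have [measurable]: "T n \<in> borel_measurable borel" for n unfolding T_def by measurable
  have "(\<lambda>n. \<integral>\<^sup>+x. ennreal ((H x - T n x)\<^sup>2) \<partial>lborel) \<longlonglongrightarrow> (\<integral>\<^sup>+x. 0 \<partial>(lborel :: 'a measure))"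
  proof (rule nn_integral_dominated_convergence[where w="\<lambda>x. ennreal ((H x)\<^sup>2)"])
    show "AE x in lborel. ennreal ((H x - T n x)\<^sup>2) \<le> ennreal ((H x)\<^sup>2)" for n
    proof (intro AE_I2 ennreal_leI)
      fix x
      have "\<bar>H x - T n x\<bar> \<le> \<bar>H x\<bar>" by (auto simp: T_def max_def min_def)
      then show "(H x - T n x)\<^sup>2 \<le> (H x)\<^sup>2" by (rule abs_le_square_iff[THEN iffD1])
    qed
    show "AE x in lborel. (\<lambda>n. ennreal ((H x - T n x)\<^sup>2)) \<longlonglongrightarrow> 0"
    proof (rule AE_I2)
      fix x
      obtain n0 :: nat where n0: "max (norm x) \<bar>H x\<bar> \<le> real n0" using real_arch_simple by blast
      have "eventually (\<lambda>n. 0 = ennreal ((H x - T n x)\<^sup>2)) sequentially"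
        using eventually_ge_at_top[of n0]
      proof eventually_elim
        case (elim n)
        then have "norm x \<le> real n" "\<bar>H x\<bar> \<le> real n" using n0 by auto
        then have "T n x = H x" by (auto simp: T_def max_def min_def)
        then show ?case by simp
      qed
      then show "(\<lambda>n. ennreal ((H x - T n x)\<^sup>2)) \<longlonglongrightarrow> 0" by (rule Lim_transform_eventually[OF tendsto_const])
    qed
  qed (use fin in auto)
  then have "(\<lambda>n. \<integral>\<^sup>+x. ennreal ((H x - T n x)\<^sup>2) \<partial>lborel) \<longlonglongrightarrow> 0" by simp
  moreover have "0 < ennreal \<kappa>" using \<kappa> by simp
  ultimately have "eventually (\<lambda>n. (\<integral>\<^sup>+x. ennreal ((H x - T n x)\<^sup>2) \<partial>lborel) < ennreal \<kappa>) sequentially" by (rule order_tendstoD(2))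
  then obtain n where "(\<integral>\<^sup>+x. ennreal ((H x - T n x)\<^sup>2) \<partial>lborel) < ennreal \<kappa>" by (meson eventually_sequentially order_refl)
  then show ?thesis unfolding T_def by (intro exI[of _ n] less_imp_le)
qed

text \<open>Measurable functions are almost everywhere limits of continuous ones; clamping the
  values to [-M, M] and multiplying by a radial cutoff yields a common integrable majorant for
  dominated convergence.\<close>

lemma L2_bounded_approximation:
  fixes H :: "'a::euclidean_space \<Rightarrow> real"
  assumes Hm[measurable]: "H \<in> borel_measurable borel" and B: "\<And>x. \<bar>H x\<bar> \<le> M" "\<And>x. norm x > M \<Longrightarrow> H x = 0" and \<kappa>: "\<kappa> > 0"
  shows "\<exists>\<phi>. continuous_on UNIV \<phi> \<and> (\<forall>x. norm x > M + 1 \<longrightarrow> \<phi> x = 0) \<and> (\<integral>\<^sup>+x. ennreal ((H x - \<phi> x)\<^sup>2) \<partial>lborel) \<le> ennreal \<kappa>"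
proof -
  have M0: "0 \<le> M" using B(1)[of 0] by linarith
  have "H measurable_on UNIV" by (rule lebesgue_measurable_imp_measurable_on) (use Hm in \<open>auto intro: measurable_completion\<close>)
  then obtain N g where N: "negligible N" and gc: "\<And>n. continuous_on UNIV (g n)" and gl: "\<And>x. x \<notin> N \<Longrightarrow> (\<lambda>n. g n x) \<longlonglongrightarrow> H x"
    unfolding measurable_on_def by auto
  define f where "f n x = max (- M) (min M (g n x)) * max 0 (min 1 (M + 1 - norm x))" for n x
  have fc: "continuous_on UNIV (f n)" for n unfolding f_def by (intro continuous_intros gc)
  have fm[measurable]: "f n \<in> borel_measurable borel" for n using fc by (rule borel_measurable_continuous_onI)
  have f0: "f n x = 0" if "norm x > M + 1" for n x using that by (simp add: f_def)
  have fB: "\<bar>f n x\<bar> \<le> M" for n x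
  proof -
    have "\<bar>f n x\<bar> \<le> M * 1" unfolding f_def abs_mult using M0 by (intro mult_mono) auto
    then show ?thesis by simp
  qed
  have AEN: "AE x in lborel. x \<notin> N"
  proof -
    have "AE x in lebesgue. x \<notin> N" using N by (simp add: negligible_iff_null_sets AE_not_in)
    then show ?thesis by (simp add: AE_completion_iff)
  qed
  have "(\<lambda>n. \<integral>\<^sup>+x. ennreal ((H x - f n x)\<^sup>2) \<partial>lborel) \<longlonglongrightarrow> (\<integral>\<^sup>+x. 0 \<partial>(lborel :: 'a measure))"
  proof (rule nn_integral_dominated_convergence[where w="\<lambda>x. ennreal ((2 * M)\<^sup>2) * indicator (cball 0 (M + 1)) x"])
    show "AE x in lborel. ennreal ((H x - f n x)\<^sup>2) \<le> ennreal ((2 * M)\<^sup>2) * indicator (cball 0 (M + 1)) x" for n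
    proof (rule AE_I2)
      fix x
      have "\<bar>H x - f n x\<bar> \<le> 2 * M" using B(1)[of x] fB[of n x] by linarith
      then have "(H x - f n x)\<^sup>2 \<le> (2 * M)\<^sup>2" using M0 by (intro power2_le_iff_abs_le[THEN iffD2]) auto
      then show "ennreal ((H x - f n x)\<^sup>2) \<le> ennreal ((2 * M)\<^sup>2) * indicator (cball 0 (M + 1)) x"
        using B(2)[of x] f0[of x n] by (cases "norm x \<le> M + 1") (auto intro: ennreal_leI)
    qed
    have [measurable]: "cball (0::'a) (M + 1) \<in> sets borel" by (intro borel_closed closed_cball)
    show "(\<lambda>x::'a. ennreal ((2 * M)\<^sup>2) * indicator (cball 0 (M + 1)) x) \<in> borel_measurable lborel" by measurable
    show "(\<integral>\<^sup>+x. ennreal ((2 * M)\<^sup>2) * indicator (cball 0 (M + 1)) x \<partial>(lborel :: 'a measure)) < \<infinity>"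
      using emeasure_lborel_cball_finite[of "0::'a" "M + 1"] by (subst nn_integral_cmult_indicator) (auto simp: ennreal_mult_less_top)
    show "AE x in lborel. (\<lambda>n. ennreal ((H x - f n x)\<^sup>2)) \<longlonglongrightarrow> 0"
      using AEN
    proof eventually_elim
      case (elim x)
      have "(\<lambda>n. f n x) \<longlonglongrightarrow> max (- M) (min M (H x)) * max 0 (min 1 (M + 1 - norm x))"
        unfolding f_def by (intro tendsto_intros gl elim)
      also have "max (- M) (min M (H x)) * max 0 (min 1 (M + 1 - norm x)) = H x"
        using B(1)[of x] B(2)[of x] by (cases "norm x \<le> M") (auto simp: max_def min_def)
      finally have "(\<lambda>n. (H x - f n x)\<^sup>2) \<longlonglongrightarrow> (H x - H x)\<^sup>2" by (intro tendsto_intros)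
      then show ?case using tendsto_ennrealI by fastforce
    qed
  qed auto
  then have "(\<lambda>n. \<integral>\<^sup>+x. ennreal ((H x - f n x)\<^sup>2) \<partial>lborel) \<longlonglongrightarrow> 0" by simp
  moreover have "0 < ennreal \<kappa>" using \<kappa> by simp
  ultimately have "eventually (\<lambda>n. (\<integral>\<^sup>+x. ennreal ((H x - f n x)\<^sup>2) \<partial>lborel) < ennreal \<kappa>) sequentially" by (rule order_tendstoD(2))
  then obtain n where "(\<integral>\<^sup>+x. ennreal ((H x - f n x)\<^sup>2) \<partial>lborel) < ennreal \<kappa>" by (meson eventually_sequentially order_refl)
  then show ?thesis using fc f0 by (intro exI[of _ "f n"]) (auto intro: less_imp_le)
qed

lemma uniformly_continuous_compact_support:
  fixes \<phi> :: "'a::euclidean_space \<Rightarrow> 'b::real_normed_vector"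
  assumes "continuous_on UNIV \<phi>" "\<And>x. norm x > R \<Longrightarrow> \<phi> x = 0" "e > 0"
  shows "\<exists>\<delta>>0. \<delta> \<le> 1 \<and> (\<forall>x h. norm h \<le> \<delta> \<longrightarrow> norm (\<phi> (x + h) - \<phi> x) \<le> e)"
proof -
  have "uniformly_continuous_on (cball 0 (\<bar>R\<bar> + 2)) \<phi>"
    using assms(1) by (intro compact_uniformly_continuous) (auto intro: continuous_on_subset)
  then obtain d where d: "d > 0" "\<And>x x'. x \<in> cball 0 (\<bar>R\<bar> + 2) \<Longrightarrow> x' \<in> cball 0 (\<bar>R\<bar> + 2) \<Longrightarrow> dist x' x < d \<Longrightarrow> dist (\<phi> x') (\<phi> x) < e"
    unfolding uniformly_continuous_on_def using assms(3) by metis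
  have "norm (\<phi> (x + h) - \<phi> x) \<le> e" if h: "norm h \<le> min 1 (d / 2)" for x h
  proof (cases "norm x \<le> \<bar>R\<bar> + 1")
    case True
    have "norm (x + h) \<le> \<bar>R\<bar> + 2" using norm_triangle_ineq[of x h] True h by simp
    then have "x \<in> cball 0 (\<bar>R\<bar> + 2)" "x + h \<in> cball 0 (\<bar>R\<bar> + 2)" using True unfolding mem_cball_0 by auto
    moreover have "dist (x + h) x < d" using h d(1) by (simp add: dist_norm)
    ultimately have "dist (\<phi> (x + h)) (\<phi> x) < e" by (rule d(2))
    then show ?thesis by (simp add: dist_norm)
  next
    case False
    have "norm x \<le> norm (x + h) + norm h" using norm_triangle_ineq[of "x + h" "- h"] by simp
    then have "norm (x + h) > R" "norm x > R" using False h by linarith+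
    then show ?thesis using assms(2,3) by simp
  qed
  then show ?thesis using d(1) by (intro exI[of _ "min 1 (d / 2)"]) auto
qed

text \<open>Truncation and continuous approximation reduce the claim to uniform continuity. The
  budget is 2 (\<kappa> / 8) + 2 (2 (\<kappa> / 16) + 2 (\<kappa> / 8)) = \<kappa>.\<close>

lemma L2_translation_continuous:
  fixes H :: "'a::euclidean_space \<Rightarrow> real"
  assumes [measurable]: "H \<in> borel_measurable borel" and fin: "(\<integral>\<^sup>+x. ennreal ((H x)\<^sup>2) \<partial>lborel) < \<infinity>" and \<kappa>: "\<kappa> > 0"
  shows "\<exists>\<delta>>0. \<delta> \<le> 1 \<and> (\<forall>h. norm h \<le> \<delta> \<longrightarrow> (\<integral>\<^sup>+x. ennreal ((H (x + h) - H x)\<^sup>2) \<partial>lborel) \<le> ennreal \<kappa>)"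
proof -
  have k32: "\<kappa> / 32 > 0" using \<kappa> by simp
  obtain n where n: "(\<integral>\<^sup>+x. ennreal ((H x - (if norm x \<le> real n then max (- real n) (min (real n) (H x)) else 0))\<^sup>2) \<partial>lborel) \<le> ennreal (\<kappa> / 32)"
    using L2_truncation[OF assms(1) fin k32] by blast
  define T where "T x = (if norm x \<le> real n then max (- real n) (min (real n) (H x)) else 0)" for x
  have [measurable]: "T \<in> borel_measurable borel" unfolding T_def by measurable
  obtain \<phi> where \<phi>: "continuous_on UNIV \<phi>" "\<And>x. norm x > real n + 1 \<Longrightarrow> \<phi> x = 0" "(\<integral>\<^sup>+x. ennreal ((T x - \<phi> x)\<^sup>2) \<partial>lborel) \<le> ennreal (\<kappa> / 32)"
  proof -
    have a: "\<bar>T x\<bar> \<le> real n" for x by (auto simp: T_def)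
    have b: "norm x > real n \<Longrightarrow> T x = 0" for x by (auto simp: T_def)
    have Tm: "T \<in> borel_measurable borel" by measurable
    show ?thesis using L2_bounded_approximation[OF Tm a b k32] that by blast
  qed
  have [measurable]: "\<phi> \<in> borel_measurable borel" using \<phi>(1) by (rule borel_measurable_continuous_onI)
  have H\<phi>: "(\<integral>\<^sup>+x. ennreal ((H x - \<phi> x)\<^sup>2) \<partial>lborel) \<le> ennreal (\<kappa> / 8)"
  proof -
    have "(\<integral>\<^sup>+x. ennreal ((H x - \<phi> x)\<^sup>2) \<partial>lborel) \<le> 2 * (\<integral>\<^sup>+x. ennreal ((H x - T x)\<^sup>2) \<partial>lborel) + 2 * (\<integral>\<^sup>+x. ennreal ((T x - \<phi> x)\<^sup>2) \<partial>lborel)"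
      by (rule nn_integral_square_diff_le) measurable
    also have "\<dots> \<le> 2 * ennreal (\<kappa> / 32) + 2 * ennreal (\<kappa> / 32)" using n \<phi>(3) unfolding T_def by (intro add_mono mult_left_mono) auto
    also have "\<dots> = ennreal (\<kappa> / 8)"
    proof -
      have e: "2 * ennreal (\<kappa> / 32) = ennreal (\<kappa> / 16)" using ennreal_mult'[of 2 "\<kappa> / 32"] by simp
      show ?thesis unfolding e using \<kappa> by (simp add: ennreal_plus[symmetric] del: ennreal_plus)
    qed
    finally show ?thesis .
  qed
  define V where "V = measure lborel (cball (0::'a) (real n + 2))"
  have V: "emeasure lborel (cball (0::'a) (real n + 2)) = ennreal V" unfolding V_def using emeasure_lborel_cball_finite[of "0::'a" "real n + 2"] by (intro emeasure_eq_ennreal_measure) auto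
  have V0: "V \<ge> 0" by (simp add: V_def)
  \<comment> \<open>Chosen such that e^2 times the volume \<open>V\<close> of the ball is at most
    \<kappa> / 16; \<open>V + 1\<close> keeps the denominator positive.\<close>
  define e where "e = sqrt (\<kappa> / (16 * (V + 1)))"
  have e: "e > 0" "e\<^sup>2 = \<kappa> / (16 * (V + 1))" using \<kappa> V0 by (auto simp: e_def)
  obtain \<delta> where \<delta>: "\<delta> > 0" "\<delta> \<le> 1" "\<And>x h. norm h \<le> \<delta> \<Longrightarrow> norm (\<phi> (x + h) - \<phi> x) \<le> e"
    using uniformly_continuous_compact_support[OF \<phi>(1,2) e(1)] by blast
  have "(\<integral>\<^sup>+x. ennreal ((H (x + h) - H x)\<^sup>2) \<partial>lborel) \<le> ennreal \<kappa>" if h: "norm h \<le> \<delta>" for h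
  proof -
    have A: "(\<integral>\<^sup>+x. ennreal ((H (x + h) - \<phi> (x + h))\<^sup>2) \<partial>lborel) \<le> ennreal (\<kappa> / 8)"
      using H\<phi> nn_integral_translation[of "\<lambda>x. ennreal ((H x - \<phi> x)\<^sup>2)" h] by simp
    have B: "(\<integral>\<^sup>+x. ennreal ((\<phi> (x + h) - \<phi> x)\<^sup>2) \<partial>lborel) \<le> ennreal (\<kappa> / 16)"
    proof -
      have "(\<integral>\<^sup>+x. ennreal ((\<phi> (x + h) - \<phi> x)\<^sup>2) \<partial>lborel) \<le> (\<integral>\<^sup>+x. ennreal (e\<^sup>2) * indicator (cball (0::'a) (real n + 2)) x \<partial>lborel)"
      proof (rule nn_integral_mono)
        fix x
        show "ennreal ((\<phi> (x + h) - \<phi> x)\<^sup>2) \<le> ennreal (e\<^sup>2) * indicator (cball (0::'a) (real n + 2)) x"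
        proof (cases "norm x \<le> real n + 2")
          case True
          have "(\<phi> (x + h) - \<phi> x)\<^sup>2 \<le> e\<^sup>2" using \<delta>(3)[OF h, of x] e(1) by (intro power2_le_iff_abs_le[THEN iffD2]) auto
          then show ?thesis using True by (simp add: ennreal_leI)
        next
          case False
          have "norm x \<le> norm (x + h) + norm h" using norm_triangle_ineq[of "x + h" "- h"] by simp
          then have "norm (x + h) > real n + 1" "norm x > real n + 1" using False h \<delta>(2) by linarith+
          then show ?thesis using \<phi>(2) by simp
        qed
      qed
      also have "\<dots> = ennreal (e\<^sup>2 * V)" by (subst nn_integral_cmult_indicator) (auto simp: V ennreal_mult V0)
      also have "\<dots> \<le> ennreal (\<kappa> / 16)"
      proof (rule ennreal_leI)
        have "e\<^sup>2 * V = (\<kappa> / 16) * (V / (V + 1))" unfolding e(2) using V0 by (simp add: field_simps)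
        also have "\<dots> \<le> (\<kappa> / 16) * 1" using V0 \<kappa> by (intro mult_left_mono) auto
        finally show "e\<^sup>2 * V \<le> \<kappa> / 16" by simp
      qed
      finally show ?thesis .
    qed
    have C: "(\<integral>\<^sup>+x. ennreal ((H (x + h) - H x)\<^sup>2) \<partial>lborel) \<le> 2 * (\<integral>\<^sup>+x. ennreal ((H (x + h) - \<phi> (x + h))\<^sup>2) \<partial>lborel) + 2 * (\<integral>\<^sup>+x. ennreal ((\<phi> (x + h) - H x)\<^sup>2) \<partial>lborel)"
      by (rule nn_integral_square_diff_le) measurable
    have D: "(\<integral>\<^sup>+x. ennreal ((\<phi> (x + h) - H x)\<^sup>2) \<partial>lborel) \<le> 2 * (\<integral>\<^sup>+x. ennreal ((\<phi> (x + h) - \<phi> x)\<^sup>2) \<partial>lborel) + 2 * (\<integral>\<^sup>+x. ennreal ((\<phi> x - H x)\<^sup>2) \<partial>lborel)"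
      by (rule nn_integral_square_diff_le) measurable
    have "(\<integral>\<^sup>+x. ennreal ((H (x + h) - H x)\<^sup>2) \<partial>lborel) \<le> 2 * (\<integral>\<^sup>+x. ennreal ((H (x + h) - \<phi> (x + h))\<^sup>2) \<partial>lborel) +
      2 * (2 * (\<integral>\<^sup>+x. ennreal ((\<phi> (x + h) - \<phi> x)\<^sup>2) \<partial>lborel) + 2 * (\<integral>\<^sup>+x. ennreal ((\<phi> x - H x)\<^sup>2) \<partial>lborel))"
      by (rule order_trans[OF C add_left_mono[OF mult_left_mono[OF D]]]) simp
    also have "\<dots> \<le> 2 * ennreal (\<kappa> / 8) + 2 * (2 * ennreal (\<kappa> / 16) + 2 * ennreal (\<kappa> / 8))"
      using A B H\<phi> by (intro add_mono mult_left_mono) (simp_all only: power2_commute[of "\<phi> x" "H x" for x] zero_le)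
    also have "\<dots> = ennreal (\<kappa> / 4 + 2 * (\<kappa> / 8 + \<kappa> / 4))"
    proof -
      have "2 * ennreal t = ennreal (2 * t)" if "0 \<le> t" for t using that by (simp add: ennreal_mult)
      then show ?thesis using \<kappa> by (simp add: ennreal_plus[symmetric] del: ennreal_plus)
    qed
    also have "\<dots> = ennreal \<kappa>" by simp
    finally show ?thesis .
  qed
  then show ?thesis using \<delta> by blast
qed

lemma integral_abs_le:
  fixes f g :: "'a \<Rightarrow> real"
  assumes "integrable M f" "integrable M g" "\<And>x. \<bar>f x\<bar> \<le> g x"
  shows "\<bar>LINT x|M. f x\<bar> \<le> (LINT x|M. g x)"
proof -
  have "\<bar>LINT x|M. f x\<bar> \<le> (LINT x|M. \<bar>f x\<bar>)" by (rule integral_abs_bound)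
  also have "\<dots> \<le> (LINT x|M. g x)" using assms by (intro integral_mono) auto
  finally show ?thesis .
qed

text \<open>The squared positive part of \<rho>^2 - |z - a|^2, written in coordinates so that the
  C^1 rules apply term by term.\<close>

definition bump :: "real^2 \<Rightarrow> real \<Rightarrow> real^2 \<Rightarrow> real" where
  "bump a \<rho> z = (max 0 (\<rho>\<^sup>2 - ((z $ 1 - a $ 1) * (z $ 1 - a $ 1) + (z $ 2 - a $ 2) * (z $ 2 - a $ 2))))\<^sup>2"

lemma bump_C1: "\<exists>g. C1_grad (bump a \<rho>) g"
  unfolding bump_def[abs_def]
  by (rule exI, rule C1_grad_max0_square[OF C1_grad_diff[OF C1_grad_const C1_grad_add[OF
      C1_grad_mult[OF C1_grad_diff[OF C1_grad_component C1_grad_const] C1_grad_diff[OF C1_grad_component C1_grad_const]]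
      C1_grad_mult[OF C1_grad_diff[OF C1_grad_component C1_grad_const] C1_grad_diff[OF C1_grad_component C1_grad_const]]]]])

lemma bump_eq: "bump a \<rho> z = (max 0 (\<rho>\<^sup>2 - (norm (z - a))\<^sup>2))\<^sup>2"
  by (simp add: bump_def power2_norm_eq_inner inner_vec_def sum_2)

lemma bump_nonneg: "0 \<le> bump a \<rho> z" by (simp add: bump_eq)

lemma bump_zero: "0 < \<rho> \<Longrightarrow> \<rho> \<le> norm (z - a) \<Longrightarrow> bump a \<rho> z = 0"
  using power_mono[of \<rho> "norm (z - a)" 2] by (simp add: bump_eq)

lemma bump_pos: "0 \<le> norm (z - a) \<Longrightarrow> norm (z - a) < \<rho> \<Longrightarrow> 0 < bump a \<rho> z"
  using power_strict_mono[of "norm (z - a)" \<rho> 2] by (simp add: bump_eq)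

lemma bump_le: "bump a \<rho> z \<le> (\<rho>\<^sup>2)\<^sup>2"
  unfolding bump_eq by (intro power_mono) auto

lemma bump_C1_compact: assumes "0 < \<rho>" "cball a \<rho> \<subseteq> U" shows "bump a \<rho> \<in> C1_compact U"
proof -
  obtain g where g: "C1_grad (bump a \<rho>) g" using bump_C1 by blast
  show ?thesis by (rule C1_grad_C1_compact(1)[OF g compact_cball assms(2)])
    (use bump_zero[OF assms(1)] in \<open>force simp: dist_norm norm_minus_commute\<close>)
qed

lemma bump_measurable[measurable]: "bump a \<rho> \<in> borel_measurable borel"
  using bump_C1[of a \<rho>] C1_grad_continuous borel_measurable_continuous_onI by blast

lemma bump_integrable: assumes "0 < \<rho>" shows "integrable lborel (bump a \<rho>)"
proof -
  have "(\<lambda>z::real^2. 1::real) \<in> L_loc 1" by (rule L_loc_1_bounded[of _ 1]) auto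
  from C1_compact_integrable_mult(1)[OF this bump_C1_compact[OF assms subset_UNIV]] show ?thesis by simp
qed

lemma bump_integral_pos: assumes "0 < \<rho>" shows "0 < (LINT z|lborel. bump a \<rho> z)"
proof -
  have "(LINT z|lborel. bump a \<rho> z) \<ge> 0" by (intro integral_nonneg_AE AE_I2 bump_nonneg)
  moreover have "(LINT z|lborel. bump a \<rho> z) \<noteq> 0"
  proof
    assume "(LINT z|lborel. bump a \<rho> z) = 0"
    then have "AE z in lborel. bump a \<rho> z = 0"
      using integral_nonneg_eq_0_iff_AE[OF bump_integrable[OF assms]] bump_nonneg by simp
    then have "AE z in lborel. z \<notin> ball a \<rho>"
      by eventually_elim (use bump_pos[of _ a \<rho>] in \<open>force simp: dist_norm norm_minus_commute\<close>)
    then have "emeasure lborel (ball a \<rho>) = 0" by (subst (asm) AE_iff_measurable[of "ball a \<rho>"]) auto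
    then have "measure lborel (ball a \<rho>) = 0" by (simp add: measure_def)
    then show False using content_ball_gt_0_iff[of a \<rho>] assms by simp
  qed
  ultimately show ?thesis by simp
qed

text \<open>Convolution of an integrable function with an even \<open>C\<^sup>1\<close> kernel; \<open>k (y - z)\<close> is used instead of
  \<open>k (z - y)\<close>, so that only translations are needed.\<close>

lemma C1_grad_convolution:
  fixes w :: "real^2 \<Rightarrow> real"
  assumes w: "integrable lborel w" and k: "C1_grad k g" and k0: "\<And>z. norm z > R \<Longrightarrow> k z = 0" "\<And>z. norm z > R \<Longrightarrow> g z = 0"
    and kB: "\<And>z. \<bar>k z\<bar> \<le> B" "\<And>z. norm (g z) \<le> B"
  shows "C1_grad (\<lambda>z. LINT y|lborel. w y * k (y - z)) (\<lambda>z. \<chi> j. - (LINT y|lborel. w y * g (y - z) $ j))"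
proof -
  have wm[measurable]: "w \<in> borel_measurable borel" using w by simp
  have km[measurable]: "k \<in> borel_measurable borel" using C1_grad_continuous[OF k] by (rule borel_measurable_continuous_onI)
  have gm[measurable]: "(\<lambda>z. g z $ j) \<in> borel_measurable borel" for j
    using C1_grad_continuous_grad[OF k] by (intro borel_measurable_continuous_onI continuous_intros)
  have int: "integrable lborel (\<lambda>y. w y * f (y - z))" if [measurable]: "f \<in> borel_measurable borel" and f: "\<And>z. \<bar>f z\<bar> \<le> B" for f :: "real^2 \<Rightarrow> real" and z
  proof (rule Bochner_Integration.integrable_bound)
    show "integrable lborel (\<lambda>y. B * w y)" using w by simp
    show "AE y in lborel. norm (w y * f (y - z)) \<le> norm (B * w y)"
      by (intro AE_I2) (simp add: abs_mult mult.commute[of "\<bar>w _\<bar>"] mult_right_mono[OF order_trans[OF f abs_ge_self]])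
  qed measurable
  have gB: "\<bar>g z $ j\<bar> \<le> B" for z j using component_le_norm_cart[of "g z" j] kB(2)[of z] by simp
  note ik = int[OF km kB(1)] and ig = int[OF gm gB]
  define W where "W = (LINT y|lborel. \<bar>w y\<bar>)"
  have W0: "0 \<le> W" by (simp add: W_def)
  have gU: "\<exists>\<delta>>0. \<forall>x h. norm h \<le> \<delta> \<longrightarrow> norm (g (x + h) - g x) \<le> e" if "e > 0" for e
    using uniformly_continuous_compact_support[OF C1_grad_continuous_grad[OF k] k0(2) that] by blast
  \<comment> \<open>The linearization error of the kernel. It is uniform in the base point because
    \<open>g\<close> is uniformly continuous, so integrating it against |w| gives differentiability
    of the convolution.\<close>
  have lin: "\<bar>k (x + h) - k x - g x \<bullet> h\<bar> \<le> norm h * e" if lh: "\<And>h'. norm h' \<le> norm h \<Longrightarrow> norm (g (x + h') - g x) \<le> e" for x h e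
  proof -
    have "norm (k (x + h) - k x - g x \<bullet> (x + h - x)) \<le> norm (x + h - x) * e"
    proof (rule differentiable_bound_linearization[where S="cball x (norm h)" and f'="\<lambda>x h. g x \<bullet> h"])
      show "x + t *\<^sub>R (x + h - x) \<in> cball x (norm h)" if "t \<in> {0..1}" for t
        using that by (simp add: dist_norm mult_left_le_one_le)
      show "onorm ((\<bullet>) (g y) - (\<bullet>) (g x)) \<le> e" if y: "y \<in> cball x (norm h)" for y
      proof -
        have ge: "norm (g y - g x) \<le> e" using lh[of "y - x"] y
          by (simp add: dist_norm norm_minus_commute)
        show ?thesis
        proof (rule onorm_le)
          fix v
          have "norm (((\<bullet>) (g y) - (\<bullet>) (g x)) v) = \<bar>(g y - g x) \<bullet> v\<bar>" by (simp add: inner_diff_left)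
          also have "\<dots> \<le> norm (g y - g x) * norm v" by (rule Cauchy_Schwarz_ineq2)
          also have "\<dots> \<le> e * norm v" using ge by (rule mult_right_mono) simp
          finally show "norm (((\<bullet>) (g y) - (\<bullet>) (g x)) v) \<le> e * norm v" .
        qed
      qed
      show "(k has_derivative (\<bullet>) (g y)) (at y within cball x (norm h))" for y using C1_gradD[OF k] by (rule has_derivative_at_withinI)
    qed simp
    then show ?thesis by simp
  qed
  define v where "v z = (LINT y|lborel. w y * k (y - z))" for z
  define L where "L z = (\<chi> j. - (LINT y|lborel. w y * g (y - z) $ j))" for z
  have Lh: "L z \<bullet> h = - (LINT y|lborel. w y * (g (y - z) \<bullet> h))" for z h
  proof -
    have "L z \<bullet> h = - ((LINT y|lborel. w y * g (y - z) $ 1) * h $ 1 + (LINT y|lborel. w y * g (y - z) $ 2) * h $ 2)"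
      by (simp add: L_def inner_vec_def sum_2)
    also have "(LINT y|lborel. w y * g (y - z) $ 1) * h $ 1 + (LINT y|lborel. w y * g (y - z) $ 2) * h $ 2
      = (LINT y|lborel. (w y * g (y - z) $ 1) * h $ 1 + (w y * g (y - z) $ 2) * h $ 2)"
      by (subst Bochner_Integration.integral_add) (auto intro: ig)
    also have "\<dots> = (LINT y|lborel. w y * (g (y - z) \<bullet> h))"
      by (intro Bochner_Integration.integral_cong refl) (simp add: inner_vec_def sum_2 algebra_simps)
    finally show ?thesis .
  qed
  have igh: "integrable lborel (\<lambda>y. w y * (g (y - z) \<bullet> h))" for z h
  proof -
    have "integrable lborel (\<lambda>y. (w y * g (y - z) $ 1) * h $ 1 + (w y * g (y - z) $ 2) * h $ 2)"
      by (intro Bochner_Integration.integrable_add integrable_mult_left ig)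
    then show ?thesis by (rule Bochner_Integration.integrable_cong[THEN iffD1, rotated -1]) (auto simp: inner_vec_def sum_2 algebra_simps)
  qed
  have wabs: "integrable lborel (\<lambda>y. \<bar>w y\<bar> * c)" for c using w by (intro integrable_mult_left integrable_abs)
  have der: "(v has_derivative (\<lambda>h. L z \<bullet> h)) (at z)" for z
    unfolding has_derivative_at_alt
  proof (intro conjI allI impI)
    show "bounded_linear ((\<bullet>) (L z))" by (rule bounded_linear_inner_right)
    fix e :: real assume e: "e > 0"
    define e' where "e' = e / (W + 1)"
    have e': "e' > 0" using e W0 by (simp add: e'_def)
    obtain \<delta> where \<delta>: "\<delta> > 0" "\<And>x h. norm h \<le> \<delta> \<Longrightarrow> norm (g (x + h) - g x) \<le> e'" using gU[OF e'] by blast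
    have "norm (v z' - v z - L z \<bullet> (z' - z)) \<le> e * norm (z' - z)" if z': "norm (z' - z) < \<delta>" for z'
    proof -
      define h where "h = z - z'"
      have h: "norm h < \<delta>" "norm (z' - z) = norm h" using z' by (auto simp: h_def norm_minus_commute)
      have "v z' - v z - L z \<bullet> (z' - z) = (LINT y|lborel. w y * k (y - z')) - (LINT y|lborel. w y * k (y - z)) + (LINT y|lborel. w y * (g (y - z) \<bullet> (z' - z)))"
        by (simp add: v_def Lh)
      also have "\<dots> = (LINT y|lborel. w y * k (y - z') - w y * k (y - z) + w y * (g (y - z) \<bullet> (z' - z)))"
        by (subst Bochner_Integration.integral_add, intro Bochner_Integration.integrable_diff ik, rule igh,
            subst Bochner_Integration.integral_diff[OF ik ik]) simp
      also have "\<bar>\<dots>\<bar> \<le> (LINT y|lborel. \<bar>w y\<bar> * (norm h * e'))"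
      proof (rule integral_abs_le)
        show "integrable lborel (\<lambda>y. w y * k (y - z') - w y * k (y - z) + w y * (g (y - z) \<bullet> (z' - z)))"
          by (intro Bochner_Integration.integrable_add Bochner_Integration.integrable_diff ik igh)
        show "integrable lborel (\<lambda>y. \<bar>w y\<bar> * (norm h * e'))" by (rule wabs)
        fix y
        have "w y * k (y - z') - w y * k (y - z) + w y * (g (y - z) \<bullet> (z' - z)) = w y * (k ((y - z) + h) - k (y - z) - g (y - z) \<bullet> h)"
          by (simp add: h_def algebra_simps inner_diff_right)
        then have "\<bar>w y * k (y - z') - w y * k (y - z) + w y * (g (y - z) \<bullet> (z' - z))\<bar> = \<bar>w y\<bar> * \<bar>k ((y - z) + h) - k (y - z) - g (y - z) \<bullet> h\<bar>"
          by (simp add: abs_mult)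
        also have "\<dots> \<le> \<bar>w y\<bar> * (norm h * e')" using \<delta>(2) h(1) by (intro mult_left_mono lin) auto
        finally show "\<bar>w y * k (y - z') - w y * k (y - z) + w y * (g (y - z) \<bullet> (z' - z))\<bar> \<le> \<bar>w y\<bar> * (norm h * e')" .
      qed
      also have "\<dots> = W * (norm h * e')" by (simp add: W_def)
      also have "\<dots> = (W / (W + 1)) * (e * norm h)" by (simp add: e'_def)
      also have "\<dots> \<le> 1 * (e * norm h)" using W0 e by (intro mult_right_mono) auto
      finally show ?thesis using h(2) by simp
    qed
    then show "\<exists>d>0. \<forall>y. norm (y - z) < d \<longrightarrow> norm (v y - v z - L z \<bullet> (y - z)) \<le> e * norm (y - z)" using \<delta>(1) by blast
  qed
  have "continuous_on UNIV (\<lambda>z. L z $ j)" for j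
  proof (rule continuous_on_iff[THEN iffD2], intro ballI allI impI)
    fix z and e :: real assume e: "e > 0"
    define e' where "e' = e / (W + 1) / 2"
    have e': "e' > 0" using e W0 by (simp add: e'_def)
    obtain \<delta> where \<delta>: "\<delta> > 0" "\<And>x h. norm h \<le> \<delta> \<Longrightarrow> norm (g (x + h) - g x) \<le> e'" using gU[OF e'] by blast
    have "dist (L z' $ j) (L z $ j) < e" if "dist z' z < \<delta>" for z'
    proof -
      have "L z' $ j - L z $ j = (LINT y|lborel. w y * g (y - z) $ j) - (LINT y|lborel. w y * g (y - z') $ j)" by (simp add: L_def)
      also have "\<dots> = (LINT y|lborel. w y * g (y - z) $ j - w y * g (y - z') $ j)" by (rule Bochner_Integration.integral_diff[OF ig ig, symmetric])
      also have "\<bar>\<dots>\<bar> \<le> (LINT y|lborel. \<bar>w y\<bar> * e')"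
      proof (rule integral_abs_le)
        show "integrable lborel (\<lambda>y. w y * g (y - z) $ j - w y * g (y - z') $ j)" by (intro Bochner_Integration.integrable_diff ig)
        show "integrable lborel (\<lambda>y. \<bar>w y\<bar> * e')" by (rule wabs)
        fix y
        have "\<bar>w y * g (y - z) $ j - w y * g (y - z') $ j\<bar> = \<bar>w y\<bar> * \<bar>(g (y - z' + (z' - z)) - g (y - z')) $ j\<bar>"
          by (simp add: abs_mult[symmetric] algebra_simps)
        also have "\<dots> \<le> \<bar>w y\<bar> * e'"
        proof (intro mult_left_mono)
          show "\<bar>(g (y - z' + (z' - z)) - g (y - z')) $ j\<bar> \<le> e'"
            by (rule order_trans[OF component_le_norm_cart \<delta>(2)]) (use that in \<open>simp add: dist_norm\<close>)
        qed simp
        finally show "\<bar>w y * g (y - z) $ j - w y * g (y - z') $ j\<bar> \<le> \<bar>w y\<bar> * e'" .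
      qed
      also have "\<dots> = W * e'" by (simp add: W_def)
      also have "\<dots> = (W / (W + 1)) * (e / 2)" by (simp add: e'_def)
      also have "\<dots> \<le> 1 * (e / 2)" using W0 e by (intro mult_right_mono) auto
      also have "\<dots> < e" using e by simp
      finally show ?thesis by (simp add: dist_real_def)
    qed
    then show "\<exists>d>0. \<forall>x'\<in>UNIV. dist x' z < d \<longrightarrow> dist (L x' $ j) (L z $ j) < e" using \<delta>(1) by blast
  qed
  then have "continuous_on UNIV (\<lambda>z. \<chi> j. L z $ j)" by (intro continuous_on_vec_lambda)
  then have "continuous_on UNIV L" by (simp add: vec_nth_inverse)
  then have "C1_grad v L" using der by (simp add: C1_grad_def)
  then show ?thesis unfolding v_def[abs_def] L_def[abs_def] .
qed

text \<open>The variance of \<open>f\<close> under the probability density \<open>\<eta>\<close> is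
  nonnegative.\<close>

lemma jensen_square:
  fixes f \<eta> :: "real^2 \<Rightarrow> real"
  assumes [measurable]: "f \<in> borel_measurable borel" "\<eta> \<in> borel_measurable borel" and \<eta>: "\<And>x. 0 \<le> \<eta> x" "integrable lborel \<eta>" "(LINT x|lborel. \<eta> x) = 1"
    and f: "integrable lborel (\<lambda>x. f x * \<eta> x)"
  shows "ennreal ((LINT x|lborel. f x * \<eta> x)\<^sup>2) \<le> (\<integral>\<^sup>+x. ennreal ((f x)\<^sup>2 * \<eta> x) \<partial>lborel)"
proof (cases "(\<integral>\<^sup>+x. ennreal ((f x)\<^sup>2 * \<eta> x) \<partial>lborel) = \<infinity>")
  case False
  then have int: "integrable lborel (\<lambda>x. (f x)\<^sup>2 * \<eta> x)"
    by (intro integrableI_nonneg) (auto simp: \<eta>(1) top.not_eq_extremum)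
  define c where "c = (LINT x|lborel. f x * \<eta> x)"
  have "0 \<le> (LINT x|lborel. (f x - c)\<^sup>2 * \<eta> x)" using \<eta>(1) by (intro integral_nonneg_AE AE_I2) auto
  also have "\<dots> = (LINT x|lborel. ((f x)\<^sup>2 * \<eta> x - 2 * c * (f x * \<eta> x)) + c\<^sup>2 * \<eta> x)"
    by (intro Bochner_Integration.integral_cong refl) (simp add: power2_eq_square algebra_simps)
  also have "\<dots> = (LINT x|lborel. (f x)\<^sup>2 * \<eta> x) - 2 * c * c + c\<^sup>2 * 1"
    using int f \<eta>(2) by (subst Bochner_Integration.integral_add, simp, simp, subst Bochner_Integration.integral_diff, simp, simp) (simp add: c_def \<eta>(3))
  finally have "c\<^sup>2 \<le> (LINT x|lborel. (f x)\<^sup>2 * \<eta> x)" by (simp add: power2_eq_square)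
  then have "ennreal (c\<^sup>2) \<le> ennreal (LINT x|lborel. (f x)\<^sup>2 * \<eta> x)" by (rule ennreal_leI)
  also have "\<dots> = (\<integral>\<^sup>+x. ennreal ((f x)\<^sup>2 * \<eta> x) \<partial>lborel)" using int \<eta>(1) by (intro nn_integral_eq_integral[symmetric]) auto
  finally show ?thesis by (simp add: c_def)
qed simp

text \<open>Testing the weak derivative with translates of the kernel shows that the gradient of the
  mollification is the mollification of \<open>H\<close>. By Jensen and Fubini its squared L^2
  distance to \<open>H j\<close> is at most an average of squared translation errors over shifts of
  norm at most \<delta>.\<close>

lemma mollification:
  fixes w :: "real^2 \<Rightarrow> real" and H :: "2 \<Rightarrow> real^2 \<Rightarrow> real"
  assumes w: "integrable lborel w" "AE z in lborel. z \<notin> Omega \<longrightarrow> w z = 0"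
    and H: "\<And>j. integrable lborel (H j)" "\<And>j. (\<integral>\<^sup>+z. ennreal ((H j z)\<^sup>2) \<partial>lborel) < \<infinity>" "\<And>j. weak_deriv j w (H j)" and \<kappa>: "\<kappa> > 0"
  shows "\<exists>v G. C1_grad v G \<and> (\<forall>z. v z \<noteq> 0 \<longrightarrow> z \<in> cbox (-1) 2) \<and> (\<forall>j. (\<integral>\<^sup>+z. ennreal ((G z $ j - H j z)\<^sup>2) \<partial>lborel) \<le> ennreal \<kappa>)"
proof -
  have Hm[measurable]: "H j \<in> borel_measurable borel" for j using H(1)[of j] by simp
  have "\<exists>\<delta>>0. \<delta> \<le> 1 \<and> (\<forall>h. norm h \<le> \<delta> \<longrightarrow> (\<integral>\<^sup>+x. ennreal ((H j (x + h) - H j x)\<^sup>2) \<partial>lborel) \<le> ennreal \<kappa>)" for j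
    by (rule L2_translation_continuous[OF Hm H(2) \<kappa>])
  then have "\<exists>d. \<forall>j. d j > 0 \<and> d j \<le> 1 \<and> (\<forall>h. norm h \<le> d j \<longrightarrow> (\<integral>\<^sup>+x. ennreal ((H j (x + h) - H j x)\<^sup>2) \<partial>lborel) \<le> ennreal \<kappa>)"
    by (intro choice allI)
  then obtain d where D: "\<forall>j. d j > 0 \<and> d j \<le> 1 \<and> (\<forall>h. norm h \<le> d j \<longrightarrow> (\<integral>\<^sup>+x. ennreal ((H j (x + h) - H j x)\<^sup>2) \<partial>lborel) \<le> ennreal \<kappa>)"
    by (rule exE)
  have d: "d j > 0" "d j \<le> 1" "norm h \<le> d j \<Longrightarrow> (\<integral>\<^sup>+x. ennreal ((H j (x + h) - H j x)\<^sup>2) \<partial>lborel) \<le> ennreal \<kappa>" for j h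
    using D by (simp_all only: simp_thms)
  \<comment> \<open>One kernel serves both directions; \<delta> \<le> 1 keeps the support in the
    square enlarged by 1 on each side.\<close>
  define \<delta> where "\<delta> = min (d 1) (d 2)"
  have \<delta>: "\<delta> > 0" "\<delta> \<le> 1" and \<delta>j: "\<delta> \<le> d j" for j using d(1,2) exhaust_2[of j] by (auto simp: \<delta>_def min_le_iff_disj)
  define c where "c = (LINT z|lborel. bump 0 \<delta> z)"
  have c: "c > 0" unfolding c_def by (rule bump_integral_pos[OF \<delta>(1)])
  define \<eta> where "\<eta> z = (1 / c) * bump 0 \<delta> z" for z
  obtain b where b: "C1_grad (bump 0 \<delta>) b" using bump_C1 by blast
  define g where "g z = bump 0 \<delta> z *\<^sub>R 0 + (1 / c) *\<^sub>R b z" for z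
  have \<eta>g: "C1_grad \<eta> g" unfolding \<eta>_def[abs_def] g_def[abs_def] by (rule C1_grad_mult[OF C1_grad_const b])
  have \<eta>0: "\<eta> z = 0" if "norm z \<ge> \<delta>" for z using bump_zero[OF \<delta>(1), of z 0] that by (simp add: \<eta>_def)
  have \<eta>nn: "0 \<le> \<eta> z" for z using c bump_nonneg by (simp add: \<eta>_def)
  have K: "z \<in> cball 0 \<delta>" if "\<eta> z \<noteq> 0" for z using \<eta>0[of z] that by (cases "\<delta> \<le> norm z") auto
  have \<eta>C: "\<eta> \<in> C1_compact UNIV" and pd: "partial_deriv j \<eta> z = g z $ j" for j z
    using C1_grad_C1_compact[OF \<eta>g compact_cball subset_UNIV K] by blast+
  have g0: "g z = 0" if "norm z > \<delta>" for z
  proof -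
    have "((\<lambda>z. 0) has_derivative (\<lambda>h. g z \<bullet> h)) (at z)"
    proof (rule has_derivative_transform_within_open[OF C1_gradD[OF \<eta>g]])
      show "open (- cball (0::real^2) \<delta>)" by (intro open_Compl closed_cball)
    qed (use that \<eta>0 in auto)
    moreover have "((\<lambda>z. 0) has_derivative (\<lambda>h. 0)) (at z)" by simp
    ultimately have "(\<lambda>h. g z \<bullet> h) = (\<lambda>h. 0)" by (rule has_derivative_unique)
    then have "g z \<bullet> g z = 0" by meson
    then show ?thesis by simp
  qed
  obtain B where B: "\<And>z. \<bar>\<eta> z\<bar> \<le> B" "\<And>z. norm (g z) \<le> B"
  proof -
    obtain K B where "compact K" "B \<ge> 0" and KB: "\<And>z. \<bar>\<eta> z\<bar> \<le> B" "\<And>z j. \<bar>partial_deriv j \<eta> z\<bar> \<le> B"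
      by (rule C1_compact_bounded[OF \<eta>C]) blast
    have "norm (g z) \<le> B + B" for z
      using norm_le_l1_cart[of "g z"] KB(2)[of 1 z] KB(2)[of 2 z] by (simp add: sum_2 pd)
    moreover have "\<bar>\<eta> z\<bar> \<le> B + B" for z using KB(1)[of z] \<open>B \<ge> 0\<close> by linarith
    ultimately show ?thesis using that by blast
  qed
  have \<eta>m[measurable]: "\<eta> \<in> borel_measurable borel" unfolding \<eta>_def by measurable
  have \<eta>i: "integrable lborel \<eta>" "(LINT z|lborel. \<eta> z) = 1"
    using bump_integrable[OF \<delta>(1), of 0] c unfolding \<eta>_def by (auto simp: c_def)
  define v where "v z = (LINT y|lborel. w y * \<eta> (y - z))" for z
  define G where "G z = (\<chi> j. - (LINT y|lborel. w y * g (y - z) $ j))" for z :: "real^2"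
  have vG: "C1_grad v G" unfolding v_def[abs_def] G_def[abs_def]
    by (rule C1_grad_convolution[OF w(1) \<eta>g, of \<delta> B]) (use \<eta>0 g0 B in auto)
  have supp: "z \<in> cbox (-1) 2" if "v z \<noteq> 0" for z
  proof (rule ccontr)
    assume z: "z \<notin> cbox (-1) 2"
    have "AE y in lborel. w y * \<eta> (y - z) = 0"
      using w(2)
    proof eventually_elim
      case (elim y)
      show ?case
      proof (cases "y \<in> Omega")
        case True
        have "norm (y - z) \<ge> 1"
        proof (rule ccontr)
          assume "\<not> norm (y - z) \<ge> 1"
          then have "\<bar>y $ k - z $ k\<bar> < 1" for k using component_le_norm_cart[of "y - z" k] by simp
          then have "z \<in> cbox (-1) 2" using True unfolding Omega_def mem_box_cart
            by (auto simp: forall_2 abs_less_iff) (smt (verit))+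
          then show False using z by simp
        qed
        then show ?thesis using \<eta>0[of "y - z"] \<delta>(2) by simp
      qed (use elim in simp)
    qed
    then have "v z = 0" unfolding v_def by (subst integral_eq_zero_AE) auto
    then show False using that by simp
  qed
  have Gj: "G z $ j = (LINT x|lborel. H j (x + z) * \<eta> x)" for z j
  proof -
    have "C1_grad (\<lambda>y. \<eta> (y + (- z))) (\<lambda>y. g (y + (- z)))" by (rule C1_grad_shift[OF \<eta>g])
    then have s: "C1_grad (\<lambda>y. \<eta> (y - z)) (\<lambda>y. g (y - z))" by simp
    have K': "y \<in> cball z \<delta>" if "\<eta> (y - z) \<noteq> 0" for y using K[OF that] by (simp add: dist_norm norm_minus_commute)
    have C: "(\<lambda>y. \<eta> (y - z)) \<in> C1_compact UNIV" and P: "partial_deriv j (\<lambda>y. \<eta> (y - z)) y = g (y - z) $ j" for y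
      using C1_grad_C1_compact[OF s compact_cball subset_UNIV K'] by auto
    have "(LINT y|lborel. w y * g (y - z) $ j) = - (LINT y|lborel. H j y * \<eta> (y - z))"
      using H(3)[of j] C unfolding weak_deriv_def P[symmetric] by blast
    then have "G z $ j = (LINT y|lborel. H j y * \<eta> (y - z))" by (simp add: G_def)
    also have "\<dots> = (LINT x|lborel. H j (x + z) * \<eta> x)" using integral_translation[of "\<lambda>y. H j y * \<eta> (y - z)" z] by simp
    finally show ?thesis .
  qed
  have "(\<integral>\<^sup>+z. ennreal ((G z $ j - H j z)\<^sup>2) \<partial>lborel) \<le> ennreal \<kappa>" for j
  proof -
    have i1: "integrable lborel (\<lambda>x. H j (x + z) * \<eta> x)" for z
    proof (rule Bochner_Integration.integrable_bound)
      show "integrable lborel (\<lambda>x. B * H j (x + z))" by (intro integrable_mult_right integrable_translation H(1))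
      show "AE x in lborel. norm (H j (x + z) * \<eta> x) \<le> norm (B * H j (x + z))"
        by (intro AE_I2) (simp add: abs_mult mult.commute[of "\<bar>H j _\<bar>"] mult_right_mono[OF order_trans[OF B(1) abs_ge_self]])
    qed measurable
    have "(\<integral>\<^sup>+z. ennreal ((G z $ j - H j z)\<^sup>2) \<partial>lborel) \<le> (\<integral>\<^sup>+z. \<integral>\<^sup>+x. ennreal ((H j (x + z) - H j z)\<^sup>2 * \<eta> x) \<partial>lborel \<partial>lborel)"
    proof (rule nn_integral_mono)
      fix z
      have i2: "integrable lborel (\<lambda>x. H j z * \<eta> x)" using \<eta>i by simp
      have e: "G z $ j - H j z = (LINT x|lborel. (H j (x + z) - H j z) * \<eta> x)"
        unfolding Gj left_diff_distrib Bochner_Integration.integral_diff[OF i1 i2] using \<eta>i by simp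
      show "ennreal ((G z $ j - H j z)\<^sup>2) \<le> (\<integral>\<^sup>+x. ennreal ((H j (x + z) - H j z)\<^sup>2 * \<eta> x) \<partial>lborel)"
        unfolding e using \<eta>nn \<eta>i Bochner_Integration.integrable_diff[OF i1 i2] by (intro jensen_square) (auto simp: left_diff_distrib)
    qed
    also have "\<dots> = (\<integral>\<^sup>+x. \<integral>\<^sup>+z. ennreal ((H j (x + z) - H j z)\<^sup>2 * \<eta> x) \<partial>lborel \<partial>lborel)"
      by (rule lborel_pair.Fubini') measurable
    also have "\<dots> = (\<integral>\<^sup>+x. ennreal (\<eta> x) * (\<integral>\<^sup>+z. ennreal ((H j (z + x) - H j z)\<^sup>2) \<partial>lborel) \<partial>lborel)"
      by (intro nn_integral_cong) (simp add: nn_integral_cmult[symmetric] ennreal_mult[symmetric] \<eta>nn mult.commute add.commute)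
    also have "\<dots> \<le> (\<integral>\<^sup>+x. ennreal (\<eta> x) * ennreal \<kappa> \<partial>lborel)"
    proof (rule nn_integral_mono)
      fix x
      show "ennreal (\<eta> x) * (\<integral>\<^sup>+z. ennreal ((H j (z + x) - H j z)\<^sup>2) \<partial>lborel) \<le> ennreal (\<eta> x) * ennreal \<kappa>"
      proof (cases "norm x \<le> \<delta>")
        case True
        then show ?thesis using d(3)[of x j] \<delta>j[of j] by (intro mult_left_mono) auto
      next
        case False then show ?thesis using \<eta>0[of x] by simp
      qed
    qed
    also have "\<dots> = (\<integral>\<^sup>+x. ennreal (\<eta> x) \<partial>lborel) * ennreal \<kappa>" by (rule nn_integral_multc) measurable
    also have "(\<integral>\<^sup>+x. ennreal (\<eta> x) \<partial>lborel) = 1" using nn_integral_eq_integral[OF \<eta>i(1)] \<eta>nn \<eta>i(2) by simp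
    finally show ?thesis by simp
  qed
  then show ?thesis using vG supp by blast
qed

section \<open>Estimates for low-energy functions\<close>

text \<open>A class closed under sums, products, squares, absolute values and translations, so that
  integrability in the lower bounds follows from introduction rules.\<close>

definition bdd_supp :: "(real^2 \<Rightarrow> real) \<Rightarrow> bool" where
  "bdd_supp f \<longleftrightarrow> f \<in> borel_measurable borel \<and> (\<exists>K B. compact K \<and> (\<forall>x. \<bar>f x\<bar> \<le> B) \<and> (\<forall>x. x \<notin> K \<longrightarrow> f x = 0))"

lemma bdd_suppI: "f \<in> borel_measurable borel \<Longrightarrow> compact K \<Longrightarrow> (\<And>x. \<bar>f x\<bar> \<le> B) \<Longrightarrow> (\<And>x. x \<notin> K \<Longrightarrow> f x = 0) \<Longrightarrow> bdd_supp f"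
  unfolding bdd_supp_def by blast

lemma bdd_supp_integrable: assumes "bdd_supp f" shows "integrable lborel f"
proof -
  obtain K B where K: "f \<in> borel_measurable borel" "compact K" "\<And>x. \<bar>f x\<bar> \<le> B" "\<And>x. x \<notin> K \<Longrightarrow> f x = 0"
    using assms unfolding bdd_supp_def by blast
  have "(\<lambda>z::real^2. 1::real) \<in> L_loc 1" by (rule L_loc_1_bounded[of _ 1]) auto
  from L_loc_integrable_mult[OF this K(1,3,2,4)] show ?thesis by simp
qed

lemma bdd_supp_mult:
  assumes "bdd_supp f" and g: "g \<in> borel_measurable borel" "\<And>x. \<bar>g x\<bar> \<le> C"
  shows "bdd_supp (\<lambda>x. f x * g x)"
proof -
  obtain K B where K: "f \<in> borel_measurable borel" "compact K" "\<And>x. \<bar>f x\<bar> \<le> B" "\<And>x. x \<notin> K \<Longrightarrow> f x = 0"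
    using assms(1) unfolding bdd_supp_def by blast
  have B: "0 \<le> B" using K(3)[of 0] by linarith
  show ?thesis
  proof (rule bdd_suppI[OF _ K(2)])
    show "(\<lambda>x. f x * g x) \<in> borel_measurable borel" using K(1) g(1) by simp
    show "\<bar>f x * g x\<bar> \<le> B * C" for x unfolding abs_mult by (intro mult_mono K(3) g(2) B) simp
  qed (simp add: K(4))
qed

lemma bdd_supp_mult2: assumes "bdd_supp f" "bdd_supp g" shows "bdd_supp (\<lambda>x. f x * g x)"
proof -
  obtain B where B: "g \<in> borel_measurable borel" "\<And>x. \<bar>g x\<bar> \<le> B" using assms(2) unfolding bdd_supp_def by blast
  show ?thesis by (rule bdd_supp_mult[OF assms(1) B])
qed

lemma bdd_supp_cmult: assumes "bdd_supp f" shows "bdd_supp (\<lambda>x. c * f x)"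
  using bdd_supp_mult[OF assms, of "\<lambda>x. c" "\<bar>c\<bar>"] by (simp add: mult.commute)

lemma bdd_supp_power2: "bdd_supp f \<Longrightarrow> bdd_supp (\<lambda>x. (f x)\<^sup>2)"
  unfolding power2_eq_square by (rule bdd_supp_mult2)

lemma bdd_supp_add: assumes "bdd_supp f" "bdd_supp g" shows "bdd_supp (\<lambda>x. f x + g x)"
proof -
  obtain K B where K: "f \<in> borel_measurable borel" "compact K" "\<And>x. \<bar>f x\<bar> \<le> B" "\<And>x. x \<notin> K \<Longrightarrow> f x = 0"
    using assms(1) unfolding bdd_supp_def by blast
  obtain L C where L: "g \<in> borel_measurable borel" "compact L" "\<And>x. \<bar>g x\<bar> \<le> C" "\<And>x. x \<notin> L \<Longrightarrow> g x = 0"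
    using assms(2) unfolding bdd_supp_def by blast
  show ?thesis
  proof (rule bdd_suppI[of _ "K \<union> L" "B + C"])
    show "\<bar>f x + g x\<bar> \<le> B + C" for x using K(3)[of x] L(3)[of x] by linarith
  qed (use K L in auto)
qed

lemma bdd_supp_diff: "bdd_supp f \<Longrightarrow> bdd_supp g \<Longrightarrow> bdd_supp (\<lambda>x. f x - g x)"
  using bdd_supp_add[of f "\<lambda>x. -1 * g x"] bdd_supp_cmult[of g "-1"] by simp

lemma bdd_supp_abs: "bdd_supp f \<Longrightarrow> bdd_supp (\<lambda>x. \<bar>f x\<bar>)"
  unfolding bdd_supp_def by auto

lemma bdd_supp_shift: assumes "bdd_supp f" shows "bdd_supp (\<lambda>x. f (x + c))"
proof -
  obtain K B where K: "f \<in> borel_measurable borel" "compact K" "\<And>x. \<bar>f x\<bar> \<le> B" "\<And>x. x \<notin> K \<Longrightarrow> f x = 0"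
    using assms(1) unfolding bdd_supp_def by blast
  show ?thesis
  proof (rule bdd_suppI[of _ "(\<lambda>x. - c + x) ` K"])
    show "(\<lambda>x. f (x + c)) \<in> borel_measurable borel" using K(1) by measurable
    show "compact ((\<lambda>x. - c + x) ` K)" by (rule compact_translation[OF K(2)])
    fix x assume x: "x \<notin> (\<lambda>x. - c + x) ` K"
    have "x = - c + (x + c)" by simp
    then have "x + c \<notin> K" using x by blast
    then show "f (x + c) = 0" by (rule K(4))
  qed (rule K(3))
qed

lemma bdd_supp_C1:
  assumes "\<phi> \<in> C1_compact U" shows "bdd_supp \<phi>" "bdd_supp (partial_deriv j \<phi>)"
proof -
  obtain K B where K: "compact K" "\<And>x. x \<notin> K \<Longrightarrow> \<phi> x = 0" "\<And>x. \<bar>\<phi> x\<bar> \<le> B"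
    "\<And>x j. x \<notin> K \<Longrightarrow> partial_deriv j \<phi> x = 0" "\<And>x j. \<bar>partial_deriv j \<phi> x\<bar> \<le> B"
    "\<And>j. continuous_on UNIV (partial_deriv j \<phi>)" using C1_compact_bounded[OF assms] by metis
  show "bdd_supp \<phi>"
    using borel_measurable_continuous_onI[OF C1_compact_continuous[OF assms]] K(1,3,2) by (rule bdd_suppI)
  show "bdd_supp (partial_deriv j \<phi>)"
    using borel_measurable_continuous_onI[OF K(6)] K(1,5,4) by (rule bdd_suppI)
qed

lemma bdd_supp_indicator: "bdd_supp (indicator (box a b))" "bdd_supp (indicator (cbox a b))"
  by (rule bdd_suppI[of _ "cbox a b" 1]; use box_subset_cbox in \<open>force simp: indicator_def\<close>)+

lemma partial_deriv_zero_outside: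
  assumes "v \<in> C1_compact U" "\<And>z. v z \<noteq> 0 \<Longrightarrow> z \<in> K" "closed K" "z \<notin> K"
  shows "partial_deriv j v z = 0"
proof -
  obtain g where g: "\<And>x j. partial_deriv j v x = g x $ j" "\<And>x. x \<notin> closure {x. v x \<noteq> 0} \<Longrightarrow> g x = 0"
    using C1_compact_gradE[OF assms(1)] by metis
  have "closure {x. v x \<noteq> 0} \<subseteq> K" using assms(2,3) by (intro closure_minimal) auto
  then have "z \<notin> closure {x. v x \<noteq> 0}" using assms(4) by blast
  then show ?thesis unfolding g(1) using g(2)[of z] by simp
qed

lemma C1_compact_shift:
  assumes "\<phi> \<in> C1_compact V" "compact K" "K \<subseteq> U" "\<And>z. \<phi> (z + c) \<noteq> 0 \<Longrightarrow> z \<in> K"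
  shows "(\<lambda>z. \<phi> (z + c)) \<in> C1_compact U" "partial_deriv j (\<lambda>z. \<phi> (z + c)) z = partial_deriv j \<phi> (z + c)"
proof -
  obtain g where g: "C1_grad \<phi> g" "\<And>x j. partial_deriv j \<phi> x = g x $ j" using C1_compact_C1_grad[OF assms(1)] by metis
  show "(\<lambda>z. \<phi> (z + c)) \<in> C1_compact U" "partial_deriv j (\<lambda>z. \<phi> (z + c)) z = partial_deriv j \<phi> (z + c)"
    using C1_grad_C1_compact[OF C1_grad_shift[OF g(1)] assms(2-4)] g(2) by auto
qed

lemma C1_compact_shift_UNIV:
  fixes \<phi> :: "real^2 \<Rightarrow> real"
  assumes "\<phi> \<in> C1_compact V"
  shows "(\<lambda>z. \<phi> (z + c)) \<in> C1_compact UNIV" "partial_deriv j (\<lambda>z. \<phi> (z + c)) z = partial_deriv j \<phi> (z + c)"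
proof -
  obtain K where K: "compact K" "\<And>x. x \<notin> K \<Longrightarrow> \<phi> x = 0" using C1_compact_bounded[OF assms] by metis
  have K': "z \<in> (\<lambda>x. - c + x) ` K" if "\<phi> (z + c) \<noteq> 0" for z
  proof -
    have "z = - c + (z + c)" by simp
    then show ?thesis using K(2)[of "z + c"] that by blast
  qed
  show "(\<lambda>z. \<phi> (z + c)) \<in> C1_compact UNIV" "partial_deriv j (\<lambda>z. \<phi> (z + c)) z = partial_deriv j \<phi> (z + c)"
    by (rule C1_compact_shift[OF assms compact_translation[OF K(1)] subset_UNIV K'], assumption)+
qed

lemma C1_compact_diff:
  fixes \<phi> \<psi> :: "real^2 \<Rightarrow> real"
  assumes "\<phi> \<in> C1_compact U" "\<psi> \<in> C1_compact U"
  shows "(\<lambda>z. \<phi> z - \<psi> z) \<in> C1_compact U" "partial_deriv j (\<lambda>z. \<phi> z - \<psi> z) z = partial_deriv j \<phi> z - partial_deriv j \<psi> z"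
proof -
  obtain g K where g: "C1_grad \<phi> g" "compact K" "K \<subseteq> U" "\<And>x. \<phi> x \<noteq> 0 \<Longrightarrow> x \<in> K" "\<And>x j. partial_deriv j \<phi> x = g x $ j"
    using C1_compact_C1_grad[OF assms(1)] by metis
  obtain g' K' where g': "C1_grad \<psi> g'" "compact K'" "K' \<subseteq> U" "\<And>x. \<psi> x \<noteq> 0 \<Longrightarrow> x \<in> K'" "\<And>x j. partial_deriv j \<psi> x = g' x $ j"
    using C1_compact_C1_grad[OF assms(2)] by metis
  have KU: "K \<union> K' \<subseteq> U" using g(3) g'(3) by blast
  have KK: "x \<in> K \<union> K'" if "\<phi> x - \<psi> x \<noteq> 0" for x using g(4)[of x] g'(4)[of x] that by (cases "\<phi> x = 0") auto
  from C1_grad_C1_compact[OF C1_grad_diff[OF g(1) g'(1)] compact_Un[OF g(2) g'(2)] KU KK]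
  show "(\<lambda>z. \<phi> z - \<psi> z) \<in> C1_compact U" "partial_deriv j (\<lambda>z. \<phi> z - \<psi> z) z = partial_deriv j \<phi> z - partial_deriv j \<psi> z"
    by (auto simp: g(5) g'(5))
qed

text \<open>The Cauchy-Schwarz inequality with a free parameter \<open>t\<close>, to be chosen
  according to the known sizes of the two norms.\<close>

lemma young_integral:
  assumes "bdd_supp a" "bdd_supp b" "0 < t"
  shows "(LINT z|lborel. \<bar>a z * b z\<bar>) \<le> (t * (LINT z|lborel. (a z)\<^sup>2) + (LINT z|lborel. (b z)\<^sup>2) / t) / 2"
proof -
  have a2: "integrable lborel (\<lambda>z. (a z)\<^sup>2)" and b2: "integrable lborel (\<lambda>z. (b z)\<^sup>2)"
    by (intro bdd_supp_integrable bdd_supp_power2 assms)+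
  have "(LINT z|lborel. \<bar>a z * b z\<bar>) \<le> (LINT z|lborel. (t * (a z)\<^sup>2 + (b z)\<^sup>2 / t) / 2)"
  proof (rule integral_mono)
    show "integrable lborel (\<lambda>z. \<bar>a z * b z\<bar>)" by (intro bdd_supp_integrable bdd_supp_abs bdd_supp_mult2 assms)
    show "integrable lborel (\<lambda>z. (t * (a z)\<^sup>2 + (b z)\<^sup>2 / t) / 2)" using a2 b2 by auto
    fix z
    have "0 \<le> (t * \<bar>a z\<bar> - \<bar>b z\<bar>)\<^sup>2 / t" using assms(3) by simp
    also have "\<dots> = t * (a z)\<^sup>2 + (b z)\<^sup>2 / t - 2 * \<bar>a z * b z\<bar>"
      using assms(3) by (simp add: power2_eq_square field_simps abs_mult)
    finally show "\<bar>a z * b z\<bar> \<le> (t * (a z)\<^sup>2 + (b z)\<^sup>2 / t) / 2" by simp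
  qed
  also have "\<dots> = (t * (LINT z|lborel. (a z)\<^sup>2) + (LINT z|lborel. (b z)\<^sup>2) / t) / 2" using a2 b2 by simp
  finally show ?thesis .
qed

text \<open>Convolving \<open>w\<close> with \<open>v\<close> gives a C^1 function even if
  \<open>w\<close> is rough. The mean value theorem for this function yields a single \<tau> for the
  whole integral.\<close>

lemma integral_shift_mvt:
  fixes v :: "real^2 \<Rightarrow> real"
  assumes w: "integrable lborel w" and v: "v \<in> C1_compact U" and s: "0 < s"
  shows "\<exists>\<tau>. 0 < \<tau> \<and> \<tau> < s \<and> (LINT z|lborel. w z * v (z + axis i s)) - (LINT z|lborel. w z * v z) = s * (LINT z|lborel. w z * partial_deriv i v (z + axis i \<tau>))"
proof -
  obtain g K where g: "C1_grad v g" "compact K" "\<And>x. v x \<noteq> 0 \<Longrightarrow> x \<in> K" "\<And>x j. partial_deriv j v x = g x $ j" "\<And>x. x \<notin> K \<Longrightarrow> g x = 0"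
    using C1_compact_C1_grad[OF v] by metis
  obtain B where B: "\<And>z. \<bar>v z\<bar> \<le> B" "\<And>z j. \<bar>partial_deriv j v z\<bar> \<le> B"
    using C1_compact_bounded[OF v] by metis
  have B0: "0 \<le> B" using B(1)[of 0] by linarith
  obtain R where R: "\<And>z. z \<in> K \<Longrightarrow> norm z \<le> R" using compact_imp_bounded[OF g(2)] bounded_iff by metis
  have gB: "norm (g z) \<le> B + B" for z
    using norm_le_l1_cart[of "g z"] B(2)[of 1 z] B(2)[of 2 z] by (simp add: sum_2 g(4))
  have vB: "\<bar>v z\<bar> \<le> B + B" for z using B(1)[of z] B0 by linarith
  define c where "c z = (LINT y|lborel. w y * v (y - z))" for z
  define cg where "cg z = (\<chi> j. - (LINT y|lborel. w y * g (y - z) $ j))" for z :: "real^2"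
  have R': "v z = 0" "g z = 0" if "norm z > R" for z using R[of z] g(3)[of z] g(5)[of z] that by force+
  have C: "C1_grad c cg" unfolding c_def[abs_def] cg_def[abs_def]
    by (rule C1_grad_convolution[OF w g(1) R' vB gB])
  have der: "((\<lambda>t. c (- axis i t)) has_real_derivative (LINT y|lborel. w y * g (y + axis i t) $ i)) (at t)" for t :: real
  proof -
    have "((\<lambda>t. t *\<^sub>R (- axis i 1 :: real^2)) has_derivative (\<lambda>h. h *\<^sub>R (- axis i 1))) (at t)"
      by (auto intro!: derivative_eq_intros)
    moreover have "(\<lambda>t. t *\<^sub>R (- axis i 1 :: real^2)) = (\<lambda>t. - axis i t)" by (simp add: fun_eq_iff vec_eq_iff axis_def)
    ultimately have "((\<lambda>t. - axis i t :: real^2) has_derivative (\<lambda>h. h *\<^sub>R (- axis i 1))) (at t)"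
      by (rule back_subst[of "\<lambda>f. (f has_derivative (\<lambda>h. h *\<^sub>R (- axis i 1))) (at t)"])
    from has_derivative_compose[OF this C1_gradD[OF C]]
    have "((\<lambda>t. c (- axis i t)) has_derivative (\<lambda>h. cg (- axis i t) \<bullet> (h *\<^sub>R (- axis i 1)))) (at t)" .
    moreover have "cg (- axis i t) \<bullet> (h *\<^sub>R (- axis i 1)) = (LINT y|lborel. w y * g (y + axis i t) $ i) * h" for h
      by (simp add: cg_def inner_axis)
    ultimately show ?thesis by (simp add: has_field_derivative_def)
  qed
  obtain \<tau> where "0 < \<tau>" "\<tau> < s" "c (- axis i s) - c (- axis i 0) = (s - 0) * (LINT y|lborel. w y * g (y + axis i \<tau>) $ i)"
    using MVT2[OF s, of "\<lambda>t. c (- axis i t)", OF der] by blast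
  moreover have "axis i (0::real) = (0 :: real^2)" by (simp add: vec_eq_iff axis_def)
  ultimately show ?thesis by (auto simp: c_def g(4))
qed

text \<open>The mean value formula is applied with the increment itself as weight \<open>w\<close>;
  by Young's inequality half of the left side is then absorbed.\<close>

lemma square_integral_shift_le:
  fixes v :: "real^2 \<Rightarrow> real"
  assumes v: "v \<in> C1_compact U" and s: "0 < s"
  shows "(LINT z|lborel. (v (z + axis i s) - v z)\<^sup>2) \<le> s\<^sup>2 * (LINT z|lborel. (partial_deriv i v z)\<^sup>2)"
proof -
  define g where "g z = v (z + axis i s) - v z" for z
  have b: "bdd_supp v" "bdd_supp (partial_deriv i v)" using bdd_supp_C1[OF v] by auto
  have gb: "bdd_supp g" unfolding g_def[abs_def] by (intro bdd_supp_diff bdd_supp_shift b)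
  obtain \<tau> where \<tau>: "(LINT z|lborel. g z * v (z + axis i s)) - (LINT z|lborel. g z * v z) = s * (LINT z|lborel. g z * partial_deriv i v (z + axis i \<tau>))"
    using integral_shift_mvt[OF bdd_supp_integrable[OF gb] v s] by blast
  define D where "D = (LINT z|lborel. (partial_deriv i v z)\<^sup>2)"
  have D: "(LINT z|lborel. (partial_deriv i v (z + axis i \<tau>))\<^sup>2) = D"
    unfolding D_def by (rule integral_translation)
  have "(LINT z|lborel. (g z)\<^sup>2) = (LINT z|lborel. g z * v (z + axis i s) - g z * v z)"
    by (intro Bochner_Integration.integral_cong refl) (simp add: g_def power2_eq_square algebra_simps)
  also have "\<dots> = s * (LINT z|lborel. g z * partial_deriv i v (z + axis i \<tau>))"
    unfolding \<tau>[symmetric] by (intro Bochner_Integration.integral_diff bdd_supp_integrable bdd_supp_mult2 gb b bdd_supp_shift)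
  also have "\<dots> \<le> s * (LINT z|lborel. \<bar>g z * partial_deriv i v (z + axis i \<tau>)\<bar>)"
    using s by (intro mult_left_mono integral_mono bdd_supp_integrable bdd_supp_abs bdd_supp_mult2 gb b bdd_supp_shift) auto
  also have "\<dots> \<le> s * (((1 / s) * (LINT z|lborel. (g z)\<^sup>2) + D / (1 / s)) / 2)"
    using young_integral[OF gb bdd_supp_shift[OF b(2)], of "1 / s" "axis i \<tau>"] s by (intro mult_left_mono) (auto simp: D)
  also have "\<dots> = (LINT z|lborel. (g z)\<^sup>2) / 2 + s\<^sup>2 * D / 2" using s by (simp add: field_simps power2_eq_square)
  finally show ?thesis by (simp add: g_def D_def)
qed

text \<open>The integral of \<partial>_j (z_j v^2) = v^2 + 2 z_j v \<partial>_j v vanishes, |z_j|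
  \<le> 2 on the support, and 4 |v| |\<partial>_j v| \<le> v^2 / 2 + 8 (\<partial>_j v)^2. A single
  direction is enough, so each component of the deformation is controlled by its off-diagonal
  derivative.\<close>

lemma poincare:
  fixes v :: "real^2 \<Rightarrow> real"
  assumes v: "v \<in> C1_compact U" and supp: "\<And>z. v z \<noteq> 0 \<Longrightarrow> z \<in> cbox (-1) 2"
  shows "(LINT z|lborel. (v z)\<^sup>2) \<le> 16 * (LINT z|lborel. (partial_deriv j v z)\<^sup>2)"
proof -
  obtain g where g: "C1_grad v g" "\<And>x j. partial_deriv j v x = g x $ j"
    using C1_compact_C1_grad[OF v] by metis
  have C: "C1_grad (\<lambda>z. z $ j * (v z * v z)) (\<lambda>z. (v z * v z) *\<^sub>R axis j 1 + z $ j *\<^sub>R (v z *\<^sub>R g z + v z *\<^sub>R g z))"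
    by (intro C1_grad_mult C1_grad_component g(1))
  have K: "z \<in> cbox (-1) 2" if "z $ j * (v z * v z) \<noteq> 0" for z using supp[of z] that by auto
  define p where "p = partial_deriv j (\<lambda>z. z $ j * (v z * v z))"
  have pC: "(\<lambda>z. z $ j * (v z * v z)) \<in> C1_compact UNIV" by (rule C1_grad_C1_compact(1)[OF C compact_cbox subset_UNIV K])
  have p: "p z = (v z)\<^sup>2 + 2 * (z $ j * v z * partial_deriv j v z)" for z
    using C1_grad_C1_compact(2)[OF C compact_cbox subset_UNIV K, of j z] by (simp add: p_def g(2) power2_eq_square)
  have p0: "(LINT z|lborel. p z) = 0" unfolding p_def by (rule integral_partial_deriv_zero[OF pC])
  have pi: "integrable lborel p" unfolding p_def by (rule bdd_supp_integrable[OF bdd_supp_C1(2)[OF pC]])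
  have vi: "integrable lborel (\<lambda>z. (v z)\<^sup>2)" and di: "integrable lborel (\<lambda>z. (partial_deriv j v z)\<^sup>2)"
    by (intro bdd_supp_integrable bdd_supp_power2 bdd_supp_C1[OF v])+
  have "(LINT z|lborel. (v z)\<^sup>2) \<le> (LINT z|lborel. p z + (v z)\<^sup>2 / 2 + 8 * (partial_deriv j v z)\<^sup>2)"
  proof (rule integral_mono)
    fix z
    define d where "d = partial_deriv j v z"
    have "\<bar>z $ j * v z\<bar> \<le> 2 * \<bar>v z\<bar>"
    proof (cases "v z = 0")
      case False
      then have "- 1 \<le> z $ j" "z $ j \<le> 2" using supp[OF False] by (auto simp: mem_box_cart)
      then show ?thesis unfolding abs_mult by (intro mult_right_mono) auto
    qed simp
    then have "\<bar>z $ j * v z\<bar> * \<bar>d\<bar> \<le> 2 * \<bar>v z\<bar> * \<bar>d\<bar>" by (intro mult_right_mono) auto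
    then have 1: "\<bar>z $ j * v z * d\<bar> \<le> 2 * (\<bar>v z\<bar> * \<bar>d\<bar>)" by (simp add: abs_mult mult.assoc)
    have "0 \<le> (\<bar>v z\<bar> - 4 * \<bar>d\<bar>)\<^sup>2" by simp
    then have 2: "8 * (\<bar>v z\<bar> * \<bar>d\<bar>) \<le> (v z)\<^sup>2 + 16 * d\<^sup>2" by (simp add: power2_eq_square algebra_simps)
    show "(v z)\<^sup>2 \<le> p z + (v z)\<^sup>2 / 2 + 8 * (partial_deriv j v z)\<^sup>2"
      unfolding p d_def[symmetric] using 1 2 by linarith
  qed (use pi vi di in auto)
  also have "\<dots> = 0 + (LINT z|lborel. (v z)\<^sup>2) / 2 + 8 * (LINT z|lborel. (partial_deriv j v z)\<^sup>2)"
    using pi vi di by (simp add: p0)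
  finally show ?thesis by simp
qed

lemma one_minus_cos_le: "1 - cos x \<le> x\<^sup>2 / 2" for x :: real
proof -
  have "1 - cos x = 2 * (sin (x / 2))\<^sup>2" using cos_double_sin[of "x / 2"] by simp
  also have "(sin (x / 2))\<^sup>2 \<le> (x / 2)\<^sup>2" using abs_sin_x_le_abs_x[of "x / 2"] by (simp only: abs_le_square_iff[symmetric])
  finally show ?thesis by (simp add: power_divide)
qed

lemma sine_test_function:
  fixes \<zeta> g :: "real^2 \<Rightarrow> real"
  assumes \<zeta>: "\<zeta> \<in> C1_compact U" and g: "g \<in> C1_compact V" and M: "0 < M"
  shows "(\<lambda>z. \<zeta> z * (M * sin (g z / M))) \<in> C1_compact U"
    "partial_deriv j (\<lambda>z. \<zeta> z * (M * sin (g z / M))) z = M * sin (g z / M) * partial_deriv j \<zeta> z + \<zeta> z * (cos (g z / M) * partial_deriv j g z)"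
proof -
  obtain g' where g': "C1_grad g g'" "\<And>x j. partial_deriv j g x = g' x $ j" using C1_compact_C1_grad[OF g] by metis
  obtain \<zeta>' K where z': "C1_grad \<zeta> \<zeta>'" "compact K" "K \<subseteq> U" "\<And>x. \<zeta> x \<noteq> 0 \<Longrightarrow> x \<in> K" "\<And>x j. partial_deriv j \<zeta> x = \<zeta>' x $ j"
    using C1_compact_C1_grad[OF \<zeta>] by metis
  have "((\<lambda>x. M * sin (x / M)) has_real_derivative cos (s / M)) (at s)" for s
    using M by (auto intro!: derivative_eq_intros)
  then have C: "C1_grad (\<lambda>z. \<zeta> z * (M * sin (g z / M))) (\<lambda>z. (M * sin (g z / M)) *\<^sub>R \<zeta>' z + \<zeta> z *\<^sub>R (cos (g z / M) *\<^sub>R g' z))"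
    using M by (intro C1_grad_mult[OF z'(1)] C1_grad_compose[OF g'(1), of "\<lambda>x. M * sin (x / M)"]) (auto intro!: continuous_intros)
  have K: "z \<in> K" if "\<zeta> z * (M * sin (g z / M)) \<noteq> 0" for z using z'(4)[of z] that by auto
  show "(\<lambda>z. \<zeta> z * (M * sin (g z / M))) \<in> C1_compact U"
    "partial_deriv j (\<lambda>z. \<zeta> z * (M * sin (g z / M))) z = M * sin (g z / M) * partial_deriv j \<zeta> z + \<zeta> z * (cos (g z / M) * partial_deriv j g z)"
    using C1_grad_C1_compact[OF C z'(2,3) K] by (auto simp: z'(5) g'(2))
qed

lemma integral_indicator_Omega: "(LINT z|lborel. indicator Omega z) = (1::real)" "integrable lborel (indicator Omega :: real^2 \<Rightarrow> real)"
proof -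
  have "measure lborel (cbox 0 (1::real^2)) = (\<Prod>i\<in>UNIV. (1::real^2) $ i - (0::real^2) $ i)"
    by (rule content_cbox_cart) (simp add: interval_ne_empty_cart)
  then show "(LINT z|lborel. indicator Omega z) = (1::real)" by (simp add: Omega_def)
  show "integrable lborel (indicator Omega :: real^2 \<Rightarrow> real)" unfolding Omega_def by (rule bdd_supp_integrable[OF bdd_supp_indicator(2)])
qed

text \<open>The test function \<open>\<zeta> M sin (g / M)\<close> is small, but its derivative is close to \<open>\<zeta> \<partial>\<^sub>2 g\<close> wherever \<open>g\<close> is
  small compared to \<open>M\<close>.\<close>

lemma sine_test:
  fixes \<zeta> f g :: "real^2 \<Rightarrow> real"
  assumes \<zeta>: "\<zeta> \<in> C1_compact U" "\<And>z. 0 \<le> \<zeta> z" "\<And>z. \<zeta> z \<le> indicator Omega z"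
    and f: "bdd_supp f" "\<And>z. \<bar>f z\<bar> \<le> 2" and g: "g \<in> C1_compact V"
    and \<rho>: "(LINT z|lborel. (partial_deriv 2 g z - f z)\<^sup>2) \<le> \<rho>\<^sup>2" "0 < \<rho>" and M: "0 < M"
    and A: "(LINT z|lborel. f z * partial_deriv 2 (\<lambda>z. \<zeta> z * (M * sin (g z / M))) z) \<le> A"
  shows "(LINT z|lborel. \<zeta> z * (f z)\<^sup>2) \<le> A + 2 * M * (LINT z|lborel. \<bar>partial_deriv 2 \<zeta> z\<bar>) + 2 * \<rho> + 2 / M\<^sup>2 * (LINT z|lborel. (g z)\<^sup>2)"
proof -
  define \<psi> where "\<psi> = (\<lambda>z. \<zeta> z * (M * sin (g z / M)))"
  note st = sine_test_function[OF \<zeta>(1) g M, folded \<psi>_def]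
  define r where "r z = partial_deriv 2 g z - f z" for z
  have rb: "bdd_supp r" unfolding r_def[abs_def] by (intro bdd_supp_diff f bdd_supp_C1[OF g])
  have i1: "integrable lborel (\<lambda>z. f z * partial_deriv 2 \<psi> z)" by (intro bdd_supp_integrable bdd_supp_mult2 f bdd_supp_C1[OF st(1)])
  have i2: "integrable lborel (\<lambda>z. \<bar>partial_deriv 2 \<zeta> z\<bar>)" by (intro bdd_supp_integrable bdd_supp_abs bdd_supp_C1[OF \<zeta>(1)])
  have i3: "integrable lborel (\<lambda>z. (r z)\<^sup>2)" by (intro bdd_supp_integrable bdd_supp_power2 rb)
  have i4: "integrable lborel (\<lambda>z. (g z)\<^sup>2)" by (intro bdd_supp_integrable bdd_supp_power2 bdd_supp_C1[OF g])
  have "(LINT z|lborel. \<zeta> z * (f z)\<^sup>2) \<le> (LINT z|lborel. f z * partial_deriv 2 \<psi> z + 2 * M * \<bar>partial_deriv 2 \<zeta> z\<bar> + \<rho> * indicator Omega z + (r z)\<^sup>2 / \<rho> + 2 / M\<^sup>2 * (g z)\<^sup>2)"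
  proof (rule integral_mono)
    show "integrable lborel (\<lambda>z. \<zeta> z * (f z)\<^sup>2)" by (intro bdd_supp_integrable bdd_supp_mult2 bdd_supp_power2 f bdd_supp_C1[OF \<zeta>(1)])
    show "integrable lborel (\<lambda>z. f z * partial_deriv 2 \<psi> z + 2 * M * \<bar>partial_deriv 2 \<zeta> z\<bar> + \<rho> * indicator Omega z + (r z)\<^sup>2 / \<rho> + 2 / M\<^sup>2 * (g z)\<^sup>2)"
      using i1 i2 i3 i4 integral_indicator_Omega(2) by auto
    fix z
    define c where "c = cos (g z / M)"
    define q where "q = partial_deriv 2 \<zeta> z"
    have \<zeta>1: "\<zeta> z \<le> 1" using \<zeta>(3)[of z] by (cases "z \<in> Omega") auto
    have f4: "(f z)\<^sup>2 \<le> 4" using abs_le_square_iff[of "f z" 2] f(2)[of z] by simp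
    \<comment> \<open>The product rule with \<open>partial_deriv 2 g\<close> written as f + r. The
      three terms come from the derivative of the cutoff, from the main part and from the gradient
      error; they are bounded in \<open>1\<close>, \<open>3\<close> and \<open>2\<close>.\<close>
    have e: "f z * partial_deriv 2 \<psi> z = M * (f z * sin (g z / M) * q) + \<zeta> z * c * (f z)\<^sup>2 + \<zeta> z * c * (f z * r z)"
      unfolding st(2) c_def q_def r_def by (simp add: power2_eq_square algebra_simps)
    have 1: "- (2 * M * \<bar>q\<bar>) \<le> M * (f z * sin (g z / M) * q)"
    proof -
      have "\<bar>f z * sin (g z / M)\<bar> \<le> 2 * 1" unfolding abs_mult by (intro mult_mono f(2)) auto
      then have "\<bar>f z * sin (g z / M)\<bar> * \<bar>q\<bar> \<le> 2 * \<bar>q\<bar>" by (intro mult_right_mono) auto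
      then have "M * \<bar>f z * sin (g z / M) * q\<bar> \<le> M * (2 * \<bar>q\<bar>)" using M by (intro mult_left_mono) (auto simp: abs_mult)
      moreover have "\<bar>M * (f z * sin (g z / M) * q)\<bar> = M * \<bar>f z * sin (g z / M) * q\<bar>" using M by (simp add: abs_mult)
      ultimately show ?thesis by linarith
    qed
    have 2: "- (\<rho> * indicator Omega z + (r z)\<^sup>2 / \<rho>) \<le> \<zeta> z * c * (f z * r z)"
    proof (cases "z \<in> Omega")
      case True
      have "\<bar>\<zeta> z * c\<bar> \<le> 1 * 1" unfolding abs_mult c_def using \<zeta>(2)[of z] \<zeta>1 by (intro mult_mono) auto
      then have "\<bar>\<zeta> z * c\<bar> * \<bar>f z * r z\<bar> \<le> 1 * (2 * \<bar>r z\<bar>)" unfolding abs_mult[of "f z"] using f(2) by (intro mult_mono mult_right_mono) auto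
      then have "\<bar>\<zeta> z * c * (f z * r z)\<bar> \<le> 2 * \<bar>r z\<bar>" by (simp add: abs_mult)
      moreover have "0 \<le> (\<rho> - \<bar>r z\<bar>)\<^sup>2 / \<rho>" using \<rho>(2) by simp
      moreover have "(\<rho> - \<bar>r z\<bar>)\<^sup>2 / \<rho> = \<rho> + (r z)\<^sup>2 / \<rho> - 2 * \<bar>r z\<bar>" using \<rho>(2) by (simp add: power2_eq_square field_simps)
      ultimately show ?thesis using True by (simp add: abs_le_iff)
    next
      case False
      then show ?thesis using \<zeta>(2)[of z] \<zeta>(3)[of z] \<rho>(2) by simp
    qed
    \<comment> \<open>Replacing cos (g / M) by 1 costs at most (g / M)^2 / 2, multiplied by f^2
      \<le> 4.\<close>
    have 3: "\<zeta> z * (f z)\<^sup>2 - \<zeta> z * c * (f z)\<^sup>2 \<le> 2 / M\<^sup>2 * (g z)\<^sup>2"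
    proof -
      have "\<zeta> z * (f z)\<^sup>2 - \<zeta> z * c * (f z)\<^sup>2 = (\<zeta> z * (f z)\<^sup>2) * (1 - c)" by (simp add: algebra_simps)
      also have "\<dots> \<le> (1 * 4) * ((g z / M)\<^sup>2 / 2)" unfolding c_def using \<zeta>(2) \<zeta>1 f4 by (intro mult_mono one_minus_cos_le) auto
      finally show ?thesis by (simp add: power_divide)
    qed
    show "\<zeta> z * (f z)\<^sup>2 \<le> f z * partial_deriv 2 \<psi> z + 2 * M * \<bar>partial_deriv 2 \<zeta> z\<bar> + \<rho> * indicator Omega z + (r z)\<^sup>2 / \<rho> + 2 / M\<^sup>2 * (g z)\<^sup>2"
      unfolding e q_def[symmetric] using 1 2 3 by linarith
  qed
  also have "\<dots> = (LINT z|lborel. f z * partial_deriv 2 \<psi> z) + 2 * M * (LINT z|lborel. \<bar>partial_deriv 2 \<zeta> z\<bar>) + \<rho> * 1 + (LINT z|lborel. (r z)\<^sup>2) / \<rho> + 2 / M\<^sup>2 * (LINT z|lborel. (g z)\<^sup>2)"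
    using i1 i2 i3 i4 integral_indicator_Omega by simp
  also have "\<dots> \<le> A + 2 * M * (LINT z|lborel. \<bar>partial_deriv 2 \<zeta> z\<bar>) + \<rho> * 1 + \<rho> + 2 / M\<^sup>2 * (LINT z|lborel. (g z)\<^sup>2)"
  proof (intro add_mono order_refl)
    show "(LINT z|lborel. f z * partial_deriv 2 \<psi> z) \<le> A" using A by (simp add: \<psi>_def)
    show "(LINT z|lborel. (r z)\<^sup>2) / \<rho> \<le> \<rho>" using \<rho> by (simp add: r_def divide_le_eq power2_eq_square)
  qed
  finally show ?thesis by simp
qed

text \<open>The centre lies to the left of the middle: the ball of radius 1/4 about (3/8, 1/2) stays
  in the open square also after translation by s e_1 with 0 \<le> s \<le> 1/4, since the first
  coordinate then ranges between 1/8 and 7/8.\<close>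

definition cutoff :: "real^2 \<Rightarrow> real" where
  "cutoff = bump (vector [3/8, 1/2]) (1/4)"

lemma cutoff_cball: assumes "cutoff z \<noteq> 0" shows "z \<in> cball (vector [3/8, 1/2]) (1/4)"
proof -
  have "\<not> 1/4 \<le> norm (z - vector [3/8, 1/2])" using assms bump_zero[of "1/4" z "vector [3/8, 1/2]"] by (auto simp: cutoff_def)
  then show ?thesis by (simp add: dist_norm norm_minus_commute)
qed

lemma cball_shift_subset_box:
  assumes "0 \<le> s" "s \<le> 1/4" shows "cball (vector [3/8, 1/2] + axis 1 s) (1/4) \<subseteq> (box 0 1 :: (real^2) set)"
proof
  fix z :: "real^2" assume "z \<in> cball (vector [3/8, 1/2] + axis 1 s) (1/4)"
  then have n: "norm (z - (vector [3/8, 1/2] + axis 1 s)) \<le> 1/4" by (simp add: dist_norm norm_minus_commute)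
  have "\<bar>z $ 1 - 3/8 - s\<bar> \<le> 1/4" "\<bar>z $ 2 - 1/2\<bar> \<le> 1/4"
    using order_trans[OF component_le_norm_cart n, of 1] order_trans[OF component_le_norm_cart n, of 2] by (simp_all add: axis_def diff_diff_eq)
  then have "0 < z $ 1" "z $ 1 < 1" "0 < z $ 2" "z $ 2 < 1" using assms unfolding abs_le_iff by linarith+
  then show "z \<in> box 0 1" by (simp add: mem_box_cart forall_2)
qed

lemma cball_subset_box: "cball (vector [3/8, 1/2]) (1/4) \<subseteq> (box 0 1 :: (real^2) set)"
proof -
  have e: "vector [3/8, 1/2] + axis 1 0 = (vector [3/8, 1/2] :: real^2)" by (simp add: vec_eq_iff axis_def)
  show ?thesis using cball_shift_subset_box[of 0] unfolding e by simp
qed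

lemma cutoff_box: "cutoff z \<noteq> 0 \<Longrightarrow> z \<in> box 0 1"
  using cutoff_cball cball_subset_box by blast

lemma cutoff_shift_box:
  assumes "cutoff z \<noteq> 0" "0 \<le> s" "s \<le> 1/4" shows "z + axis 1 s \<in> box 0 1"
proof -
  have "z + axis 1 s \<in> cball (vector [3/8, 1/2] + axis 1 s) (1/4)" using cutoff_cball[OF assms(1)] by (simp add: dist_norm)
  then show ?thesis using cball_shift_subset_box[OF assms(2,3)] by blast
qed

lemma cutoff_C1_compact: "cutoff \<in> C1_compact (box 0 1)"
  unfolding cutoff_def by (rule bump_C1_compact[OF _ cball_subset_box]) simp

lemma cutoff_nonneg: "0 \<le> cutoff z" by (simp add: cutoff_def bump_nonneg)

lemma cutoff_le_1: "cutoff z \<le> 1"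
  using bump_le[of "vector [3/8, 1/2]" "1/4" z] by (simp add: cutoff_def power2_eq_square)

lemma cutoff_le_indicator: "cutoff z \<le> indicator Omega z"
proof (cases "cutoff z = 0")
  case False
  then have "z \<in> Omega" using cutoff_box[OF False] box_subset_cbox[of 0 "1::real^2"] by (auto simp: Omega_def)
  then show ?thesis using cutoff_le_1 by simp
qed simp

lemma cutoff_integral_pos: "0 < (LINT z|lborel. cutoff z)"
  unfolding cutoff_def by (rule bump_integral_pos) simp

lemmas cutoff_bdd = bdd_supp_C1(1)[OF cutoff_C1_compact]

lemma partial_deriv_zero_off:
  assumes "\<psi> \<in> C1_compact U" "z \<notin> U" shows "partial_deriv j \<psi> z = 0"
proof -
  obtain g where g: "\<And>x j. partial_deriv j \<psi> x = g x $ j" "\<And>x. x \<notin> closure {x. \<psi> x \<noteq> 0} \<Longrightarrow> g x = 0" "closure {x. \<psi> x \<noteq> 0} \<subseteq> U"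
    using C1_compact_gradE[OF assms(1)] by metis
  have "z \<notin> closure {x. \<psi> x \<noteq> 0}" using g(3) assms(2) by blast
  then show ?thesis unfolding g(1) using g(2)[of z] by simp
qed

lemma integral_abs_mult_le:
  assumes a: "bdd_supp a" "\<And>z. \<bar>a z\<bar> \<le> indicator Omega z" and b: "bdd_supp b" "(LINT z|lborel. (b z)\<^sup>2) \<le> K\<^sup>2" and K: "0 < K"
  shows "(LINT z|lborel. \<bar>a z * b z\<bar>) \<le> K"
proof -
  have "(LINT z|lborel. (a z)\<^sup>2) \<le> (LINT z|lborel. indicator Omega z)"
  proof (rule integral_mono)
    show "integrable lborel (\<lambda>z. (a z)\<^sup>2)" by (intro bdd_supp_integrable bdd_supp_power2 a)
    fix z
    have "\<bar>a z\<bar>\<^sup>2 \<le> (indicator Omega z)\<^sup>2" by (intro power_mono a) simp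
    then show "(a z)\<^sup>2 \<le> indicator Omega z" by (cases "z \<in> Omega") auto
  qed (rule integral_indicator_Omega)
  then have a2: "(LINT z|lborel. (a z)\<^sup>2) \<le> 1" by (simp only: integral_indicator_Omega)
  have "(LINT z|lborel. \<bar>a z * b z\<bar>) \<le> (K * (LINT z|lborel. (a z)\<^sup>2) + (LINT z|lborel. (b z)\<^sup>2) / K) / 2"
    by (rule young_integral[OF a(1) b(1) K])
  also have "\<dots> \<le> (K * 1 + K\<^sup>2 / K) / 2" using a2 b(2) K by (intro divide_right_mono add_mono mult_left_mono) auto
  also have "\<dots> = K" using K by (simp add: power2_eq_square)
  finally show ?thesis .
qed

text \<open>What the lower bounds use of a competitor of energy at most \<open>E\<close>. Here
  \<open>ch\<close> stands for \<chi>_22, the difference of the third and second phase indicator;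
  its square is their sum, so that \<chi>_11 = 1 - 2 ch^2. \<open>\<alpha>\<close> and
  \<open>\<beta>\<close> are the diagonal entries of F, \<open>T\<close> bounds the variation, and
  the factor 4 accounts for the mollification.\<close>

locale low_energy =
  fixes ch v1 v2 :: "real^2 \<Rightarrow> real" and \<alpha> \<beta> E T :: real
  assumes chi: "ch \<in> borel_measurable borel" "\<And>z. ch z \<in> {-1, 0, 1}" "\<And>z. z \<notin> box 0 1 \<Longrightarrow> ch z = 0"
    and v1: "v1 \<in> C1_compact UNIV" "\<And>z. v1 z \<noteq> 0 \<Longrightarrow> z \<in> cbox (-1) 2"
    and v2: "v2 \<in> C1_compact UNIV" "\<And>z. v2 z \<noteq> 0 \<Longrightarrow> z \<in> cbox (-1) 2"
    and E: "0 < E"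
    and d11: "(LINT z|lborel. (partial_deriv 1 v1 z - ((1 - \<alpha>) * indicator (box 0 1) z - 2 * (ch z)\<^sup>2))\<^sup>2) \<le> 4 * E"
    and d12: "(LINT z|lborel. (partial_deriv 2 v1 z)\<^sup>2) \<le> 4 * E"
    and d21: "(LINT z|lborel. (partial_deriv 1 v2 z)\<^sup>2) \<le> 4 * E"
    and d22: "(LINT z|lborel. (partial_deriv 2 v2 z - (ch z - \<beta> * indicator (box 0 1) z))\<^sup>2) \<le> 4 * E"
    and tv: "\<And>\<psi> M. \<psi> \<in> C1_compact (box 0 1) \<Longrightarrow> (\<And>z. \<bar>\<psi> z\<bar> \<le> M) \<Longrightarrow> \<bar>LINT z|lborel. ch z * partial_deriv 2 \<psi> z\<bar> \<le> M * T"
begin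

lemma chi_bdd: "bdd_supp ch"
proof (rule bdd_suppI[OF chi(1) compact_cbox])
  show "\<bar>ch x\<bar> \<le> 1" for x using chi(2)[of x] by auto
  show "ch x = 0" if "x \<notin> cbox 0 1" for x using chi(3)[of x] that box_subset_cbox[of 0 "1::real^2"] by blast
qed

lemma v_small: "(LINT z|lborel. (v1 z)\<^sup>2) \<le> (8 * sqrt E)\<^sup>2" "(LINT z|lborel. (v2 z)\<^sup>2) \<le> (8 * sqrt E)\<^sup>2"
  using poincare[OF v1, of 2] poincare[OF v2, of 1] d12 d21 E by (simp_all add: power_mult_distrib)

lemma sine_bound: "0 < M \<Longrightarrow> \<bar>cutoff z * (M * sin t)\<bar> \<le> M"
  using mult_mono[of "cutoff z" 1 "M * \<bar>sin t\<bar>" "M * 1"] cutoff_nonneg[of z] cutoff_le_1[of z]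
  by (auto simp: abs_mult)

text \<open>Away from the first phase |ch - \<beta>| \<ge> 1 - |\<beta>|, so the sine test bounds
  the left side up to the area of the first phase. For \<alpha> = -1 this area is of order sqrt E,
  because twice the indicator of the first phase is the target of \<partial>_1 v_1, and the integral
  of \<partial>_1 v_1 vanishes.\<close>

lemma first_order_estimate:
  assumes \<alpha>: "\<alpha> = -1" and \<beta>: "\<bar>\<beta>\<bar> < 1" and M: "0 < M"
  shows "(1 - \<bar>\<beta>\<bar>)\<^sup>2 * (LINT z|lborel. cutoff z) \<le> 128 * E / M\<^sup>2 + M * (T + 2 * (LINT z|lborel. \<bar>partial_deriv 2 cutoff z\<bar>)) + 10 * sqrt E"
proof -
  define B where "B = (LINT z|lborel. \<bar>partial_deriv 2 cutoff z\<bar>)"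
  define f where "f z = ch z - \<beta> * indicator (box 0 1) z" for z
  have fb: "bdd_supp f" unfolding f_def[abs_def] by (intro bdd_supp_diff bdd_supp_cmult chi_bdd bdd_supp_indicator)
  have f2: "\<bar>f z\<bar> \<le> 2" for z using chi(2)[of z] \<beta> by (auto simp: f_def indicator_def)
  have sE: "0 < sqrt E" "(sqrt E)\<^sup>2 = E" using E by auto
  define \<psi> where "\<psi> = (\<lambda>z. cutoff z * (M * sin (v2 z / M)))"
  have \<psi>: "\<psi> \<in> C1_compact (box 0 1)" unfolding \<psi>_def by (rule sine_test_function(1)[OF cutoff_C1_compact v2(1) M])
  have \<psi>b: "bdd_supp (partial_deriv 2 \<psi>)" by (rule bdd_supp_C1(2)[OF \<psi>])
  have A: "(LINT z|lborel. f z * partial_deriv 2 \<psi> z) \<le> M * T"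
  proof -
    have "(LINT z|lborel. f z * partial_deriv 2 \<psi> z) = (LINT z|lborel. ch z * partial_deriv 2 \<psi> z - \<beta> * partial_deriv 2 \<psi> z)"
      using partial_deriv_zero_off[OF \<psi>] by (intro Bochner_Integration.integral_cong refl) (auto simp: f_def indicator_def left_diff_distrib)
    also have "\<dots> = (LINT z|lborel. ch z * partial_deriv 2 \<psi> z)"
      using bdd_supp_integrable[OF bdd_supp_mult2[OF chi_bdd \<psi>b]] bdd_supp_integrable[OF bdd_supp_cmult[OF \<psi>b, of \<beta>]]
      by (simp add: integral_partial_deriv_zero[OF \<psi>])
    also have "\<dots> \<le> M * T" using tv[OF \<psi>, of M] sine_bound[OF M] by (auto simp: \<psi>_def)
    finally show ?thesis .
  qed
  have "(LINT z|lborel. cutoff z * (f z)\<^sup>2) \<le> M * T + 2 * M * B + 2 * (2 * sqrt E) + 2 / M\<^sup>2 * (LINT z|lborel. (v2 z)\<^sup>2)"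
    unfolding B_def
  proof (rule sine_test[OF cutoff_C1_compact cutoff_nonneg cutoff_le_indicator fb f2 v2(1) _ _ M])
    show "(LINT z|lborel. (partial_deriv 2 v2 z - f z)\<^sup>2) \<le> (2 * sqrt E)\<^sup>2" using d22 E by (simp add: f_def power_mult_distrib)
  qed (use A E in \<open>simp_all add: \<psi>_def\<close>)
  also have "\<dots> \<le> M * T + 2 * M * B + 2 * (2 * sqrt E) + 2 / M\<^sup>2 * (8 * sqrt E)\<^sup>2"
    by (intro add_left_mono mult_left_mono v_small) simp
  also have "\<dots> = M * T + 2 * M * B + 4 * sqrt E + 128 * E / M\<^sup>2" using sE by (simp add: power_mult_distrib)
  finally have 1: "(LINT z|lborel. cutoff z * (f z)\<^sup>2) \<le> M * T + 2 * M * B + 4 * sqrt E + 128 * E / M\<^sup>2" .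
  define h where "h z = indicator (box 0 1) z - (ch z)\<^sup>2" for z
  have hb: "bdd_supp h" unfolding h_def[abs_def] by (intro bdd_supp_diff bdd_supp_power2 chi_bdd bdd_supp_indicator)
  define r where "r z = partial_deriv 1 v1 z - 2 * h z" for z
  have rb: "bdd_supp r" unfolding r_def[abs_def] by (intro bdd_supp_diff bdd_supp_cmult hb bdd_supp_C1[OF v1(1)])
  have r2: "(LINT z|lborel. (r z)\<^sup>2) \<le> 4 * E" using d11 \<alpha> by (simp add: r_def h_def right_diff_distrib)
  have 2: "(LINT z|lborel. h z) \<le> 4 * sqrt E"
  proof -
    have i: "integrable lborel (partial_deriv 1 v1)" by (rule bdd_supp_integrable[OF bdd_supp_C1(2)[OF v1(1)]])
    \<comment> \<open>The integrand on the right is supported in a square of area 9. Young's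
      inequality with parameter sqrt E gives (9 + 4) / 2 times sqrt E, which is rounded up to 8 sqrt
      E.\<close>
    have "2 * (LINT z|lborel. h z) = (LINT z|lborel. 2 * h z - partial_deriv 1 v1 z)"
      using i bdd_supp_integrable[OF hb] by (simp add: integral_partial_deriv_zero[OF v1(1)])
    also have "\<dots> \<le> (LINT z|lborel. \<bar>indicator (cbox (-1) 2) z * r z\<bar>)"
    proof (rule integral_mono)
      show "integrable lborel (\<lambda>z. 2 * h z - partial_deriv 1 v1 z)" using i bdd_supp_integrable[OF hb] by simp
      show "integrable lborel (\<lambda>z. \<bar>indicator (cbox (-1) 2) z * r z\<bar>)"
        by (intro bdd_supp_integrable bdd_supp_abs bdd_supp_mult2 bdd_supp_indicator rb)
      fix z
      show "2 * h z - partial_deriv 1 v1 z \<le> \<bar>indicator (cbox (-1) 2) z * r z\<bar>"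
      proof (cases "z \<in> cbox (-1) (2::real^2)")
        case False
        have sub: "box 0 1 \<subseteq> cbox (-1) (2::real^2)"
        proof
          fix x :: "real^2" assume "x \<in> box 0 1"
          then have "0 < x $ i" "x $ i < 1" for i by (simp_all add: mem_box_cart)
          then have "-1 \<le> x $ i \<and> x $ i \<le> 2" for i using less_eq_real_def[of 0 "x $ i"] by (smt (verit))
          then show "x \<in> cbox (-1) 2" by (simp add: mem_box_cart)
        qed
        then have "z \<notin> box 0 1" using False by blast
        then have "h z = 0" using chi(3) by (simp add: h_def)
        moreover have "partial_deriv 1 v1 z = 0" by (rule partial_deriv_zero_outside[OF v1 closed_cbox False])
        ultimately show ?thesis by simp
      qed (simp add: r_def)
    qed
    also have "\<dots> \<le> (sqrt E * (LINT z|lborel. (indicator (cbox (-1) (2::real^2)) z)\<^sup>2) + (LINT z|lborel. (r z)\<^sup>2) / sqrt E) / 2"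
      by (rule young_integral[OF bdd_supp_indicator(2) rb sE(1)])
    also have "(LINT z|lborel. (indicator (cbox (-1) (2::real^2)) z)\<^sup>2) = (9::real)"
    proof -
      have "measure lborel (cbox (-1) (2::real^2)) = (\<Prod>i\<in>UNIV. (2::real^2) $ i - (-1::real^2) $ i)"
        by (rule content_cbox_cart) (simp add: interval_ne_empty_cart)
      moreover have "(indicator (cbox (-1) (2::real^2)) z)\<^sup>2 = (indicator (cbox (-1) 2) z :: real)" for z by (simp add: indicator_def)
      ultimately show ?thesis by (simp add: UNIV_2)
    qed
    also have "(sqrt E * 9 + (LINT z|lborel. (r z)\<^sup>2) / sqrt E) / 2 \<le> (sqrt E * 9 + 4 * E / sqrt E) / 2"
      using r2 E by (intro divide_right_mono add_left_mono) auto
    also have "4 * E / sqrt E = 4 * sqrt E" by (simp only: times_divide_eq_right[symmetric] real_div_sqrt[OF less_imp_le[OF E]])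
    finally have "2 * (LINT z|lborel. h z) \<le> 13 / 2 * sqrt E" by (simp add: algebra_simps)
    then have "2 * (LINT z|lborel. h z) \<le> 8 * sqrt E" by (rule order_trans[OF _ mult_right_mono]) (use sE(1) in simp_all)
    then show ?thesis by simp
  qed
  have "(1 - \<bar>\<beta>\<bar>)\<^sup>2 * (LINT z|lborel. cutoff z) = (LINT z|lborel. (1 - \<bar>\<beta>\<bar>)\<^sup>2 * cutoff z)" by simp
  also have "\<dots> \<le> (LINT z|lborel. cutoff z * (f z)\<^sup>2 + h z)"
  proof (rule integral_mono)
    show "integrable lborel (\<lambda>z. (1 - \<bar>\<beta>\<bar>)\<^sup>2 * cutoff z)" by (intro bdd_supp_integrable bdd_supp_cmult cutoff_bdd)
    show "integrable lborel (\<lambda>z. cutoff z * (f z)\<^sup>2 + h z)" by (intro bdd_supp_integrable bdd_supp_add bdd_supp_mult2 bdd_supp_power2 cutoff_bdd fb hb)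
    fix z
    show "(1 - \<bar>\<beta>\<bar>)\<^sup>2 * cutoff z \<le> cutoff z * (f z)\<^sup>2 + h z"
    proof (cases "z \<in> box 0 1")
      case False
      then have "cutoff z = 0" using cutoff_box[of z] by blast
      then show ?thesis using False chi(3)[OF False] by (simp add: h_def)
    next
      case True
      show ?thesis
      proof (cases "ch z = 0")
        case True
        have "(1 - \<bar>\<beta>\<bar>)\<^sup>2 \<le> 1" using \<beta> by (intro power_le_one) auto
        then have "(1 - \<bar>\<beta>\<bar>)\<^sup>2 * cutoff z \<le> 1 * 1" using cutoff_nonneg cutoff_le_1 by (intro mult_mono) auto
        then show ?thesis using True \<open>z \<in> box 0 1\<close> mult_nonneg_nonneg[OF cutoff_nonneg[of z] zero_le_power2[of "f z"]] by (simp add: h_def)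
      next
        case False
        then have c: "ch z = 1 \<or> ch z = -1" using chi(2)[of z] by auto
        then have "\<bar>1 - \<bar>\<beta>\<bar>\<bar> \<le> \<bar>f z\<bar>" using \<beta> True by (auto simp: f_def)
        then have "(1 - \<bar>\<beta>\<bar>)\<^sup>2 \<le> (f z)\<^sup>2" by (simp only: abs_le_square_iff)
        then have "(1 - \<bar>\<beta>\<bar>)\<^sup>2 * cutoff z \<le> (f z)\<^sup>2 * cutoff z" using cutoff_nonneg by (intro mult_right_mono)
        moreover have "h z = 0" using c True by (auto simp: h_def)
        ultimately show ?thesis by (simp add: mult.commute)
      qed
    qed
  qed
  also have "\<dots> = (LINT z|lborel. cutoff z * (f z)\<^sup>2) + (LINT z|lborel. h z)"
    by (intro Bochner_Integration.integral_add bdd_supp_integrable bdd_supp_mult2 bdd_supp_power2 cutoff_bdd fb hb)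
  finally have 3: "(1 - \<bar>\<beta>\<bar>)\<^sup>2 * (LINT z|lborel. cutoff z) \<le> (LINT z|lborel. cutoff z * (f z)\<^sup>2) + (LINT z|lborel. h z)" .
  have "M * (T + 2 * B) = M * T + 2 * M * B" by (simp add: algebra_simps)
  then show ?thesis using 1 2 3 sE(1) unfolding B_def by linarith
qed

text \<open>The gain over testing with v_2 itself: the norm of the increment carries the factor
  \<open>s\<close>, so \<open>M\<close> may be taken smaller by that factor. Since \<open>ch\<close>
  takes only the values -1, 0 and 1, the change of \<open>ch\<close> squared is at most the square
  of the change of \<open>ch\<close>.\<close>

lemma oscillation_estimate:
  assumes \<beta>: "\<beta> = 0" and s: "0 < s" "s \<le> 1/4" and M: "0 < M"
  shows "(LINT z|lborel. cutoff z * \<bar>(ch (z + axis 1 s))\<^sup>2 - (ch z)\<^sup>2\<bar>)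
    \<le> 2 * M * (T + (LINT z|lborel. \<bar>partial_deriv 2 cutoff z\<bar>)) + 8 * sqrt E + 8 * s\<^sup>2 * E / M\<^sup>2"
proof -
  define B where "B = (LINT z|lborel. \<bar>partial_deriv 2 cutoff z\<bar>)"
  define f where "f z = ch (z + axis 1 s) - ch z" for z
  define g where "g = (\<lambda>z. v2 (z + axis 1 s) - v2 z)"
  have fb: "bdd_supp f" unfolding f_def[abs_def] by (intro bdd_supp_diff bdd_supp_shift chi_bdd)
  have f2: "\<bar>f z\<bar> \<le> 2" for z using chi(2)[of z] chi(2)[of "z + axis 1 s"] by (auto simp: f_def)
  have sE: "0 < sqrt E" "(sqrt E)\<^sup>2 = E" using E by auto
  note sh = C1_compact_shift_UNIV[OF v2(1), where c="axis 1 s"]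
  have gC: "g \<in> C1_compact UNIV" and gd: "partial_deriv 2 g z = partial_deriv 2 v2 (z + axis 1 s) - partial_deriv 2 v2 z" for z
    unfolding g_def using C1_compact_diff[OF sh(1) v2(1)] sh(2) by auto
  define \<psi> where "\<psi> = (\<lambda>z. cutoff z * (M * sin (g z / M)))"
  have \<psi>: "\<psi> \<in> C1_compact (box 0 1)" unfolding \<psi>_def by (rule sine_test_function(1)[OF cutoff_C1_compact gC M])
  have \<psi>b: "bdd_supp (partial_deriv 2 \<psi>)" by (rule bdd_supp_C1(2)[OF \<psi>])
  have \<psi>M: "\<bar>\<psi> z\<bar> \<le> M" for z unfolding \<psi>_def by (rule sine_bound[OF M])
  have A: "(LINT z|lborel. f z * partial_deriv 2 \<psi> z) \<le> 2 * M * T"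
  proof -
    \<comment> \<open>The shifted field is handled by translating \<open>\<psi>\<close> by s e_1;
      because of \<open>s \<le> 1/4\<close> its support stays in the square, so the same variation
      bound applies.\<close>
    have K: "z \<in> cball (vector [3/8, 1/2] + axis 1 s) (1/4)" if "\<psi> (z + - axis 1 s) \<noteq> 0" for z
    proof -
      have "cutoff (z - axis 1 s) \<noteq> 0" using that by (auto simp: \<psi>_def)
      from cutoff_cball[OF this] show ?thesis by (simp add: dist_norm diff_diff_eq2 add.commute)
    qed
    have sub: "cball (vector [3/8, 1/2] + axis 1 s) (1/4) \<subseteq> (box 0 1 :: (real^2) set)" using s by (intro cball_shift_subset_box) auto
    note sh\<psi> = C1_compact_shift[where c="- axis 1 s", OF \<psi> compact_cball sub K]
    have e: "partial_deriv 2 (\<lambda>z. \<psi> (z - axis 1 s)) z = partial_deriv 2 \<psi> (z - axis 1 s)" for z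
      using C1_compact_shift_UNIV(2)[OF \<psi>, of 2 "- axis 1 s" z] by simp
    have "(LINT z|lborel. ch (z + axis 1 s) * partial_deriv 2 \<psi> z) = (LINT z|lborel. ch z * partial_deriv 2 (\<lambda>z. \<psi> (z + - axis 1 s)) z)"
      using integral_translation[of "\<lambda>z. ch z * partial_deriv 2 \<psi> (z + - axis 1 s)" "axis 1 s"] by (simp add: e)
    also have "\<dots> \<le> M * T" using tv[OF sh\<psi>(1), where M=M] \<psi>M by (simp add: abs_le_iff)
    finally have 1: "(LINT z|lborel. ch (z + axis 1 s) * partial_deriv 2 \<psi> z) \<le> M * T" .
    have 2: "- (LINT z|lborel. ch z * partial_deriv 2 \<psi> z) \<le> M * T" using tv[OF \<psi> \<psi>M] by (simp add: abs_le_iff)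
    have "(LINT z|lborel. f z * partial_deriv 2 \<psi> z) = (LINT z|lborel. ch (z + axis 1 s) * partial_deriv 2 \<psi> z) - (LINT z|lborel. ch z * partial_deriv 2 \<psi> z)"
      unfolding f_def left_diff_distrib
      by (intro Bochner_Integration.integral_diff bdd_supp_integrable bdd_supp_mult2 bdd_supp_shift chi_bdd \<psi>b)
    then show ?thesis using 1 2 by linarith
  qed
  have R: "(LINT z|lborel. (partial_deriv 2 g z - f z)\<^sup>2) \<le> (4 * sqrt E)\<^sup>2"
  proof -
    define r where "r z = partial_deriv 2 v2 z - ch z" for z
    have rb: "bdd_supp r" unfolding r_def[abs_def] by (intro bdd_supp_diff chi_bdd bdd_supp_C1[OF v2(1)])
    have i: "integrable lborel (\<lambda>z. (r z)\<^sup>2)" "integrable lborel (\<lambda>z. (r (z + axis 1 s))\<^sup>2)" "integrable lborel (\<lambda>z. (r (z + axis 1 s) - r z)\<^sup>2)"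
      by (intro bdd_supp_integrable bdd_supp_power2 bdd_supp_diff bdd_supp_shift rb)+
    have "(LINT z|lborel. (partial_deriv 2 g z - f z)\<^sup>2) = (LINT z|lborel. (r (z + axis 1 s) - r z)\<^sup>2)"
      by (intro Bochner_Integration.integral_cong refl arg_cong[where f="\<lambda>x. x\<^sup>2"]) (simp add: gd f_def r_def)
    also have "\<dots> \<le> (LINT z|lborel. 2 * (r (z + axis 1 s))\<^sup>2 + 2 * (r z)\<^sup>2)"
    proof (rule integral_mono[OF i(3)])
      show "integrable lborel (\<lambda>z. 2 * (r (z + axis 1 s))\<^sup>2 + 2 * (r z)\<^sup>2)" using i by simp
      show "(r (z + axis 1 s) - r z)\<^sup>2 \<le> 2 * (r (z + axis 1 s))\<^sup>2 + 2 * (r z)\<^sup>2" for z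
        using zero_le_power2[of "r (z + axis 1 s) + r z"] by (simp add: power2_eq_square algebra_simps)
    qed
    also have "\<dots> = 4 * (LINT z|lborel. (r z)\<^sup>2)" using i integral_translation[of "\<lambda>z. (r z)\<^sup>2" "axis 1 s"] by simp
    also have "\<dots> \<le> 4 * (4 * E)" using d22 \<beta> by (simp add: r_def)
    finally show ?thesis using sE by (simp add: power_mult_distrib)
  qed
  have "(LINT z|lborel. cutoff z * \<bar>(ch (z + axis 1 s))\<^sup>2 - (ch z)\<^sup>2\<bar>) \<le> (LINT z|lborel. cutoff z * (f z)\<^sup>2)"
  proof (rule integral_mono)
    show "integrable lborel (\<lambda>z. cutoff z * \<bar>(ch (z + axis 1 s))\<^sup>2 - (ch z)\<^sup>2\<bar>)" "integrable lborel (\<lambda>z. cutoff z * (f z)\<^sup>2)"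
      by (intro bdd_supp_integrable bdd_supp_mult2 bdd_supp_abs bdd_supp_diff bdd_supp_power2 bdd_supp_shift cutoff_bdd chi_bdd fb)+
    have "\<bar>(ch (z + axis 1 s))\<^sup>2 - (ch z)\<^sup>2\<bar> \<le> (f z)\<^sup>2" for z
      using chi(2)[of z] chi(2)[of "z + axis 1 s"] by (auto simp: f_def)
    then show "cutoff z * \<bar>(ch (z + axis 1 s))\<^sup>2 - (ch z)\<^sup>2\<bar> \<le> cutoff z * (f z)\<^sup>2" for z by (intro mult_left_mono cutoff_nonneg)
  qed
  also have "\<dots> \<le> 2 * M * T + 2 * M * B + 2 * (4 * sqrt E) + 2 / M\<^sup>2 * (LINT z|lborel. (g z)\<^sup>2)"
    unfolding B_def
    by (rule sine_test[OF cutoff_C1_compact cutoff_nonneg cutoff_le_indicator fb f2 gC R _ M A[unfolded \<psi>_def]]) (use sE in simp)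
  finally have U: "(LINT z|lborel. cutoff z * \<bar>(ch (z + axis 1 s))\<^sup>2 - (ch z)\<^sup>2\<bar>) \<le> 2 * M * T + 2 * M * B + 2 * (4 * sqrt E) + 2 / M\<^sup>2 * (LINT z|lborel. (g z)\<^sup>2)" .
  have V: "(LINT z|lborel. (g z)\<^sup>2) \<le> s\<^sup>2 * (4 * E)"
    using square_integral_shift_le[OF v2(1) s(1), of 1] mult_left_mono[OF d21 zero_le_power2[of s]] unfolding g_def by linarith
  have "(LINT z|lborel. cutoff z * \<bar>(ch (z + axis 1 s))\<^sup>2 - (ch z)\<^sup>2\<bar>) \<le> 2 * M * T + 2 * M * B + 2 * (4 * sqrt E) + 2 / M\<^sup>2 * (s\<^sup>2 * (4 * E))"
    by (rule order_trans[OF U add_left_mono[OF mult_left_mono[OF V]]]) simp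
  also have "\<dots> = 2 * M * (T + B) + 8 * sqrt E + 8 * s\<^sup>2 * E / M\<^sup>2" by (simp add: algebra_simps)
  finally show ?thesis unfolding B_def .
qed

text \<open>\<open>\<sigma>\<close> is the cutoff times \<chi>_11, which is 1 or -1. The increment
  of v_1 by s e_1 integrates against \<open>\<sigma>\<close> to at most 16 sqrt E, but this integral
  equals s times that of \<open>\<sigma>\<close> against \<partial>_1 v_1 shifted by some t < s. The
  shifted derivative is close to \<chi>_11 - \<alpha> as \<chi>_11 hardly oscillates, and \<chi>_11
  (\<chi>_11 - \<alpha>) \<ge> 1 - |\<alpha>|.\<close>

lemma second_order_estimate:
  assumes \<alpha>: "\<bar>\<alpha>\<bar> < 1" and \<beta>: "\<beta> = 0" and s: "0 < s" "s \<le> 1/4" and M: "0 < M"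
  shows "(1 - \<bar>\<alpha>\<bar>) * (LINT z|lborel. cutoff z) \<le> 16 * sqrt E / s + 2 * sqrt E
    + 2 * (2 * M * (T + (LINT z|lborel. \<bar>partial_deriv 2 cutoff z\<bar>)) + 8 * sqrt E + 8 * s\<^sup>2 * E / M\<^sup>2)"
proof -
  define B where "B = (LINT z|lborel. \<bar>partial_deriv 2 cutoff z\<bar>)"
  define P where "P = 2 * M * (T + B) + 8 * sqrt E + 8 * s\<^sup>2 * E / M\<^sup>2"
  have sE: "0 < sqrt E" "(sqrt E)\<^sup>2 = E" using E by auto
  define \<sigma> where "\<sigma> z = cutoff z * (1 - 2 * (ch z)\<^sup>2)" for z
  have \<sigma>1: "\<bar>\<sigma> z\<bar> = cutoff z" for z using chi(2)[of z] cutoff_nonneg[of z] by (auto simp: \<sigma>_def)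
  have \<sigma>b: "bdd_supp \<sigma>"
  proof -
    have "(\<lambda>z. 1 - 2 * (ch z)\<^sup>2) \<in> borel_measurable borel" using chi(1) by measurable
    moreover have "\<bar>1 - 2 * (ch z)\<^sup>2\<bar> \<le> 1" for z using chi(2)[of z] by auto
    ultimately show ?thesis unfolding \<sigma>_def[abs_def] by (intro bdd_supp_mult[OF cutoff_bdd])
  qed
  have \<sigma>v: "\<bar>LINT z|lborel. \<sigma> z * v z\<bar> \<le> 8 * sqrt E" if v: "bdd_supp v" "(LINT z|lborel. (v z)\<^sup>2) \<le> (8 * sqrt E)\<^sup>2" for v
  proof -
    have "\<bar>LINT z|lborel. \<sigma> z * v z\<bar> \<le> (LINT z|lborel. \<bar>\<sigma> z * v z\<bar>)" by (rule integral_abs_bound)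
    also have "\<dots> \<le> 8 * sqrt E" by (rule integral_abs_mult_le[OF \<sigma>b _ v]) (use \<sigma>1 cutoff_le_indicator sE in auto)
    finally show ?thesis .
  qed
  have v1b: "bdd_supp v1" by (rule bdd_supp_C1(1)[OF v1(1)])
  obtain t where t: "0 < t" "t < s" "(LINT z|lborel. \<sigma> z * v1 (z + axis 1 s)) - (LINT z|lborel. \<sigma> z * v1 z) = s * (LINT z|lborel. \<sigma> z * partial_deriv 1 v1 (z + axis 1 t))"
    using integral_shift_mvt[OF bdd_supp_integrable[OF \<sigma>b] v1(1) s(1), of 1] by blast
  have "(LINT z|lborel. (v1 (z + axis 1 s))\<^sup>2) = (LINT z|lborel. (v1 z)\<^sup>2)" by (rule integral_translation)
  then have 1: "s * (LINT z|lborel. \<sigma> z * partial_deriv 1 v1 (z + axis 1 t)) \<le> 16 * sqrt E"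
    using t(3) \<sigma>v[OF bdd_supp_shift[OF v1b], of "axis 1 s"] \<sigma>v[OF v1b] v_small(1) by (simp add: abs_le_iff)
  have osc: "(LINT z|lborel. cutoff z * \<bar>(ch (z + axis 1 t))\<^sup>2 - (ch z)\<^sup>2\<bar>) \<le> P"
  proof -
    \<comment> \<open>The oscillation bound is monotone in the distance, so the unknown
      \<open>t\<close> may be replaced by \<open>s\<close>.\<close>
    have "t\<^sup>2 \<le> s\<^sup>2" using t by (intro power_mono) auto
    then have "8 * t\<^sup>2 * E / M\<^sup>2 \<le> 8 * s\<^sup>2 * E / M\<^sup>2" using E by (intro divide_right_mono mult_right_mono) auto
    then show ?thesis using oscillation_estimate[OF \<beta> t(1) _ M] t s unfolding P_def B_def by linarith
  qed
  define r where "r z = partial_deriv 1 v1 z - ((1 - \<alpha>) * indicator (box 0 1) z - 2 * (ch z)\<^sup>2)" for z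
  have rb: "bdd_supp r" unfolding r_def[abs_def]
    by (intro bdd_supp_diff bdd_supp_cmult bdd_supp_power2 chi_bdd bdd_supp_indicator bdd_supp_C1[OF v1(1)])
  have r2: "(LINT z|lborel. (r (z + axis 1 t))\<^sup>2) \<le> (2 * sqrt E)\<^sup>2"
    using d11 E integral_translation[of "\<lambda>z. (r z)\<^sup>2" "axis 1 t"] by (simp add: r_def power_mult_distrib)
  have 2: "(LINT z|lborel. \<bar>cutoff z * r (z + axis 1 t)\<bar>) \<le> 2 * sqrt E"
    by (rule integral_abs_mult_le[OF cutoff_bdd _ bdd_supp_shift[OF rb] r2]) (use cutoff_nonneg cutoff_le_indicator sE in auto)
  have i1: "integrable lborel (\<lambda>z. cutoff z * \<bar>(ch (z + axis 1 t))\<^sup>2 - (ch z)\<^sup>2\<bar>)"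
    by (intro bdd_supp_integrable bdd_supp_mult2 bdd_supp_abs bdd_supp_diff bdd_supp_power2 bdd_supp_shift cutoff_bdd chi_bdd)
  have i2: "integrable lborel (\<lambda>z. \<bar>cutoff z * r (z + axis 1 t)\<bar>)"
    by (intro bdd_supp_integrable bdd_supp_abs bdd_supp_mult2 bdd_supp_shift cutoff_bdd rb)
  have i3: "integrable lborel (\<lambda>z. \<sigma> z * partial_deriv 1 v1 (z + axis 1 t))"
    by (intro bdd_supp_integrable bdd_supp_mult2 bdd_supp_shift \<sigma>b bdd_supp_C1[OF v1(1)])
  have i4: "integrable lborel cutoff" by (rule bdd_supp_integrable[OF cutoff_bdd])
  have "(1 - \<bar>\<alpha>\<bar>) * (LINT z|lborel. cutoff z) = (LINT z|lborel. (1 - \<bar>\<alpha>\<bar>) * cutoff z)" by simp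
  also have "\<dots> \<le> (LINT z|lborel. \<sigma> z * partial_deriv 1 v1 (z + axis 1 t) + 2 * (cutoff z * \<bar>(ch (z + axis 1 t))\<^sup>2 - (ch z)\<^sup>2\<bar>) + \<bar>cutoff z * r (z + axis 1 t)\<bar>)"
  proof (rule integral_mono)
    show "integrable lborel (\<lambda>z. \<sigma> z * partial_deriv 1 v1 (z + axis 1 t) + 2 * (cutoff z * \<bar>(ch (z + axis 1 t))\<^sup>2 - (ch z)\<^sup>2\<bar>) + \<bar>cutoff z * r (z + axis 1 t)\<bar>)"
      using i1 i2 i3 by simp
    show "integrable lborel (\<lambda>z. (1 - \<bar>\<alpha>\<bar>) * cutoff z)" using i4 by simp
    fix z
    show "(1 - \<bar>\<alpha>\<bar>) * cutoff z \<le> \<sigma> z * partial_deriv 1 v1 (z + axis 1 t) + 2 * (cutoff z * \<bar>(ch (z + axis 1 t))\<^sup>2 - (ch z)\<^sup>2\<bar>) + \<bar>cutoff z * r (z + axis 1 t)\<bar>"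
    proof (cases "cutoff z = 0")
      case True then show ?thesis by (simp add: \<sigma>_def)
    next
      case False
      have b: "z + axis 1 t \<in> box 0 1" using cutoff_shift_box[OF False, of t] t s by simp
      define d where "d = (ch (z + axis 1 t))\<^sup>2 - (ch z)\<^sup>2"
      define R where "R = r (z + axis 1 t)"
      define S where "S = 1 - 2 * (ch z)\<^sup>2"
      have S: "S = 1 \<or> S = -1" using chi(2)[of z] by (auto simp: S_def)
      have p: "partial_deriv 1 v1 (z + axis 1 t) = S - \<alpha> - 2 * d + R" using b by (simp add: r_def d_def R_def S_def)
      have "1 - \<bar>\<alpha>\<bar> \<le> S * (S - \<alpha> - 2 * d + R) + 2 * \<bar>d\<bar> + \<bar>R\<bar>" using S by auto
      then have "cutoff z * (1 - \<bar>\<alpha>\<bar>) \<le> cutoff z * (S * (S - \<alpha> - 2 * d + R) + 2 * \<bar>d\<bar> + \<bar>R\<bar>)" by (intro mult_left_mono cutoff_nonneg)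
      also have "\<dots> = \<sigma> z * (S - \<alpha> - 2 * d + R) + 2 * (cutoff z * \<bar>d\<bar>) + \<bar>cutoff z * R\<bar>"
        using cutoff_nonneg[of z] by (simp add: \<sigma>_def S_def[symmetric] abs_mult algebra_simps)
      finally show ?thesis unfolding p d_def[symmetric] R_def[symmetric] by (simp add: mult.commute)
    qed
  qed
  also have "\<dots> = (LINT z|lborel. \<sigma> z * partial_deriv 1 v1 (z + axis 1 t)) + 2 * (LINT z|lborel. cutoff z * \<bar>(ch (z + axis 1 t))\<^sup>2 - (ch z)\<^sup>2\<bar>) + (LINT z|lborel. \<bar>cutoff z * r (z + axis 1 t)\<bar>)"
    using i1 i2 i3 by simp
  finally have "(1 - \<bar>\<alpha>\<bar>) * (LINT z|lborel. cutoff z) \<le> (LINT z|lborel. \<sigma> z * partial_deriv 1 v1 (z + axis 1 t)) + 2 * P + 2 * sqrt E"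
    using osc 2 by linarith
  moreover have "(LINT z|lborel. \<sigma> z * partial_deriv 1 v1 (z + axis 1 t)) \<le> 16 * sqrt E / s" using 1 s(1) by (simp add: pos_le_divide_eq mult.commute)
  ultimately show ?thesis unfolding P_def B_def by linarith
qed

end

section \<open>From finite energy to smooth functions\<close>

lemma L_loc_1_dominated:
  fixes f :: "'a::euclidean_space \<Rightarrow> 'b::euclidean_space" and g :: "'a \<Rightarrow> 'c::euclidean_space"
  assumes f: "f \<in> L_loc 1" and g: "g \<in> borel_measurable borel"
    and B: "\<And>K. compact K \<Longrightarrow> \<exists>B. \<forall>x\<in>K. norm (g x) \<le> B * norm (f x)"
  shows "g \<in> L_loc 1"
proof -
  have "set_integrable lborel K (\<lambda>x. norm (g x) ^ 1)" if K: "compact K" for K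
  proof -
    obtain B where B: "\<And>x. x \<in> K \<Longrightarrow> norm (g x) \<le> B * norm (f x)" using B[OF K] by blast
    have "set_integrable lborel K (\<lambda>x. norm (f x) ^ 1)" using f K by (simp add: L_loc_def)
    then have i: "integrable lborel (\<lambda>x. B * (indicator K x *\<^sub>R norm (f x) ^ 1))" unfolding set_integrable_def by (rule integrable_mult_right)
    show ?thesis unfolding set_integrable_def
    proof (rule Bochner_Integration.integrable_bound[OF i])
      show "(\<lambda>x. indicat_real K x *\<^sub>R norm (g x) ^ 1) \<in> borel_measurable lborel"
        using g borel_compact[OF K] by auto
      show "AE x in lborel. norm (indicat_real K x *\<^sub>R norm (g x) ^ 1) \<le> norm (B * (indicator K x *\<^sub>R norm (f x) ^ 1))"
      proof (rule AE_I2)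
        fix x
        show "norm (indicat_real K x *\<^sub>R norm (g x) ^ 1) \<le> norm (B * (indicator K x *\<^sub>R norm (f x) ^ 1))"
        proof (cases "x \<in> K")
          case True
          have "norm (g x) \<le> \<bar>B * norm (f x)\<bar>" using B[OF True] by linarith
          then show ?thesis using True by simp
        qed simp
      qed
    qed
  qed
  then show ?thesis using g by (simp add: L_loc_def)
qed

lemma L_loc_1_add:
  fixes f g :: "'a::euclidean_space \<Rightarrow> real"
  assumes f: "f \<in> L_loc 1" and g: "g \<in> L_loc 1" shows "(\<lambda>x. f x + g x) \<in> L_loc 1"
proof -
  have m[measurable]: "f \<in> borel_measurable borel" "g \<in> borel_measurable borel" using f g by (simp_all add: L_loc_def)
  have "set_integrable lborel K (\<lambda>x. norm (f x + g x) ^ 1)" if K: "compact K" for K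
  proof -
    have "set_integrable lborel K (\<lambda>x. norm (f x) ^ 1 + norm (g x) ^ 1)" using f g K by (intro set_integral_add) (auto simp: L_loc_def)
    then show ?thesis unfolding set_integrable_def
    proof (rule Bochner_Integration.integrable_bound)
      show "(\<lambda>x. indicat_real K x *\<^sub>R norm (f x + g x) ^ 1) \<in> borel_measurable lborel"
        using borel_compact[OF K] by measurable
    qed (auto simp: indicator_def)
  qed
  then show ?thesis by (simp add: L_loc_def)
qed

lemma L_loc_1_component:
  fixes u :: "real^2 \<Rightarrow> real^2"
  assumes "u \<in> L_loc 1" shows "(\<lambda>z. u z $ k) \<in> L_loc 1"
proof (rule L_loc_1_dominated[OF assms])
  show "(\<lambda>z. u z $ k) \<in> borel_measurable borel"
    using assms by (intro measurable_compose[OF _ borel_measurable_continuous_onI[of "\<lambda>v. v $ k"]]) (auto simp: L_loc_def intro!: continuous_intros)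
  show "\<exists>B. \<forall>x\<in>K. norm (u x $ k) \<le> B * norm (u x)" for K using component_le_norm_cart[of "u _" k] by (intro exI[of _ 1]) auto
qed

lemma L_loc_1_entry:
  fixes W :: "real^2 \<Rightarrow> real^2^2"
  assumes "W \<in> L_loc 1" shows "(\<lambda>z. W z $ k $ j) \<in> L_loc 1"
proof (rule L_loc_1_dominated[OF assms])
  show "(\<lambda>z. W z $ k $ j) \<in> borel_measurable borel"
    using assms by (intro measurable_compose[OF _ borel_measurable_continuous_onI[of "\<lambda>v. v $ k $ j"]]) (auto simp: L_loc_def intro!: continuous_intros)
  have "\<bar>W x $ k $ j\<bar> \<le> norm (W x)" for x
    using component_le_norm_cart[of "W x $ k" j] Finite_Cartesian_Product.norm_nth_le[of "W x" k] by linarith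
  then show "\<exists>B. \<forall>x\<in>K. norm (W x $ k $ j) \<le> B * norm (W x)" for K by (intro exI[of _ 1]) auto
qed

lemma weak_deriv_const: "weak_deriv j (\<lambda>x::real^2. c) (\<lambda>x. 0)"
  unfolding weak_deriv_def by (simp add: integral_partial_deriv_zero)

text \<open>Testing with \<open>m \<phi>\<close>, where \<open>m\<close> is a \<open>C\<^sup>1\<close> function that vanishes exactly on the square.\<close>

lemma weak_deriv_zero_off_Omega:
  fixes w :: "real^2 \<Rightarrow> real"
  assumes w: "w \<in> L_loc 1" "AE z in lborel. z \<notin> Omega \<longrightarrow> w z = 0" and H: "H \<in> L_loc 1" "weak_deriv j w H"
  shows "AE z in lborel. z \<notin> Omega \<longrightarrow> H z = 0"
proof -
  \<comment> \<open>\<open>q k\<close> measures how far the k-th coordinate is outside [0, 1].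
    Inside it vanishes together with its gradient, so the product rule leaves no term on the
    square.\<close>
  define q where "q k z = (max 0 (z $ k - 1))\<^sup>2 + (max 0 (0 - z $ k))\<^sup>2" for k :: 2 and z :: "real^2"
  define q' where "q' k z = (2 * max 0 (z $ k - 1)) *\<^sub>R (axis k 1 - 0) + (2 * max 0 (0 - z $ k)) *\<^sub>R (0 - axis k 1 :: real^2)" for k :: 2 and z :: "real^2"
  define m where "m z = q 1 z + q 2 z" for z
  define m' where "m' z = q' 1 z + q' 2 z" for z
  have q: "C1_grad (q k) (q' k)" for k unfolding q_def[abs_def] q'_def[abs_def]
    by (rule C1_grad_add[OF C1_grad_max0_square[OF C1_grad_diff[OF C1_grad_component C1_grad_const]] C1_grad_max0_square[OF C1_grad_diff[OF C1_grad_const C1_grad_component]]])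
  have m: "C1_grad m m'" unfolding m_def[abs_def] m'_def[abs_def] by (rule C1_grad_add[OF q q])
  have cm: "continuous_on UNIV m" by (rule C1_grad_continuous[OF m])
  have in_Omega: "m z = 0 \<and> m' z = 0" if "z \<in> Omega" for z
    using that by (simp add: m_def m'_def q_def q'_def Omega_def mem_box_cart)
  have m_pos: "m z \<noteq> 0" if "z \<notin> Omega" for z
  proof
    assume "m z = 0"
    then have "q 1 z = 0" "q 2 z = 0" unfolding m_def q_def by (simp_all add: add_nonneg_eq_0_iff)
    then have "0 \<le> z $ k \<and> z $ k \<le> 1" for k using exhaust_2[of k] by (auto simp: q_def add_nonneg_eq_0_iff max_def split: if_splits)
    then show False using that by (simp add: Omega_def mem_box_cart)
  qed
  have L: "(\<lambda>z. H z * m z) \<in> L_loc 1"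
  proof (rule L_loc_1_dominated[OF H(1)])
    show "(\<lambda>z. H z * m z) \<in> borel_measurable borel" using H(1) borel_measurable_continuous_onI[OF cm] by (auto simp: L_loc_def)
    fix K :: "(real^2) set" assume "compact K"
    then have "bounded (m ` K)" using cm by (intro compact_imp_bounded compact_continuous_image) (auto intro: continuous_on_subset)
    then obtain B where "\<forall>x\<in>K. \<bar>m x\<bar> \<le> B" by (auto simp: bounded_iff)
    then show "\<exists>B. \<forall>x\<in>K. norm (H x * m x) \<le> B * norm (H x)"
      by (intro exI[of _ B]) (auto simp: abs_mult mult.commute[of "\<bar>H _\<bar>"] intro!: mult_right_mono)
  qed
  have "AE z in lborel. H z * m z = 0"
  proof (rule AE_zero_if_test_zero[OF L])
    fix \<phi> :: "real^2 \<Rightarrow> real" assume \<phi>: "\<phi> \<in> C1_compact UNIV"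
    obtain g K where g: "C1_grad \<phi> g" "compact K" "\<And>x. \<phi> x \<noteq> 0 \<Longrightarrow> x \<in> K" using C1_compact_C1_grad[OF \<phi>] by metis
    have C: "C1_grad (\<lambda>z. m z * \<phi> z) (\<lambda>z. \<phi> z *\<^sub>R m' z + m z *\<^sub>R g z)" by (rule C1_grad_mult[OF m g(1)])
    have K: "z \<in> K" if "m z * \<phi> z \<noteq> 0" for z using g(3)[of z] that by auto
    have mC: "(\<lambda>z. m z * \<phi> z) \<in> C1_compact UNIV" by (rule C1_grad_C1_compact(1)[OF C g(2) subset_UNIV K])
    have pd: "partial_deriv j (\<lambda>z. m z * \<phi> z) z = (\<phi> z *\<^sub>R m' z + m z *\<^sub>R g z) $ j" for z
      by (rule C1_grad_C1_compact(2)[OF C g(2) subset_UNIV K])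
    have "(LINT z|lborel. H z * m z * \<phi> z) = - (LINT z|lborel. w z * partial_deriv j (\<lambda>z. m z * \<phi> z) z)"
      using H(2)[unfolded weak_deriv_def, rule_format, OF mC] by (simp add: mult.assoc)
    also have "(LINT z|lborel. w z * partial_deriv j (\<lambda>z. m z * \<phi> z) z) = 0"
    proof (rule integral_eq_zero_AE)
      show "AE z in lborel. w z * partial_deriv j (\<lambda>z. m z * \<phi> z) z = 0"
        using w(2) unfolding pd
      proof eventually_elim
        case (elim z) then show ?case using in_Omega[of z] by (cases "z \<in> Omega") auto
      qed
    qed
    finally show "(LINT z|lborel. H z * m z * \<phi> z) = 0" by simp
  qed
  then show ?thesis by eventually_elim (use m_pos in auto)
qed

lemma integrable_if_zero_off_Omega:
  fixes w :: "real^2 \<Rightarrow> real"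
  assumes w: "w \<in> L_loc 1" "AE z in lborel. z \<notin> Omega \<longrightarrow> w z = 0"
  shows "integrable lborel w"
proof -
  have [measurable]: "w \<in> borel_measurable borel" using w by (simp add: L_loc_def)
  have "compact Omega" by (simp add: Omega_def)
  then have i: "integrable lborel (\<lambda>x. indicator Omega x *\<^sub>R norm (w x) ^ 1)" using w(1) by (simp add: L_loc_def set_integrable_def)
  show ?thesis
  proof (rule Bochner_Integration.integrable_bound[OF i])
    show "AE x in lborel. norm (w x) \<le> norm (indicator Omega x *\<^sub>R norm (w x) ^ 1)"
      using w(2) by eventually_elim (auto simp: indicator_def)
  qed simp
qed

text \<open>The test field is \<open>\<psi>\<close> times c e_j. The free constant serves both
  signs, c = 1 / M and c = - 1 / M; an absolute value is recovered from the two, although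
  \<open>ennreal\<close> truncates negative numbers.\<close>

lemma total_variation_test:
  fixes f \<psi> :: "real^'n \<Rightarrow> real"
  assumes \<psi>: "\<psi> \<in> C1_compact U" and M: "\<And>z. \<bar>\<psi> z\<bar> \<le> M" and c: "\<bar>c\<bar> * M \<le> 1"
  shows "ennreal (c * (LINT x:U|lborel. f x * partial_deriv j \<psi> x)) \<le> total_variation U f"
proof -
  define \<phi> where "\<phi> x = \<psi> x *\<^sub>R (axis j c :: real^'n)" for x
  obtain \<psi>' where \<psi>': "\<And>x. (\<psi> has_derivative blinfun_apply (\<psi>' x)) (at x)" "continuous_on UNIV \<psi>'"
    and K: "compact (closure {x. \<psi> x \<noteq> 0})" "closure {x. \<psi> x \<noteq> 0} \<subseteq> U" using \<psi> unfolding C1_compact_def by blast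
  show ?thesis
  proof (cases "c = 0")
    case False
    define L where "L = blinfun_scaleR_left (axis j c :: real^'n)"
    have d: "(\<phi> has_derivative blinfun_apply (L o\<^sub>L \<psi>' x)) (at x)" for x
      unfolding \<phi>_def[abs_def] L_def by (rule has_derivative_eq_rhs[OF has_derivative_scaleR_left[OF \<psi>'(1)[of x]]])
        (simp add: fun_eq_iff blinfun_scaleR_left.rep_eq blinfun_compose.rep_eq)
    have "continuous_on UNIV (\<lambda>x. L o\<^sub>L \<psi>' x)"
      by (intro bounded_bilinear.continuous_on[OF bounded_bilinear_blinfun_compose] continuous_on_const \<psi>'(2))
    then have "\<exists>\<phi>'. (\<forall>x. (\<phi> has_derivative blinfun_apply (\<phi>' x)) (at x)) \<and> continuous_on UNIV \<phi>'"
      by (intro exI[of _ "\<lambda>x. L o\<^sub>L \<psi>' x"] conjI allI d)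
    moreover have e: "{x. \<phi> x \<noteq> 0} = {x. \<psi> x \<noteq> 0}" using False by (simp add: \<phi>_def)
    ultimately have C: "\<phi> \<in> C1_compact U" unfolding C1_compact_def mem_Collect_eq e using K by blast
    have "norm (\<phi> x) \<le> 1" for x
    proof -
      have "norm (\<phi> x) = \<bar>c\<bar> * \<bar>\<psi> x\<bar>" by (simp add: \<phi>_def norm_axis_real mult.commute)
      also have "\<dots> \<le> \<bar>c\<bar> * M" by (intro mult_left_mono M) simp
      finally show ?thesis using c by linarith
    qed
    then have "ennreal (LINT x:U|lborel. f x * divergence \<phi> x) \<le> total_variation U f"
      unfolding total_variation_def using C by (intro SUP_upper) simp
    moreover have "divergence \<phi> x = c * partial_deriv j \<psi> x" for x
    proof -
      have k: "(\<lambda>x. \<phi> x $ k) = (\<lambda>x. (if k = j then c else 0) * \<psi> x)" for k by (auto simp: \<phi>_def axis_def)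
      have "frechet_derivative (\<lambda>x. b * \<psi> x) (at x) = (\<lambda>h. b * blinfun_apply (\<psi>' x) h)" for b
        by (rule frechet_derivative_at[symmetric]) (rule has_derivative_mult_right[OF \<psi>'(1)])
      moreover have "frechet_derivative \<psi> (at x) = blinfun_apply (\<psi>' x)" by (rule frechet_derivative_at[symmetric, OF \<psi>'(1)])
      ultimately have "partial_deriv k (\<lambda>x. \<phi> x $ k) x = (if k = j then c * partial_deriv j \<psi> x else 0)" for k
        unfolding k partial_deriv_def by simp
      then show ?thesis unfolding C1_compact_component(2)[OF C] by simp
    qed
    ultimately show ?thesis by (simp add: mult.left_commute)
  qed simp
qed

text \<open>Subtracting the affine boundary values leaves a function that vanishes outside the
  square, and so does its weak gradient. Hence on the whole plane this gradient is L^2-close to the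
  phases minus F on the square, extended by 0, and mollification preserves the estimate.\<close>

lemma low_energy_exists:
  fixes F :: "real^2^2"
  assumes F: "F $ 1 $ 2 = 0" "F $ 2 $ 1 = 0" and X: "X \<in> phases" and u: "u \<in> admissible F"
    and en: "energy \<epsilon> u X \<le> ennreal E" and E: "0 < E" and eps: "0 < \<epsilon>"
  shows "\<exists>ch v1 v2. low_energy ch v1 v2 (F $ 1 $ 1) (F $ 2 $ 2) E (E / \<epsilon>)"
proof -
  define W where "W = weak_gradient u"
  obtain b G0 where b: "AE x in lborel. x \<notin> Omega \<longrightarrow> u x = F *v x + b" and G0: "has_weak_gradient u G0"
    using u unfolding admissible_def W12_loc_def by blast
  have W: "has_weak_gradient u W" unfolding W_def weak_gradient_def by (rule someI[of "has_weak_gradient u", OF G0])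
  have uL: "u \<in> L_loc 1" and WL: "W \<in> L_loc 1" using W by (auto simp: has_weak_gradient_def)
  define w where "w k z = (u z $ k + ((- F) *v z) $ k) + - b $ k" for k z
  define H where "H k j z = (W z $ k $ j + (- F) $ k $ j) + 0" for k j z
  have L1: "(\<lambda>z::real^2. c::real) \<in> L_loc 1" for c by (rule L_loc_1_bounded[of _ "\<bar>c\<bar>"]) auto
  have wL: "w k \<in> L_loc 1" for k unfolding w_def[abs_def]
    by (intro L_loc_1_add L_loc_1_component uL weak_deriv_linear(2) L1)
  have HL: "H k j \<in> L_loc 1" for k j unfolding H_def[abs_def]
    by (intro L_loc_1_add L_loc_1_entry WL L1)
  have Hm[measurable]: "H k j \<in> borel_measurable borel" for k j using HL[of k j] by (simp add: L_loc_def)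
  have wH: "weak_deriv j (w k) (H k j)" for k j
  proof -
    have "weak_deriv j (\<lambda>z. u z $ k) (\<lambda>z. W z $ k $ j)" using W by (auto simp: has_weak_gradient_def weak_deriv_def)
    then show ?thesis unfolding w_def[abs_def] H_def[abs_def]
      by (intro weak_deriv_add weak_deriv_linear weak_deriv_const L_loc_1_add L_loc_1_component L_loc_1_entry uL WL L1)
  qed
  have w0: "AE z in lborel. z \<notin> Omega \<longrightarrow> w k z = 0" for k
    using b by eventually_elim (simp add: w_def matrix_vector_mult_def sum_negf)
  have H0: "AE z in lborel. z \<notin> Omega \<longrightarrow> H k j z = 0" for k j
    by (rule weak_deriv_zero_off_Omega[OF wL w0 HL wH])
  have wi: "integrable lborel (w k)" and Hi: "integrable lborel (H k j)" for k j
    using integrable_if_zero_off_Omega[OF wL w0] integrable_if_zero_off_Omega[OF HL H0] by auto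

  have BV: "X j \<in> BV (box 0 1)" and X01: "AE x in lborel. x \<in> box 0 1 \<longrightarrow> X j x \<in> {0, 1}" if "j \<in> {1..3}" for j
    using X that by (auto simp: phases_def)
  have X1: "AE x in lborel. x \<in> box 0 1 \<longrightarrow> X 1 x + X 2 x + X 3 x = 1" using X by (simp add: phases_def)
  have XI: "set_integrable lborel (box 0 1) (X j)" if "j \<in> {1..3}" for j using BV[OF that] by (simp add: BV_def)
  define y where "y z = indicator (box 0 1) z *\<^sub>R X 3 z - indicator (box 0 1) z *\<^sub>R X 2 z" for z :: "real^2"
  \<comment> \<open>The phases are constrained only almost everywhere; this Borel representative has
    values in {-1, 0, 1} at every point.\<close>
  define ch where "ch z = (if y z = -1 \<or> y z = 0 \<or> y z = 1 then y z else 0)" for z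
  have ym[measurable]: "y \<in> borel_measurable borel"
    using XI[of 2] XI[of 3] borel_measurable_integrable unfolding y_def[abs_def] set_integrable_def by (intro borel_measurable_diff) force+
  have chm: "ch \<in> borel_measurable borel" unfolding ch_def[abs_def] by measurable
  have chv: "ch z \<in> {-1, 0, 1}" for z by (auto simp: ch_def)
  have ch0: "ch z = 0" if "z \<notin> box 0 1" for z using that by (simp add: ch_def y_def)
  have chX: "AE z in lborel. z \<in> box 0 1 \<longrightarrow> ch z = X 3 z - X 2 z \<and> 1 - 2 * (ch z)\<^sup>2 = X 1 z - X 2 z - X 3 z"
    using X01[of 1, simplified] X01[of 2, simplified] X01[of 3, simplified] X1
  proof eventually_elim
    case (elim z)
    show ?case
    proof
      assume z: "z \<in> box 0 1"
      then have c: "X 1 z = 0 \<or> X 1 z = 1" "X 2 z = 0 \<or> X 2 z = 1" "X 3 z = 0 \<or> X 3 z = 1" "X 1 z + X 2 z + X 3 z = 1" using elim by auto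
      have yz: "y z = X 3 z - X 2 z" using z by (simp add: y_def)
      have "(X 1 z = 1 \<and> X 2 z = 0 \<and> X 3 z = 0) \<or> (X 1 z = 0 \<and> X 2 z = 1 \<and> X 3 z = 0) \<or> (X 1 z = 0 \<and> X 2 z = 0 \<and> X 3 z = 1)" using c by auto
      then show "ch z = X 3 z - X 2 z \<and> 1 - 2 * (ch z)\<^sup>2 = X 1 z - X 2 z - X 3 z" unfolding ch_def yz by auto
    qed
  qed
  have chb: "bdd_supp ch"
  proof (rule bdd_suppI[OF chm compact_cbox])
    show "\<bar>ch x\<bar> \<le> 1" for x using chv[of x] by auto
    show "ch x = 0" if "x \<notin> cbox 0 1" for x using ch0[of x] that box_subset_cbox[of 0 "1::real^2"] by blast
  qed

  define f where "f k j z = (if k = 1 \<and> j = 1 then (1 - F $ 1 $ 1) * indicator (box 0 1) z - 2 * (ch z)\<^sup>2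
     else if k = 2 \<and> j = 2 then ch z - F $ 2 $ 2 * indicator (box 0 1) z else 0)" for k j :: 2 and z :: "real^2"
  have f11: "f 1 1 = (\<lambda>z. (1 - F $ 1 $ 1) * indicator (box 0 1) z - 2 * (ch z)\<^sup>2)" by (simp add: f_def fun_eq_iff)
  have f22: "f 2 2 = (\<lambda>z. ch z - F $ 2 $ 2 * indicator (box 0 1) z)" by (simp add: f_def fun_eq_iff)
  have f0: "f 1 2 = (\<lambda>z. 0)" "f 2 1 = (\<lambda>z. 0)" by (simp_all add: f_def fun_eq_iff)
  have fb: "bdd_supp (f k j)" for k j
  proof -
    have "bdd_supp (f 1 2)" "bdd_supp (f 2 1)" unfolding f0 using bdd_supp_cmult[OF chb, of 0] by simp_all
    moreover have "bdd_supp (f 1 1)" "bdd_supp (f 2 2)"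
      unfolding f11 f22 by (intro bdd_supp_diff bdd_supp_cmult bdd_supp_power2 chb bdd_supp_indicator)+
    ultimately show ?thesis using exhaust_2[of k] exhaust_2[of j] by metis
  qed
  have fm[measurable]: "f k j \<in> borel_measurable borel" for k j using fb[of k j] by (simp add: bdd_supp_def)

  have Eu: "(\<integral>\<^sup>+x. ennreal ((norm (W x - (\<Sum>j=1..3. X j x *\<^sub>R well j)))\<^sup>2) * indicator Omega x \<partial>lborel) \<le> ennreal E"
    using en unfolding energy_def W_def by (rule order_trans[rotated]) (simp add: add_increasing2)
  have Et: "ennreal \<epsilon> * (\<Sum>j=1..3. total_variation (box 0 1) (X j)) \<le> ennreal E"
    using en unfolding energy_def by (rule order_trans[rotated]) (simp add: add_increasing)

  have HE: "(\<integral>\<^sup>+z. ennreal ((H k j z - f k j z)\<^sup>2) \<partial>lborel) \<le> ennreal E" for k j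
  proof -
    have n: "AE z in lborel. (z::real^2) $ 1 \<noteq> 0 \<and> z $ 1 \<noteq> 1 \<and> z $ 2 \<noteq> 0 \<and> z $ 2 \<noteq> 1"
      using AE_nth_neq[of 1 0] AE_nth_neq[of 1 1] AE_nth_neq[of 2 0] AE_nth_neq[of 2 1] by eventually_elim simp
    have "(\<integral>\<^sup>+z. ennreal ((H k j z - f k j z)\<^sup>2) \<partial>lborel) \<le> (\<integral>\<^sup>+x. ennreal ((norm (W x - (\<Sum>j=1..3. X j x *\<^sub>R well j)))\<^sup>2) * indicator Omega x \<partial>lborel)"
    proof (rule nn_integral_mono_AE)
      show "AE z in lborel. ennreal ((H k j z - f k j z)\<^sup>2) \<le> ennreal ((norm (W z - (\<Sum>j=1..3. X j z *\<^sub>R well j)))\<^sup>2) * indicator Omega z"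
        using chX n H0[of k j]
      proof eventually_elim
        case (elim z)
        show ?case
        proof (cases "z \<in> Omega")
          case False
          then have nb: "z \<notin> box 0 1" using box_subset_cbox[of 0 "1::real^2"] by (auto simp: Omega_def)
          then have "f k j z = 0" using ch0[OF nb] by (simp add: f_def)
          then show ?thesis using elim False by simp
        next
          case True
          have "z \<in> box 0 1" using True elim(2) by (auto simp: Omega_def mem_box_cart forall_2 less_le)
          then have c: "ch z = X 3 z - X 2 z" "1 - 2 * (ch z)\<^sup>2 = X 1 z - X 2 z - X 3 z" and i: "indicator (box 0 1) z = (1::real)" using elim(1) by auto
          define S where "S = (\<Sum>j=1..3. X j z *\<^sub>R well j)"
          have s: "S $ 1 $ 1 = 1 - 2 * (ch z)\<^sup>2" "S $ 1 $ 2 = 0" "S $ 2 $ 1 = 0" "S $ 2 $ 2 = ch z"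
            unfolding S_def phase_sum_nth[of "\<lambda>j. X j z"] c(2) by (simp_all add: c(1))
          have a1: "H k j z - f k j z = (W z - S) $ k $ j"
            using exhaust_2[of k] exhaust_2[of j] F by (auto simp: H_def f_def i s)
          have a2: "(D $ k $ j)\<^sup>2 \<le> (norm D)\<^sup>2" for D :: "real^2^2"
            unfolding norm_matrix2_square using exhaust_2[of k] exhaust_2[of j] by auto
          show ?thesis using True ennreal_leI[OF a2[of "W z - S"]] unfolding S_def[symmetric] a1 by simp
        qed
      qed
    qed
    then show ?thesis using Eu by (rule order_trans)
  qed
  have Hfin: "(\<integral>\<^sup>+z. ennreal ((H k j z)\<^sup>2) \<partial>lborel) < \<infinity>" for k j
  proof -
    have "(\<integral>\<^sup>+z. ennreal ((f k j z)\<^sup>2) \<partial>lborel) = ennreal (LINT z|lborel. (f k j z)\<^sup>2)"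
      by (rule nn_integral_eq_integral[OF bdd_supp_integrable[OF bdd_supp_power2[OF fb]]]) simp
    then have "2 * (\<integral>\<^sup>+z. ennreal ((H k j z - f k j z)\<^sup>2) \<partial>lborel) + 2 * (\<integral>\<^sup>+z. ennreal ((f k j z)\<^sup>2) \<partial>lborel) < \<infinity>"
      using le_less_trans[OF HE[of k j] ennreal_less_top[of E]] by (simp add: ennreal_mult_less_top)
    moreover have "(\<integral>\<^sup>+z. ennreal ((H k j z)\<^sup>2) \<partial>lborel) \<le> 2 * (\<integral>\<^sup>+z. ennreal ((H k j z - f k j z)\<^sup>2) \<partial>lborel) + 2 * (\<integral>\<^sup>+z. ennreal ((f k j z)\<^sup>2) \<partial>lborel)"
      using nn_integral_square_diff_le[OF Hm[of k j] fm[of k j], of "\<lambda>z. 0"] by simp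
    ultimately show ?thesis by (rule le_less_trans[rotated])
  qed
  have "\<exists>v. v \<in> C1_compact UNIV \<and> (\<forall>z. v z \<noteq> 0 \<longrightarrow> z \<in> cbox (-1) 2) \<and> (\<forall>j. (LINT z|lborel. (partial_deriv j v z - f k j z)\<^sup>2) \<le> 4 * E)" for k
  proof -
    \<comment> \<open>The tolerance is \<open>E\<close>, the size of the error already present; the
      two errors add up to 2 E + 2 E.\<close>
    obtain v G where v: "C1_grad v G" "\<And>z. v z \<noteq> 0 \<Longrightarrow> z \<in> cbox (-1) 2" "\<And>j. (\<integral>\<^sup>+z. ennreal ((G z $ j - H k j z)\<^sup>2) \<partial>lborel) \<le> ennreal E"
      using mollification[of "w k" "H k", OF wi w0 Hi Hfin wH E] by blast
    note C = C1_grad_C1_compact[OF v(1) compact_cbox subset_UNIV v(2)]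
    have "(LINT z|lborel. (partial_deriv j v z - f k j z)\<^sup>2) \<le> 4 * E" for j
    proof -
      have [measurable]: "(\<lambda>z. G z $ j) \<in> borel_measurable borel"
        using C1_grad_continuous_grad[OF v(1)] by (intro borel_measurable_continuous_onI continuous_intros)
      have i: "integrable lborel (\<lambda>z. (partial_deriv j v z - f k j z)\<^sup>2)"
        by (intro bdd_supp_integrable bdd_supp_power2 bdd_supp_diff fb bdd_supp_C1[OF C(1)])
      have "ennreal (LINT z|lborel. (partial_deriv j v z - f k j z)\<^sup>2) = (\<integral>\<^sup>+z. ennreal ((G z $ j - f k j z)\<^sup>2) \<partial>lborel)"
        unfolding nn_integral_eq_integral[OF i, simplified, symmetric] using C(2)[of j] by (intro nn_integral_cong) simp
      also have "\<dots> \<le> 2 * (\<integral>\<^sup>+z. ennreal ((G z $ j - H k j z)\<^sup>2) \<partial>lborel) + 2 * (\<integral>\<^sup>+z. ennreal ((H k j z - f k j z)\<^sup>2) \<partial>lborel)"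
        by (rule nn_integral_square_diff_le) measurable
      also have "\<dots> \<le> 2 * ennreal E + 2 * ennreal E" by (intro add_mono mult_left_mono v(3) HE) auto
      also have "\<dots> = ennreal (4 * E)"
      proof -
        have "2 * ennreal E = ennreal (2 * E)" using E by (simp add: ennreal_mult)
        then show ?thesis using E by (simp add: ennreal_plus[symmetric] del: ennreal_plus)
      qed
      finally show ?thesis using E by (subst (asm) ennreal_le_iff) auto
    qed
    then show ?thesis using C(1) v(2) by blast
  qed
  note mol = this
  obtain v1 where v1: "v1 \<in> C1_compact UNIV" "\<And>z. v1 z \<noteq> 0 \<Longrightarrow> z \<in> cbox (-1) 2" "\<And>j. (LINT z|lborel. (partial_deriv j v1 z - f 1 j z)\<^sup>2) \<le> 4 * E"
    using mol[of 1] by blast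
  obtain v2 where v2: "v2 \<in> C1_compact UNIV" "\<And>z. v2 z \<noteq> 0 \<Longrightarrow> z \<in> cbox (-1) 2" "\<And>j. (LINT z|lborel. (partial_deriv j v2 z - f 2 j z)\<^sup>2) \<le> 4 * E"
    using mol[of 2] by blast

  have tv: "\<bar>LINT z|lborel. ch z * partial_deriv 2 \<psi> z\<bar> \<le> M * (E / \<epsilon>)" if \<psi>: "\<psi> \<in> C1_compact (box 0 1)" and M: "\<And>z. \<bar>\<psi> z\<bar> \<le> M" for \<psi> M
  proof -
    have M0: "0 \<le> M" using M[of 0] by linarith
    define t where "t j = enn2real (total_variation (box 0 1) (X j))" for j
    have t: "total_variation (box 0 1) (X j) = ennreal (t j)" "0 \<le> t j" if "j \<in> {1..3}" for j
      using BV[OF that] by (auto simp: t_def BV_def)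
    have set3: "{1..3::nat} = {1, 2, 3}" by auto
    have "(\<Sum>j=1..3. total_variation (box 0 1) (X j)) = ennreal (t 1 + t 2 + t 3)"
      unfolding set3 using t[of 1] t[of 2] t[of 3] by (simp add: add.assoc)
    then have "ennreal (\<epsilon> * (t 1 + t 2 + t 3)) \<le> ennreal E" using Et eps t(2)[of 1] t(2)[of 2] t(2)[of 3] by (simp add: ennreal_mult del: ennreal_plus)
    then have "\<epsilon> * (t 1 + t 2 + t 3) \<le> E" using E by (subst (asm) ennreal_le_iff) auto
    \<comment> \<open>\<open>ch\<close> is built from the second and third phase, so their share of
      the total variation is what has to be bounded.\<close>
    then have tE: "t 2 + t 3 \<le> E / \<epsilon>" using eps t(2)[of 1] by (simp add: pos_le_divide_eq mult.commute) (smt (verit) mult_nonneg_nonneg distrib_left)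
    define I where "I j = (LINT x:box 0 1|lborel. X j x * partial_deriv 2 \<psi> x)" for j
    have It: "\<bar>I j\<bar> \<le> M * t j" if j: "j \<in> {1..3}" for j
    proof (cases "M = 0")
      case True
      then have "\<psi> = (\<lambda>z. 0)" using M by (auto simp: fun_eq_iff)
      then show ?thesis using True by (simp add: I_def partial_deriv_def frechet_derivative_const)
    next
      case False
      then have M1: "0 < M" using M0 by simp
      have "ennreal (c * I j) \<le> ennreal (t j)" if "\<bar>c\<bar> * M \<le> 1" for c
        using total_variation_test[OF \<psi> M that, of "X j" 2] unfolding t(1)[OF j] I_def .
      then have "c * I j \<le> t j" if "\<bar>c\<bar> * M \<le> 1" for c using that t(2)[OF j] ennreal_le_iff by blast
      from this[of "1 / M"] this[of "- 1 / M"] show ?thesis using M1 by (simp add: abs_le_iff field_simps)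
    qed
    have int: "integrable lborel (\<lambda>z. indicator (box 0 1) z *\<^sub>R (X j z * partial_deriv 2 \<psi> z))" if j: "j \<in> {1..3}" for j
    proof -
      have i: "integrable lborel (\<lambda>z. indicator (box 0 1) z *\<^sub>R X j z)" using XI[OF j] by (simp add: set_integrable_def)
      obtain B where B: "\<And>z. \<bar>partial_deriv 2 \<psi> z\<bar> \<le> B" and m: "partial_deriv 2 \<psi> \<in> borel_measurable borel"
        using bdd_supp_C1(2)[OF \<psi>, of 2] unfolding bdd_supp_def by blast
      have "integrable lborel (\<lambda>z. indicator (box 0 1) z *\<^sub>R X j z * partial_deriv 2 \<psi> z)"
      proof (rule Bochner_Integration.integrable_bound)
        show "integrable lborel (\<lambda>z. B * (indicator (box 0 1) z *\<^sub>R X j z))" using i by (rule integrable_mult_right)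
        show "(\<lambda>z. indicator (box 0 1) z *\<^sub>R X j z * partial_deriv 2 \<psi> z) \<in> borel_measurable lborel"
          using borel_measurable_integrable[OF i] m by simp
        show "AE z in lborel. norm (indicator (box 0 1) z *\<^sub>R X j z * partial_deriv 2 \<psi> z) \<le> norm (B * (indicator (box 0 1) z *\<^sub>R X j z))"
        proof (rule AE_I2)
          fix z
          have "\<bar>partial_deriv 2 \<psi> z\<bar> * \<bar>indicator (box 0 1) z *\<^sub>R X j z\<bar> \<le> \<bar>B\<bar> * \<bar>indicator (box 0 1) z *\<^sub>R X j z\<bar>"
            by (intro mult_right_mono order_trans[OF B abs_ge_self]) simp
          then show "norm (indicator (box 0 1) z *\<^sub>R X j z * partial_deriv 2 \<psi> z) \<le> norm (B * (indicator (box 0 1) z *\<^sub>R X j z))"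
            unfolding real_norm_def abs_mult[of B] abs_mult[of _ "partial_deriv 2 \<psi> z"] by (simp only: mult.commute)
        qed
      qed
      then show ?thesis by (simp add: mult.assoc)
    qed
    have "(LINT z|lborel. ch z * partial_deriv 2 \<psi> z) = (LINT z|lborel. indicator (box 0 1) z *\<^sub>R (X 3 z * partial_deriv 2 \<psi> z) - indicator (box 0 1) z *\<^sub>R (X 2 z * partial_deriv 2 \<psi> z))"
    proof (rule integral_cong_AE)
      show "(\<lambda>z. ch z * partial_deriv 2 \<psi> z) \<in> borel_measurable lborel"
        using bdd_supp_mult2[OF chb bdd_supp_C1(2)[OF \<psi>, of 2]] by (simp add: bdd_supp_def)
      show "(\<lambda>z. indicator (box 0 1) z *\<^sub>R (X 3 z * partial_deriv 2 \<psi> z) - indicator (box 0 1) z *\<^sub>R (X 2 z * partial_deriv 2 \<psi> z)) \<in> borel_measurable lborel"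
        by (intro borel_measurable_diff borel_measurable_integrable int) auto
      show "AE z in lborel. ch z * partial_deriv 2 \<psi> z = indicator (box 0 1) z *\<^sub>R (X 3 z * partial_deriv 2 \<psi> z) - indicator (box 0 1) z *\<^sub>R (X 2 z * partial_deriv 2 \<psi> z)"
        using chX
      proof eventually_elim
        case (elim z)
        show ?case
        proof (cases "z \<in> box 0 1")
          case True then show ?thesis using elim by (simp add: left_diff_distrib)
        qed (simp add: ch0)
      qed
    qed
    also have "\<dots> = I 3 - I 2" unfolding I_def set_lebesgue_integral_def by (intro Bochner_Integration.integral_diff int) auto
    also have "\<bar>\<dots>\<bar> \<le> M * (t 2 + t 3)" using It[of 2] It[of 3] by (simp add: distrib_left)
    also have "\<dots> \<le> M * (E / \<epsilon>)" using tE M0 by (rule mult_left_mono)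
    finally show ?thesis .
  qed
  have "low_energy ch v1 v2 (F $ 1 $ 1) (F $ 2 $ 2) E (E / \<epsilon>)"
  proof
    show "(LINT z|lborel. (partial_deriv 2 v1 z)\<^sup>2) \<le> 4 * E" using v1(3)[of 2] by (simp add: f0)
    show "(LINT z|lborel. (partial_deriv 1 v2 z)\<^sup>2) \<le> 4 * E" using v2(3)[of 1] by (simp add: f0)
  qed (fact chm chv ch0 v1(1,2) v2(1,2) E tv v1(3)[of 1, unfolded f11] v2(3)[of 2, unfolded f22])+
  then show ?thesis by blast
qed

text \<open>With p = \<epsilon>^(1/3), E = d^4 p^2 and M = d p, every term of
  \<open>first_order_estimate\<close> carries a power of \<open>d\<close> and stays bounded in
  \<epsilon>: 128 d^2, d^5, 2 B d p and 10 d^2 p. Their sum is at most d (139 + 2 B), where 139 =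
  128 + 1 + 10, and \<open>d\<close> is chosen to keep this below m Z.\<close>

lemma lower_bound_first_order:
  fixes F :: "real^2^2"
  assumes F: "F $ 1 $ 1 = -1" "F $ 1 $ 2 = 0" "F $ 2 $ 1 = 0" "\<bar>F $ 2 $ 2\<bar> < 1"
  shows "\<exists>c>0. \<forall>\<epsilon>. 0 < \<epsilon> \<and> \<epsilon> < 1 \<longrightarrow> ennreal (c * \<epsilon> powr (2/3)) \<le> min_energy \<epsilon> F"
proof -
  define Z where "Z = (LINT z|lborel. cutoff z)"
  define B where "B = (LINT z|lborel. \<bar>partial_deriv 2 cutoff z\<bar>)"
  define m where "m = (1 - \<bar>F $ 2 $ 2\<bar>)\<^sup>2"
  have pos: "0 < Z" "0 \<le> B" "0 < m" using cutoff_integral_pos F(4) by (auto simp: Z_def B_def m_def)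
  define d where "d = min 1 (m * Z / (2 * (139 + 2 * B)))"
  have d: "0 < d" "d \<le> 1" "d * (139 + 2 * B) < m * Z"
  proof -
    show "0 < d" "d \<le> 1" using pos by (auto simp: d_def)
    have "d * (139 + 2 * B) \<le> m * Z / (2 * (139 + 2 * B)) * (139 + 2 * B)" using pos by (intro mult_right_mono) (auto simp: d_def)
    also have "\<dots> = m * Z / 2" using pos by (simp add: field_simps)
    also have "\<dots> < m * Z" using pos by simp
    finally show "d * (139 + 2 * B) < m * Z" .
  qed
  have "ennreal (d ^ 4 * \<epsilon> powr (2/3)) \<le> min_energy \<epsilon> F" if eps: "0 < \<epsilon>" "\<epsilon> < 1" for \<epsilon>
    unfolding min_energy_def
  proof (intro INF_greatest)
    fix X u assume X: "X \<in> phases" and u: "u \<in> admissible F"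
    define p where "p = \<epsilon> powr (1/3)"
    have p: "0 < p" "p \<le> 1" "p ^ 3 = \<epsilon>" "p\<^sup>2 = \<epsilon> powr (2/3)"
      using eps powr_le1[of "1/3" \<epsilon>] by (auto simp: p_def powr_power)
    define E where "E = d ^ 4 * p\<^sup>2"
    have E: "0 < E" using d(1) p(1) by (simp add: E_def)
    show "ennreal (d ^ 4 * \<epsilon> powr (2/3)) \<le> energy \<epsilon> u X"
    proof (rule ccontr)
      assume "\<not> ?thesis"
      then have en: "energy \<epsilon> u X \<le> ennreal E" by (simp add: E_def p(4))
      obtain ch v1 v2 where "low_energy ch v1 v2 (F $ 1 $ 1) (F $ 2 $ 2) E (E / \<epsilon>)"
        using low_energy_exists[OF F(2,3) X u en E eps(1)] by blast
      then interpret low_energy ch v1 v2 "F $ 1 $ 1" "F $ 2 $ 2" E "E / \<epsilon>" .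
      have M: "0 < d * p" using d(1) p(1) by simp
      have sqE: "sqrt E = d\<^sup>2 * p" unfolding E_def using d(1) p(1) by (intro real_sqrt_unique) (auto simp: power_mult_distrib)
      have d2: "d ^ n \<le> d" if "1 \<le> n" for n using power_decreasing[of 1 n d] that d by simp
      have e1: "128 * E / (d * p)\<^sup>2 = 128 * d\<^sup>2" using d(1) p(1) by (simp add: E_def power_mult_distrib field_simps)
      have e2: "d * p * (E / \<epsilon>) = d ^ 5" using d(1) p(1) unfolding p(3)[symmetric] E_def by (simp add: field_simps) (simp add: power2_eq_square power3_eq_cube eval_nat_numeral)
      have e3: "d * p * (2 * B) \<le> d * 1 * (2 * B)" using d(1) p(1,2) pos by (intro mult_right_mono mult_left_mono) auto
      have e4: "sqrt E \<le> d * 1" unfolding sqE using d(1) p(1,2) d2[of 2] by (intro mult_mono) auto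
      have "m * Z \<le> 128 * E / (d * p)\<^sup>2 + d * p * (E / \<epsilon> + 2 * B) + 10 * sqrt E"
        using first_order_estimate[OF F(1,4) M] unfolding m_def Z_def B_def .
      also have "\<dots> \<le> 128 * d + (d + d * (2 * B)) + 10 * d"
        unfolding e1 distrib_left e2 using e3 e4 d2[of 2] d2[of 5] by (intro add_mono) auto
      also have "\<dots> = d * (139 + 2 * B)" by (simp add: algebra_simps)
      finally show False using d(3) by linarith
    qed
  qed
  then show ?thesis using d(1) by (intro exI[of _ "d ^ 4"]) simp
qed

text \<open>With q = \<epsilon>^(1/4), the choices s = q, M = d q^2 and E = d^4 q^2 make all terms
  of \<open>second_order_estimate\<close> small with \<open>d\<close>, uniformly in \<epsilon>; the
  sum is at most d (54 + 4 B), where 54 = 16 + 2 + 2 (2 + 8 + 8). Shifts are restricted to s \<le>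
  1/4, which explains 1 / 256 = (1/4)^4.\<close>

lemma lower_bound_second_order:
  fixes F :: "real^2^2"
  assumes F: "\<bar>F $ 1 $ 1\<bar> < 1" "F $ 1 $ 2 = 0" "F $ 2 $ 1 = 0" "F $ 2 $ 2 = 0"
  shows "\<exists>c>0. \<forall>\<epsilon>. 0 < \<epsilon> \<and> \<epsilon> < 1 / 256 \<longrightarrow> ennreal (c * \<epsilon> powr (1/2)) \<le> min_energy \<epsilon> F"
proof -
  define Z where "Z = (LINT z|lborel. cutoff z)"
  define B where "B = (LINT z|lborel. \<bar>partial_deriv 2 cutoff z\<bar>)"
  define m where "m = 1 - \<bar>F $ 1 $ 1\<bar>"
  have pos: "0 < Z" "0 \<le> B" "0 < m" using cutoff_integral_pos F(1) by (auto simp: Z_def B_def m_def)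
  define d where "d = min 1 (m * Z / (2 * (54 + 4 * B)))"
  have d: "0 < d" "d \<le> 1" "d * (54 + 4 * B) < m * Z"
  proof -
    show "0 < d" "d \<le> 1" using pos by (auto simp: d_def)
    have "d * (54 + 4 * B) \<le> m * Z / (2 * (54 + 4 * B)) * (54 + 4 * B)" using pos by (intro mult_right_mono) (auto simp: d_def)
    also have "\<dots> = m * Z / 2" using pos by (simp add: field_simps)
    also have "\<dots> < m * Z" using pos by simp
    finally show "d * (54 + 4 * B) < m * Z" .
  qed
  have "ennreal (d ^ 4 * \<epsilon> powr (1/2)) \<le> min_energy \<epsilon> F" if eps: "0 < \<epsilon>" "\<epsilon> < 1 / 256" for \<epsilon>
    unfolding min_energy_def
  proof (intro INF_greatest)
    fix X u assume X: "X \<in> phases" and u: "u \<in> admissible F"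
    define q where "q = \<epsilon> powr (1/4)"
    have q: "0 < q" "q ^ 4 = \<epsilon>" "q\<^sup>2 = \<epsilon> powr (1/2)" using eps by (auto simp: q_def powr_power)
    have q4: "q \<le> 1/4"
    proof (rule ccontr)
      assume "\<not> q \<le> 1/4"
      then have "(1/4) ^ 4 \<le> q ^ 4" by (intro power_mono) auto
      then show False using eps(2) q(2) by (simp add: power4_eq_xxxx)
    qed
    define E where "E = d ^ 4 * q\<^sup>2"
    have E: "0 < E" using d(1) q(1) by (simp add: E_def)
    show "ennreal (d ^ 4 * \<epsilon> powr (1/2)) \<le> energy \<epsilon> u X"
    proof (rule ccontr)
      assume "\<not> ?thesis"
      then have en: "energy \<epsilon> u X \<le> ennreal E" by (simp add: E_def q(3))
      obtain ch v1 v2 where "low_energy ch v1 v2 (F $ 1 $ 1) (F $ 2 $ 2) E (E / \<epsilon>)"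
        using low_energy_exists[OF F(2,3) X u en E eps(1)] by blast
      then interpret low_energy ch v1 v2 "F $ 1 $ 1" "F $ 2 $ 2" E "E / \<epsilon>" .
      have M: "0 < d * q\<^sup>2" using d(1) q(1) by simp
      have sqE: "sqrt E = d\<^sup>2 * q" unfolding E_def using d(1) q(1) by (intro real_sqrt_unique) (auto simp: power_mult_distrib)
      have d2: "d ^ n \<le> d" if "1 \<le> n" for n using power_decreasing[of 1 n d] that d by simp
      have q1: "q\<^sup>2 \<le> 1" using q(1) q4 by (intro power_le_one) auto
      have e1: "16 * sqrt E / q = 16 * d\<^sup>2" unfolding sqE using q(1) by simp
      have e2: "d * q\<^sup>2 * (E / \<epsilon>) = d ^ 5" using d(1) q(1) unfolding q(2)[symmetric] E_def by (simp add: field_simps) (simp add: eval_nat_numeral)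
      have e3: "d * q\<^sup>2 * B \<le> d * 1 * B" using d q1 pos by (intro mult_right_mono mult_left_mono) auto
      have e4: "sqrt E \<le> d * 1" unfolding sqE using d(1) q(1) q4 d2[of 2] by (intro mult_mono) auto
      have e5: "8 * q\<^sup>2 * E / (d * q\<^sup>2)\<^sup>2 = 8 * d\<^sup>2" using d(1) q(1) by (simp add: E_def power_mult_distrib field_simps)
      have e6: "2 * (d * q\<^sup>2) * (E / \<epsilon> + B) = 2 * d ^ 5 + 2 * (d * q\<^sup>2 * B)" unfolding e2[symmetric] by (simp add: algebra_simps)
      have "m * Z \<le> 16 * sqrt E / q + 2 * sqrt E + 2 * (2 * (d * q\<^sup>2) * (E / \<epsilon> + B) + 8 * sqrt E + 8 * q\<^sup>2 * E / (d * q\<^sup>2)\<^sup>2)"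
        using second_order_estimate[OF F(1,4) q(1) q4 M] unfolding m_def Z_def B_def .
      also have "\<dots> \<le> 16 * d + 2 * d + 2 * ((2 * d + 2 * (d * B)) + 8 * d + 8 * d)"
        unfolding e1 e5 e6 using e3 e4 d2[of 2] d2[of 5] by (intro add_mono mult_left_mono) auto
      also have "\<dots> = d * (54 + 4 * B)" by (simp add: algebra_simps)
      finally show False using d(3) by linarith
    qed
  qed
  then show ?thesis using d(1) by (intro exI[of _ "d ^ 4"]) simp
qed

section \<open>The lamination hull of the three wells\<close>

lemma well_nth:
  "well (Suc 0) $ 1 $ 1 = 1" "well (Suc 0) $ 1 $ 2 = 0" "well (Suc 0) $ 2 $ 1 = 0" "well (Suc 0) $ 2 $ 2 = 0"
  "well 2 $ 1 $ 1 = -1" "well 2 $ 1 $ 2 = 0" "well 2 $ 2 $ 1 = 0" "well 2 $ 2 $ 2 = -1"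
  "well 3 $ 1 $ 1 = -1" "well 3 $ 1 $ 2 = 0" "well 3 $ 2 $ 1 = 0" "well 3 $ 2 $ 2 = 1"
  by (simp_all add: well_def)

lemma matrix2_eqI:
  fixes A B :: "real^2^2"
  shows "A $ 1 $ 1 = B $ 1 $ 1 \<Longrightarrow> A $ 1 $ 2 = B $ 1 $ 2 \<Longrightarrow> A $ 2 $ 1 = B $ 2 $ 1 \<Longrightarrow> A $ 2 $ 2 = B $ 2 $ 2 \<Longrightarrow> A = B"
  by (simp add: vec_eq_iff forall_2)

lemma rank_one_det: "rank (D :: real^2^2) = 1 \<Longrightarrow> D $ 1 $ 1 * D $ 2 $ 2 = D $ 1 $ 2 * D $ 2 $ 1"
  using det_eq_0_rank[of D] by (simp add: det_2)

definition segment3 :: "(real^2^2) set" where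
  "segment3 = {A. A $ 1 $ 1 = -1 \<and> A $ 1 $ 2 = 0 \<and> A $ 2 $ 1 = 0 \<and> \<bar>A $ 2 $ 2\<bar> \<le> 1}"

lemma convex_comb_abs_le_1: "0 \<le> l \<Longrightarrow> l \<le> 1 \<Longrightarrow> \<bar>a\<bar> \<le> 1 \<Longrightarrow> \<bar>b\<bar> \<le> 1 \<Longrightarrow> \<bar>l * a + (1 - l) * b\<bar> \<le> (1::real)"
  using convex_bound_le[of a 1 b l "1 - l"] convex_bound_le[of "- a" 1 "- b" l "1 - l"] by (auto simp: abs_le_iff)

lemma laminates_Suc_cases:
  assumes "A \<in> laminates (Suc j) K"
  obtains "A \<in> laminates j K"
  | l P Q where "A = l *\<^sub>R P + (1 - l) *\<^sub>R Q" "P \<in> laminates j K" "Q \<in> laminates j K" "rank (P - Q) = 1" "0 \<le> l" "l \<le> 1"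
  using assms by auto

lemma K3_cases: "A \<in> K3 \<Longrightarrow> A = well 1 \<or> A \<in> segment3"
  by (auto simp: K3_def segment3_def well_nth)

lemma segment3_comb:
  assumes "P \<in> segment3" "Q \<in> segment3" "0 \<le> l" "l \<le> 1" shows "l *\<^sub>R P + (1 - l) *\<^sub>R Q \<in> segment3"
  using assms convex_comb_abs_le_1[of l "P $ 2 $ 2" "Q $ 2 $ 2"] by (simp add: segment3_def)

text \<open>The difference is diagonal with entries 2 and - P_22 up to sign, so a vanishing
  determinant forces P_22 = 0.\<close>

lemma rank_well_1:
  assumes "P \<in> segment3" shows "rank (well 1 - P) = 1 \<Longrightarrow> P $ 2 $ 2 = 0" "rank (P - well 1) = 1 \<Longrightarrow> P $ 2 $ 2 = 0"
  using assms rank_one_det[of "well 1 - P"] rank_one_det[of "P - well 1"] by (auto simp: segment3_def well_nth)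

text \<open>The first well is not rank-one connected to the other two, whose (2, 2) entries are
  nonzero; so mixing within \<open>K3\<close> creates only matrices of the segment between those
  two.\<close>

lemma laminates_1_cases:
  assumes "A \<in> laminates 1 K3" shows "A = well 1 \<or> A \<in> segment3"
proof -
  from assms have "A \<in> laminates (Suc 0) K3" by simp
  then show ?thesis
  proof (cases rule: laminates_Suc_cases)
    case 1 then show ?thesis using K3_cases by simp
  next
    case (2 l P Q)
    have K: "P \<in> K3" "Q \<in> K3" using 2 by simp_all
    have no0: "R $ 2 $ 2 \<noteq> 0" if "R \<in> K3" "R \<in> segment3" for R using that by (auto simp: K3_def segment3_def well_nth)
    have "\<not> (P = well 1 \<and> Q = well 1)" using 2(4) by (auto simp: rank_0)
    then show ?thesis using K3_cases[OF K(1)] K3_cases[OF K(2)] segment3_comb[of P Q l] rank_well_1[of P] rank_well_1[of Q] no0[OF K(1)] no0[OF K(2)] 2 by auto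
  qed
qed

lemma segment3_laminates_1:
  assumes "A \<in> segment3" shows "A \<in> laminates 1 K3"
proof -
  \<comment> \<open>The weight of \<open>well 2\<close>, read off from the (2, 2) entry of
    \<open>A\<close>.\<close>
  define l where "l = (1 - A $ 2 $ 2) / 2"
  have l: "0 \<le> l" "l \<le> 1" using assms by (auto simp: l_def segment3_def abs_le_iff)
  have e: "A = l *\<^sub>R well 2 + (1 - l) *\<^sub>R well 3"
    using assms by (intro matrix2_eqI) (auto simp: segment3_def well_nth l_def field_simps)
  have r: "rank (well 2 - well 3) = 1"
  proof -
    have "rank (well 2 - well 3) \<le> 1"
    proof -
      have "rows (well 2 - well 3) \<subseteq> span {axis 2 1}"
      proof
        fix v assume "v \<in> rows (well 2 - well 3)"
        then obtain i where "v = row i (well 2 - well 3)" by (auto simp: rows_def)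
        then have "v = (v $ 2) *\<^sub>R axis 2 1" using exhaust_2[of i] by (auto simp: row_def vec_eq_iff forall_2 axis_def well_nth)
        then show "v \<in> span {axis 2 1}" by (metis span_base span_scale singletonI)
      qed
      then have "dim (rows (well 2 - well 3)) \<le> card {axis 2 (1::real) :: real^2}" by (rule dim_le_card) simp
      then show ?thesis by (simp add: row_rank_def)
    qed
    moreover have "rank (well 2 - well 3) \<noteq> 0"
    proof
      assume "rank (well 2 - well 3) = 0"
      then have "well 2 - well 3 = 0" by (simp add: rank_eq_0)
      then have "(well 2 - well 3) $ 2 $ 2 = 0" by simp
      then show False by (simp add: well_nth)
    qed
    ultimately show ?thesis by linarith
  qed
  have "\<exists>l' P Q. A = l' *\<^sub>R P + (1 - l') *\<^sub>R Q \<and> P \<in> K3 \<and> Q \<in> K3 \<and> rank (P - Q) = 1 \<and> l' \<in> {0..1}"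
    using e r l by (intro exI[of _ l] exI[of _ "well 2"] exI[of _ "well 3"]) (simp add: K3_def)
  then show ?thesis by (simp add: numeral_nat)
qed

lemma laminate_order_1:
  assumes "F \<in> laminates 1 K3 - K3"
  shows "F $ 1 $ 1 = -1" "F $ 1 $ 2 = 0" "F $ 2 $ 1 = 0" "\<bar>F $ 2 $ 2\<bar> < 1"
proof -
  have F: "F \<in> segment3" using laminates_1_cases[of F] assms by (auto simp: K3_def)
  then show "F $ 1 $ 1 = -1" "F $ 1 $ 2 = 0" "F $ 2 $ 1 = 0" by (auto simp: segment3_def)
  have "F \<noteq> well 2" "F \<noteq> well 3" using assms by (auto simp: K3_def)
  then have "F $ 2 $ 2 \<noteq> -1" "F $ 2 $ 2 \<noteq> 1" using F by (auto simp: segment3_def well_nth intro: matrix2_eqI)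
  then show "\<bar>F $ 2 $ 2\<bar> < 1" using F by (auto simp: segment3_def)
qed

text \<open>The hull up to order 1 is the first well together with a segment closed under convex
  combinations. A new matrix therefore mixes the first well with a segment matrix that is rank-one
  connected to it, that is with diag(-1, 0), and both weights are nonzero.\<close>

lemma laminate_order_2:
  assumes "F \<in> laminates 2 K3 - laminates 1 K3"
  shows "\<bar>F $ 1 $ 1\<bar> < 1" "F $ 1 $ 2 = 0" "F $ 2 $ 1 = 0" "F $ 2 $ 2 = 0"
proof -
  have n: "F \<notin> laminates 1 K3" and "F \<in> laminates (Suc 1) K3" using assms by (auto simp: numeral_2_eq_2)
  from this(2) obtain l P Q where F: "F = l *\<^sub>R P + (1 - l) *\<^sub>R Q" and P: "P \<in> laminates 1 K3" and Q: "Q \<in> laminates 1 K3"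
    and r: "rank (P - Q) = 1" and l: "0 \<le> l" "l \<le> 1"
    using n by (cases rule: laminates_Suc_cases) auto
  have "\<not> (P = well 1 \<and> Q = well 1)" using r by (auto simp: rank_0)
  then consider "P = well 1" "Q \<in> segment3" | "P \<in> segment3" "Q = well 1"
    using segment3_comb[of P Q l] segment3_laminates_1[of F] n F l laminates_1_cases[OF P] laminates_1_cases[OF Q] by auto
  then obtain R k where R: "F = k *\<^sub>R well 1 + (1 - k) *\<^sub>R R" "R \<in> segment3" "R $ 2 $ 2 = 0" and k: "0 \<le> k" "k \<le> 1"
  proof cases
    case 1 then show thesis using that[of l Q] F l r rank_well_1(1)[of Q] by simp
  next
    case 2 then show thesis using that[of "1 - l" P] F l r rank_well_1(2)[of P] by (simp add: add.commute)
  qed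
  have e: "F $ 1 $ 1 = 2 * k - 1" "F $ 1 $ 2 = 0" "F $ 2 $ 1 = 0" "F $ 2 $ 2 = 0"
    using R(2,3) by (auto simp: R(1) segment3_def well_nth)
  have "well 1 \<in> laminates 1 K3" using laminates.simps by (auto simp: K3_def)
  then have ne: "F \<noteq> well 1" "F \<noteq> R" using n segment3_laminates_1[OF R(2)] by blast+
  have "k \<noteq> 1"
  proof
    assume "k = 1"
    then have "F = well 1" using R(1) by (simp only: scale_one diff_self scale_zero_left add_0_right)
    then show False using ne(1) by contradiction
  qed
  moreover have "k \<noteq> 0"
  proof
    assume "k = 0"
    then have "F = R" using R(1) by (simp only: scale_one diff_zero scale_zero_left add_0_left)
    then show False using ne(2) by contradiction
  qed
  ultimately show "\<bar>F $ 1 $ 1\<bar> < 1" using e(1) k unfolding abs_less_iff by linarith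
  show "F $ 1 $ 2 = 0" "F $ 2 $ 1 = 0" "F $ 2 $ 2 = 0" using e by simp_all
qed

theorem theorem2:
  fixes F :: "real^2^2"
  assumes "F \<in> lc_hull K3 - K3"
  shows "(F \<in> laminates 1 K3 - K3 \<longrightarrow>
           (\<exists>c C. 0 < c \<and> c \<le> C \<and>
              (\<forall>\<epsilon>::real. 0 < \<epsilon> \<and> \<epsilon> < 1 \<longrightarrow>
                 ennreal (c * \<epsilon> powr (2/3)) \<le> min_energy \<epsilon> F \<and>
                 min_energy \<epsilon> F \<le> ennreal (C * \<epsilon> powr (2/3)))))
       \<and> (F \<in> laminates 2 K3 - laminates 1 K3 \<longrightarrow>
           (\<exists>c C \<epsilon>\<^sub>0. 0 < c \<and> c \<le> C \<and> 0 < \<epsilon>\<^sub>0 \<and>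
              (\<forall>\<epsilon>::real. 0 < \<epsilon> \<and> \<epsilon> < \<epsilon>\<^sub>0 \<longrightarrow>
                 ennreal (c * \<epsilon> powr (1/2)) \<le> min_energy \<epsilon> F \<and>
                 min_energy \<epsilon> F \<le> ennreal (C * \<epsilon> powr (1/2)))))"
proof (intro conjI impI)
  assume "F \<in> laminates 1 K3 - K3"
  note F = laminate_order_1[OF this]
  obtain c where c: "0 < c" "\<forall>\<epsilon>. 0 < \<epsilon> \<and> \<epsilon> < 1 \<longrightarrow> ennreal (c * \<epsilon> powr (2/3)) \<le> min_energy \<epsilon> F"
    using lower_bound_first_order[OF F] by blast
  \<comment> \<open>The maximum enlarges the upper constant so that c \<le> C holds.\<close>
  have "min_energy \<epsilon> F \<le> ennreal (max c 560 * \<epsilon> powr (2/3))" if "0 < \<epsilon>" "\<epsilon> < 1" for \<epsilon>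
    by (rule order_trans[OF upper_bound_first_order[OF F(1-3) refl F(4) that] ennreal_leI]) (simp add: mult_right_mono)
  then show "\<exists>c C. 0 < c \<and> c \<le> C \<and> (\<forall>\<epsilon>::real. 0 < \<epsilon> \<and> \<epsilon> < 1 \<longrightarrow>
      ennreal (c * \<epsilon> powr (2/3)) \<le> min_energy \<epsilon> F \<and> min_energy \<epsilon> F \<le> ennreal (C * \<epsilon> powr (2/3)))"
    using c by (intro exI[of _ c] exI[of _ "max c 560"]) simp
next
  assume "F \<in> laminates 2 K3 - laminates 1 K3"
  note F = laminate_order_2[OF this]
  obtain c where c: "0 < c" "\<forall>\<epsilon>. 0 < \<epsilon> \<and> \<epsilon> < 1 / 256 \<longrightarrow> ennreal (c * \<epsilon> powr (1/2)) \<le> min_energy \<epsilon> F"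
    using lower_bound_second_order[OF F] by blast
  obtain C where C: "0 < C" "\<forall>\<epsilon>. 0 < \<epsilon> \<and> \<epsilon> < 1 \<longrightarrow> min_energy \<epsilon> F \<le> ennreal (C * \<epsilon> powr (1/2))"
    using upper_bound_second_order[of F "F $ 1 $ 1", OF refl F(2-4,1)] by blast
  have "min_energy \<epsilon> F \<le> ennreal (max c C * \<epsilon> powr (1/2))" if "0 < \<epsilon>" "\<epsilon> < 1 / 256" for \<epsilon>
  proof -
    have "min_energy \<epsilon> F \<le> ennreal (C * \<epsilon> powr (1/2))" using C(2) that by simp
    also have "\<dots> \<le> ennreal (max c C * \<epsilon> powr (1/2))" by (rule ennreal_leI) (simp add: mult_right_mono)
    finally show ?thesis .
  qed
  then show "\<exists>c C \<epsilon>\<^sub>0. 0 < c \<and> c \<le> C \<and> 0 < \<epsilon>\<^sub>0 \<and> (\<forall>\<epsilon>::real. 0 < \<epsilon> \<and> \<epsilon> < \<epsilon>\<^sub>0 \<longrightarrow>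
      ennreal (c * \<epsilon> powr (1/2)) \<le> min_energy \<epsilon> F \<and> min_energy \<epsilon> F \<le> ennreal (C * \<epsilon> powr (1/2)))"
    using c by (intro exI[of _ c] exI[of _ "max c C"] exI[of _ "1 / 256"]) simp
qed

end
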